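(* Let $M$ be a smooth closed $n$-dimensional manifold and let $X\subset\mathbb{R}^\nu$ be a compact Lipschitz neighborhood retract. Then the Lipschitz mappings $\mathrm{Lip}(M,X)$ are dense in $W^{1,n}(M,X)$.
   Context: A closed manifold is a smooth, compact manifold without boundary; it is equipped with a fixed (arbitrary) Riemannian metric. For $1\le p<\infty$, $W^{1,p}(M,\mathbb{R}^\nu)$ is the Sobolev space with norm $\|u\|_{1,p}=\|u\|_p+\|\nabla u\|_p$. For $X\subset\mathbb{R}^\nu$, $$W^{1,p}(M,X)=\{u\in W^{1,p}(M,\mathbb{R}^\nu):\ u(x)\in X \text{ for a.e. } x\in M\},$$ equipped with the metric $\rho(u,v)=\|u-v\|_{1,p}$. $\mathrm{Lip}(M,X)$ is the class of Lipschitz mappings $u:M\to X$, where $X$ carries the Euclidean metric of $\mathbb{R}^\nu$. A set $X\subset\mathbb{R}^\nu$ is a Lipschitz neighborhood retract if there is an open set $U\subset\mathbb{R}^\nu$ with $X\subset U$ and a Lipschitz mapping $r:U\to X$ such that $r(x)=x$ for all $x\in X$. *)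

theory Defs
  imports "HOL-Analysis.Analysis"
begin

subsection \<open>Smooth functions on open subsets of normed spaces\<close>

primrec Ck_on :: "nat \<Rightarrow> ('a::real_normed_vector \<Rightarrow> 'b::real_normed_vector) \<Rightarrow> 'a set \<Rightarrow> bool" where
  "Ck_on 0 f S \<longleftrightarrow> continuous_on S f"
| "Ck_on (Suc k) f S \<longleftrightarrow>
     (\<forall>x\<in>S. f differentiable (at x)) \<and>
     (\<forall>v. Ck_on k (\<lambda>x. frechet_derivative f (at x) v) S)"

definition smooth_on :: "'a::real_normed_vector set \<Rightarrow> ('a \<Rightarrow> 'b::real_normed_vector) \<Rightarrow> bool" where
  "smooth_on S f \<longleftrightarrow> (\<forall>k. Ck_on k f S)"


subsection \<open>Closed manifolds\<close>

text \<open>A chart is a pair of its domain and its coordinate map; only the values of the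
  coordinate map on the domain are relevant. The dimension of the manifold is \<open>CARD('n)\<close>.\<close>

type_synonym ('a, 'n) chart = "'a set \<times> ('a \<Rightarrow> real^'n)"

abbreviation chart_dom :: "('a, 'n::finite) chart \<Rightarrow> 'a set" where
  "chart_dom \<equiv> fst"

abbreviation chart_map :: "('a, 'n::finite) chart \<Rightarrow> 'a \<Rightarrow> real^'n" where
  "chart_map \<equiv> snd"

definition chart_img :: "('a, 'n::finite) chart \<Rightarrow> (real^'n) set" where
  "chart_img c = chart_map c ` chart_dom c"

definition chart_inv :: "('a, 'n::finite) chart \<Rightarrow> real^'n \<Rightarrow> 'a" where
  "chart_inv c = inv_into (chart_dom c) (chart_map c)"

definition transition ::
    "('a, 'n::finite) chart \<Rightarrow> ('a, 'n) chart \<Rightarrow> real^'n \<Rightarrow> real^'n" where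
  "transition c d = chart_map d \<circ> chart_inv c"

definition jacobian ::
    "('a, 'n::finite) chart \<Rightarrow> ('a, 'n) chart \<Rightarrow> real^'n \<Rightarrow> real^'n^'n" where
  "jacobian c d y = matrix (frechet_derivative (transition c d) (at y))"

definition is_chart :: "'a topology \<Rightarrow> ('a, 'n::finite) chart \<Rightarrow> bool" where
  "is_chart M c \<longleftrightarrow>
     openin M (chart_dom c) \<and> open (chart_img c) \<and>
     homeomorphic_map (subtopology M (chart_dom c)) (top_of_set (chart_img c)) (chart_map c)"

definition smooth_atlas :: "'a topology \<Rightarrow> ('a, 'n::finite) chart set \<Rightarrow> bool" where
  "smooth_atlas M A \<longleftrightarrow>
     (\<forall>c\<in>A. is_chart M c) \<and>
     (\<Union>c\<in>A. chart_dom c) = topspace M \<and>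
     (\<forall>c\<in>A. \<forall>d\<in>A.
        smooth_on (chart_map c ` (chart_dom c \<inter> chart_dom d)) (transition c d))"

text \<open>The smooth structure is the one generated by \<open>A\<close>, which need not be maximal. Second
  countability is not listed because it follows from compactness.\<close>

definition closed_manifold :: "'a topology \<Rightarrow> ('a, 'n::finite) chart set \<Rightarrow> bool" where
  "closed_manifold M A \<longleftrightarrow> compact_space M \<and> Hausdorff_space M \<and> smooth_atlas M A"

text \<open>A chart around a given point. It is only used to evaluate expressions whose value does
  not depend on the chart.\<close>

definition chart_at :: "('a, 'n::finite) chart set \<Rightarrow> 'a \<Rightarrow> ('a, 'n) chart" where
  "chart_at A x = (SOME c. c \<in> A \<and> x \<in> chart_dom c)"


subsection \<open>Riemannian metrics, distance and volume\<close>

text \<open>A tensor field is given by its family of coordinate expressions, indexed by the charts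
  and subject to the transformation law; \<open>g c y\<close> is the Gram matrix of the coordinate vector
  fields of \<open>c\<close> at the point with coordinates \<open>y\<close>.\<close>

definition riemannian_metric ::
    "('a, 'n::finite) chart set \<Rightarrow> (('a, 'n) chart \<Rightarrow> real^'n \<Rightarrow> real^'n^'n) \<Rightarrow> bool" where
  "riemannian_metric A g \<longleftrightarrow>
     (\<forall>c\<in>A. smooth_on (chart_img c) (g c) \<and>
        (\<forall>y\<in>chart_img c. transpose (g c y) = g c y \<and>
                          (\<forall>v. v \<noteq> 0 \<longrightarrow> v \<bullet> (g c y *v v) > 0))) \<and>
     (\<forall>c\<in>A. \<forall>d\<in>A. \<forall>y\<in>chart_map c ` (chart_dom c \<inter> chart_dom d).
        g c y = transpose (jacobian c d y) ** g d (transition c d y) ** jacobian c d y)"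

text \<open>Continuous curves on \<open>[0,1]\<close> that are continuously differentiable off a finite set, in
  analogy with \<^const>\<open>piecewise_C1_differentiable_on\<close>.\<close>

definition pw_C1_curve ::
    "'a topology \<Rightarrow> ('a, 'n::finite) chart set \<Rightarrow> (real \<Rightarrow> 'a) \<Rightarrow> bool" where
  "pw_C1_curve M A \<gamma> \<longleftrightarrow>
     continuous_map (top_of_set {0..1}) M \<gamma> \<and>
     (\<exists>F. finite F \<and>
        (\<forall>c\<in>A. (chart_map c \<circ> \<gamma>) C1_differentiable_on
                 {t \<in> {0<..<1} - F. \<gamma> t \<in> chart_dom c}))"

definition curve_speed ::
    "('a, 'n::finite) chart set \<Rightarrow> (('a, 'n) chart \<Rightarrow> real^'n \<Rightarrow> real^'n^'n) \<Rightarrow>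
     (real \<Rightarrow> 'a) \<Rightarrow> real \<Rightarrow> real" where
  "curve_speed A g \<gamma> t =
     (let c = chart_at A (\<gamma> t); v = vector_derivative (chart_map c \<circ> \<gamma>) (at t)
      in sqrt (v \<bullet> (g c (chart_map c (\<gamma> t)) *v v)))"

definition curve_length ::
    "('a, 'n::finite) chart set \<Rightarrow> (('a, 'n) chart \<Rightarrow> real^'n \<Rightarrow> real^'n^'n) \<Rightarrow>
     (real \<Rightarrow> 'a) \<Rightarrow> ennreal" where
  "curve_length A g \<gamma> = (\<integral>\<^sup>+t\<in>{0..1}. ennreal (curve_speed A g \<gamma> t) \<partial>lborel)"

text \<open>The distance is infinite between different connected components.\<close>

definition riem_dist ::
    "'a topology \<Rightarrow> ('a, 'n::finite) chart set \<Rightarrow> (('a, 'n) chart \<Rightarrow> real^'n \<Rightarrow> real^'n^'n) \<Rightarrow>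
     'a \<Rightarrow> 'a \<Rightarrow> ennreal" where
  "riem_dist M A g x y =
     Inf {curve_length A g \<gamma> | \<gamma>. pw_C1_curve M A \<gamma> \<and> \<gamma> 0 = x \<and> \<gamma> 1 = y}"

text \<open>The measurable sets are the Lebesgue (not just Borel) measurable subsets of the manifold;
  in the coordinates of \<open>c\<close> the volume has density \<open>sqrt (det (g c))\<close>.\<close>

definition is_riem_volume ::
    "'a topology \<Rightarrow> ('a, 'n::finite) chart set \<Rightarrow> (('a, 'n) chart \<Rightarrow> real^'n \<Rightarrow> real^'n^'n) \<Rightarrow>
     'a measure \<Rightarrow> bool" where
  "is_riem_volume M A g \<mu> \<longleftrightarrow>
     space \<mu> = topspace M \<and>
     sets \<mu> = {B. B \<subseteq> topspace M \<and>
                  (\<forall>c\<in>A. chart_map c ` (B \<inter> chart_dom c) \<in> sets lebesgue)} \<and>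
     (\<forall>c\<in>A. \<forall>B\<in>sets \<mu>. B \<subseteq> chart_dom c \<longrightarrow>
        emeasure \<mu> B = (\<integral>\<^sup>+y\<in>chart_map c ` B. ennreal (sqrt (det (g c y))) \<partial>lebesgue))"

text \<open>On a closed manifold there is exactly one such measure: the densities in two charts differ by
  the absolute value of the Jacobian determinant of the transition, and finitely many chart
  domains cover the manifold.\<close>

definition riem_volume ::
    "'a topology \<Rightarrow> ('a, 'n::finite) chart set \<Rightarrow> (('a, 'n) chart \<Rightarrow> real^'n \<Rightarrow> real^'n^'n) \<Rightarrow>
     'a measure" where
  "riem_volume M A g = (THE \<mu>. is_riem_volume M A g \<mu>)"


subsection \<open>Weak derivatives\<close>

definition test_function :: "(real^'n::finite) set \<Rightarrow> (real^'n \<Rightarrow> real) \<Rightarrow> bool" where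
  "test_function S \<psi> \<longleftrightarrow>
     smooth_on UNIV \<psi> \<and> (\<exists>K. compact K \<and> K \<subseteq> S \<and> (\<forall>y. y \<notin> K \<longrightarrow> \<psi> y = 0))"

definition locally_integrable ::
    "'a::euclidean_space set \<Rightarrow> ('a \<Rightarrow> 'b::euclidean_space) \<Rightarrow> bool" where
  "locally_integrable S f \<longleftrightarrow> (\<forall>K. compact K \<and> K \<subseteq> S \<longrightarrow> set_integrable lebesgue K f)"

text \<open>The entry of \<open>G y\<close> in row \<open>k\<close> and column \<open>i\<close> is the weak partial derivative in direction
  \<open>i\<close> of the component \<open>k\<close> of \<open>f\<close>.\<close>

definition has_weak_derivative_on ::
    "(real^'n::finite \<Rightarrow> real^'m::finite) \<Rightarrow> (real^'n \<Rightarrow> real^'n^'m) \<Rightarrow> (real^'n) set \<Rightarrow> bool" where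
  "has_weak_derivative_on f G S \<longleftrightarrow>
     locally_integrable S f \<and> locally_integrable S G \<and>
     (\<forall>\<psi> i. test_function S \<psi> \<longrightarrow>
        (LINT y:S|lebesgue. frechet_derivative \<psi> (at y) (axis i 1) *\<^sub>R f y) =
        - (LINT y:S|lebesgue. \<psi> y *\<^sub>R column i (G y)))"

text \<open>The weak differential of a map on the manifold is a field of covectors with values in
  \<open>real^'m\<close>; such fields are described by their coordinate expressions, as for the metric.\<close>

definition has_weak_differential ::
    "('a, 'n::finite) chart set \<Rightarrow> ('a \<Rightarrow> real^'m::finite) \<Rightarrow>
     (('a, 'n) chart \<Rightarrow> real^'n \<Rightarrow> real^'n^'m) \<Rightarrow> bool" where
  "has_weak_differential A u D \<longleftrightarrow>
     (\<forall>c\<in>A. has_weak_derivative_on (u \<circ> chart_inv c) (D c) (chart_img c)) \<and>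
     (\<forall>c\<in>A. \<forall>d\<in>A. \<forall>y\<in>chart_map c ` (chart_dom c \<inter> chart_dom d).
        D c y = D d (transition c d y) ** jacobian c d y)"

text \<open>The Hilbert--Schmidt norm of the differential with respect to the metric:
  its square is the sum over \<open>i\<close>, \<open>j\<close> of \<open>g\<^sup>i\<^sup>j\<close> times the inner product of the \<open>i\<close>-th
  and \<open>j\<close>-th partial derivatives.\<close>

definition differential_norm ::
    "('a, 'n::finite) chart set \<Rightarrow> (('a, 'n) chart \<Rightarrow> real^'n \<Rightarrow> real^'n^'n) \<Rightarrow>
     (('a, 'n) chart \<Rightarrow> real^'n \<Rightarrow> real^'n^'m::finite) \<Rightarrow> 'a \<Rightarrow> real" where
  "differential_norm A g D x =
     (let c = chart_at A x; y = chart_map c x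
      in sqrt (trace (D c y ** matrix_inv (g c y) ** transpose (D c y))))"


subsection \<open>Sobolev spaces\<close>

definition in_Lp :: "'a measure \<Rightarrow> real \<Rightarrow> ('a \<Rightarrow> 'b::euclidean_space) \<Rightarrow> bool" where
  "in_Lp \<mu> p f \<longleftrightarrow> f \<in> borel_measurable \<mu> \<and> integrable \<mu> (\<lambda>x. norm (f x) powr p)"

definition Lp_norm :: "'a measure \<Rightarrow> real \<Rightarrow> ('a \<Rightarrow> 'b::euclidean_space) \<Rightarrow> real" where
  "Lp_norm \<mu> p f = (LINT x|\<mu>. norm (f x) powr p) powr (1 / p)"

text \<open>Elements of Sobolev spaces are represented by functions rather than by classes of almost
  everywhere equal functions.\<close>

definition sobolev_space ::
    "'a topology \<Rightarrow> ('a, 'n::finite) chart set \<Rightarrow> (('a, 'n) chart \<Rightarrow> real^'n \<Rightarrow> real^'n^'n) \<Rightarrow>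
     real \<Rightarrow> ('a \<Rightarrow> real^'m::finite) set" where
  "sobolev_space M A g p =
     {u. in_Lp (riem_volume M A g) p u \<and>
         (\<exists>D. has_weak_differential A u D \<and>
              in_Lp (riem_volume M A g) p (differential_norm A g D))}"

text \<open>Weak differentials are unique up to null sets, so the norm does not depend on the choice.\<close>

definition weak_differential ::
    "('a, 'n::finite) chart set \<Rightarrow> ('a \<Rightarrow> real^'m::finite) \<Rightarrow>
     (('a, 'n) chart \<Rightarrow> real^'n \<Rightarrow> real^'n^'m)" where
  "weak_differential A u = (SOME D. has_weak_differential A u D)"

definition sobolev_norm ::
    "'a topology \<Rightarrow> ('a, 'n::finite) chart set \<Rightarrow> (('a, 'n) chart \<Rightarrow> real^'n \<Rightarrow> real^'n^'n) \<Rightarrow>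
     real \<Rightarrow> ('a \<Rightarrow> real^'m::finite) \<Rightarrow> real" where
  "sobolev_norm M A g p u =
     Lp_norm (riem_volume M A g) p u +
     Lp_norm (riem_volume M A g) p (differential_norm A g (weak_differential A u))"

definition sobolev_maps ::
    "'a topology \<Rightarrow> ('a, 'n::finite) chart set \<Rightarrow> (('a, 'n) chart \<Rightarrow> real^'n \<Rightarrow> real^'n^'n) \<Rightarrow>
     real \<Rightarrow> (real^'m::finite) set \<Rightarrow> ('a \<Rightarrow> real^'m) set" where
  "sobolev_maps M A g p X =
     {u \<in> sobolev_space M A g p. AE x in riem_volume M A g. u x \<in> X}"

definition sobolev_dist ::
    "'a topology \<Rightarrow> ('a, 'n::finite) chart set \<Rightarrow> (('a, 'n) chart \<Rightarrow> real^'n \<Rightarrow> real^'n^'n) \<Rightarrow>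
     real \<Rightarrow> ('a \<Rightarrow> real^'m::finite) \<Rightarrow> ('a \<Rightarrow> real^'m) \<Rightarrow> real" where
  "sobolev_dist M A g p u v = sobolev_norm M A g p (\<lambda>x. u x - v x)"


subsection \<open>Lipschitz maps and Lipschitz neighborhood retracts\<close>

definition Lip_maps ::
    "'a topology \<Rightarrow> ('a, 'n::finite) chart set \<Rightarrow> (('a, 'n) chart \<Rightarrow> real^'n \<Rightarrow> real^'n^'n) \<Rightarrow>
     (real^'m::finite) set \<Rightarrow> ('a \<Rightarrow> real^'m) set" where
  "Lip_maps M A g X =
     {u. u ` topspace M \<subseteq> X \<and>
         (\<exists>L>0. \<forall>x\<in>topspace M. \<forall>y\<in>topspace M.
            ennreal (dist (u x) (u y)) \<le> ennreal L * riem_dist M A g x y)}"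

definition Lipschitz_neighborhood_retract :: "'b::metric_space set \<Rightarrow> bool" where
  "Lipschitz_neighborhood_retract X \<longleftrightarrow>
     (\<exists>U r L. open U \<and> X \<subseteq> U \<and> L-lipschitz_on U r \<and> r ` U \<subseteq> X \<and> (\<forall>x\<in>X. r x = x))"

end

theory Submission
  imports Defs
begin

text \<open>The proof truncates a Sobolev map \<open>u\<close> to a Lipschitz one. The behaviour of \<open>u\<close> is controlled by
the maximal function of its gradient: on the set where that maximal function is at most \<open>t\<close>, the
map \<open>u\<close> is Lipschitz with a constant proportional to \<open>t\<close>
(\<open>ex_pointwise_lipschitz_constant\<close>, \<open>Lipschitz_on_good_points\<close>). McShane's formula extends it from
there to a Lipschitz map \<open>w\<close> on the whole manifold, but the values of \<open>w\<close> need not lie in \<open>X\<close>.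

The exponent \<open>n\<close>, the dimension of the manifold, enters at this point. Since the \<open>n\<close>-th power of the
gradient is integrable, the exceptional set, where the maximal function exceeds \<open>t\<close>, has measure
\<open>o(t\<^sup>-\<^sup>n)\<close> (\<open>bad_set_measure_tendsto\<close>, \<open>exceptional_measure\<close>). A ball of radius \<open>\<delta> / t\<close> has measure of
order \<open>(\<delta> / t)\<^sup>n\<close>, so for large \<open>t\<close> it meets the good set (\<open>good_points_dense\<close>). Moving by \<open>\<delta> / t\<close>
changes \<open>w\<close> by at most a multiple of \<open>\<delta>\<close>; hence \<open>w\<close> takes its values in any prescribed
neighbourhood of \<open>X\<close>, and the composition \<open>v\<close> with the Lipschitz retraction is a Lipschitz map into \<open>X\<close>
which agrees with \<open>u\<close> off the exceptional set (\<open>Lipschitz_truncation\<close>).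

The difference \<open>u - v\<close> is bounded and vanishes off the exceptional set, and so does its weak
differential, because a weak derivative vanishes almost everywhere on the zero set of its function
(\<open>weak_derivative_zero_on_zero_set\<close>). On the exceptional set the differential of \<open>v\<close> is at most a
multiple of \<open>t\<close>, which contributes at most a multiple of \<open>t\<^sup>n\<close> times the measure of that set; this
tends to zero, and so does the integral of the \<open>n\<close>-th power of the gradient of \<open>u\<close> over it
(\<open>sobolev_dist_truncation_tendsto_0\<close>).

Two points need care on the manifold. The Riemannian distance is given by lengths of curves and may
be infinite; extensions are therefore built with a finite pseudo-metric, a sum over finitely many
charts, that is dominated by the Riemannian distance and bounds distances in the charts
(\<open>ex_comparison_pseudometric\<close>). That Lipschitz maps are Sobolev maps rests on Rademacher's theorem
(\<open>AE_differentiable_of_locally_lipschitz\<close>), which is derived from the same comparison of a function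
with its kernel averages that gives the pointwise Lipschitz estimate.\<close>

section \<open>Smooth functions and bumps\<close>

lemma Ck_on_SucI:
  assumes "\<And>x. (f has_derivative f' x) (at x)" "\<And>v. Ck_on k (\<lambda>x. f' x v) UNIV"
  shows "Ck_on (Suc k) f UNIV"
proof -
  have "frechet_derivative f (at x) = f' x" for x
    using frechet_derivative_at[OF assms(1)] by simp
  then show ?thesis
    using assms by (auto simp: differentiable_def)
qed

lemma Ck_on_UNIV_Suc:
  assumes "Ck_on (Suc k) f UNIV"
  shows "(f has_derivative frechet_derivative f (at x)) (at x)"
  using assms by (simp add: frechet_derivative_works[symmetric])

lemma Ck_on_Suc_imp: "Ck_on (Suc k) f S \<Longrightarrow> Ck_on k f S"
proof (induction k arbitrary: f)
  case 0
  then show ?case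
    by (auto intro!: continuous_at_imp_continuous_on dest: differentiable_imp_continuous_within)
next
  case (Suc k)
  then show ?case by (metis Ck_on.simps(2))
qed

lemma Ck_on_const: "Ck_on k (\<lambda>x. c) UNIV"
  by (induction k arbitrary: c) (auto simp: frechet_derivative_const)

lemma Ck_on_bounded_linear:
  assumes "bounded_linear f" shows "Ck_on k f UNIV"
proof (cases k)
  case 0 then show ?thesis
    using assms by (simp add: linear_continuous_on)
next
  case (Suc l)
  show ?thesis unfolding Suc
    by (rule Ck_on_SucI[OF bounded_linear_imp_has_derivative[OF assms]]) (rule Ck_on_const)
qed

lemma Ck_on_add: "Ck_on k f UNIV \<Longrightarrow> Ck_on k g UNIV \<Longrightarrow> Ck_on k (\<lambda>x. f x + g x) UNIV"
proof (induction k arbitrary: f g)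
  case 0 then show ?case by (simp add: continuous_on_add)
next
  case (Suc k)
  show ?case
    by (rule Ck_on_SucI[OF has_derivative_add[OF Ck_on_UNIV_Suc[OF Suc.prems(1)] Ck_on_UNIV_Suc[OF Suc.prems(2)]]])
      (use Suc in auto)
qed

lemma Ck_on_mult:
  fixes f g :: "'a::real_normed_vector \<Rightarrow> real"
  shows "Ck_on k f UNIV \<Longrightarrow> Ck_on k g UNIV \<Longrightarrow> Ck_on k (\<lambda>x. f x * g x) UNIV"
proof (induction k arbitrary: f g)
  case 0 then show ?case by (simp add: continuous_on_mult)
next
  case (Suc k)
  show ?case
    by (rule Ck_on_SucI[OF has_derivative_mult[OF Ck_on_UNIV_Suc[OF Suc.prems(1)] Ck_on_UNIV_Suc[OF Suc.prems(2)]]])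
      (use Suc Suc.prems[THEN Ck_on_Suc_imp] in \<open>auto intro!: Ck_on_add\<close>)
qed

lemma Ck_on_affine_compose:
  assumes "bounded_linear L"
  shows "Ck_on k f UNIV \<Longrightarrow> Ck_on k (\<lambda>y. f (L y + b)) UNIV"
proof (induction k arbitrary: f)
  case 0
  have "continuous_on UNIV (\<lambda>y. L y + b)"
    by (intro continuous_intros linear_continuous_on assms)
  then show ?case using 0 continuous_on_compose2[of UNIV f UNIV "\<lambda>y. L y + b"] by auto
next
  case (Suc k)
  have "((\<lambda>y. L y + b) has_derivative L) (at y)" for y
    using has_derivative_add[OF bounded_linear_imp_has_derivative[OF assms] has_derivative_const[of b]] by simp
  from has_derivative_compose[OF this Ck_on_UNIV_Suc[OF Suc.prems]]
  have "((\<lambda>y. f (L y + b)) has_derivative (\<lambda>v. frechet_derivative f (at (L y + b)) (L v))) (at y)" for y .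
  then show ?case
    by (rule Ck_on_SucI) (use Suc in auto)
qed

lemma Ck_on_prod:
  fixes f :: "'i \<Rightarrow> 'a::real_normed_vector \<Rightarrow> real"
  assumes "finite I" "\<And>i. i \<in> I \<Longrightarrow> Ck_on k (f i) UNIV"
  shows "Ck_on k (\<lambda>x. \<Prod>i\<in>I. f i x) UNIV"
  using assms by (induction I) (auto intro!: Ck_on_const Ck_on_mult)

text \<open>Inverse powers times the flat function \<open>exp (- 1 / t)\<close>. Differentiation stays within linear
  combinations of this family, so all of its members are shown to be smooth at once.\<close>

definition flat :: "nat \<Rightarrow> real \<Rightarrow> real" where
  "flat k t = (if t \<le> 0 then 0 else exp (- (1 / t)) / t ^ k)"

lemma flat_tendsto_0: "(flat k \<longlongrightarrow> 0) (at 0)"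
proof -
  have *: "((\<lambda>x::real. x ^ k / exp x) \<longlongrightarrow> 0) at_top"
    by (rule tendsto_power_div_exp_0)
  have "((\<lambda>t::real. inverse t ^ k / exp (inverse t)) \<longlongrightarrow> 0) (at_right 0)"
    by (rule filterlim_compose[OF * filterlim_inverse_at_top_right])
  moreover have "\<forall>\<^sub>F t in at_right 0. inverse t ^ k / exp (inverse t) = flat k t"
    by (auto simp: eventually_at_filter flat_def exp_minus field_simps)
  ultimately have "(flat k \<longlongrightarrow> 0) (at_right 0)"
    by (rule Lim_transform_eventually)
  moreover have "(flat k \<longlongrightarrow> 0) (at_left 0)"
    by (rule Lim_transform_eventually[OF tendsto_const[of 0]])
       (auto simp: eventually_at_filter flat_def)
  ultimately show ?thesis by (simp add: filterlim_split_at)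
qed

lemma flat_deriv: "(flat k has_real_derivative (flat (k+2) t - real k * flat (k+1) t)) (at t)"
proof -
  consider "t < 0" | "t = 0" | "t > 0" by linarith
  then show ?thesis
  proof cases
    case 1
    have "((\<lambda>t. 0) has_real_derivative 0) (at t)" by simp
    then have "(flat k has_real_derivative 0) (at t)"
      by (rule has_field_derivative_transform_within_open[where S="{..<0}"]) (use 1 in \<open>auto simp: flat_def\<close>)
    then show ?thesis using 1 by (simp add: flat_def)
  next
    case 2
    have "((\<lambda>h. (flat k (0 + h) - flat k 0) / h) \<longlongrightarrow> 0) (at 0)"
      by (rule Lim_transform_eventually[OF flat_tendsto_0[of "k+1"]])
         (auto simp: eventually_at_filter flat_def)
    then show ?thesis using 2 by (simp add: DERIV_def flat_def)
  next
    case 3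
    have "((\<lambda>t. exp (- (1 / t)) / t ^ k) has_real_derivative (flat (k+2) t - real k * flat (k+1) t)) (at t)"
    proof -
      have P: "((\<lambda>t. t ^ k) has_real_derivative real k * t ^ k / t) (at t)"
      proof (cases k)
        case (Suc m)
        then show ?thesis using DERIV_pow[of k t] 3 by simp
      qed simp
      have E: "((\<lambda>t. exp (- (1 / t))) has_real_derivative exp (- (1 / t)) / t\<^sup>2) (at t)"
        using 3 by (auto intro!: derivative_eq_intros simp: power2_eq_square)
      show ?thesis
        by (rule DERIV_cong[OF DERIV_divide[OF E P]])
          (use 3 in \<open>simp_all add: flat_def divide_simps power2_eq_square\<close>, (simp add: algebra_simps)?)
    qed
    then show ?thesis
      by (rule has_field_derivative_transform_within_open[where S="{0<..}"]) (use 3 in \<open>auto simp: flat_def\<close>)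
  qed
qed

lemma flat_smooth: "Ck_on j (flat k) UNIV"
proof (induction j arbitrary: k)
  case 0
  then show ?case
    by (auto intro!: continuous_at_imp_continuous_on DERIV_isCont[OF flat_deriv])
next
  case (Suc j)
  have "Ck_on j (\<lambda>t. (flat (k+2) t + (- real k) * flat (k+1) t) * v) UNIV" for v
    by (intro Ck_on_mult Ck_on_add Ck_on_const Suc.IH)
  then show ?case
    by (intro Ck_on_SucI[OF flat_deriv[unfolded has_field_derivative_def]]) simp
qed

lemma integrable_lebesgue_bounded_support:
  fixes f :: "'a::euclidean_space \<Rightarrow> 'b::euclidean_space"
  assumes "f \<in> borel_measurable lebesgue" "\<And>x. norm (f x) \<le> B" "bounded K" "\<And>x. x \<notin> K \<Longrightarrow> f x = 0"
  shows "integrable lebesgue f"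
proof -
  obtain R where R: "K \<subseteq> cball 0 R" using bounded_subset_ballD[OF assms(3), of 0] ball_subset_cball by blast
  have "integrable lebesgue (\<lambda>x. indicator (cball 0 R :: 'a set) x *\<^sub>R B)"
    using emeasure_lborel_cball_finite[of "0::'a" R]
    by (intro integrable_scaleR_left integrable_real_indicator) auto
  then show ?thesis
  proof (rule Bochner_Integration.integrable_bound[OF _ assms(1)], intro AE_I2)
    show "norm (f x) \<le> norm (indicator (cball 0 R :: 'a set) x *\<^sub>R B)" for x
      using assms(2)[of x] assms(4)[of x] R by (cases "x \<in> cball 0 R") (auto simp: subset_iff)
  qed
qed

lemma integrable_lebesgue_continuous_support:
  fixes f :: "'a::euclidean_space \<Rightarrow> 'b::euclidean_space"
  assumes "continuous_on UNIV f" "compact K" "\<And>x. x \<notin> K \<Longrightarrow> f x = 0"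
  shows "integrable lebesgue f" "\<exists>B>0. \<forall>x. norm (f x) \<le> B"
proof -
  have "bounded (f ` K)"
    using assms by (meson compact_continuous_image compact_imp_bounded continuous_on_subset subset_UNIV)
  then obtain B where B: "\<And>x. x \<in> K \<Longrightarrow> norm (f x) \<le> B" "B > 0"
    by (auto simp: bounded_pos)
  then have B': "norm (f x) \<le> B" for x
    using assms(3)[of x] by (cases "x \<in> K") auto
  then show "\<exists>B>0. \<forall>x. norm (f x) \<le> B" using B by blast
  have "f \<in> borel_measurable borel" using assms(1) by (rule borel_measurable_continuous_onI)
  then have "f \<in> borel_measurable lebesgue" by (intro measurable_completion) simp
  then show "integrable lebesgue f"
    using B' assms by (intro integrable_lebesgue_bounded_support[of f B K]) (auto intro: compact_imp_bounded)
qed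

lemma ex_unit_bump:
  obtains \<phi> :: "real^'n::finite \<Rightarrow> real" where
    "smooth_on UNIV \<phi>" "\<And>z. z \<notin> cball 0 1 \<Longrightarrow> \<phi> z = 0" "integrable lebesgue \<phi>"
    "integral\<^sup>L lebesgue \<phi> = 1"
proof -
  \<comment> \<open>the cube of half side \<open>1 / n\<close> lies in the unit ball, since the l1 norm bounds the Euclidean one\<close>
  define r where "r = 1 / real CARD('n)"
  have r: "r > 0" by (simp add: r_def)
  define \<beta> :: "real^'n \<Rightarrow> real" where "\<beta> z = (\<Prod>i\<in>UNIV. flat 0 (z $ i + r) * flat 0 (- z $ i + r))" for z
  have Ck: "Ck_on k \<beta> UNIV" for k
    unfolding \<beta>_def
    by (intro Ck_on_prod Ck_on_mult Ck_on_affine_compose[where L="\<lambda>z. z $ _"]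
        Ck_on_affine_compose[where L="\<lambda>z. - z $ _"] flat_smooth finite_class.finite_UNIV
        bounded_linear_minus bounded_linear_vec_nth)
  have cont: "continuous_on UNIV \<beta>" using Ck[of 0] by simp
  have zero: "\<beta> z = 0" if "z \<notin> cball 0 1" for z
  proof (rule ccontr)
    assume "\<beta> z \<noteq> 0"
    then have "\<bar>z $ i\<bar> \<le> r" for i
      by (auto simp: \<beta>_def flat_def abs_le_iff split: if_splits) (smt (verit) UNIV_I)+
    then have "(\<Sum>i\<in>UNIV. \<bar>z $ i\<bar>) \<le> real CARD('n) * r"
      by (intro sum_bounded_above)
    then have "norm z \<le> 1" using norm_le_l1_cart[of z] by (simp add: r_def)
    with that show False by simp
  qed
  have nonneg: "\<beta> z \<ge> 0" for z
    by (auto simp: \<beta>_def flat_def intro!: prod_nonneg)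
  have int: "integrable lebesgue \<beta>"
    by (rule integrable_lebesgue_continuous_support[OF cont compact_cball zero])
  have pos: "\<beta> 0 > 0" using r by (simp add: \<beta>_def flat_def not_le)
  have "integral\<^sup>L lebesgue \<beta> \<noteq> 0"
  proof
    assume "integral\<^sup>L lebesgue \<beta> = 0"
    then have "AE x in lebesgue. \<beta> x = 0"
      using integral_nonneg_eq_0_iff_AE[OF int] nonneg by auto
    then have neg: "negligible {x. \<beta> x \<noteq> 0}"
      by (simp add: eventually_ae_filter_negligible) (meson negligible_subset)
    have "open {x. \<beta> x \<noteq> 0}"
      using cont by (intro open_Collect_neq continuous_on_const)
    moreover have "0 \<in> {x. \<beta> x \<noteq> 0}" using pos by simp
    ultimately show False
      using open_not_negligible[of "{x. \<beta> x \<noteq> 0}"] neg by blast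
  qed
  then have I: "integral\<^sup>L lebesgue \<beta> > 0"
    using Bochner_Integration.integral_nonneg[of lebesgue \<beta>] nonneg by (simp add: order_less_le)
  show ?thesis
  proof
    show "smooth_on UNIV (\<lambda>z. (1 / integral\<^sup>L lebesgue \<beta>) * \<beta> z)"
      unfolding smooth_on_def by (intro allI Ck_on_mult Ck_on_const Ck)
  qed (use zero int I in auto)
qed

section \<open>The maximal function and Lebesgue points\<close>

text \<open>A superlevel set of the uncentred Hardy--Littlewood maximal function. Masses are compared with
  the power of the radius instead of the volume of the ball.\<close>

definition bad_set :: "real \<Rightarrow> ('a::euclidean_space \<Rightarrow> real) \<Rightarrow> 'a set" where
  "bad_set t h = \<Union>{ball z s | z s. s > 0 \<and> (LINT y:ball z s|lebesgue. h y) > t * s ^ DIM('a)}"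

lemma open_bad_set: "open (bad_set t h)"
  unfolding bad_set_def by (rule open_Union) auto

lemma bad_set_antimono: "t \<le> t' \<Longrightarrow> bad_set t' h \<subseteq> bad_set t h"
  unfolding bad_set_def
  by clarify (smt (verit) UnionI mem_Collect_eq mult_right_mono zero_le_power)

lemma integral_ball_le_of_not_bad:
  fixes x :: "'a::euclidean_space"
  assumes "x \<notin> bad_set t h" "s > 0"
  shows "(LINT y:ball x s|lebesgue. h y) \<le> t * s ^ DIM('a)"
  using assms unfolding bad_set_def by (force simp: not_less)

lemma set_integrable_lebesgue_subset:
  fixes h :: "'a::euclidean_space \<Rightarrow> 'b::euclidean_space"
  assumes "integrable lebesgue h" "A \<in> sets lebesgue"
  shows "set_integrable lebesgue A h"
  using assms unfolding set_integrable_def by (intro integrable_mult_indicator) auto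

lemma set_integrable_lebesgue_const:
  fixes a :: "'b::euclidean_space"
  assumes "A \<in> lmeasurable" shows "set_integrable lebesgue A (\<lambda>y. a)"
  unfolding set_integrable_def using assms
  by (intro integrable_scaleR_left integrable_real_indicator) (auto simp: fmeasurable_def)

lemma set_integral_nonneg_mono:
  fixes h :: "'a::euclidean_space \<Rightarrow> real"
  assumes "integrable lebesgue h" "\<And>y. h y \<ge> 0" "A \<in> sets lebesgue" "B \<in> sets lebesgue" "A \<subseteq> B"
  shows "(LINT y:A|lebesgue. h y) \<le> (LINT y:B|lebesgue. h y)"
  unfolding set_lebesgue_integral_def
  using assms by (intro integral_mono set_integrable_lebesgue_subset[unfolded set_integrable_def])
    (auto simp: indicator_def)

text \<open>The factor \<open>2 ^ n\<close> comes from enclosing the closed ball in the open ball of twice the radius.\<close>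

lemma integral_cball_le_of_not_bad:
  fixes x :: "'a::euclidean_space"
  assumes "x \<notin> bad_set t h" "s > 0" and h: "integrable lebesgue h" "\<And>y. h y \<ge> 0"
  shows "(LINT y:cball x s|lebesgue. h y) \<le> t * 2 ^ DIM('a) * s ^ DIM('a)"
proof -
  have "(LINT y:cball x s|lebesgue. h y) \<le> (LINT y:ball x (2 * s)|lebesgue. h y)"
    using h assms(2) by (intro set_integral_nonneg_mono) auto
  also have "\<dots> \<le> t * (2 * s) ^ DIM('a)"
    using assms by (intro integral_ball_le_of_not_bad) auto
  finally show ?thesis by (simp add: power_mult_distrib mult_ac)
qed

lemma emeasure_lebesgue_ball:
  fixes c :: "'a::euclidean_space"
  assumes "r \<ge> 0"
  shows "emeasure lebesgue (ball c r) = ennreal (unit_ball_vol (DIM('a)) * r ^ DIM('a))"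
  using emeasure_ball[OF assms, of c] by simp

text \<open>By Vitali's covering lemma, disjoint balls of large mass suffice such that their fivefold
  enlargements cover the set.\<close>

lemma bad_set_weak_type:
  fixes h :: "'a::euclidean_space \<Rightarrow> real"
  assumes h: "integrable lebesgue h" "\<And>y. h y \<ge> 0" and t: "t > 0"
  shows "emeasure lebesgue (bad_set t h) \<le> ennreal (unit_ball_vol (DIM('a)) * 5 ^ DIM('a) / t * integral\<^sup>L lebesgue h)"
    (is "_ \<le> ennreal (?c / t * _)")
proof -
  let ?n = "DIM('a)"
  define I where "I = integral\<^sup>L lebesgue h"
  define K where "K = {p::'a \<times> real. snd p > 0 \<and> (LINT y:ball (fst p) (snd p)|lebesgue. h y) > t * snd p ^ ?n}"
  have cov: "bad_set t h \<subseteq> (\<Union>p\<in>K. ball (fst p) (snd p))"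
    unfolding bad_set_def K_def by force
  \<comment> \<open>the covering lemma requires bounded radii; large balls cannot have large mass\<close>
  have bd: "0 < snd p \<and> snd p \<le> max 1 (I / t)" if "p \<in> K" for p
  proof -
    have "t * snd p ^ ?n < (LINT y:ball (fst p) (snd p)|lebesgue. h y)" "0 < snd p"
      using that by (auto simp: K_def)
    moreover have "(LINT y:ball (fst p) (snd p)|lebesgue. h y) \<le> I"
      unfolding I_def set_lebesgue_integral_def
      using h by (intro integral_mono set_integrable_lebesgue_subset[unfolded set_integrable_def])
        (auto simp: indicator_def)
    ultimately have "snd p ^ ?n \<le> I / t" using t by (simp add: field_simps)
    moreover have "snd p \<le> snd p ^ ?n" if "snd p \<ge> 1"
      using power_increasing[of 1 ?n "snd p"] that DIM_positive[where 'a='a] by (simp add: Suc_leI)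
    ultimately show ?thesis using \<open>0 < snd p\<close> by linarith
  qed
  obtain C where C: "countable C" "C \<subseteq> K"
    "pairwise (\<lambda>p q. disjnt (ball (fst p) (snd p)) (ball (fst q) (snd q))) C"
    "bad_set t h \<subseteq> (\<Union>p\<in>C. ball (fst p) (5 * snd p))"
    by (rule Vitali_covering_lemma_balls[OF cov bd]) auto
  define N where "N = to_nat_on C ` C"
  define g where "g = from_nat_into C"
  have g: "g n \<in> C" "to_nat_on C (g n) = n" if "n \<in> N" for n
    using that C(1) by (auto simp: N_def g_def)
  define A where "A n = (if n \<in> N then ball (fst (g n)) (5 * snd (g n)) else {})" for n
  define B where "B n = (if n \<in> N then ball (fst (g n)) (snd (g n)) else {})" for n
  have dis: "disjoint_family B"
    unfolding disjoint_family_on_def B_def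
    using C(3) g by (auto simp: pairwise_def disjnt_def) (metis IntI empty_iff mem_ball)+
  have subA: "bad_set t h \<subseteq> (\<Union>n. A n)"
  proof
    fix x assume "x \<in> bad_set t h"
    then obtain p where "p \<in> C" "x \<in> ball (fst p) (5 * snd p)" using C(4) by blast
    then have "x \<in> A (to_nat_on C p)" using C(1) by (auto simp: A_def N_def g_def)
    then show "x \<in> (\<Union>n. A n)" by blast
  qed
  define \<nu> where "\<nu> = density lebesgue (\<lambda>x. ennreal (h x))"
  have hm[measurable]: "h \<in> borel_measurable lebesgue" using h(1) by auto
  have \<nu>: "emeasure \<nu> (ball z s) = ennreal (LINT y:ball z s|lebesgue. h y)" for z s
  proof -
    have "emeasure \<nu> (ball z s) = (\<integral>\<^sup>+ y. ennreal (indicator (ball z s) y *\<^sub>R h y) \<partial>lebesgue)"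
      unfolding \<nu>_def by (subst emeasure_density) (auto intro!: nn_integral_cong simp: indicator_def)
    also have "\<dots> = ennreal (LINT y:ball z s|lebesgue. h y)"
      unfolding set_lebesgue_integral_def
      using h by (intro nn_integral_eq_integral set_integrable_lebesgue_subset[unfolded set_integrable_def]) auto
    finally show ?thesis .
  qed
  have AB: "emeasure lebesgue (A n) \<le> ennreal (?c / t) * emeasure \<nu> (B n)" for n
  proof (cases "n \<in> N")
    case True
    then have p: "g n \<in> K" using g C(2) by auto
    let ?s = "snd (g n)"
    have s: "?s > 0" "t * ?s ^ ?n < (LINT y:ball (fst (g n)) ?s|lebesgue. h y)"
      using p by (auto simp: K_def)
    have "emeasure lebesgue (A n) = ennreal (?c * ?s ^ ?n)"
      using True s emeasure_lebesgue_ball[of "5 * ?s" "fst (g n)"]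
      by (simp add: A_def power_mult_distrib mult_ac del: emeasure_completion)
    also have "\<dots> \<le> ennreal (?c / t * (LINT y:ball (fst (g n)) ?s|lebesgue. h y))"
    proof (rule ennreal_leI)
      have "?c * ?s ^ ?n = ?c / t * (t * ?s ^ ?n)" using t by simp
      also have "\<dots> \<le> ?c / t * (LINT y:ball (fst (g n)) ?s|lebesgue. h y)"
        using s t by (intro mult_left_mono) auto
      finally show "?c * ?s ^ ?n \<le> ?c / t * (LINT y:ball (fst (g n)) ?s|lebesgue. h y)" .
    qed
    also have "\<dots> = ennreal (?c / t) * emeasure \<nu> (B n)"
      using True t by (simp add: B_def \<nu> ennreal_mult'[symmetric] del: times_divide_eq_left)
    finally show ?thesis .
  qed (simp add: A_def)
  have "emeasure lebesgue (bad_set t h) \<le> emeasure lebesgue (\<Union>n. A n)"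
    by (rule emeasure_mono[OF subA]) (auto simp: A_def)
  also have "\<dots> \<le> (\<Sum>n. emeasure lebesgue (A n))"
    by (rule emeasure_subadditive_countably) (auto simp: A_def)
  also have "\<dots> \<le> (\<Sum>n. ennreal (?c / t) * emeasure \<nu> (B n))"
    by (intro suminf_le AB) auto
  also have "\<dots> = ennreal (?c / t) * emeasure \<nu> (\<Union>n. B n)"
    by (subst ennreal_suminf_cmult) (subst suminf_emeasure, use dis in \<open>auto simp: \<nu>_def B_def\<close>)
  also have "emeasure \<nu> (\<Union>n. B n) \<le> emeasure \<nu> UNIV"
    by (rule emeasure_mono) (auto simp: \<nu>_def)
  also have "emeasure \<nu> UNIV = ennreal I"
    unfolding \<nu>_def I_def using h by (subst emeasure_density) (auto simp: nn_integral_eq_integral)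
  finally show ?thesis
    using t by (simp add: I_def ennreal_mult'[symmetric] mult_left_mono)
qed

lemma bad_set_lmeasurable:
  fixes h :: "'a::euclidean_space \<Rightarrow> real"
  assumes h: "integrable lebesgue h" "\<And>y. h y \<ge> 0" and t: "t > 0"
  shows "bad_set t h \<in> lmeasurable"
    "measure lebesgue (bad_set t h) \<le> unit_ball_vol (DIM('a)) * 5 ^ DIM('a) / t * integral\<^sup>L lebesgue h"
proof -
  note * = bad_set_weak_type[OF assms]
  have "bad_set t h \<in> sets lebesgue"
    by (simp add: open_bad_set borel_open sets_completionI_sets)
  then show "bad_set t h \<in> lmeasurable"
    by (rule fmeasurableI) (rule le_less_trans[OF *], simp)
  then show "measure lebesgue (bad_set t h) \<le> unit_ball_vol (DIM('a)) * 5 ^ DIM('a) / t * integral\<^sup>L lebesgue h"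
    using * t h by (subst (asm) emeasure_eq_measure2) (auto simp: ennreal_le_iff)
qed

text \<open>The weak type estimate alone, applied to \<open>h\<close>, decays like \<open>1 / t\<close>. Values of \<open>h\<close> below a fixed
  fraction of \<open>t\<close> account for at most half of the mass that a ball needs, so the estimate may be
  applied to the part of \<open>h\<close> above that height, where \<open>t ^ (n - 1) * h\<close> is at most a multiple of
  \<open>h ^ n\<close>; the integral of \<open>h ^ n\<close> over that part tends to zero.\<close>

lemma bad_set_measure_tendsto:
  fixes h :: "'a::euclidean_space \<Rightarrow> real"
  assumes h: "integrable lebesgue h" "\<And>y. h y \<ge> 0" and hn: "integrable lebesgue (\<lambda>y. h y ^ DIM('a))"
  shows "((\<lambda>t. t ^ DIM('a) * measure lebesgue (bad_set t h)) \<longlongrightarrow> 0) at_top"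
proof -
  let ?n = "DIM('a)"
  define w where "w = unit_ball_vol (real ?n)"
  have w: "w > 0" by (simp add: w_def)
  define C where "C = 2 * w * 5 ^ ?n * (2 * w) ^ (?n - 1)"
  have C: "C \<ge> 0" using w by (simp add: C_def)
  have hm[measurable]: "h \<in> borel_measurable lebesgue" using h(1) by auto
  define k where "k t y = (if h y > t / (2 * w) then h y ^ ?n else 0)" for t y
  have ki: "integrable lebesgue (k t)" for t
    unfolding k_def by (rule Bochner_Integration.integrable_bound[OF hn]) (auto simp: h)
  have "((\<lambda>t. integral\<^sup>L lebesgue (k t)) \<longlongrightarrow> integral\<^sup>L lebesgue (\<lambda>y::'a. 0)) at_top"
  proof (rule integral_dominated_convergence_at_top[where s=k and w="\<lambda>y. h y ^ DIM('a)"])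
    show "\<forall>\<^sub>F i in at_top. AE x in lebesgue. norm (k i x) \<le> h x ^ DIM('a)"
      using h by (intro always_eventually) (auto simp: k_def)
    show "AE x in lebesgue. ((\<lambda>i. k i x) \<longlongrightarrow> 0) at_top"
    proof (rule AE_I2)
      fix x
      have "\<forall>\<^sub>F t in at_top. k t x = 0"
        using eventually_ge_at_top[of "2 * w * h x"]
        by eventually_elim (use w in \<open>auto simp: k_def field_simps\<close>)
      then show "((\<lambda>i. k i x) \<longlongrightarrow> 0) at_top" by (simp add: tendsto_eventually)
    qed
  qed (use ki hn in auto)
  then have lim: "((\<lambda>t. C * integral\<^sup>L lebesgue (k t)) \<longlongrightarrow> 0) at_top"
    by (auto intro!: tendsto_mult_right_zero)
  have le: "t ^ ?n * measure lebesgue (bad_set t h) \<le> C * integral\<^sup>L lebesgue (k t)" if t: "t > 0" for t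
  proof -
    \<comment> \<open>a constant function of this height has exactly half of the critical mass on every ball\<close>
    define a where "a = t / (2 * w)"
    have a: "a > 0" using t w by (simp add: a_def)
    define h' where "h' y = (if h y > a then h y else 0)" for y
    have h': "integrable lebesgue h'" "\<And>y. h' y \<ge> 0"
      unfolding h'_def by (rule Bochner_Integration.integrable_bound[OF h(1)]) (auto simp: h)
    have sub: "bad_set t h \<subseteq> bad_set (t/2) h'"
    proof
      fix x assume "x \<in> bad_set t h"
      then obtain z s where z: "x \<in> ball z s" "s > 0" "t * s ^ ?n < (LINT y:ball z s|lebesgue. h y)"
        unfolding bad_set_def by blast
      have const: "set_integrable lebesgue (ball z s) (\<lambda>y. a)"
        by (rule set_integrable_lebesgue_const) simp
      have "(LINT y:ball z s|lebesgue. h y) \<le> (LINT y:ball z s|lebesgue. h' y + a)"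
      proof (rule set_integral_mono)
        show "set_integrable lebesgue (ball z s) (\<lambda>y. h' y + a)"
          using h' by (intro set_integral_add(1)[OF _ const] set_integrable_lebesgue_subset) auto
      qed (use h a in \<open>auto simp: h'_def intro: set_integrable_lebesgue_subset\<close>)
      also have "\<dots> = (LINT y:ball z s|lebesgue. h' y) + (LINT y:ball z s|lebesgue. a)"
        using h' by (intro set_integral_add(2)[OF _ const] set_integrable_lebesgue_subset) auto
      also have "(LINT y:ball z s|lebesgue. a) = t / 2 * s ^ ?n"
        using z w unfolding set_lebesgue_integral_def
        by (simp add: content_ball a_def w_def[symmetric] less_imp_le)
      finally have "t / 2 * s ^ ?n < (LINT y:ball z s|lebesgue. h' y)" using z(3) by linarith
      then show "x \<in> bad_set (t/2) h'" using z unfolding bad_set_def by blast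
    qed
    have "measure lebesgue (bad_set t h) \<le> measure lebesgue (bad_set (t/2) h')"
      using sub bad_set_lmeasurable[OF h' , of "t/2"] bad_set_lmeasurable[OF h t] t
      by (intro measure_mono_fmeasurable) auto
    also have "\<dots> \<le> w * 5 ^ ?n / (t/2) * integral\<^sup>L lebesgue h'"
      using bad_set_lmeasurable(2)[OF h' , of "t/2"] t by (simp add: w_def)
    finally have "t ^ ?n * measure lebesgue (bad_set t h) \<le> t ^ ?n * (w * 5 ^ ?n / (t/2) * integral\<^sup>L lebesgue h')"
      using t by (intro mult_left_mono) auto
    also have "\<dots> = 2 * w * 5 ^ ?n * (t ^ (?n - 1) * integral\<^sup>L lebesgue h')"
      using t power_minus_mult[of ?n t] by (simp add: field_simps)
    also have "t ^ (?n - 1) * integral\<^sup>L lebesgue h' = (LINT y|lebesgue. t ^ (?n - 1) * h' y)" by simp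
    also have "\<dots> \<le> (LINT y|lebesgue. (2 * w) ^ (?n - 1) * k t y)"
    proof (intro integral_mono integrable_mult_right h' ki)
      fix y
      show "t ^ (?n - 1) * h' y \<le> (2 * w) ^ (?n - 1) * k t y"
      proof (cases "h y > a")
        case True
        then have "t \<le> 2 * w * h y" using w by (simp add: a_def field_simps)
        then have "t ^ (?n - 1) \<le> (2 * w * h y) ^ (?n - 1)" using t by (intro power_mono) auto
        then have "t ^ (?n - 1) * h y \<le> (2 * w * h y) ^ (?n - 1) * h y"
          using h by (intro mult_right_mono) auto
        also have "\<dots> = (2 * w) ^ (?n - 1) * h y ^ ?n"
          using power_minus_mult[of ?n "h y"] by (simp add: power_mult_distrib mult_ac)
        finally show ?thesis using True by (simp add: h'_def k_def a_def)
      qed (simp add: h'_def k_def a_def)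
    qed
    finally show ?thesis using w by (simp add: C_def mult_ac)
  qed
  show ?thesis
    by (rule tendsto_sandwich[OF _ _ tendsto_const lim])
      (use le in \<open>auto intro!: eventually_mono[OF eventually_gt_at_top[of 0]]\<close>)
qed

definition leb_point :: "('a::euclidean_space \<Rightarrow> 'b::euclidean_space) \<Rightarrow> 'a \<Rightarrow> bool" where
  "leb_point f x \<longleftrightarrow>
     ((\<lambda>s. (LINT y:cball x s|lebesgue. norm (f y - f x)) / s ^ DIM('a)) \<longlongrightarrow> 0) (at_right 0)"

text \<open>The function is truncated in height and support; clamping and cutting off the continuous
  functions that converge to it almost everywhere keeps them dominated.\<close>

lemma integrable_approx_continuous:
  fixes f :: "'a::euclidean_space \<Rightarrow> real"
  assumes f: "integrable lebesgue f" and e: "e > 0"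
  obtains c where "continuous_on UNIV c" "integrable lebesgue c" "(LINT y|lebesgue. \<bar>f y - c y\<bar>) < e"
proof -
  have fm[measurable]: "f \<in> borel_measurable lebesgue" using f by auto
  define cl :: "nat \<Rightarrow> real \<Rightarrow> real" where "cl j r = max (- real j) (min (real j) r)" for j r
  have cl_cont: "isCont (cl j) r" for j r
    unfolding cl_def by (intro continuous_intros)
  have cl_le: "\<bar>cl j r\<bar> \<le> real j" for j r by (auto simp: cl_def)
  define F where "F j x = indicator (cball 0 (real j)) x * cl j (f x)" for j x
  have Fm[measurable]: "F j \<in> borel_measurable lebesgue" for j
    unfolding F_def cl_def using fm
    by (intro borel_measurable_times borel_measurable_max borel_measurable_min borel_measurable_const borel_measurable_indicator) auto
  have Fi: "integrable lebesgue (F j)" for j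
    by (rule integrable_lebesgue_bounded_support[OF Fm, where B="real j" and K="cball 0 (real j)"])
      (auto simp: F_def indicator_def cl_le)
  have "(\<lambda>j. LINT x|lebesgue. \<bar>f x - F j x\<bar>) \<longlonglongrightarrow> (LINT x::'a|lebesgue. 0)"
  proof (rule integral_dominated_convergence[where w="\<lambda>x. \<bar>f x\<bar>"])
    show "AE x in lebesgue. (\<lambda>j. \<bar>f x - F j x\<bar>) \<longlonglongrightarrow> 0"
    proof (rule AE_I2)
      fix x
      obtain N where N: "real N \<ge> max (norm x) \<bar>f x\<bar>" using real_arch_simple by blast
      have "\<forall>\<^sub>F j in sequentially. \<bar>f x - F j x\<bar> = 0"
        using eventually_ge_at_top[of N]
      proof eventually_elim
        case (elim j)
        then have "real N \<le> real j" by simp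
        with N have "norm x \<le> real j" "\<bar>f x\<bar> \<le> real j" by auto
        then show ?case by (auto simp: F_def cl_def)
      qed
      then show "(\<lambda>j. \<bar>f x - F j x\<bar>) \<longlonglongrightarrow> 0" by (simp add: tendsto_eventually)
    qed
    show "AE x in lebesgue. norm \<bar>f x - F j x\<bar> \<le> \<bar>f x\<bar>" for j
      by (rule AE_I2) (auto simp: F_def cl_def indicator_def)
  qed (use f in auto)
  then have "\<forall>\<^sub>F j in sequentially. (LINT x|lebesgue. \<bar>f x - F j x\<bar>) < e / 2"
    using e by (intro order_tendstoD(2)) auto
  then obtain j where j: "(LINT x|lebesgue. \<bar>f x - F j x\<bar>) < e / 2"
    by (meson eventually_sequentially order_refl)
  have "F j measurable_on UNIV"
    using lebesgue_measurable_imp_measurable_on[of "F j" UNIV] Fm by simp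
  then obtain N g where N: "negligible N" "\<And>k::nat. continuous_on UNIV (g k)"
    "\<And>x. x \<notin> N \<Longrightarrow> (\<lambda>k. g k x) \<longlonglongrightarrow> F j x"
    unfolding measurable_on_def by auto
  define z where "z x = max 0 (min 1 (real j + 1 - norm x))" for x :: 'a
  define G where "G k x = cl j (g k x) * z x" for k x
  have Gcont: "continuous_on UNIV (G k)" for k
    unfolding G_def cl_def z_def by (intro continuous_intros N)
  have Gle: "\<bar>G k x\<bar> \<le> indicator (cball 0 (real j + 1)) x * real j" for k x
  proof (cases "x \<in> cball 0 (real j + 1)")
    case True
    have "\<bar>cl j (g k x)\<bar> * \<bar>z x\<bar> \<le> real j * 1"
      by (intro mult_mono cl_le) (auto simp: z_def)
    then show ?thesis using True by (simp add: G_def abs_mult)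
  qed (simp add: G_def z_def)
  have Gi: "integrable lebesgue (G k)" for k
    by (rule integrable_lebesgue_continuous_support(1)[OF Gcont compact_cball, of 0 "real j + 1"])
      (use Gle[of k] in \<open>metis abs_le_zero_iff indicator_simps(2) mult_zero_left\<close>)
  have "(\<lambda>k. LINT x|lebesgue. \<bar>F j x - G k x\<bar>) \<longlonglongrightarrow> (LINT x::'a|lebesgue. 0)"
  proof (rule integral_dominated_convergence[where w="\<lambda>x. indicator (cball 0 (real j + 1)) x * (2 * real j)"])
    show "AE x in lebesgue. (\<lambda>k. \<bar>F j x - G k x\<bar>) \<longlonglongrightarrow> 0"
    proof -
      have "(\<lambda>k. \<bar>F j x - G k x\<bar>) \<longlonglongrightarrow> 0" if "x \<notin> N" for x
      proof -
        have "(\<lambda>k. cl j (g k x)) \<longlonglongrightarrow> cl j (F j x)"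
          by (rule isCont_tendsto_compose[OF cl_cont N(3)[OF that]])
        moreover have "cl j (F j x) * z x = F j x"
          by (auto simp: F_def cl_def z_def indicator_def)
        ultimately have "(\<lambda>k. G k x) \<longlonglongrightarrow> F j x"
          unfolding G_def using tendsto_mult_right[of "\<lambda>k. cl j (g k x)" _ _ "z x"] by metis
        then show ?thesis
          using tendsto_rabs_zero[OF LIM_zero[of "\<lambda>k. G k x" "F j x"]] by (simp add: abs_minus_commute)
      qed
      then show ?thesis
        using N(1) by (auto simp: eventually_ae_filter_negligible)
    qed
    show "AE x in lebesgue. norm \<bar>F j x - G k x\<bar> \<le> indicator (cball 0 (real j + 1)) x * (2 * real j)" for k
    proof (rule AE_I2)
      fix x
      have "\<bar>F j x\<bar> \<le> indicator (cball 0 (real j + 1)) x * real j"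
        using cl_le[of j "f x"] by (auto simp: F_def indicator_def)
      then show "norm \<bar>F j x - G k x\<bar> \<le> indicator (cball 0 (real j + 1)) x * (2 * real j)"
        using Gle[of k x] by (auto simp: indicator_def split: if_splits)
    qed
    show "integrable lebesgue (\<lambda>x. indicator (cball 0 (real j + 1)) x * (2 * real j))"
      using set_integrable_lebesgue_const[of "cball 0 (real j + 1)" "2 * real j"]
      by (simp add: set_integrable_def del: mem_cball)
  qed (use Gi Fi in \<open>auto intro!: borel_measurable_integrable\<close>)
  then have "\<forall>\<^sub>F k in sequentially. (LINT x|lebesgue. \<bar>F j x - G k x\<bar>) < e / 2"
    using e by (intro order_tendstoD(2)) auto
  then obtain k where k: "(LINT x|lebesgue. \<bar>F j x - G k x\<bar>) < e / 2"
    by (meson eventually_sequentially order_refl)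
  have "(LINT x|lebesgue. \<bar>f x - G k x\<bar>) \<le> (LINT x|lebesgue. \<bar>f x - F j x\<bar> + \<bar>F j x - G k x\<bar>)"
    using f Fi Gi by (intro integral_mono Bochner_Integration.integrable_add integrable_abs Bochner_Integration.integrable_diff) auto
  also have "\<dots> = (LINT x|lebesgue. \<bar>f x - F j x\<bar>) + (LINT x|lebesgue. \<bar>F j x - G k x\<bar>)"
    using f Fi Gi by (intro Bochner_Integration.integral_add integrable_abs Bochner_Integration.integrable_diff)
  finally have "(LINT x|lebesgue. \<bar>f x - G k x\<bar>) < e" using j k by linarith
  then show ?thesis using that Gcont Gi by blast
qed

lemma set_integral_const_cball:
  fixes x :: "'a::euclidean_space"
  assumes "s \<ge> 0"
  shows "set_integrable lebesgue (cball x s) (\<lambda>y. a::real)"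
    "(LINT y:cball x s|lebesgue. a) = a * unit_ball_vol (DIM('a)) * s ^ DIM('a)"
proof -
  show "set_integrable lebesgue (cball x s) (\<lambda>y. a::real)"
    by (rule set_integrable_lebesgue_const) simp
  show "(LINT y:cball x s|lebesgue. a) = a * unit_ball_vol (DIM('a)) * s ^ DIM('a)"
    unfolding set_lebesgue_integral_def using assms by (simp add: content_cball)
qed

text \<open>Up to a small error \<open>h\<close> in the mean the function is continuous. Where the averages of the
  oscillation stay above \<open>l\<close>, either \<open>h\<close> or its maximal function is large, and such points form a
  set of small measure.\<close>

lemma AE_leb_point_real:
  fixes f :: "'a::euclidean_space \<Rightarrow> real"
  assumes f: "integrable lebesgue f"
  shows "AE x in lebesgue. leb_point f x"
proof -
  let ?n = "DIM('a)"
  define w where "w = unit_ball_vol (real ?n)"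
  have w: "w > 0" by (simp add: w_def)
  define A where "A x s = (LINT y:cball x s|lebesgue. norm (f y - f x)) / s ^ ?n" for x s
  have neg: "negligible {x. \<not> (\<forall>\<^sub>F s in at_right 0. A x s \<le> l)}" if l: "l > 0" for l
    unfolding negligible_outer_le
  proof (intro allI impI)
    fix e :: real assume e: "e > 0"
    define t where "t = l / (3 * 2 ^ ?n)"
    define a where "a = l / (3 * w)"
    have ta: "t > 0" "a > 0" using l w by (auto simp: t_def a_def)
    define K where "K = w * 5 ^ ?n / t + 1 / a"
    have K: "K > 0" unfolding K_def using ta w by (intro add_pos_pos) auto
    obtain c where c: "continuous_on UNIV c" "integrable lebesgue c" "(LINT y|lebesgue. \<bar>f y - c y\<bar>) < e / K"
      using integrable_approx_continuous[OF f, of "e / K"] e K by auto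
    define h where "h y = \<bar>f y - c y\<bar>" for y
    have h: "integrable lebesgue h" "\<And>y. h y \<ge> 0" unfolding h_def using f c by auto
    have hm[measurable]: "h \<in> borel_measurable lebesgue" using h by auto
    have hI: "integral\<^sup>L lebesgue h < e / K" using c by (simp add: h_def[abs_def])
    define T where "T = bad_set t h \<union> {x. h x \<ge> a}"
    note bad = bad_set_lmeasurable[OF h ta(1)]
    have mk: "measure lebesgue {x\<in>space lebesgue. h x \<ge> a} \<le> integral\<^sup>L lebesgue h / a"
      using h ta by (intro integral_Markov_inequality_measure[where A="{}"]) auto
    have mk': "emeasure lebesgue {x\<in>space lebesgue. h x \<ge> a} \<le> (1 / a) * integral\<^sup>L lebesgue h"
      using h ta by (intro integral_Markov_inequality) auto
    have lm: "{x. h x \<ge> a} \<in> lmeasurable"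
    proof (rule fmeasurableI)
      show "{x. h x \<ge> a} \<in> sets lebesgue"
        using measurable_sets[OF hm, of "{a..}"] by (simp add: vimage_def)
      show "emeasure lebesgue {x. h x \<ge> a} < \<infinity>" using mk' by (auto intro: le_less_trans)
    qed
    have "measure lebesgue T \<le> measure lebesgue (bad_set t h) + measure lebesgue {x. h x \<ge> a}"
      unfolding T_def using bad lm by (intro measure_Un_le) auto
    also have "\<dots> \<le> K * integral\<^sup>L lebesgue h"
      using bad(2) mk by (simp add: K_def w_def algebra_simps)
    also have "\<dots> \<le> e" using hI K by (simp add: field_simps)
    finally have "measure lebesgue T \<le> e" .
    moreover have "T \<in> lmeasurable" unfolding T_def using bad lm by (intro fmeasurable.Un)
    moreover have "{x. \<not> (\<forall>\<^sub>F s in at_right 0. A x s \<le> l)} \<subseteq> T"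
    proof (rule ccontr)
      assume "\<not> ?thesis"
      then obtain x where "x \<notin> T" and nA: "\<not> (\<forall>\<^sub>F s in at_right 0. A x s \<le> l)"
        by blast
      then have x: "x \<notin> bad_set t h" "h x < a"
        by (simp_all add: T_def)
      have "isCont c x" using c(1) by (simp add: continuous_on_eq_continuous_at)
      then obtain d where d: "d > 0" "\<And>y. dist y x < d \<Longrightarrow> dist (c y) (c x) < a"
        using ta(2) unfolding continuous_at_eps_delta by blast
      have "A x s \<le> l" if s: "s > 0" "s < d" for s
      proof -
        have hi: "set_integrable lebesgue (cball x s) h"
          using h by (intro set_integrable_lebesgue_subset) auto
        note ci = set_integral_const_cball[of s x "2 * a"]
        have "(LINT y:cball x s|lebesgue. norm (f y - f x)) \<le> (LINT y:cball x s|lebesgue. h y + 2 * a)"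
        proof (rule set_integral_mono)
          have "set_integrable lebesgue (cball x s) (\<lambda>y. f y - f x)"
            using s set_integral_const_cball(1)[of s x "f x"] f
            by (intro set_integral_diff(1)[OF set_integrable_lebesgue_subset]) auto
          then show "set_integrable lebesgue (cball x s) (\<lambda>y. norm (f y - f x))"
            by (rule set_integrable_norm)
          show "set_integrable lebesgue (cball x s) (\<lambda>y. h y + 2 * a)"
            using hi ci s by (intro set_integral_add(1)) auto
          fix y assume "y \<in> cball x s"
          then have "\<bar>c y - c x\<bar> < a" using d(2)[of y] s by (simp add: dist_real_def dist_commute)
          then show "norm (f y - f x) \<le> h y + 2 * a" using x(2) by (simp add: h_def)
        qed
        also have "\<dots> = (LINT y:cball x s|lebesgue. h y) + (LINT y:cball x s|lebesgue. 2 * a)"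
          using hi ci s by (intro set_integral_add(2)) auto
        also have "\<dots> \<le> t * 2 ^ ?n * s ^ ?n + 2 * a * w * s ^ ?n"
        proof (rule add_mono)
          show "(LINT y:cball x s|lebesgue. h y) \<le> t * 2 ^ ?n * s ^ ?n"
            by (rule integral_cball_le_of_not_bad[OF x(1) s(1) h])
          show "(LINT y:cball x s|lebesgue. 2 * a) \<le> 2 * a * w * s ^ ?n"
            unfolding w_def by (rule eq_refl[OF ci(2)]) (use s in simp)
        qed
        also have "\<dots> = l * s ^ ?n" using w by (simp add: t_def a_def field_simps)
        finally show ?thesis using s by (simp add: A_def field_simps)
      qed
      then have "\<forall>\<^sub>F s in at_right 0. A x s \<le> l"
        using d(1) by (auto simp: eventually_at_right_field)
      with nA show False by blast
    qed
    ultimately show "\<exists>T. {x. \<not> (\<forall>\<^sub>F s in at_right 0. A x s \<le> l)} \<subseteq> T \<and> T \<in> lmeasurable \<and> measure lebesgue T \<le> e"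
      by blast
  qed
  define Z where "Z = (\<Union>m::nat. {x. \<not> (\<forall>\<^sub>F s in at_right 0. A x s \<le> 1 / (real m + 1))})"
  have "negligible Z" unfolding Z_def by (rule negligible_Union_nat) (rule neg, simp)
  moreover have "leb_point f x" if "x \<notin> Z" for x
    unfolding leb_point_def A_def[symmetric]
  proof (rule tendstoI)
    fix e :: real assume "e > 0"
    then obtain m where m: "1 / (real m + 1) < e" by (metis inverse_eq_divide reals_Archimedean of_nat_Suc add.commute)
    have "\<forall>\<^sub>F s in at_right 0. A x s \<le> 1 / (real m + 1)" using that by (auto simp: Z_def)
    moreover have "\<forall>\<^sub>F s::real in at_right 0. s > 0" by (simp add: eventually_at_right_less)
    ultimately show "\<forall>\<^sub>F s in at_right 0. dist (A x s) 0 < e"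
    proof eventually_elim
      case (elim s)
      have "A x s \<ge> 0" unfolding A_def set_lebesgue_integral_def
        using elim(2) by (intro divide_nonneg_nonneg Bochner_Integration.integral_nonneg) auto
      then show ?case using elim m by (simp add: dist_real_def)
    qed
  qed
  ultimately show ?thesis by (auto simp: eventually_ae_filter_negligible)
qed

lemma AE_leb_point_integrable:
  fixes f :: "'a::euclidean_space \<Rightarrow> 'b::euclidean_space"
  assumes f: "integrable lebesgue f"
  shows "AE x in lebesgue. leb_point f x"
proof -
  have "AE x in lebesgue. \<forall>b\<in>Basis. leb_point (\<lambda>x. f x \<bullet> b) x"
    using f by (subst AE_finite_all) (auto intro!: AE_leb_point_real)
  then show ?thesis
  proof eventually_elim
    case (elim x)
    have fi: "set_integrable lebesgue (cball x s) (\<lambda>y. f y - f x)" for s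
    proof -
      have "set_integrable lebesgue (cball x s) (\<lambda>y. f x)"
        by (rule set_integrable_lebesgue_const) simp
      then show ?thesis
        using f by (intro set_integral_diff(1)[OF set_integrable_lebesgue_subset]) auto
    qed
    have bi: "set_integrable lebesgue (cball x s) (\<lambda>y. norm (f y \<bullet> b - f x \<bullet> b))" for s b
    proof -
      have "set_integrable lebesgue (cball x s) (\<lambda>y. f y \<bullet> b - f x \<bullet> b)"
        using integrable_inner_left[of b, OF fi[of s, unfolded set_integrable_def]]
        by (simp add: set_integrable_def inner_diff_left)
      then show ?thesis by (rule set_integrable_norm)
    qed
    have sum: "((\<lambda>s. \<Sum>b\<in>Basis. (LINT y:cball x s|lebesgue. norm (f y \<bullet> b - f x \<bullet> b)) / s ^ DIM('a)) \<longlongrightarrow> (\<Sum>b\<in>(Basis::'b set). 0)) (at_right 0)"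
      using elim unfolding leb_point_def by (intro tendsto_sum) auto
    have le: "(LINT y:cball x s|lebesgue. norm (f y - f x)) / s ^ DIM('a)
        \<le> (\<Sum>b\<in>Basis. (LINT y:cball x s|lebesgue. norm (f y \<bullet> b - f x \<bullet> b)) / s ^ DIM('a))" if "s > 0" for s
    proof -
      have "(LINT y:cball x s|lebesgue. norm (f y - f x))
        \<le> (LINT y:cball x s|lebesgue. \<Sum>b\<in>Basis. norm (f y \<bullet> b - f x \<bullet> b))"
      proof (rule set_integral_mono[OF set_integrable_norm[OF fi]])
        show "set_integrable lebesgue (cball x s) (\<lambda>y. \<Sum>b\<in>Basis. norm (f y \<bullet> b - f x \<bullet> b))"
          using bi unfolding set_integrable_def scaleR_sum_right by (intro Bochner_Integration.integrable_sum)
        show "norm (f y - f x) \<le> (\<Sum>b\<in>Basis. norm (f y \<bullet> b - f x \<bullet> b))" for y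
          using norm_le_l1[of "f y - f x"] by (simp add: inner_diff_left)
      qed
      also have "\<dots> = (\<Sum>b\<in>Basis. (LINT y:cball x s|lebesgue. norm (f y \<bullet> b - f x \<bullet> b)))"
        unfolding set_lebesgue_integral_def scaleR_sum_right
        by (rule Bochner_Integration.integral_sum) (use bi in \<open>simp add: set_integrable_def\<close>)
      finally show ?thesis using that by (simp add: sum_divide_distrib[symmetric] divide_right_mono)
    qed
    show ?case unfolding leb_point_def
    proof (rule tendsto_sandwich[OF _ _ tendsto_const])
      show "\<forall>\<^sub>F s in at_right 0. (0::real) \<le> (LINT y:cball x s|lebesgue. norm (f y - f x)) / s ^ DIM('a)"
        by (rule eventually_mono[OF eventually_at_right_less[of 0]])
          (auto simp: set_lebesgue_integral_def intro!: divide_nonneg_nonneg Bochner_Integration.integral_nonneg)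
      show "\<forall>\<^sub>F s in at_right 0. (LINT y:cball x s|lebesgue. norm (f y - f x)) / s ^ DIM('a)
        \<le> (\<Sum>b\<in>Basis. (LINT y:cball x s|lebesgue. norm (f y \<bullet> b - f x \<bullet> b)) / s ^ DIM('a))"
        by (rule eventually_mono[OF eventually_at_right_less[of 0]]) (rule le)
    qed (use sum in simp)
  qed
qed

text \<open>The open set is exhausted by compact sets, off which the function may be replaced by zero.\<close>

lemma AE_leb_point:
  fixes f :: "'a::euclidean_space \<Rightarrow> 'b::euclidean_space"
  assumes S: "open S" and f: "locally_integrable S f"
  shows "AE x in lebesgue. x \<in> S \<longrightarrow> leb_point f x"
proof -
  obtain C where C: "\<And>n::nat. compact (C n)" "\<And>n. C n \<subseteq> S" "\<And>n. C n \<subseteq> interior (C (Suc n))" "\<Union>(range C) = S"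
    using open_Union_compact_subsets[OF S] by metis
  define F where "F n x = indicator (C n) x *\<^sub>R f x" for n x
  have "integrable lebesgue (F n)" for n
    using f C unfolding locally_integrable_def set_integrable_def F_def by blast
  then have "AE x in lebesgue. \<forall>n. leb_point (F n) x"
    by (auto simp: AE_all_countable intro: AE_leb_point_integrable)
  then show ?thesis
  proof eventually_elim
    case (elim x)
    show ?case
    proof
      assume "x \<in> S"
      then obtain n where "x \<in> C n" using C(4) by blast
      then have "x \<in> interior (C (Suc n))" using C(3) by blast
      then obtain d where d: "d > 0" "cball x d \<subseteq> C (Suc n)"
        by (meson mem_interior_cball)
      have eq: "F (Suc n) y = f y" if "y \<in> cball x d" for y using that d by (auto simp: F_def)
      have "(LINT y:cball x s|lebesgue. norm (F (Suc n) y - F (Suc n) x)) = (LINT y:cball x s|lebesgue. norm (f y - f x))"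
        if "s < d" for s
        by (rule set_lebesgue_integral_cong) (use that eq d in auto)
      then have "\<forall>\<^sub>F s in at_right 0. (LINT y:cball x s|lebesgue. norm (F (Suc n) y - F (Suc n) x)) / s ^ DIM('a)
          = (LINT y:cball x s|lebesgue. norm (f y - f x)) / s ^ DIM('a)"
        using d(1) by (auto simp: eventually_at_right_field)
      then show "leb_point f x"
        using elim[rule_format, of "Suc n"] unfolding leb_point_def by (rule Lim_transform_eventually[rotated])
    qed
  qed
qed

section \<open>Weak derivatives and difference quotients\<close>

lemma lebesgue_integral_affine:
  fixes f :: "'a::euclidean_space \<Rightarrow> 'b::euclidean_space"
  assumes f: "integrable lebesgue f" and c: "c \<noteq> 0"
  shows "integrable lebesgue (\<lambda>y. f (a + c *\<^sub>R y))"
    "(LINT y|lebesgue. f (a + c *\<^sub>R y)) = (1 / \<bar>c\<bar> ^ DIM('a)) *\<^sub>R integral\<^sup>L lebesgue f"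
proof -
  define T :: "'a \<Rightarrow> 'a" where "T = (\<lambda>x. a + c *\<^sub>R x)"
  have T: "(\<lambda>x. a + (\<Sum>j\<in>Basis. (c * (x \<bullet> j)) *\<^sub>R j)) = T"
    by (simp add: T_def scaleR_scaleR[symmetric] scaleR_sum_right[symmetric] euclidean_representation del: scaleR_scaleR)
  have Tm: "T \<in> lebesgue \<rightarrow>\<^sub>M lebesgue"
    using lebesgue_affine_measurable[of "\<lambda>_. c" a] c by (simp add: T)
  have L: "lebesgue = density (distr lebesgue lebesgue T) (\<lambda>_. ennreal (\<bar>c\<bar> ^ DIM('a)))"
    using lebesgue_affine_euclidean[of "\<lambda>_. c" a] c by (simp add: T)
  have fm: "f \<in> borel_measurable lebesgue" using f by auto
  have "integrable (density (distr lebesgue lebesgue T) (\<lambda>_. ennreal (\<bar>c\<bar> ^ DIM('a)))) f"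
    using f L by simp
  then have "integrable (distr lebesgue lebesgue T) (\<lambda>x. (\<bar>c\<bar> ^ DIM('a)) *\<^sub>R f x)"
    using fm by (subst (asm) integrable_density) auto
  then have "integrable lebesgue (\<lambda>x. (\<bar>c\<bar> ^ DIM('a)) *\<^sub>R f (T x))"
    using fm Tm by (subst (asm) integrable_distr_eq) auto
  from integrable_scaleR_right[of "1 / \<bar>c\<bar> ^ DIM('a)", OF this]
  show "integrable lebesgue (\<lambda>y. f (a + c *\<^sub>R y))" using c by (simp add: T_def)
  have "integral\<^sup>L lebesgue f = integral\<^sup>L (density (distr lebesgue lebesgue T) (\<lambda>_. ennreal (\<bar>c\<bar> ^ DIM('a)))) f"
    using L by simp
  also have "\<dots> = integral\<^sup>L (distr lebesgue lebesgue T) (\<lambda>x. (\<bar>c\<bar> ^ DIM('a)) *\<^sub>R f x)"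
    using fm by (subst integral_density) auto
  also have "\<dots> = (LINT x|lebesgue. (\<bar>c\<bar> ^ DIM('a)) *\<^sub>R f (T x))"
    using fm Tm by (subst integral_distr) auto
  finally show "(LINT y|lebesgue. f (a + c *\<^sub>R y)) = (1 / \<bar>c\<bar> ^ DIM('a)) *\<^sub>R integral\<^sup>L lebesgue f"
    using c by (simp add: T_def)
qed

lemma difference_quotient_tendsto:
  fixes f :: "'a::real_normed_vector \<Rightarrow> 'b::real_normed_vector"
  assumes "(f has_derivative D) (at y)"
  shows "(\<lambda>j. real (Suc j) *\<^sub>R (f (y + (1 / real (Suc j)) *\<^sub>R v) - f y)) \<longlonglongrightarrow> D v"
proof (cases "v = 0")
  case True
  then show ?thesis using linear_0[OF has_derivative_linear[OF assms]] by simp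
next
  case False
  let ?h = "\<lambda>j. (1 / real (Suc j)) *\<^sub>R v"
  have D: "bounded_linear D" and lim: "(\<lambda>h. norm (f (y + h) - f y - D h) / norm h) \<midarrow>0\<rightarrow> 0"
    using assms unfolding has_derivative_at by auto
  have h: "?h \<longlonglongrightarrow> 0"
    using tendsto_scaleR[OF LIMSEQ_inverse_real_of_nat tendsto_const[of v]] by (simp add: inverse_eq_divide)
  have "(\<lambda>j. norm (f (y + ?h j) - f y - D (?h j)) / norm (?h j)) \<longlonglongrightarrow> 0"
    by (rule filterlim_compose[OF lim]) (use h False in \<open>auto simp: filterlim_at\<close>)
  then have "(\<lambda>j. norm (f (y + ?h j) - f y - D (?h j)) / norm (?h j) * norm v) \<longlonglongrightarrow> 0"
    by (rule tendsto_mult_left_zero)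
  moreover have "norm (f (y + ?h j) - f y - D (?h j)) / norm (?h j) * norm v
      = norm (real (Suc j) *\<^sub>R (f (y + ?h j) - f y) - D v)" for j
  proof -
    have "real (Suc j) *\<^sub>R (f (y + ?h j) - f y) - D v = real (Suc j) *\<^sub>R (f (y + ?h j) - f y - D (?h j))"
      using linear_cmul[OF bounded_linear.linear[OF D]] by (simp add: scaleR_diff_right)
    then show ?thesis using False by (simp add: divide_simps)
  qed
  ultimately have "(\<lambda>j. norm (real (Suc j) *\<^sub>R (f (y + ?h j) - f y) - D v)) \<longlonglongrightarrow> 0" by simp
  then show ?thesis by (simp add: tendsto_norm_zero_iff LIM_zero_iff)
qed

lemma smooth_has_derivative:
  assumes "smooth_on UNIV f"
  shows "(f has_derivative frechet_derivative f (at x)) (at x)"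
  using assms unfolding smooth_on_def by (intro Ck_on_UNIV_Suc[of 0]) blast

lemma smooth_continuous_derivative:
  assumes "smooth_on UNIV f"
  shows "continuous_on UNIV (\<lambda>x. frechet_derivative f (at x) v)" "continuous_on UNIV f"
proof -
  have "Ck_on (Suc 0) f UNIV" "Ck_on 0 f UNIV" using assms unfolding smooth_on_def by blast+
  then show "continuous_on UNIV (\<lambda>x. frechet_derivative f (at x) v)" "continuous_on UNIV f" by auto
qed

lemma frechet_derivative_zero_off_support:
  fixes f :: "'a::real_normed_vector \<Rightarrow> real"
  assumes "closed K" "\<And>y. y \<notin> K \<Longrightarrow> f y = 0" "y \<notin> K"
  shows "frechet_derivative f (at y) = (\<lambda>v. 0)"
proof -
  have "((\<lambda>y. 0) has_derivative (\<lambda>v. 0)) (at y)" by simp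
  then have "(f has_derivative (\<lambda>v. 0)) (at y)"
    by (rule has_derivative_transform_within_open[of _ _ _ _ "- K"]) (use assms in auto)
  then show ?thesis using frechet_derivative_at by metis
qed

lemma smooth_compact_support_lipschitz:
  fixes \<psi> :: "real^'n::finite \<Rightarrow> real"
  assumes s: "smooth_on UNIV \<psi>" and K: "compact K" "\<And>y. y \<notin> K \<Longrightarrow> \<psi> y = 0"
  obtains B where "B > 0" "\<And>y z. \<bar>\<psi> y - \<psi> z\<bar> \<le> B * norm (y - z)" "\<And>y. \<bar>\<psi> y\<bar> \<le> B"
proof -
  let ?D = "\<lambda>y. frechet_derivative \<psi> (at y)"
  have "\<exists>B>0. \<forall>y. norm (?D y (axis i 1)) \<le> B" for i
    using integrable_lebesgue_continuous_support(2)[OF smooth_continuous_derivative(1)[OF s] K(1), of "axis i 1"]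
      frechet_derivative_zero_off_support[OF compact_imp_closed[OF K(1)] K(2)] by simp
  then obtain b where b: "\<And>i. b i > 0" "\<And>i y. \<bar>?D y (axis i 1)\<bar> \<le> b i" by (metis real_norm_def)
  obtain B0 where B0: "B0 > 0" "\<And>y. \<bar>\<psi> y\<bar> \<le> B0"
    using integrable_lebesgue_continuous_support(2)[OF smooth_continuous_derivative(2)[OF s] K] by auto
  define B where "B = (\<Sum>i\<in>UNIV. b i)"
  have B: "B > 0" unfolding B_def using b(1) by (intro sum_pos) auto
  have "\<bar>?D y v\<bar> \<le> B * norm v" for y v
  proof -
    have lin: "linear (?D y)" using has_derivative_linear[OF smooth_has_derivative[OF s]] .
    have "?D y v = (\<Sum>i\<in>UNIV. v $ i * ?D y (axis i 1))"
      using arg_cong[OF basis_expansion[of v], of "?D y"]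
      by (simp add: linear_sum[OF lin] linear_cmul[OF lin] scalar_mult_eq_scaleR)
    also have "\<bar>\<dots>\<bar> \<le> (\<Sum>i\<in>UNIV. b i * norm v)"
      by (rule order_trans[OF sum_abs sum_mono])
        (use mult_mono[OF b(2) component_le_norm_cart[of v] less_imp_le[OF b(1)]] in \<open>auto simp: abs_mult mult.commute\<close>)
    finally show ?thesis by (simp add: B_def sum_distrib_right)
  qed
  then have on: "onorm (?D y) \<le> B" for y
    using B by (intro onorm_bound) (auto simp: less_imp_le)
  have "norm (\<psi> y - \<psi> z) \<le> B * norm (y - z)" for y z
    by (rule differentiable_bound[OF convex_UNIV, of \<psi> ?D]) (use on smooth_has_derivative[OF s] in auto)
  then have L: "\<bar>\<psi> y - \<psi> z\<bar> \<le> (B + B0) * norm (y - z)" for y z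
  proof -
    have "\<bar>\<psi> y - \<psi> z\<bar> \<le> B * norm (y - z)" using \<open>norm (\<psi> y - \<psi> z) \<le> B * norm (y - z)\<close> by simp
    also have "\<dots> \<le> (B + B0) * norm (y - z)" using B0 by (intro mult_right_mono) auto
    finally show ?thesis .
  qed
  show ?thesis by (rule that[OF _ L]) (use B B0 in \<open>auto intro: order_trans[OF B0(2)]\<close>)
qed

lemma set_integrable_continuous_compact:
  fixes f :: "'a::euclidean_space \<Rightarrow> 'b::euclidean_space"
  assumes "compact K" "continuous_on K f"
  shows "set_integrable lebesgue K f"
proof -
  obtain B where B: "\<And>x. x \<in> K \<Longrightarrow> norm (f x) \<le> B" "B > 0"
    using compact_imp_bounded[OF compact_continuous_image[OF assms(2,1)]] by (auto simp: bounded_pos)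
  have "(\<lambda>x. indicator K x *\<^sub>R f x) \<in> borel_measurable borel"
    using assms by (intro borel_measurable_continuous_on_indicator) (auto intro: borel_closed compact_imp_closed)
  then have "(\<lambda>x. indicator K x *\<^sub>R f x) \<in> borel_measurable lebesgue" by (intro measurable_completion) simp
  then show ?thesis unfolding set_integrable_def
    by (rule integrable_lebesgue_bounded_support[where B=B and K=K])
      (use B assms in \<open>auto simp: indicator_def compact_imp_bounded less_imp_le\<close>)
qed

lemma norm_le_sum_columns:
  fixes G :: "real^'n::finite^'m::finite"
  shows "norm (column i G) \<le> norm G" "norm G \<le> (\<Sum>i\<in>UNIV. norm (column i G))"
proof -
  have c: "\<bar>G $ k $ i\<bar> \<le> norm (G $ k)" for k by (rule component_le_norm_cart)
  show "norm (column i G) \<le> norm G"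
    unfolding norm_vec_def[of "column i G"] norm_vec_def[of G]
    by (rule L2_set_mono) (use c in \<open>auto simp: column_def\<close>)
  have eq: "G = (\<Sum>i\<in>UNIV. (\<chi> k. G $ k $ i *\<^sub>R axis i 1))"
    by (auto simp: vec_eq_iff axis_def sum.delta' if_distrib cong: if_cong)
  have "norm (\<chi> k. G $ k $ i *\<^sub>R axis i 1 :: real^'n^'m) = norm (column i G)" for i
    unfolding norm_vec_def[of "column i G"] norm_vec_def[of "\<chi> k. G $ k $ i *\<^sub>R axis i 1 :: real^'n^'m"]
    by (simp add: column_def)
  with eq show "norm G \<le> (\<Sum>i\<in>UNIV. norm (column i G))"
    by (metis (no_types, lifting) norm_sum sum.cong)
qed

lemma matrix_measurable_columns:
  fixes G :: "'a::euclidean_space \<Rightarrow> real^'n::finite^'m::finite"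
  assumes "\<And>i. (\<lambda>y. column i (G y)) \<in> borel_measurable lebesgue"
  shows "G \<in> borel_measurable lebesgue"
proof -
  have "(\<lambda>y. G y $ k $ i) \<in> borel_measurable lebesgue" for k i
    using borel_measurable_euclidean_space[THEN iffD1, OF assms[of i], rule_format, of "axis k 1"]
    by (simp add: inner_axis column_def)
  then show ?thesis
    unfolding borel_measurable_euclidean_space[of G] by (auto simp: Basis_vec_def inner_axis)
qed

text \<open>A weak derivative is obtained from almost everywhere convergent difference quotients: a
  discrete integration by parts moves the quotient onto the test function, and dominated
  convergence does the rest.\<close>

lemma has_weak_derivative_of_difference_quotients:
  fixes f :: "real^'n::finite \<Rightarrow> real^'m::finite"
  assumes S: "open S" and lip: "\<And>K. compact K \<Longrightarrow> K \<subseteq> S \<Longrightarrow> \<exists>L. L-lipschitz_on K f"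
    and dq: "\<And>i. AE y in lebesgue. y \<in> S \<longrightarrow>
      (\<lambda>j. real (Suc j) *\<^sub>R (f (y + (1 / real (Suc j)) *\<^sub>R axis i 1) - f y)) \<longlonglongrightarrow> column i (G y)"
  shows "has_weak_derivative_on f G S"
proof -
  define h where "h i j = (1 / real (Suc j)) *\<^sub>R (axis i 1 :: real^'n)" for i j
  define Q where "Q i j y = real (Suc j) *\<^sub>R (f (y + h i j) - f y)" for i j y
  have nh: "norm (h i j) = 1 / real (Suc j)" for i j by (simp add: h_def)
  \<comment> \<open>a compact neighbourhood on which the quotients are controlled\<close>
  have nbhd: "\<exists>K' j0 L. compact K' \<and> K \<subseteq> K' \<and> K' \<subseteq> S \<and> L-lipschitz_on K' f \<and> (\<forall>j\<ge>j0. \<forall>i. \<forall>y\<in>K. y + h i j \<in> K')"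
    if K: "compact K" "K \<subseteq> S" for K
  proof -
    obtain d where d: "d > 0" "(\<Union>x\<in>K. cball x d) \<subseteq> S"
      using compact_subset_open_imp_cball_epsilon_subset[OF K(1) S K(2)] .
    have "compact (\<Union>x\<in>K. cball x d)" using compact_minkowski_sum_cball[OF K(1)] .
    moreover obtain j0 where j0: "1 / real (Suc j0) < d"
      using d(1) by (metis inverse_eq_divide reals_Archimedean)
    have "y + h i j \<in> (\<Union>x\<in>K. cball x d)" if "j \<ge> j0" "y \<in> K" for i j y
    proof -
      have "norm (h i j) \<le> 1 / real (Suc j0)" unfolding nh using that(1) by (simp add: frac_le)
      then have "y + h i j \<in> cball y d" using j0 by (simp add: dist_norm)
      then show ?thesis using that(2) by blast
    qed
    moreover have "K \<subseteq> (\<Union>x\<in>K. cball x d)" using d(1) by force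
    ultimately show ?thesis using lip[of "\<Union>x\<in>K. cball x d"] d(2) by blast
  qed
  have fcont: "continuous_on K f" if K: "compact K" "K \<subseteq> S" for K
    using lip[OF K] lipschitz_on_continuous_on by blast
  have fint: "locally_integrable S f"
    unfolding locally_integrable_def using fcont set_integrable_continuous_compact by blast
  \<comment> \<open>on a compact set the quotients are eventually bounded by a Lipschitz constant, and so is their limit\<close>
  have main: "(\<lambda>y. indicator K y *\<^sub>R column i (G y)) \<in> borel_measurable lebesgue \<and>
      (\<exists>L. AE y in lebesgue. y \<in> K \<longrightarrow> norm (column i (G y)) \<le> L) \<and>
      (\<exists>j0 L. \<forall>j\<ge>j0. (\<lambda>y. indicator K y *\<^sub>R Q i j y) \<in> borel_measurable lebesgue \<and>
          (\<forall>y. norm (indicator K y *\<^sub>R Q i j y) \<le> L * indicator K y))"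
    if K: "compact K" "K \<subseteq> S" for K i
  proof -
    obtain K' j0 L where K': "compact K'" "K \<subseteq> K'" "K' \<subseteq> S" "L-lipschitz_on K' f"
      "\<And>j y. j \<ge> j0 \<Longrightarrow> y \<in> K \<Longrightarrow> y + h i j \<in> K'"
      using nbhd[OF K] by blast
    have meas: "(\<lambda>y. indicator K y *\<^sub>R Q i j y) \<in> borel_measurable lebesgue" if "j \<ge> j0" for j
    proof -
      have "continuous_on K (\<lambda>y. f (y + h i j))"
        by (rule continuous_on_compose2[OF fcont[OF K'(1,3)]]) (use K'(5)[OF that] in \<open>auto intro!: continuous_intros\<close>)
      then have "continuous_on K (Q i j)"
        unfolding Q_def by (intro continuous_intros fcont[OF K]) 
      then have "set_integrable lebesgue K (Q i j)" by (rule set_integrable_continuous_compact[OF K(1)])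
      then show ?thesis unfolding set_integrable_def by auto
    qed
    have bd: "norm (Q i j y) \<le> L" if "j \<ge> j0" "y \<in> K" for j y
    proof -
      have "norm (f (y + h i j) - f y) \<le> L * norm (h i j)"
        using lipschitz_onD[OF K'(4), of "y + h i j" y] K'(5)[OF that] K'(2) that by (auto simp: dist_norm)
      then have "real (Suc j) * norm (f (y + h i j) - f y) \<le> real (Suc j) * (L * (1 / real (Suc j)))"
        unfolding nh by (intro mult_left_mono) auto
      moreover have "norm (Q i j y) = real (Suc j) * norm (f (y + h i j) - f y)"
        unfolding Q_def norm_scaleR by simp
      ultimately show ?thesis by simp
    qed
    have ae: "AE y in lebesgue. (\<lambda>j. indicator K y *\<^sub>R Q i (j + j0) y) \<longlonglongrightarrow> indicator K y *\<^sub>R column i (G y)"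
      using dq[of i]
    proof eventually_elim
      case (elim y)
      show ?case
      proof (cases "y \<in> K")
        case True
        then have "(\<lambda>j. Q i j y) \<longlonglongrightarrow> column i (G y)" using elim K(2) by (auto simp: Q_def h_def)
        then show ?thesis using True LIMSEQ_ignore_initial_segment by auto
      qed simp
    qed
    have "(\<lambda>y. lim (\<lambda>j. indicator K y *\<^sub>R Q i (j + j0) y)) \<in> borel_measurable lebesgue"
      by (intro borel_measurable_lim_metric meas) simp
    then have 1: "(\<lambda>y. indicator K y *\<^sub>R column i (G y)) \<in> borel_measurable lebesgue"
      by (rule borel_measurable_AE) (use ae in \<open>eventually_elim, auto intro: limI\<close>)
    have 2: "AE y in lebesgue. y \<in> K \<longrightarrow> norm (column i (G y)) \<le> L"
      using ae
    proof eventually_elim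
      case (elim y)
      show ?case
      proof
        assume y: "y \<in> K"
        with elim have "(\<lambda>j. Q i (j + j0) y) \<longlonglongrightarrow> column i (G y)" by simp
        then have "(\<lambda>j. norm (Q i (j + j0) y)) \<longlonglongrightarrow> norm (column i (G y))" by (rule tendsto_norm)
        then show "norm (column i (G y)) \<le> L"
          by (rule LIMSEQ_le_const2) (use bd[OF _ y] in auto)
      qed
    qed
    have 3: "\<forall>j\<ge>j0. (\<lambda>y. indicator K y *\<^sub>R Q i j y) \<in> borel_measurable lebesgue \<and>
          (\<forall>y. norm (indicator K y *\<^sub>R Q i j y) \<le> L * indicator K y)"
      using meas bd by (auto simp: indicator_def)
    show ?thesis using 1 2 3 by blast
  qed
  have Gint: "set_integrable lebesgue K G" if K: "compact K" "K \<subseteq> S" for K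
  proof -
    have m: "(\<lambda>y. indicator K y *\<^sub>R G y) \<in> borel_measurable lebesgue"
    proof (rule matrix_measurable_columns)
      fix i
      have "column i (indicator K y *\<^sub>R G y) = indicator K y *\<^sub>R column i (G y)" for y
        by (simp add: column_def vec_eq_iff)
      then show "(\<lambda>y. column i (indicator K y *\<^sub>R G y)) \<in> borel_measurable lebesgue"
        using main[OF K] by simp
    qed
    have "\<forall>i. \<exists>L. AE y in lebesgue. y \<in> K \<longrightarrow> norm (column i (G y)) \<le> L" using main[OF K] by blast
    then obtain L where L: "\<And>i. AE y in lebesgue. y \<in> K \<longrightarrow> norm (column i (G y)) \<le> L i" by metis
    have "AE y in lebesgue. \<forall>i\<in>UNIV. y \<in> K \<longrightarrow> norm (column i (G y)) \<le> L i"
      using L by (subst AE_finite_all) auto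
    then have b: "AE y in lebesgue. norm (indicator K y *\<^sub>R G y) \<le> norm (indicator K y *\<^sub>R (\<Sum>i\<in>UNIV. L i))"
    proof eventually_elim
      case (elim y)
      have "norm (G y) \<le> (\<Sum>i\<in>UNIV. L i)" if "y \<in> K"
        using elim that by (intro order_trans[OF norm_le_sum_columns(2)] sum_mono) auto
      then show ?case by (auto simp: indicator_def)
    qed
    have "K \<in> lmeasurable" using K by (simp add: lmeasurable_compact)
    from set_integrable_lebesgue_const[OF this, of "\<Sum>i\<in>UNIV. L i"]
    show ?thesis unfolding set_integrable_def using m b by (rule Bochner_Integration.integrable_bound)
  qed
  have parts: "(LINT y:S|lebesgue. frechet_derivative \<psi> (at y) (axis i 1) *\<^sub>R f y) =
        - (LINT y:S|lebesgue. \<psi> y *\<^sub>R column i (G y))" if tf: "test_function S \<psi>" for \<psi> i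
  proof -
    obtain K where s: "smooth_on UNIV \<psi>" and K: "compact K" "K \<subseteq> S" and z: "\<And>y. y \<notin> K \<Longrightarrow> \<psi> y = 0"
      using tf unfolding test_function_def by blast
    let ?D = "\<lambda>y. frechet_derivative \<psi> (at y)"
    obtain B where B: "B > 0" "\<And>y z. \<bar>\<psi> y - \<psi> z\<bar> \<le> B * norm (y - z)" "\<And>y. \<bar>\<psi> y\<bar> \<le> B"
      using smooth_compact_support_lipschitz[OF s K(1) z] by blast
    have \<psi>m: "\<psi> \<in> borel_measurable lebesgue"
      using integrable_lebesgue_continuous_support(1)[OF smooth_continuous_derivative(2)[OF s] K(1) z] by auto
    have Dz: "?D y = (\<lambda>v. 0)" if "y \<notin> K" for y
      using frechet_derivative_zero_off_support[OF compact_imp_closed[OF K(1)] z that] .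
    have Dm: "(\<lambda>y. ?D y (axis i 1)) \<in> borel_measurable lebesgue"
      using integrable_lebesgue_continuous_support(1)[OF smooth_continuous_derivative(1)[OF s] K(1)] Dz by auto
    obtain K' j1 L where K': "compact K'" "K \<subseteq> K'" "K' \<subseteq> S"
      "\<And>j y. j \<ge> j1 \<Longrightarrow> y \<in> K \<Longrightarrow> y + h i j \<in> K'"
      using nbhd[OF K] by blast
    obtain j2 L' where j2: "\<And>j. j \<ge> j2 \<Longrightarrow> (\<lambda>y. indicator K y *\<^sub>R Q i j y) \<in> borel_measurable lebesgue"
      "\<And>j y. j \<ge> j2 \<Longrightarrow> norm (indicator K y *\<^sub>R Q i j y) \<le> L' * indicator K y"
      using main[OF K] by meson
    define j0 where "j0 = max j1 j2"
    define F where "F y = indicator K' y *\<^sub>R f y" for y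
    have F: "integrable lebesgue F"
      using set_integrable_continuous_compact[OF K'(1) fcont[OF K'(1,3)]] by (simp add: set_integrable_def F_def[abs_def])
    have lim1: "(\<lambda>j. LINT y|lebesgue. \<psi> y *\<^sub>R (indicator K y *\<^sub>R Q i (j + j0) y))
        \<longlonglongrightarrow> (LINT y|lebesgue. \<psi> y *\<^sub>R (indicator K y *\<^sub>R column i (G y)))"
    proof (rule integral_dominated_convergence[where w="\<lambda>y. indicator K y *\<^sub>R (B * L')"])
      show "integrable lebesgue (\<lambda>y. indicator K y *\<^sub>R (B * L'))"
        using set_integrable_lebesgue_const[of K "B * L'"] K by (simp add: set_integrable_def lmeasurable_compact)
      show "AE y in lebesgue. (\<lambda>j. \<psi> y *\<^sub>R (indicator K y *\<^sub>R Q i (j + j0) y))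
          \<longlonglongrightarrow> \<psi> y *\<^sub>R (indicator K y *\<^sub>R column i (G y))"
        using dq[of i]
      proof eventually_elim
        case (elim y)
        show ?case
        proof (cases "y \<in> K")
          case True
          then have "(\<lambda>j. Q i j y) \<longlonglongrightarrow> column i (G y)" using elim K(2) by (auto simp: Q_def h_def)
          from LIMSEQ_ignore_initial_segment[OF this, of j0]
          show ?thesis by (intro tendsto_intros)
        qed simp
      qed
      show "AE y in lebesgue. norm (\<psi> y *\<^sub>R (indicator K y *\<^sub>R Q i (j + j0) y)) \<le> indicator K y *\<^sub>R (B * L')" for j
      proof (rule AE_I2)
        fix y
        have "norm (indicator K y *\<^sub>R Q i (j + j0) y) \<le> L' * indicator K y" by (rule j2) (simp add: j0_def)
        then have "\<bar>\<psi> y\<bar> * norm (indicator K y *\<^sub>R Q i (j + j0) y) \<le> B * (L' * indicator K y)"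
          using B by (intro mult_mono) auto
        then show "norm (\<psi> y *\<^sub>R (indicator K y *\<^sub>R Q i (j + j0) y)) \<le> indicator K y *\<^sub>R (B * L')"
          by (simp add: abs_mult mult_ac)
      qed
      show "(\<lambda>y. \<psi> y *\<^sub>R (indicator K y *\<^sub>R Q i (j + j0) y)) \<in> borel_measurable lebesgue" for j
        by (intro borel_measurable_scaleR \<psi>m j2) (simp add: j0_def)
      show "(\<lambda>y. \<psi> y *\<^sub>R (indicator K y *\<^sub>R column i (G y))) \<in> borel_measurable lebesgue"
        by (rule borel_measurable_scaleR[OF \<psi>m conjunct1[OF main[OF K]]])
    qed
    have lim2: "(\<lambda>j. LINT y|lebesgue. (real (Suc (j + j0)) * (\<psi> (y - h i (j + j0)) - \<psi> y)) *\<^sub>R F y)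
        \<longlonglongrightarrow> (LINT y|lebesgue. (- ?D y (axis i 1)) *\<^sub>R F y)"
    proof (rule integral_dominated_convergence[where w="\<lambda>y. B * norm (F y)"])
      show "AE y in lebesgue. (\<lambda>j. (real (Suc (j + j0)) * (\<psi> (y - h i (j + j0)) - \<psi> y)) *\<^sub>R F y)
          \<longlonglongrightarrow> (- ?D y (axis i 1)) *\<^sub>R F y"
      proof (rule AE_I2)
        fix y
        have "(\<lambda>j. real (Suc j) *\<^sub>R (\<psi> (y + (1 / real (Suc j)) *\<^sub>R (- axis i 1)) - \<psi> y)) \<longlonglongrightarrow> ?D y (- axis i 1)"
          by (rule difference_quotient_tendsto[OF smooth_has_derivative[OF s]])
        then have "(\<lambda>j. real (Suc j) * (\<psi> (y - h i j) - \<psi> y)) \<longlonglongrightarrow> - ?D y (axis i 1)"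
          using linear_neg[OF has_derivative_linear[OF smooth_has_derivative[OF s]]] by (simp add: h_def)
        from LIMSEQ_ignore_initial_segment[OF this, of j0]
        show "(\<lambda>j. (real (Suc (j + j0)) * (\<psi> (y - h i (j + j0)) - \<psi> y)) *\<^sub>R F y)
          \<longlonglongrightarrow> (- ?D y (axis i 1)) *\<^sub>R F y" by (intro tendsto_intros)
      qed
      show "AE y in lebesgue. norm ((real (Suc (j + j0)) * (\<psi> (y - h i (j + j0)) - \<psi> y)) *\<^sub>R F y) \<le> B * norm (F y)" for j
      proof (rule AE_I2)
        fix y
        have "real (Suc (j + j0)) * \<bar>\<psi> (y - h i (j + j0)) - \<psi> y\<bar> \<le> real (Suc (j + j0)) * (B * (1 / real (Suc (j + j0))))"
          using B(2)[of "y - h i (j + j0)" y] by (intro mult_left_mono) (auto simp: nh)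
        also have "\<dots> = B" by simp
        finally show "norm ((real (Suc (j + j0)) * (\<psi> (y - h i (j + j0)) - \<psi> y)) *\<^sub>R F y) \<le> B * norm (F y)"
          by (simp add: abs_mult mult_right_mono)
      qed
      show "(\<lambda>y. (real (Suc (j + j0)) * (\<psi> (y - h i (j + j0)) - \<psi> y)) *\<^sub>R F y) \<in> borel_measurable lebesgue" for j
      proof -
        have "continuous_on UNIV (\<lambda>y. \<psi> (y - h i (j + j0)))"
          by (rule continuous_on_compose2[OF smooth_continuous_derivative(2)[OF s]]) (auto intro!: continuous_intros)
        then have "(\<lambda>y. \<psi> (y - h i (j + j0))) \<in> borel_measurable lebesgue"
          by (intro measurable_completion) (simp add: borel_measurable_continuous_onI)
        then show ?thesis using F \<psi>m by (intro borel_measurable_scaleR borel_measurable_times borel_measurable_diff) auto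
      qed
    qed (use F Dm in \<open>auto intro!: borel_measurable_scaleR\<close>)
    \<comment> \<open>translating the variable moves the quotient from the function onto the test function\<close>
    have eq: "(LINT y|lebesgue. \<psi> y *\<^sub>R (indicator K y *\<^sub>R Q i j y)) =
        (LINT y|lebesgue. (real (Suc j) * (\<psi> (y - h i j) - \<psi> y)) *\<^sub>R F y)" if "j \<ge> j0" for j
    proof -
      have inF: "integrable lebesgue (\<lambda>y. k y *\<^sub>R F y)" if "k \<in> borel_measurable lebesgue" "\<And>y. \<bar>k y\<bar> \<le> B" for k
        by (rule Bochner_Integration.integrable_bound[OF integrable_scaleR_right[OF F, of B]])
          (use that F B in \<open>auto intro!: borel_measurable_scaleR mult_right_mono\<close>)
      have sm: "(\<lambda>y. \<psi> (y - h i j)) \<in> borel_measurable lebesgue"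
      proof -
        have "continuous_on UNIV (\<lambda>y. \<psi> (y - h i j))"
          by (rule continuous_on_compose2[OF smooth_continuous_derivative(2)[OF s]]) (auto intro!: continuous_intros)
        then show ?thesis
          by (intro measurable_completion) (simp add: borel_measurable_continuous_onI)
      qed
      note i1 = inF[OF sm B(3)] and i2 = inF[OF \<psi>m B(3)]
      have e1: "\<psi> y *\<^sub>R (indicator K y *\<^sub>R Q i j y) = real (Suc j) *\<^sub>R (\<psi> y *\<^sub>R F (h i j + 1 *\<^sub>R y) - \<psi> y *\<^sub>R F y)" for y
      proof (cases "y \<in> K")
        case True
        then have "y + h i j \<in> K'" "y \<in> K'" using K' that by (auto simp: j0_def)
        then show ?thesis using True by (simp add: Q_def F_def add.commute scaleR_diff_right mult.commute)
      qed (simp add: z)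
      have i1': "integrable lebesgue (\<lambda>y. \<psi> y *\<^sub>R F (h i j + 1 *\<^sub>R y))"
        "(LINT y|lebesgue. \<psi> y *\<^sub>R F (h i j + 1 *\<^sub>R y)) = (LINT y|lebesgue. \<psi> (y - h i j) *\<^sub>R F y)"
        using lebesgue_integral_affine[OF i1, of 1 "h i j"] by simp_all
      have "(LINT y|lebesgue. \<psi> y *\<^sub>R (indicator K y *\<^sub>R Q i j y)) =
         real (Suc j) *\<^sub>R ((LINT y|lebesgue. \<psi> y *\<^sub>R F (h i j + 1 *\<^sub>R y)) - (LINT y|lebesgue. \<psi> y *\<^sub>R F y))"
        unfolding e1 using i1'(1) i2 by simp
      also have "\<dots> = real (Suc j) *\<^sub>R (LINT y|lebesgue. \<psi> (y - h i j) *\<^sub>R F y - \<psi> y *\<^sub>R F y)"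
        unfolding i1'(2) using i1 i2 by simp
      also have "\<dots> = (LINT y|lebesgue. (real (Suc j) * (\<psi> (y - h i j) - \<psi> y)) *\<^sub>R F y)"
        by (simp add: scaleR_diff_left integral_scaleR_right[symmetric] scaleR_scaleR[symmetric] del: scaleR_scaleR integral_scaleR_right)
      finally show ?thesis .
    qed
    have "(LINT y|lebesgue. \<psi> y *\<^sub>R (indicator K y *\<^sub>R column i (G y))) = (LINT y|lebesgue. (- ?D y (axis i 1)) *\<^sub>R F y)"
      using LIMSEQ_unique[OF lim1] lim2 eq by simp
    moreover have "(LINT y:S|lebesgue. ?D y (axis i 1) *\<^sub>R f y) = - (LINT y|lebesgue. (- ?D y (axis i 1)) *\<^sub>R F y)"
      unfolding set_lebesgue_integral_def Bochner_Integration.integral_minus[symmetric]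
    proof (rule Bochner_Integration.integral_cong[OF refl])
      show "indicator S y *\<^sub>R ?D y (axis i 1) *\<^sub>R f y = - ((- ?D y (axis i 1)) *\<^sub>R F y)" for y
        using Dz[of y] K K' by (cases "y \<in> K") (auto simp: F_def indicator_def)
    qed
    moreover have "(LINT y:S|lebesgue. \<psi> y *\<^sub>R column i (G y)) = (LINT y|lebesgue. \<psi> y *\<^sub>R (indicator K y *\<^sub>R column i (G y)))"
      unfolding set_lebesgue_integral_def
    proof (rule Bochner_Integration.integral_cong[OF refl])
      show "indicator S y *\<^sub>R \<psi> y *\<^sub>R column i (G y) = \<psi> y *\<^sub>R (indicator K y *\<^sub>R column i (G y))" for y
        using z[of y] K by (cases "y \<in> K") (auto simp: indicator_def)
    qed
    ultimately show ?thesis by simp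
  qed
  show ?thesis
    unfolding has_weak_derivative_on_def using fint Gint parts by (auto simp: locally_integrable_def)
qed

section \<open>Kernel averages of weakly differentiable functions\<close>

text \<open>Differentiation under the integral sign.\<close>

lemma has_real_derivative_integral_kernel:
  fixes k k' :: "real \<Rightarrow> 'a::euclidean_space \<Rightarrow> real" and u :: "'a \<Rightarrow> real"
  assumes u: "integrable lebesgue u" and T: "convex T" "s \<in> T"
    and km: "\<And>s. s \<in> T \<Longrightarrow> k s \<in> borel_measurable lebesgue" "k' s \<in> borel_measurable lebesgue"
    and kb: "\<And>s y. s \<in> T \<Longrightarrow> \<bar>k s y\<bar> \<le> B"
    and der: "\<And>s y. s \<in> T \<Longrightarrow> ((\<lambda>s. k s y) has_real_derivative k' s y) (at s within T)"
    and kb': "\<And>s y. s \<in> T \<Longrightarrow> \<bar>k' s y\<bar> \<le> B'"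
  shows "((\<lambda>s. LINT y|lebesgue. k s y * u y) has_real_derivative (LINT y|lebesgue. k' s y * u y)) (at s within T)"
proof -
  have int: "integrable lebesgue (\<lambda>y. k r y * u y)" if "r \<in> T" for r
    by (rule Bochner_Integration.integrable_bound[OF integrable_mult_right[OF u, of B]])
      (use that km(1)[OF that] u kb[OF that] in \<open>auto simp: abs_mult intro!: mult_mono order_trans[OF kb[OF that] abs_ge_self] AE_I2\<close>)
  show ?thesis
    unfolding has_field_derivative_iff tendsto_at_iff_sequentially comp_def
  proof (intro allI impI)
    fix X assume X: "\<forall>i. X i \<in> T - {s}" "X \<longlonglongrightarrow> s"
    have "(\<lambda>i. LINT y|lebesgue. (k (X i) y - k s y) / (X i - s) * u y) \<longlonglongrightarrow> (LINT y|lebesgue. k' s y * u y)"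
    proof (rule integral_dominated_convergence[where w="\<lambda>y. B' * \<bar>u y\<bar>"])
      show "AE y in lebesgue. (\<lambda>i. (k (X i) y - k s y) / (X i - s) * u y) \<longlonglongrightarrow> k' s y * u y"
      proof (rule AE_I2)
        fix y
        have "(\<lambda>i. (k (X i) y - k s y) / (X i - s)) \<longlonglongrightarrow> k' s y"
          using der[OF T(2), of y] X unfolding has_field_derivative_iff tendsto_at_iff_sequentially comp_def by blast
        then show "(\<lambda>i. (k (X i) y - k s y) / (X i - s) * u y) \<longlonglongrightarrow> k' s y * u y" by (intro tendsto_intros)
      qed
      show "AE y in lebesgue. norm ((k (X i) y - k s y) / (X i - s) * u y) \<le> B' * \<bar>u y\<bar>" for i
      proof (rule AE_I2)
        fix y
        have "norm (k (X i) y - k s y) \<le> B' * norm (X i - s)"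
          by (rule field_differentiable_bound[OF T(1) der]) (use kb' X T in auto)
        then have "\<bar>(k (X i) y - k s y) / (X i - s)\<bar> \<le> B'" using X(1) by (auto simp: abs_divide pos_divide_le_eq)
        then have "\<bar>(k (X i) y - k s y) / (X i - s)\<bar> * \<bar>u y\<bar> \<le> B' * \<bar>u y\<bar>"
          by (rule mult_right_mono) simp
        then show "norm ((k (X i) y - k s y) / (X i - s) * u y) \<le> B' * \<bar>u y\<bar>"
          by (simp only: real_norm_def abs_mult)
      qed
      show "(\<lambda>y. (k (X i) y - k s y) / (X i - s) * u y) \<in> borel_measurable lebesgue" for i
        using km(1)[of "X i"] km(1)[OF T(2)] X(1) u
        by (intro borel_measurable_times borel_measurable_divide borel_measurable_diff) auto
      show "(\<lambda>y. k' s y * u y) \<in> borel_measurable lebesgue"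
        using km(2) u by (intro borel_measurable_times) auto
    qed (use u in auto)
    moreover have "(LINT y|lebesgue. (k (X i) y - k s y) / (X i - s) * u y) =
        ((LINT y|lebesgue. k (X i) y * u y) - (LINT y|lebesgue. k s y * u y)) / (X i - s)" for i
    proof -
      have "(LINT y|lebesgue. (k (X i) y - k s y) / (X i - s) * u y) =
         (LINT y|lebesgue. (k (X i) y * u y - k s y * u y) / (X i - s))"
        by (simp add: algebra_simps)
      then show ?thesis using int[of "X i"] int[OF T(2)] X(1) by simp
    qed
    ultimately show "(\<lambda>i. ((LINT y|lebesgue. k (X i) y * u y) - (LINT y|lebesgue. k s y * u y)) / (X i - s))
        \<longlonglongrightarrow> (LINT y|lebesgue. k' s y * u y)" by (simp only:)
  qed
qed

definition kernel_avg :: "(real^'n::finite \<Rightarrow> real) \<Rightarrow> (real^'n \<Rightarrow> 'b::euclidean_space) \<Rightarrow> real^'n \<Rightarrow> real \<Rightarrow> 'b" where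
  "kernel_avg \<phi> u x s = (1 / s ^ CARD('n)) *\<^sub>R (LINT y|lebesgue. \<phi> ((1 / s) *\<^sub>R (y - x)) *\<^sub>R u y)"

lemma scaled_in_cball:
  fixes x y :: "'a::real_normed_vector"
  assumes "s > 0"
  shows "(1 / s) *\<^sub>R (y - x) \<in> cball 0 \<rho> \<longleftrightarrow> y \<in> cball x (s * \<rho>)"
proof -
  have "norm ((1 / s) *\<^sub>R (y - x)) = norm (y - x) / s" using assms by simp
  then show ?thesis using assms by (simp add: dist_norm norm_minus_commute pos_divide_le_eq mult.commute)
qed

lemma continuous_borel_measurable_lebesgue:
  fixes f :: "'a::euclidean_space \<Rightarrow> 'b::euclidean_space"
  assumes "continuous_on UNIV f"
  shows "f \<in> borel_measurable lebesgue"
  using assms by (intro measurable_completion) (simp add: borel_measurable_continuous_onI)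

text \<open>With \<open>z = (y - x) / s\<close>, the derivative of the kernel \<open>s\<^sup>-\<^sup>n \<phi>(z)\<close> with respect to \<open>s\<close> is
  \<open>- s\<^sup>-\<^sup>n\<close> times the divergence in \<open>y\<close> of the compactly supported vector field \<open>z \<phi>(z)\<close>. The
  definition of the weak derivative moves this divergence onto \<open>u\<close>, so the average changes with \<open>s\<close>
  at a rate that is bounded by averages of \<open>G\<close>.\<close>

lemma kernel_avg_diff:
  fixes u :: "real^'n::finite \<Rightarrow> real^'m::finite"
  assumes weak: "has_weak_derivative_on u G S"
    and \<phi>: "smooth_on UNIV \<phi>" "\<And>z. z \<notin> cball 0 \<rho> \<Longrightarrow> \<phi> z = 0" "\<And>z. \<bar>\<phi> z\<bar> \<le> B" "\<rho> > 0"
    and \<sigma>: "0 < \<sigma>" "\<sigma> \<le> \<tau>" and S: "cball x (\<tau> * \<rho>) \<subseteq> S"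
    and N: "\<And>s. \<sigma> \<le> s \<Longrightarrow> s \<le> \<tau> \<Longrightarrow> (LINT y:cball x (s * \<rho>)|lebesgue. norm (G y)) \<le> N * s ^ CARD('n)"
  shows "norm (kernel_avg \<phi> u x \<tau> - kernel_avg \<phi> u x \<sigma>) \<le> (\<tau> - \<sigma>) * (real CARD('n) * \<rho> * B * N)"
proof -
  let ?n = "CARD('n)"
  let ?D = "\<lambda>z. frechet_derivative \<phi> (at z)"
  define z where "z s y = (1 / s) *\<^sub>R (y - x)" for s y
  define K where "K = cball x (\<tau> * \<rho>)"
  have K: "compact K" "K \<subseteq> S" using S by (auto simp: K_def)
  define U where "U y = indicator K y *\<^sub>R u y" for y
  have ui: "integrable lebesgue U"
    using weak K unfolding has_weak_derivative_on_def locally_integrable_def set_integrable_def U_def by blast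
  have Gi: "set_integrable lebesgue (cball x (s * \<rho>)) G" if "s \<le> \<tau>" for s
  proof -
    have "cball x (s * \<rho>) \<subseteq> S" by (rule subset_trans[OF subset_cball[OF mult_right_mono[OF that less_imp_le[OF \<phi>(4)]]] S])
    moreover have "locally_integrable S G" using weak by (simp add: has_weak_derivative_on_def)
    ultimately show ?thesis by (simp add: locally_integrable_def)
  qed
  have D: "(\<phi> has_derivative ?D z) (at z)" for z by (rule smooth_has_derivative[OF \<phi>(1)])
  have Dlin: "linear (?D z)" for z by (rule has_derivative_linear[OF D])
  \<comment> \<open>the divergence of \<open>z \<phi>(z)\<close>\<close>
  define H where "H z = real ?n * \<phi> z + (\<Sum>i\<in>UNIV. z $ i * ?D z (axis i 1))" for z
  have Dexp: "?D w v = (\<Sum>i\<in>UNIV. v $ i * ?D w (axis i 1))" for w v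
    using arg_cong[OF basis_expansion[of v], of "?D w"]
    by (simp add: linear_sum[OF Dlin] linear_cmul[OF Dlin] scalar_mult_eq_scaleR)
  have Hc: "continuous_on UNIV H"
    unfolding H_def by (intro continuous_intros smooth_continuous_derivative[OF \<phi>(1)] linear_continuous_on bounded_linear_vec_nth)
  have Hz: "H z = 0" if "z \<notin> cball 0 \<rho>" for z
    using \<phi>(2)[OF that] frechet_derivative_zero_off_support[of "cball 0 \<rho>" \<phi> z] \<phi>(2) that by (simp add: H_def)
  obtain BH where BH: "BH > 0" "\<And>z. \<bar>H z\<bar> \<le> BH"
    using integrable_lebesgue_continuous_support(2)[OF Hc compact_cball[of 0 \<rho>] Hz] by (auto simp del: mem_cball)
  define k where "k s y = (1 / s ^ ?n) * \<phi> (z s y)" for s y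
  define k' where "k' s y = - (1 / s) * (1 / s ^ ?n) * H (z s y)" for s y
  \<comment> \<open>pairing with the difference itself reduces the estimate to a real function of the scale\<close>
  define d where "d = kernel_avg \<phi> u x \<tau> - kernel_avg \<phi> u x \<sigma>"
  define F where "F s = (LINT y|lebesgue. k s y * (U y \<bullet> d))" for s
  define F' where "F' s = (LINT y|lebesgue. k' s y * (U y \<bullet> d))" for s
  have zc: "continuous_on UNIV (z s)" for s unfolding z_def by (intro continuous_intros)
  have pow: "1 / s ^ m \<le> 1 / \<sigma> ^ m" if "s \<in> {\<sigma>..\<tau>}" for s m
    using \<sigma> that by (intro divide_left_mono power_mono) auto
  have kern: "\<phi> (z s y) = 0" if "0 < s" "s \<le> \<tau>" "y \<notin> K" for s y
  proof -
    have "y \<notin> cball x (s * \<rho>)" using subset_cball[OF mult_right_mono[OF that(2) less_imp_le[OF \<phi>(4)]]] that(3)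
      by (auto simp: K_def simp del: mem_cball)
    then show ?thesis using \<phi>(2) scaled_in_cball[OF that(1), of y x \<rho>] by (auto simp: z_def)
  qed
  have FK: "F s = kernel_avg \<phi> u x s \<bullet> d" if "s \<in> {\<sigma>..\<tau>}" for s
  proof -
    have s: "0 < s" "s \<le> \<tau>" using that \<sigma> by auto
    have "\<phi> (z s y) *\<^sub>R u y = \<phi> (z s y) *\<^sub>R U y" for y
      using kern[OF s, of y] by (cases "y \<in> K") (auto simp: U_def)
    then have e: "kernel_avg \<phi> u x s = (1 / s ^ ?n) *\<^sub>R (LINT y|lebesgue. \<phi> (z s y) *\<^sub>R U y)"
      by (simp only: kernel_avg_def flip: z_def)
    have "integrable lebesgue (\<lambda>y. \<phi> (z s y) *\<^sub>R U y)"
    proof (rule Bochner_Integration.integrable_bound[OF integrable_scaleR_right[OF ui, of B]])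
      show "(\<lambda>y. \<phi> (z s y) *\<^sub>R U y) \<in> borel_measurable lebesgue"
        by (rule borel_measurable_scaleR[OF continuous_borel_measurable_lebesgue borel_measurable_integrable[OF ui]])
          (rule continuous_on_compose2[OF smooth_continuous_derivative(2)[OF \<phi>(1)] zc], simp)
      show "AE y in lebesgue. norm (\<phi> (z s y) *\<^sub>R U y) \<le> norm (B *\<^sub>R U y)"
        using \<phi>(3) by (intro AE_I2) (auto intro!: mult_right_mono order_trans[OF _ abs_ge_self])
    qed
    then have "(LINT y|lebesgue. \<phi> (z s y) *\<^sub>R U y) \<bullet> d = (LINT y|lebesgue. (\<phi> (z s y) *\<^sub>R U y) \<bullet> d)"
      by (rule integral_inner_left[symmetric])
    then show ?thesis unfolding e F_def k_def by (simp add: mult.assoc)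
  qed
  have derF: "(F has_real_derivative F' s) (at s within {\<sigma>..\<tau>})" if s: "s \<in> {\<sigma>..\<tau>}" for s
    unfolding F_def F'_def
  proof (rule has_real_derivative_integral_kernel[where B="1 / \<sigma> ^ ?n * B" and B'="1 / \<sigma> * (1 / \<sigma> ^ ?n) * BH"])
    show "integrable lebesgue (\<lambda>y. U y \<bullet> d)" using ui by simp
    show "k s \<in> borel_measurable lebesgue" for s
      unfolding k_def by (intro continuous_borel_measurable_lebesgue continuous_intros
          continuous_on_compose2[OF smooth_continuous_derivative(2)[OF \<phi>(1)] zc]) auto
    show "k' s \<in> borel_measurable lebesgue"
      unfolding k'_def by (intro continuous_borel_measurable_lebesgue continuous_intros
          continuous_on_compose2[OF Hc zc]) auto
    show "\<bar>k s y\<bar> \<le> 1 / \<sigma> ^ ?n * B" if "s \<in> {\<sigma>..\<tau>}" for s y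
      unfolding k_def abs_mult using pow[OF that, of ?n] \<phi>(3) \<sigma> that by (intro mult_mono) auto
    show "\<bar>k' s y\<bar> \<le> 1 / \<sigma> * (1 / \<sigma> ^ ?n) * BH" if "s \<in> {\<sigma>..\<tau>}" for s y
      unfolding k'_def abs_mult abs_minus_cancel
      using pow[OF that, of ?n] pow[OF that, of 1] BH \<sigma> that by (intro mult_mono) auto
    show "((\<lambda>s. k s y) has_real_derivative k' s y) (at s within {\<sigma>..\<tau>})" if "s \<in> {\<sigma>..\<tau>}" for s y
    proof -
      have s0: "s \<noteq> 0" using that \<sigma> by auto
      have "((\<lambda>s. z s y) has_derivative (\<lambda>h. (h * (- (1 / s\<^sup>2))) *\<^sub>R (y - x))) (at s within {\<sigma>..\<tau>})"
        unfolding z_def using s0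
        by (auto intro!: derivative_eq_intros simp: power2_eq_square field_simps)
      from has_derivative_compose[OF this D]
      have "((\<lambda>s. \<phi> (z s y)) has_derivative (\<lambda>h. ?D (z s y) ((h * (- (1 / s\<^sup>2))) *\<^sub>R (y - x)))) (at s within {\<sigma>..\<tau>})" .
      moreover have "?D (z s y) ((h * (- (1 / s\<^sup>2))) *\<^sub>R (y - x)) = - (1 / s) * ?D (z s y) (z s y) * h" for h
        using s0 by (simp add: z_def linear_cmul[OF Dlin] linear_neg[OF Dlin] power2_eq_square)
      ultimately have P: "((\<lambda>s. \<phi> (z s y)) has_real_derivative - (1 / s) * ?D (z s y) (z s y)) (at s within {\<sigma>..\<tau>})"
        unfolding has_field_derivative_def by (simp only:)
      have "((\<lambda>s. inverse (s ^ ?n)) has_real_derivative - (real ?n * s ^ (?n - 1) * inverse (s ^ ?n) * inverse (s ^ ?n))) (at s within {\<sigma>..\<tau>})"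
        using s0 by (auto intro!: derivative_eq_intros)
      then have "((\<lambda>s. inverse (s ^ ?n)) has_real_derivative - (real ?n * (s ^ (?n - 1) * inverse (s ^ ?n)) * inverse (s ^ ?n))) (at s within {\<sigma>..\<tau>})"
        by (simp only: mult.assoc)
      moreover have "s ^ (?n - 1) * inverse (s ^ ?n) = 1 / s"
        using s0 power_minus_mult[of ?n s] by (simp add: field_simps)
      ultimately have Q: "((\<lambda>s. inverse (s ^ ?n)) has_real_derivative - (real ?n * (1 / s) * inverse (s ^ ?n))) (at s within {\<sigma>..\<tau>})"
        by (simp only:)
      have Hval: "H (z s y) = real ?n * \<phi> (z s y) + ?D (z s y) (z s y)"
        by (simp only: H_def Dexp[of "z s y" "z s y"])
      have "(\<lambda>s. k s y) = (\<lambda>s. inverse (s ^ ?n) * \<phi> (z s y))"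
        by (simp add: k_def inverse_eq_divide)
      moreover have "k' s y = - (real ?n * (1 / s) * inverse (s ^ ?n)) * \<phi> (z s y)
          + (- (1 / s) * ?D (z s y) (z s y)) * inverse (s ^ ?n)"
        unfolding k'_def Hval inverse_eq_divide by (simp add: algebra_simps add_divide_distrib)
      ultimately show ?thesis using DERIV_mult[OF Q P] by simp
    qed
  qed (use s in auto)
  have boundF': "\<bar>F' s\<bar> \<le> real ?n * \<rho> * B * N * norm d" if s: "s \<in> {\<sigma>..\<tau>}" for s
  proof -
    have s0: "0 < s" "s \<le> \<tau>" using s \<sigma> by auto
    \<comment> \<open>the components of the vector field are test functions\<close>
    define \<psi> where "\<psi> i y = z s y $ i * \<phi> (z s y)" for i y
    have zaff: "z s = (\<lambda>y. (1 / s) *\<^sub>R y + (- (1 / s) *\<^sub>R x))"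
      unfolding z_def by (simp add: fun_eq_iff scaleR_diff_right)
    have smooth: "smooth_on UNIV (\<psi> i)" for i
      unfolding smooth_on_def
    proof
      fix j
      have "Ck_on j (\<lambda>w. w $ i * \<phi> w) UNIV"
        using \<phi>(1) unfolding smooth_on_def
        by (intro Ck_on_mult Ck_on_bounded_linear[OF bounded_linear_vec_nth]) auto
      from Ck_on_affine_compose[OF bounded_linear_scaleR_right[of "1 / s"] this, of "- (1 / s) *\<^sub>R x"]
      show "Ck_on j (\<psi> i) UNIV" unfolding \<psi>_def zaff .
    qed
    have supp: "\<psi> i y = 0" if "y \<notin> cball x (s * \<rho>)" for i y
      using \<phi>(2)[of "z s y"] scaled_in_cball[OF s0(1), of y x \<rho>] that by (auto simp: \<psi>_def z_def)
    have cs: "cball x (s * \<rho>) \<subseteq> S" by (rule subset_trans[OF subset_cball[OF mult_right_mono[OF s0(2) less_imp_le[OF \<phi>(4)]]] S])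
    have test: "test_function S (\<psi> i)" for i
      unfolding test_function_def
      by (intro conjI smooth exI[of _ "cball x (s * \<rho>)"] allI impI compact_cball cs supp)
    have D\<psi>: "frechet_derivative (\<psi> i) (at y) (axis i 1) = (1 / s) * (\<phi> (z s y) + z s y $ i * ?D (z s y) (axis i 1))" for i y
    proof -
      have dz: "(z s has_derivative (\<lambda>v. (1 / s) *\<^sub>R v)) (at y)"
        unfolding z_def by (auto intro!: derivative_eq_intros)
      have "((\<lambda>y. z s y $ i) has_derivative (\<lambda>v. ((1 / s) *\<^sub>R v) $ i)) (at y)"
        by (rule bounded_linear.has_derivative[OF bounded_linear_vec_nth dz])
      from has_derivative_mult[OF this has_derivative_compose[OF dz D]]
      have "(\<psi> i has_derivative (\<lambda>v. z s y $ i * ?D (z s y) ((1 / s) *\<^sub>R v) + ((1 / s) *\<^sub>R v) $ i * \<phi> (z s y))) (at y)"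
        unfolding \<psi>_def .
      from frechet_derivative_at[OF this, symmetric] show ?thesis
        by (simp add: linear_cmul[OF Dlin] algebra_simps)
    qed
    have W: "(LINT y:S|lebesgue. ((1 / s) * (\<phi> (z s y) + z s y $ i * ?D (z s y) (axis i 1))) *\<^sub>R u y) =
       - (LINT y:S|lebesgue. \<psi> i y *\<^sub>R column i (G y))" for i
      using weak test[of i] unfolding has_weak_derivative_on_def D\<psi>[symmetric] by blast
    define E where "E i y = (1 / s) * (\<phi> (z s y) + z s y $ i * ?D (z s y) (axis i 1))" for i y
    have Ez: "E i y = 0" if "y \<notin> K" for i y
    proof -
      have "z s y \<notin> cball 0 \<rho>" using that scaled_in_cball[OF s0(1), of y x \<rho>] subset_cball[OF mult_right_mono[OF s0(2) less_imp_le[OF \<phi>(4)]], of x]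
        by (auto simp: z_def K_def simp del: mem_cball)
      then show ?thesis
        using \<phi>(2) frechet_derivative_zero_off_support[of "cball 0 \<rho>" \<phi> "z s y"] by (simp add: E_def)
    qed
    have Ec: "continuous_on UNIV (E i)" for i
      unfolding E_def
      by (intro continuous_intros continuous_on_compose2[OF smooth_continuous_derivative(2)[OF \<phi>(1)] zc]
          continuous_on_compose2[OF smooth_continuous_derivative(1)[OF \<phi>(1)] zc]
          continuous_on_compose2[OF linear_continuous_on[OF bounded_linear_vec_nth] zc]) auto
    have Ei: "integrable lebesgue (\<lambda>y. E i y *\<^sub>R U y)" for i
    proof -
      obtain b where "b > 0" "\<And>y. \<bar>E i y\<bar> \<le> b"
        using integrable_lebesgue_continuous_support(2)[OF Ec K(1) Ez] by auto
      then show ?thesis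
        by (intro Bochner_Integration.integrable_bound[OF integrable_scaleR_right[OF ui, of b]])
          (use ui in \<open>auto intro!: borel_measurable_scaleR continuous_borel_measurable_lebesgue[OF Ec] mult_right_mono\<close>)
    qed
    have W': "(LINT y|lebesgue. E i y *\<^sub>R U y) = - (LINT y:S|lebesgue. \<psi> i y *\<^sub>R column i (G y))" for i
    proof -
      have "(LINT y|lebesgue. E i y *\<^sub>R U y) = (LINT y:S|lebesgue. E i y *\<^sub>R u y)"
        unfolding set_lebesgue_integral_def
      proof (rule Bochner_Integration.integral_cong[OF refl])
        show "E i y *\<^sub>R U y = indicator S y *\<^sub>R E i y *\<^sub>R u y" for y
          using Ez[of y i] K by (cases "y \<in> K") (auto simp: U_def)
      qed
      then show ?thesis using W[of i] by (simp add: E_def)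
    qed
    have HE: "(1 / s) * H (z s y) = (\<Sum>i\<in>UNIV. E i y)" for y
      by (simp add: H_def E_def sum_divide_distrib[symmetric] sum.distrib)
    have "F' s = - (1 / s ^ ?n) * (LINT y|lebesgue. (\<Sum>i\<in>UNIV. E i y *\<^sub>R U y) \<bullet> d)"
      unfolding F'_def integral_mult_right_zero[symmetric]
    proof (rule Bochner_Integration.integral_cong[OF refl])
      fix y
      have "k' s y * (U y \<bullet> d) = - (1 / s ^ ?n) * (((1 / s) * H (z s y)) * (U y \<bullet> d))"
        by (simp add: k'_def)
      also have "((1 / s) * H (z s y)) * (U y \<bullet> d) = (\<Sum>i\<in>UNIV. E i y *\<^sub>R U y) \<bullet> d"
        unfolding HE by (simp add: inner_sum_left sum_distrib_right)
      finally show "k' s y * (U y \<bullet> d) = - (1 / s ^ ?n) * ((\<Sum>i\<in>UNIV. E i y *\<^sub>R U y) \<bullet> d)" .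
    qed
    also have "\<dots> = - (1 / s ^ ?n) * ((\<Sum>i\<in>UNIV. LINT y|lebesgue. E i y *\<^sub>R U y) \<bullet> d)"
      using Ei by (simp add: integral_inner_left Bochner_Integration.integral_sum Bochner_Integration.integrable_sum)
    also have "\<dots> = (1 / s ^ ?n) * ((\<Sum>i\<in>UNIV. LINT y:S|lebesgue. \<psi> i y *\<^sub>R column i (G y)) \<bullet> d)"
      unfolding W' by (simp add: sum_negf)
    finally have F'e: "F' s = (1 / s ^ ?n) * ((\<Sum>i\<in>UNIV. LINT y:S|lebesgue. \<psi> i y *\<^sub>R column i (G y)) \<bullet> d)" .
    have B0: "B \<ge> 0" using \<phi>(3)[of 0] by simp
    have one: "norm (LINT y:S|lebesgue. \<psi> i y *\<^sub>R column i (G y)) \<le> \<rho> * B * (N * s ^ ?n)" for i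
    proof -
      have gi: "integrable lebesgue (\<lambda>y. indicator (cball x (s * \<rho>)) y *\<^sub>R norm (G y))"
        using set_integrable_norm[OF Gi[OF s0(2)]] by (simp add: set_integrable_def)
      have "norm (LINT y:S|lebesgue. \<psi> i y *\<^sub>R column i (G y)) \<le> (LINT y|lebesgue. norm (indicator S y *\<^sub>R \<psi> i y *\<^sub>R column i (G y)))"
        unfolding set_lebesgue_integral_def by (rule integral_norm_bound)
      also have "\<dots> \<le> (LINT y|lebesgue. (\<rho> * B) * (indicator (cball x (s * \<rho>)) y *\<^sub>R norm (G y)))"
      proof (rule integral_mono')
        show "integrable lebesgue (\<lambda>y. (\<rho> * B) * (indicator (cball x (s * \<rho>)) y *\<^sub>R norm (G y)))"
          using gi by (rule integrable_mult_right)
        fix y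
        show "norm (indicator S y *\<^sub>R \<psi> i y *\<^sub>R column i (G y)) \<le> (\<rho> * B) * (indicator (cball x (s * \<rho>)) y *\<^sub>R norm (G y))"
        proof (cases "y \<in> cball x (s * \<rho>)")
          case True
          then have "norm (z s y) \<le> \<rho>" using scaled_in_cball[OF s0(1), of y x \<rho>] by (simp add: z_def)
          then have "\<bar>z s y $ i\<bar> \<le> \<rho>" using component_le_norm_cart[of "z s y" i] by linarith
          then have "\<bar>\<psi> i y\<bar> \<le> \<rho> * B" unfolding \<psi>_def abs_mult using \<phi>(3,4) by (intro mult_mono) auto
          then have "\<bar>\<psi> i y\<bar> * norm (column i (G y)) \<le> \<rho> * B * norm (G y)"
            using norm_le_sum_columns(1)[of i "G y"] \<phi>(4) B0 by (intro mult_mono) auto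
          moreover have "y \<in> S" using True cs by blast
          ultimately show ?thesis using True by simp
        qed (use supp in simp)
        show "0 \<le> (\<rho> * B) * (indicator (cball x (s * \<rho>)) y *\<^sub>R norm (G y))" using B0 \<phi>(4) by simp
      qed
      also have "\<dots> = \<rho> * B * (LINT y:cball x (s * \<rho>)|lebesgue. norm (G y))"
        unfolding set_lebesgue_integral_def by simp
      also have "\<dots> \<le> \<rho> * B * (N * s ^ ?n)"
        using N[of s] s B0 \<phi>(4) by (intro mult_left_mono) auto
      finally show ?thesis .
    qed
    have "\<bar>(\<Sum>i\<in>UNIV. LINT y:S|lebesgue. \<psi> i y *\<^sub>R column i (G y)) \<bullet> d\<bar> \<le> (\<Sum>i\<in>(UNIV::'n set). \<rho> * B * (N * s ^ ?n)) * norm d"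
      by (rule order_trans[OF Cauchy_Schwarz_ineq2]) (intro mult_right_mono order_trans[OF norm_sum] sum_mono one, simp)
    then have "\<bar>F' s\<bar> \<le> (1 / s ^ ?n) * (real ?n * (\<rho> * B * (N * s ^ ?n)) * norm d)"
      unfolding F'e abs_mult using s0 by (intro mult_mono) auto
    also have "\<dots> = real ?n * \<rho> * B * N * norm d" using s0 by simp
    finally show ?thesis .
  qed
  have "norm (F \<tau> - F \<sigma>) \<le> (real ?n * \<rho> * B * N * norm d) * norm (\<tau> - \<sigma>)"
    by (rule field_differentiable_bound[of "{\<sigma>..\<tau>}" F F']) (use derF boundF' \<sigma> in auto)
  moreover have "F \<tau> - F \<sigma> = norm d * norm d"
    using FK[of \<tau>] FK[of \<sigma>] \<sigma> by (simp add: d_def inner_diff_left[symmetric] power2_norm_eq_inner[symmetric] power2_eq_square)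
  ultimately have "norm d * norm d \<le> ((\<tau> - \<sigma>) * (real ?n * \<rho> * B * N)) * norm d"
    using \<sigma> by (simp add: mult_ac)
  moreover have "0 \<le> (\<tau> - \<sigma>) * (real ?n * \<rho> * B * N)"
  proof -
    have "0 \<le> (LINT y:cball x (\<tau> * \<rho>)|lebesgue. norm (G y))"
      unfolding set_lebesgue_integral_def by (rule Bochner_Integration.integral_nonneg) auto
    also have "\<dots> \<le> N * \<tau> ^ ?n" using N[of \<tau>] \<sigma> by auto
    finally have "0 \<le> N" 
      using zero_less_power[of \<tau> ?n] \<sigma> zero_le_mult_iff[of N "\<tau> ^ ?n"] by linarith
    moreover have "B \<ge> 0" using \<phi>(3)[of 0] by simp
    ultimately show ?thesis using \<sigma> \<phi>(4) by simp
  qed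
  ultimately have "norm d \<le> (\<tau> - \<sigma>) * (real ?n * \<rho> * B * N)"
    using mult_le_cancel_right[of "norm d" "norm d"] by (cases "d = 0") auto
  then show ?thesis unfolding d_def .
qed

lemma kernel_avg_error:
  fixes u :: "real^'n::finite \<Rightarrow> real^'m::finite"
  assumes u: "locally_integrable S u" "cball x (s * \<rho>) \<subseteq> S" and s: "s > 0"
    and \<phi>: "continuous_on UNIV \<phi>" "\<And>z. z \<notin> cball 0 \<rho> \<Longrightarrow> \<phi> z = 0" "\<And>z. \<bar>\<phi> z\<bar> \<le> B"
  shows "norm (kernel_avg \<phi> u x s - integral\<^sup>L lebesgue \<phi> *\<^sub>R u x)
    \<le> B / s ^ CARD('n) * (LINT y:cball x (s * \<rho>)|lebesgue. norm (u y - u x))"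
proof -
  let ?n = "CARD('n)"
  have B0: "B \<ge> 0" using \<phi>(3)[of 0] by simp
  have \<phi>i: "integrable lebesgue \<phi>" by (rule integrable_lebesgue_continuous_support[OF \<phi>(1) compact_cball \<phi>(2)])
  let ?C = "cball x (s * \<rho>)"
  have C: "?C \<subseteq> S" "compact ?C" using u(2) by auto
  have ui: "set_integrable lebesgue ?C u" using u(1) C unfolding locally_integrable_def by blast
  have di: "set_integrable lebesgue ?C (\<lambda>y. u y - u x)"
    by (rule set_integral_diff(1)[OF ui set_integrable_lebesgue_const]) simp
  define k where "k y = \<phi> ((1 / s) *\<^sub>R (y - x))" for y
  have kz: "k y = 0" if "y \<notin> ?C" for y
    using \<phi>(2) scaled_in_cball[OF s, of y x \<rho>] that by (auto simp: k_def)
  have km: "k \<in> borel_measurable lebesgue" unfolding k_def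
    by (intro continuous_borel_measurable_lebesgue continuous_on_compose2[OF \<phi>(1)] continuous_intros) auto
  have kU: "integrable lebesgue (\<lambda>y. k y *\<^sub>R (indicator ?C y *\<^sub>R v y))" if "set_integrable lebesgue ?C v" for v :: "_ \<Rightarrow> real^'m"
  proof (rule Bochner_Integration.integrable_bound[OF integrable_scaleR_right[OF that[unfolded set_integrable_def], of B]])
    show "(\<lambda>y. k y *\<^sub>R (indicator ?C y *\<^sub>R v y)) \<in> borel_measurable lebesgue"
      by (rule borel_measurable_scaleR[OF km borel_measurable_integrable[OF that[unfolded set_integrable_def]]])
    show "AE y in lebesgue. norm (k y *\<^sub>R (indicator ?C y *\<^sub>R v y)) \<le> norm (B *\<^sub>R (indicator ?C y *\<^sub>R v y))"
      using \<phi>(3) B0 by (intro AE_I2) (auto simp: k_def abs_mult intro!: mult_right_mono)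
  qed
  have kC: "k y *\<^sub>R (indicator ?C y *\<^sub>R v) = k y *\<^sub>R v" for y and v :: "real^'m"
    using kz[of y] by (cases "y \<in> ?C") auto
  have 1: "integrable lebesgue (\<lambda>y. k y *\<^sub>R u y)" using kU[OF ui] unfolding kC .
  have 2: "integrable lebesgue (\<lambda>y. k y *\<^sub>R u x)"
    using kU[OF set_integrable_lebesgue_const, of "u x"] unfolding kC by simp
  have keq: "\<phi> (- (1 / s) *\<^sub>R x + (1 / s) *\<^sub>R y) = k y" for y by (simp add: k_def scaleR_diff_right)
  have kI: "integral\<^sup>L lebesgue k = s ^ ?n * integral\<^sup>L lebesgue \<phi>" "integrable lebesgue k"
    using lebesgue_integral_affine[OF \<phi>i, of "1 / s" "- (1 / s) *\<^sub>R x"] s unfolding keq by (simp_all add: power_divide)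
  have "kernel_avg \<phi> u x s - integral\<^sup>L lebesgue \<phi> *\<^sub>R u x
      = (1 / s ^ ?n) *\<^sub>R ((LINT y|lebesgue. k y *\<^sub>R u y) - (LINT y|lebesgue. k y *\<^sub>R u x))"
  proof -
    have "kernel_avg \<phi> u x s = (1 / s ^ ?n) *\<^sub>R (LINT y|lebesgue. k y *\<^sub>R u y)"
      by (simp only: kernel_avg_def k_def)
    then show ?thesis using s kI by (simp add: scaleR_diff_right)
  qed
  also have "\<dots> = (1 / s ^ ?n) *\<^sub>R (LINT y|lebesgue. k y *\<^sub>R (indicator ?C y *\<^sub>R (u y - u x)))"
    unfolding kC using 1 2 by (simp add: scaleR_diff_right)
  finally have "norm (kernel_avg \<phi> u x s - integral\<^sup>L lebesgue \<phi> *\<^sub>R u x)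
      = (1 / s ^ ?n) * norm (LINT y|lebesgue. k y *\<^sub>R (indicator ?C y *\<^sub>R (u y - u x)))" using s by simp
  also have "\<dots> \<le> (1 / s ^ ?n) * (LINT y|lebesgue. B * (indicator ?C y *\<^sub>R norm (u y - u x)))"
  proof (intro mult_left_mono order_trans[OF integral_norm_bound integral_mono'])
    show "integrable lebesgue (\<lambda>y. B * (indicator ?C y *\<^sub>R norm (u y - u x)))"
      using set_integrable_norm[OF di] by (simp add: set_integrable_def)
    show "norm (k y *\<^sub>R (indicator ?C y *\<^sub>R (u y - u x))) \<le> B * (indicator ?C y *\<^sub>R norm (u y - u x))" for y
    proof -
      have "\<bar>k y\<bar> * (indicator ?C y *\<^sub>R norm (u y - u x)) \<le> B * (indicator ?C y *\<^sub>R norm (u y - u x))"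
        using \<phi>(3) by (intro mult_right_mono) (auto simp: k_def)
      then show ?thesis by (simp add: abs_mult mult.assoc)
    qed
  qed (use s B0 in auto)
  also have "\<dots> = B / s ^ ?n * (LINT y:?C|lebesgue. norm (u y - u x))"
    by (simp add: set_lebesgue_integral_def)
  finally show ?thesis .
qed

lemma kernel_avg_tendsto:
  fixes u :: "real^'n::finite \<Rightarrow> real^'m::finite"
  assumes u: "locally_integrable S u" "cball x r \<subseteq> S" "r > 0" and leb: "leb_point u x"
    and \<phi>: "continuous_on UNIV \<phi>" "\<And>z. z \<notin> cball 0 \<rho> \<Longrightarrow> \<phi> z = 0" "\<And>z. \<bar>\<phi> z\<bar> \<le> B" "\<rho> > 0"
  shows "((\<lambda>s. kernel_avg \<phi> u x s) \<longlongrightarrow> integral\<^sup>L lebesgue \<phi> *\<^sub>R u x) (at_right 0)"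
proof -
  let ?n = "CARD('n)"
  let ?A = "\<lambda>s. (LINT y:cball x s|lebesgue. norm (u y - u x)) / s ^ ?n"
  have "filterlim (\<lambda>s. s * \<rho>) (at_right 0) (at_right (0::real))"
    using \<phi>(4) by (auto simp: filterlim_at eventually_at_right_less intro!: tendsto_eq_intros
        eventually_mono[OF eventually_at_right_less])
  then have "((\<lambda>s. ?A (s * \<rho>)) \<longlongrightarrow> 0) (at_right 0)"
    using leb unfolding leb_point_def by (simp add: filterlim_compose[of "\<lambda>s. ?A s"])
  then have lim: "((\<lambda>s. B * \<rho> ^ ?n * ?A (s * \<rho>)) \<longlongrightarrow> 0) (at_right 0)" by (rule tendsto_mult_right_zero)
  have le: "norm (kernel_avg \<phi> u x s - integral\<^sup>L lebesgue \<phi> *\<^sub>R u x) \<le> B * \<rho> ^ ?n * ?A (s * \<rho>)"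
    if s: "0 < s" "s < r / \<rho>" for s
  proof -
    have sub: "cball x (s * \<rho>) \<subseteq> S"
      using subset_cball[of "s * \<rho>" r x] s \<phi>(4) u(2) by (auto simp: pos_less_divide_eq simp del: mem_cball)
    have "norm (kernel_avg \<phi> u x s - integral\<^sup>L lebesgue \<phi> *\<^sub>R u x)
        \<le> B / s ^ ?n * (LINT y:cball x (s * \<rho>)|lebesgue. norm (u y - u x))"
      by (rule kernel_avg_error[OF u(1) sub s(1) \<phi>(1-3)])
    also have "\<dots> = B * \<rho> ^ ?n * ?A (s * \<rho>)"
      using s \<phi>(4) by (simp add: set_lebesgue_integral_def power_mult_distrib field_simps)
    finally show ?thesis .
  qed
  have "((\<lambda>s. kernel_avg \<phi> u x s - integral\<^sup>L lebesgue \<phi> *\<^sub>R u x) \<longlongrightarrow> 0) (at_right 0)"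
  proof (rule Lim_null_comparison[OF _ lim])
    show "\<forall>\<^sub>F s in at_right 0. norm (kernel_avg \<phi> u x s - integral\<^sup>L lebesgue \<phi> *\<^sub>R u x) \<le> B * \<rho> ^ ?n * ?A (s * \<rho>)"
      using le u(3) \<phi>(4) by (auto simp: eventually_at_right_field intro!: exI[of _ "r / \<rho>"])
  qed
  then show ?thesis by (simp add: LIM_zero_iff)
qed

text \<open>At a Lebesgue point the averages converge to the value as the scale tends to zero; the change of
  the average over all smaller scales is bounded by the maximal function of the weak derivative.\<close>

lemma kernel_avg_point_bound:
  fixes u :: "real^'n::finite \<Rightarrow> real^'m::finite"
  assumes weak: "has_weak_derivative_on u G S"
    and \<phi>: "smooth_on UNIV \<phi>" "\<And>z. z \<notin> cball 0 \<rho> \<Longrightarrow> \<phi> z = 0" "\<And>z. \<bar>\<phi> z\<bar> \<le> B" "\<rho> > 0" "integral\<^sup>L lebesgue \<phi> = 1"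
    and \<tau>: "\<tau> > 0" and S: "cball x (\<tau> * \<rho>) \<subseteq> S" and leb: "leb_point u x"
    and N: "\<And>s. 0 < s \<Longrightarrow> s \<le> \<tau> \<Longrightarrow> (LINT y:cball x (s * \<rho>)|lebesgue. norm (G y)) \<le> N * s ^ CARD('n)"
  shows "norm (kernel_avg \<phi> u x \<tau> - u x) \<le> \<tau> * (real CARD('n) * \<rho> * B * N)"
proof -
  have lu: "locally_integrable S u" using weak by (simp add: has_weak_derivative_on_def)
  have "((\<lambda>s. kernel_avg \<phi> u x s) \<longlongrightarrow> 1 *\<^sub>R u x) (at_right 0)"
    using kernel_avg_tendsto[OF lu S _ leb smooth_continuous_derivative(2)[OF \<phi>(1)] \<phi>(2,3,4)] \<tau> \<phi>(4,5) by simp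
  then have 1: "((\<lambda>s. norm (kernel_avg \<phi> u x \<tau> - kernel_avg \<phi> u x s)) \<longlongrightarrow> norm (kernel_avg \<phi> u x \<tau> - u x)) (at_right 0)"
    by (intro tendsto_intros) simp
  have 2: "((\<lambda>s. (\<tau> - s) * (real CARD('n) * \<rho> * B * N)) \<longlongrightarrow> (\<tau> - 0) * (real CARD('n) * \<rho> * B * N)) (at_right 0)"
    by (intro tendsto_intros)
  have "norm (kernel_avg \<phi> u x \<tau> - u x) \<le> (\<tau> - 0) * (real CARD('n) * \<rho> * B * N)"
  proof (rule tendsto_le[OF _ 2 1])
    show "\<forall>\<^sub>F s in at_right 0. norm (kernel_avg \<phi> u x \<tau> - kernel_avg \<phi> u x s) \<le> (\<tau> - s) * (real CARD('n) * \<rho> * B * N)"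
      unfolding eventually_at_right_field
    proof (intro exI[of _ \<tau>] conjI allI impI \<tau>)
      fix s :: real assume "0 < s" "s < \<tau>"
      then show "norm (kernel_avg \<phi> u x \<tau> - kernel_avg \<phi> u x s) \<le> (\<tau> - s) * (real CARD('n) * \<rho> * B * N)"
        by (intro kernel_avg_diff[OF weak \<phi>(1-4) _ _ S N]) auto
    qed
  qed simp
  then show ?thesis by simp
qed

text \<open>An average around \<open>x\<close> at the scale of the distance is also an average around \<open>y\<close>, for a translated
  kernel; both values are compared with it.\<close>

lemma ex_pointwise_lipschitz_constant:
  obtains C :: real where "C > 0"
    "\<And>(u :: real^'n::finite \<Rightarrow> real^'m::finite) G S N x y.
      has_weak_derivative_on u G S \<Longrightarrow> leb_point u x \<Longrightarrow> leb_point u y \<Longrightarrow>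
      cball x (2 * dist x y) \<subseteq> S \<Longrightarrow> cball y (2 * dist x y) \<subseteq> S \<Longrightarrow>
      (\<And>s. 0 < s \<Longrightarrow> s \<le> 2 * dist x y \<Longrightarrow> (LINT w:cball x s|lebesgue. norm (G w)) \<le> N * s ^ CARD('n)) \<Longrightarrow>
      (\<And>s. 0 < s \<Longrightarrow> s \<le> 2 * dist x y \<Longrightarrow> (LINT w:cball y s|lebesgue. norm (G w)) \<le> N * s ^ CARD('n)) \<Longrightarrow>
      norm (u x - u y) \<le> C * N * dist x y"
proof -
  let ?n = "CARD('n)"
  obtain \<phi> :: "real^'n \<Rightarrow> real" where \<phi>: "smooth_on UNIV \<phi>" "\<And>z. z \<notin> cball 0 1 \<Longrightarrow> \<phi> z = 0"
    "integrable lebesgue \<phi>" "integral\<^sup>L lebesgue \<phi> = 1" by (rule ex_unit_bump) (rule that)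
  obtain B where B: "B > 0" "\<And>z. \<bar>\<phi> z\<bar> \<le> B"
    using integrable_lebesgue_continuous_support(2)[OF smooth_continuous_derivative(2)[OF \<phi>(1)] compact_cball[of 0 1] \<phi>(2)]
    by (auto simp del: mem_cball)
  define C where "C = 2 * (real ?n * 2 * B * 2 ^ ?n)"
  show ?thesis
  proof (rule that[of C])
    show "C > 0" using B by (simp add: C_def)
    fix u :: "real^'n \<Rightarrow> real^'m" and G S N x y
    assume weak: "has_weak_derivative_on u G S" and leb: "leb_point u x" "leb_point u y"
      and S: "cball x (2 * dist x y) \<subseteq> S" "cball y (2 * dist x y) \<subseteq> S"
      and Nx: "\<And>s. 0 < s \<Longrightarrow> s \<le> 2 * dist x y \<Longrightarrow> (LINT w:cball x s|lebesgue. norm (G w)) \<le> N * s ^ ?n"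
      and Ny: "\<And>s. 0 < s \<Longrightarrow> s \<le> 2 * dist x y \<Longrightarrow> (LINT w:cball y s|lebesgue. norm (G w)) \<le> N * s ^ ?n"
    show "norm (u x - u y) \<le> C * N * dist x y"
    proof (cases "x = y")
      case False
      define s where "s = dist x y"
      have s: "s > 0" using False by (simp add: s_def)
      \<comment> \<open>the offset of the centres is a unit vector at this scale, so both kernels live on the ball of radius 2\<close>
      define b where "b = (1 / s) *\<^sub>R (x - y)"
      define \<phi>' where "\<phi>' w = \<phi> (w - b)" for w
      have nb: "norm b = 1" using False by (simp add: b_def s_def dist_norm)
      have \<phi>'s: "smooth_on UNIV \<phi>'"
        using \<phi>(1) Ck_on_affine_compose[OF bounded_linear_ident, of _ \<phi> "- b"] unfolding smooth_on_def \<phi>'_def by auto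
      have \<phi>z: "\<phi> z = 0" if "z \<notin> cball 0 2" for z using that by (intro \<phi>(2)) auto
      have \<phi>'z: "\<phi>' z = 0" if "z \<notin> cball 0 2" for z
        unfolding \<phi>'_def using that norm_triangle_ineq[of "z - b" b] nb by (intro \<phi>(2)) auto
      have \<phi>'I: "integral\<^sup>L lebesgue \<phi>' = 1"
        using lebesgue_integral_affine(2)[OF \<phi>(3), of 1 "- b"] \<phi>(4) by (simp add: \<phi>'_def[abs_def])
      have "(1 / s) *\<^sub>R (w - y) - b = (1 / s) *\<^sub>R (w - x)" for w
        by (simp add: b_def scaleR_diff_right)
      then have same: "kernel_avg \<phi>' u y s = kernel_avg \<phi> u x s" by (simp add: kernel_avg_def \<phi>'_def)
      have bx: "norm (kernel_avg \<phi> u x s - u x) \<le> s * (real ?n * 2 * B * (N * 2 ^ ?n))"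
      proof (rule kernel_avg_point_bound[OF weak \<phi>(1) \<phi>z B(2) _ \<phi>(4) s _ leb(1)])
        fix r assume "0 < r" "r \<le> s"
        then show "(LINT w:cball x (r * 2)|lebesgue. norm (G w)) \<le> N * 2 ^ ?n * r ^ ?n"
          using Nx[of "r * 2"] by (simp add: s_def power_mult_distrib mult_ac)
      qed (use S in \<open>auto simp: s_def mult.commute\<close>)
      have B': "\<bar>\<phi>' z\<bar> \<le> B" for z using B(2) by (simp add: \<phi>'_def)
      have by': "norm (kernel_avg \<phi>' u y s - u y) \<le> s * (real ?n * 2 * B * (N * 2 ^ ?n))"
      proof (rule kernel_avg_point_bound[OF weak \<phi>'s \<phi>'z B' _ \<phi>'I s _ leb(2)])
        fix r assume "0 < r" "r \<le> s"
        then show "(LINT w:cball y (r * 2)|lebesgue. norm (G w)) \<le> N * 2 ^ ?n * r ^ ?n"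
          using Ny[of "r * 2"] by (simp add: s_def power_mult_distrib mult_ac)
      qed (use S in \<open>auto simp: s_def mult.commute\<close>)
      have "norm (u x - u y) \<le> norm (kernel_avg \<phi> u x s - u x) + norm (kernel_avg \<phi>' u y s - u y)"
        unfolding same using norm_triangle_ineq4[of "kernel_avg \<phi> u x s - u y" "kernel_avg \<phi> u x s - u x"] by (simp add: algebra_simps)
      also have "\<dots> \<le> C * N * s" using bx by' by (simp add: C_def mult_ac)
      finally show ?thesis by (simp add: s_def)
    qed simp
  qed
qed

section \<open>Lipschitz functions: extension and almost everywhere differentiability\<close>

text \<open>McShane's formula, the greatest lower bound of the cones \<open>u y + \<Lambda> \<rho> x y\<close> with apex in \<open>E\<close>, is applied
  to each component; this costs the factor \<open>CARD('m)\<close>.\<close>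

lemma mcshane_extension:
  fixes \<rho> :: "'a \<Rightarrow> 'a \<Rightarrow> real" and u :: "'a \<Rightarrow> real^'m::finite"
  assumes nonneg: "\<And>x y. \<rho> x y \<ge> 0" and refl: "\<And>x. \<rho> x x = 0" and sym: "\<And>x y. \<rho> x y = \<rho> y x"
    and tri: "\<And>x y z. \<rho> x z \<le> \<rho> x y + \<rho> y z"
    and u: "\<And>x y. x \<in> E \<Longrightarrow> y \<in> E \<Longrightarrow> norm (u x - u y) \<le> \<Lambda> * \<rho> x y" and \<Lambda>: "\<Lambda> \<ge> 0"
  obtains v where "\<And>x. x \<in> E \<Longrightarrow> v x = u x" "\<And>x y. norm (v x - v y) \<le> real CARD('m) * \<Lambda> * \<rho> x y"
proof (cases "E = {}")
  case True
  have "norm ((0::real^'m) - 0) \<le> real CARD('m) * \<Lambda> * \<rho> x y" for x y using \<Lambda> nonneg[of x y] by simp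
  then show ?thesis using True that[of "\<lambda>x. 0"] by auto
next
  case False
  define v where "v x = (\<chi> i. INF y\<in>E. u y $ i + \<Lambda> * \<rho> x y)" for x
  have comp: "\<bar>u x $ i - u y $ i\<bar> \<le> \<Lambda> * \<rho> x y" if "x \<in> E" "y \<in> E" for x y i
    using u[OF that] component_le_norm_cart[of "u x - u y" i] by simp
  have bdd: "bdd_below ((\<lambda>y. u y $ i + \<Lambda> * \<rho> x y) ` E)" for x i
  proof -
    obtain e where e: "e \<in> E" using False by blast
    have "u e $ i - \<Lambda> * \<rho> e x \<le> u y $ i + \<Lambda> * \<rho> x y" if "y \<in> E" for y
    proof -
      have "\<Lambda> * \<rho> e y \<le> \<Lambda> * \<rho> e x + \<Lambda> * \<rho> x y"
        using mult_left_mono[OF tri[of e y x] \<Lambda>] by (simp add: algebra_simps)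
      then show ?thesis using comp[OF e that, of i] by linarith
    qed
    then show ?thesis by (intro bdd_belowI2) 
  qed
  have le: "v x $ i \<le> v y $ i + \<Lambda> * \<rho> x y" for x y i
  proof -
    have "v x $ i - \<Lambda> * \<rho> x y \<le> v y $ i"
      unfolding v_def vec_lambda_beta
    proof (rule cINF_greatest[OF False])
      fix z assume z: "z \<in> E"
      have "(INF y\<in>E. u y $ i + \<Lambda> * \<rho> x y) \<le> u z $ i + \<Lambda> * \<rho> x z" by (rule cINF_lower[OF bdd z])
      moreover have "\<Lambda> * \<rho> x z \<le> \<Lambda> * \<rho> x y + \<Lambda> * \<rho> y z"
        using mult_left_mono[OF tri[of x z y] \<Lambda>] by (simp add: algebra_simps)
      ultimately show "(INF y\<in>E. u y $ i + \<Lambda> * \<rho> x y) - \<Lambda> * \<rho> x y \<le> u z $ i + \<Lambda> * \<rho> y z" by linarith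
    qed
    then show ?thesis by linarith
  qed
  show ?thesis
  proof
    fix x assume x: "x \<in> E"
    show "v x = u x"
    proof (rule vec_eq_iff[THEN iffD2], intro allI antisym)
      fix i
      show "v x $ i \<le> u x $ i" using cINF_lower[OF bdd x, of i x] by (simp add: v_def refl)
      show "u x $ i \<le> v x $ i"
        unfolding v_def vec_lambda_beta
        by (rule cINF_greatest[OF False]) (use comp[OF x, of _ i] in \<open>force simp: abs_le_iff algebra_simps\<close>)
    qed
  next
    fix x y
    have "norm (v x - v y) \<le> (\<Sum>i\<in>UNIV. \<bar>(v x - v y) $ i\<bar>)" by (rule norm_le_l1_cart)
    also have "\<dots> \<le> (\<Sum>i\<in>(UNIV::'m set). \<Lambda> * \<rho> x y)"
      using le[of x _ y] le[of y _ x] by (intro sum_mono) (simp add: abs_le_iff sym[of y x] algebra_simps)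
    finally show "norm (v x - v y) \<le> real CARD('m) * \<Lambda> * \<rho> x y" by simp
  qed
qed

text \<open>Adding \<open>(L + 1) t\<close> makes the function an increasing bi-Lipschitz bijection \<open>F\<close>. The measure that
  assigns to a set the length of its image under \<open>F\<close> is absolutely continuous, and its density is the
  derivative of \<open>F\<close> almost everywhere.\<close>

lemma lipschitz_real_quotients_converge:
  fixes f :: "real \<Rightarrow> real"
  assumes f: "\<And>x y. \<bar>f x - f y\<bar> \<le> L * \<bar>x - y\<bar>"
  shows "AE t in lborel. convergent (\<lambda>j. real (Suc j) * (f (t + 1 / real (Suc j)) - f t))"
proof -
  have L: "L \<ge> 0" using f[of 0 1] by simp
  define F where "F t = f t + (L + 1) * t" for t
  have F1: "y - x \<le> F y - F x" if "x \<le> y" for x y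
    using f[of x y] that by (simp add: F_def algebra_simps abs_le_iff)
  have F2: "\<bar>F x - F y\<bar> \<le> (2 * L + 1) * \<bar>x - y\<bar>" for x y
  proof -
    have "F x - F y = (f x - f y) + (L + 1) * (x - y)" by (simp add: F_def algebra_simps)
    then have "\<bar>F x - F y\<bar> \<le> \<bar>f x - f y\<bar> + (L + 1) * \<bar>x - y\<bar>"
      using abs_triangle_ineq[of "f x - f y" "(L + 1) * (x - y)"] L by (simp add: abs_mult)
    then show ?thesis using f[of x y] by (simp add: algebra_simps)
  qed
  have Fabs: "\<bar>x - y\<bar> \<le> \<bar>F x - F y\<bar>" for x y
    using F1[of x y] F1[of y x] by (cases "x \<le> y") auto
  have inj: "inj F"
  proof (rule injI)
    fix x y assume "F x = F y"
    then show "x = y" using Fabs[of x y] by simp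
  qed
  have cont: "continuous_on UNIV F"
    by (rule lipschitz_on_continuous_on[of "2 * L + 1"]) (use F2 L in \<open>auto intro!: lipschitz_onI simp: dist_real_def\<close>)
  have surj: "surj F"
  proof (rule surjI)
    fix y
    have "F (- \<bar>y - F 0\<bar>) \<le> y" "y \<le> F \<bar>y - F 0\<bar>"
      using F1[of "- \<bar>y - F 0\<bar>" 0] F1[of 0 "\<bar>y - F 0\<bar>"] by auto
    then have "\<exists>x. - \<bar>y - F 0\<bar> \<le> x \<and> x \<le> \<bar>y - F 0\<bar> \<and> F x = y"
      using cont by (intro IVT') (auto intro: continuous_on_subset)
    then show "F (SOME x. F x = y) = y" by (metis (mono_tags) someI_ex)
  qed
  define I where "I = inv F"
  have IF: "I (F x) = x" "F (I y) = y" for x y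
    using inj surj by (auto simp: I_def surj_f_inv_f)
  have Icont: "continuous_on UNIV I"
    by (rule lipschitz_on_continuous_on[of 1])
      (use Fabs[of "I _" "I _"] in \<open>auto intro!: lipschitz_onI simp: dist_real_def IF\<close>)
  have Im[measurable]: "I \<in> borel_measurable borel" using Icont by (rule borel_measurable_continuous_onI)
  define \<nu> where "\<nu> = distr lborel borel I"
  have vim: "I -` A = F ` A" for A
  proof (rule set_eqI)
    show "x \<in> I -` A \<longleftrightarrow> x \<in> F ` A" for x using IF(1) IF(2)[of x] by (auto intro: image_eqI[of x F "I x"])
  qed
  have \<nu>: "emeasure \<nu> A = emeasure lborel (F ` A)" if "A \<in> sets borel" for A
    unfolding \<nu>_def using that by (subst emeasure_distr) (auto simp: vim)
  have "absolutely_continuous lborel \<nu>"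
    unfolding absolutely_continuous_def
  proof
    fix N assume N: "N \<in> null_sets (lborel :: real measure)"
    then have Nb: "N \<in> sets borel" by auto
    have "negligible N" using N by (simp add: negligible_iff_null_sets null_sets_completionI)
    then have "negligible (F ` N)"
    proof (rule negligible_locally_Lipschitz_image[rotated])
      show "\<exists>T B. open T \<and> x \<in> T \<and> (\<forall>y\<in>N \<inter> T. norm (F y - F x) \<le> B * norm (y - x))" for x
        using F2 by (intro exI[of _ UNIV] exI[of _ "2 * L + 1"]) auto
    qed simp
    then have "F ` N \<in> null_sets lebesgue" by (simp add: negligible_iff_null_sets)
    moreover have "F ` N \<in> sets borel" using measurable_sets[OF Im Nb] by (simp add: vim)
    ultimately have "emeasure lborel (F ` N) = 0" by (auto simp: null_sets_def)
    then show "N \<in> null_sets \<nu>" using \<nu>[OF Nb] Nb by (auto simp: null_sets_def \<nu>_def)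
  qed
  then obtain h where h: "h \<in> borel_measurable lborel" "density lborel h = \<nu>"
    using sigma_finite_measure.Radon_Nikodym[OF sigma_finite_lborel, of \<nu>] by (auto simp: \<nu>_def)
  have hm[measurable]: "h \<in> borel_measurable borel" using h(1) by (simp only: measurable_lborel2)
  have img: "F ` {a..b} = {F a..F b}" if "a \<le> b" for a b
  proof
    have "F x \<le> F y" if "x \<le> y" for x y using F1[OF that] that by linarith
    then show "F ` {a..b} \<subseteq> {F a..F b}" by auto
    show "{F a..F b} \<subseteq> F ` {a..b}"
    proof
      fix y assume y: "y \<in> {F a..F b}"
      have "\<exists>x\<ge>a. x \<le> b \<and> F x = y"
        using that cont y by (intro IVT') (auto intro: continuous_on_subset)
      then show "y \<in> F ` {a..b}" by auto
    qed
  qed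
  have ih: "(\<integral>\<^sup>+ t. h t * indicator {a..b} t \<partial>lborel) = ennreal (F b - F a)" if "a \<le> b" for a b
  proof -
    have "(\<integral>\<^sup>+ t. h t * indicator {a..b} t \<partial>lborel) = emeasure \<nu> {a..b}"
      by (subst h(2)[symmetric], subst emeasure_density) auto
    also have "\<dots> = ennreal (F b - F a)" using that F1[OF that] by (simp add: \<nu> img)
    finally show ?thesis .
  qed
  define h' where "h' t = enn2real (h t)" for t
  have fin: "AE t in lborel. h t \<noteq> \<infinity>"
  proof -
    have "AE t in lborel. h t * indicator {- real k..real k} t \<noteq> \<infinity>" for k :: nat
      using ih[of "- real k" "real k"] by (intro nn_integral_noteq_infinite) auto
    then have "AE t in lborel. \<forall>k::nat. h t * indicator {- real k..real k} t \<noteq> \<infinity>" by (simp add: AE_all_countable)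
    then show ?thesis
    proof eventually_elim
      case (elim t)
      obtain k :: nat where "\<bar>t\<bar> \<le> real k" using real_arch_simple by blast
      then show ?case using elim[rule_format, of k] by (auto simp: indicator_def abs_le_iff)
    qed
  qed
  have hi: "(h' has_integral (F b - F a)) {a..b}" if "a \<le> b" for a b
  proof -
    have "(\<integral>\<^sup>+ t. ennreal (h' t * indicator {a..b} t) \<partial>lborel) = (\<integral>\<^sup>+ t. h t * indicator {a..b} t \<partial>lborel)"
      by (rule nn_integral_cong_AE, use fin in eventually_elim) (auto simp: h'_def indicator_def less_top)
    then have "((\<lambda>t. h' t * indicator {a..b} t) has_integral (F b - F a)) UNIV"
      using ih[OF that] F1[OF that] that
      by (intro nn_integral_has_integral) (auto simp: h'_def)
    moreover have "(\<lambda>t. h' t * indicator {a..b} t) = (\<lambda>t. if t \<in> {a..b} then h' t else 0)"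
      by (auto simp: indicator_def)
    ultimately show ?thesis using has_integral_restrict_UNIV[of "{a..b}" h'] by simp
  qed
  have "h' integrable_on cbox a b" for a b
    using hi[of a b] by (cases "a \<le> b") (auto simp: integrable_on_def)
  then obtain N where N: "negligible N" "\<And>x e. \<lbrakk>x \<notin> N; 0 < e\<rbrakk> \<Longrightarrow>
               \<exists>d>0. \<forall>h. 0 < h \<and> h < d \<longrightarrow> norm(integral (cbox x (x + h *\<^sub>R One)) h' /\<^sub>R h ^ DIM(real) - h' x) < e"
    using integrable_ccontinuous_explicit[of h'] by metis
  have "convergent (\<lambda>j. real (Suc j) * (f (t + 1 / real (Suc j)) - f t))" if t: "t \<notin> N" for t
  proof -
    have "(\<lambda>j. real (Suc j) * (F (t + 1 / real (Suc j)) - F t)) \<longlonglongrightarrow> h' t"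
    proof (rule LIMSEQ_I)
      fix e :: real assume "e > 0"
      then obtain d where d: "d > 0" "\<And>h. 0 < h \<Longrightarrow> h < d \<Longrightarrow> norm(integral (cbox t (t + h *\<^sub>R One)) h' /\<^sub>R h ^ DIM(real) - h' t) < e"
        using N(2)[OF t, of e] by auto
      obtain j0 where j0: "1 / real (Suc j0) < d"
        using d(1) by (metis inverse_eq_divide reals_Archimedean)
      show "\<exists>j0. \<forall>j\<ge>j0. norm (real (Suc j) * (F (t + 1 / real (Suc j)) - F t) - h' t) < e"
      proof (intro exI allI impI)
        fix j assume "j0 \<le> j"
        then have "1 / real (Suc j) \<le> 1 / real (Suc j0)" by (simp add: frac_le)
        then have *: "1 / real (Suc j) < d" using j0 by simp
        have I: "integral (cbox t (t + (1 / real (Suc j)) *\<^sub>R One)) h' = F (t + 1 / real (Suc j)) - F t"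
          using integral_unique[OF hi[of t "t + 1 / real (Suc j)"]] by (simp del: of_nat_Suc)
        have "0 < 1 / real (Suc j)" by simp
        then show "norm (real (Suc j) * (F (t + 1 / real (Suc j)) - F t) - h' t) < e"
          using d(2)[OF \<open>0 < 1 / real (Suc j)\<close> *, unfolded I] by (simp del: of_nat_Suc)
      qed
    qed
    then have "(\<lambda>j. real (Suc j) * (F (t + 1 / real (Suc j)) - F t) - (L + 1)) \<longlonglongrightarrow> h' t - (L + 1)"
      by (intro tendsto_intros)
    moreover have "real (Suc j) * (F (t + 1 / real (Suc j)) - F t) - (L + 1) = real (Suc j) * (f (t + 1 / real (Suc j)) - f t)" for j
      by (simp add: F_def field_simps)
    ultimately show ?thesis by (auto simp: convergent_def)
  qed
  then have "AE t in lebesgue. convergent (\<lambda>j. real (Suc j) * (f (t + 1 / real (Suc j)) - f t))"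
    using N(1) by (auto simp: eventually_ae_filter_negligible)
  then show ?thesis by (simp add: AE_completion_iff)
qed

text \<open>The one-dimensional case holds on every line in direction \<open>v\<close>; integrating over the lines shows
  that the set of exceptions is a null set.\<close>

lemma lipschitz_quotients_converge:
  fixes f :: "'a::euclidean_space \<Rightarrow> real" and v :: 'a
  assumes f: "\<And>x y. \<bar>f x - f y\<bar> \<le> L * norm (x - y)"
  shows "AE x in lebesgue. convergent (\<lambda>j. real (Suc j) * (f (x + (1 / real (Suc j)) *\<^sub>R v) - f x))"
proof -
  have L: "L \<ge> 0" using f[of "SOME b. b \<in> Basis" 0] by (simp add: norm_Basis some_in_eq) 
  have cont: "continuous_on UNIV f"
    by (rule lipschitz_on_continuous_on[of L]) (use f L in \<open>auto intro!: lipschitz_onI simp: dist_real_def dist_norm\<close>)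
  have fm[measurable]: "f \<in> borel_measurable borel" using cont by (rule borel_measurable_continuous_onI)
  define Q where "Q j x = real (Suc j) * (f (x + (1 / real (Suc j)) *\<^sub>R v) - f x)" for j x
  have Qm[measurable]: "Q j \<in> borel_measurable borel" for j unfolding Q_def by measurable
  define N where "N = {x. \<not> convergent (\<lambda>j. Q j x)}"
  have "{x \<in> space borel. Cauchy (\<lambda>j. Q j x)} \<in> sets borel" by (rule sets_Collect_Cauchy) measurable
  moreover have "N = - {x \<in> space borel. Cauchy (\<lambda>j. Q j x)}" by (auto simp: N_def Cauchy_convergent_iff)
  ultimately have Nm[measurable]: "N \<in> sets borel" by auto
  have line: "AE t in lborel. x + t *\<^sub>R v \<notin> N" for x
  proof -
    have "AE t in lborel. convergent (\<lambda>j. real (Suc j) * (f (x + (t + 1 / real (Suc j)) *\<^sub>R v) - f (x + t *\<^sub>R v)))"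
    proof (rule lipschitz_real_quotients_converge[where f="\<lambda>t. f (x + t *\<^sub>R v)" and L="L * norm v"])
      fix s t
      show "\<bar>f (x + s *\<^sub>R v) - f (x + t *\<^sub>R v)\<bar> \<le> L * norm v * \<bar>s - t\<bar>"
        using f[of "x + s *\<^sub>R v" "x + t *\<^sub>R v"] by (simp add: scaleR_diff_left[symmetric] mult_ac)
    qed
    then show ?thesis by (simp add: N_def Q_def algebra_simps)
  qed
  \<comment> \<open>Tonelli applied to the shear \<open>(x, t) \<mapsto> x + t v\<close> avoids splitting off the direction \<open>v\<close>.\<close>
  have meas: "(\<lambda>(t, x). indicator {0..1::real} t * indicator N (x + t *\<^sub>R v) :: ennreal) \<in> borel_measurable (lborel \<Otimes>\<^sub>M lborel)"
  proof -
    have "(\<lambda>p::real \<times> 'a. snd p + fst p *\<^sub>R v) \<in> borel \<Otimes>\<^sub>M borel \<rightarrow>\<^sub>M borel" by measurable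
    then have "(\<lambda>p::real \<times> 'a. indicator {0..1::real} (fst p) * indicator N (snd p + fst p *\<^sub>R v) :: ennreal) \<in> borel_measurable (borel \<Otimes>\<^sub>M borel)"
      by (intro borel_measurable_times_ennreal) (auto intro: measurable_compose)
    then show ?thesis by (simp add: case_prod_beta cong: measurable_cong_sets)
  qed
  have trans: "(\<integral>\<^sup>+ x. indicator N (x + c) \<partial>lborel) = emeasure lborel N" for c :: 'a
  proof -
    have "(\<integral>\<^sup>+ x. indicator N (x + c) \<partial>lborel) = (\<integral>\<^sup>+ x. indicator N x \<partial>(distr lborel borel ((+) c)))"
      by (subst nn_integral_distr) (auto simp: add.commute)
    then show ?thesis by (simp add: lborel_distr_plus)
  qed
  have "emeasure lborel N = (\<integral>\<^sup>+ t. indicator {0..1::real} t * emeasure lborel N \<partial>lborel)"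
    by (subst nn_integral_multc) auto
  also have "\<dots> = (\<integral>\<^sup>+ t. (\<integral>\<^sup>+ x. indicator {0..1::real} t * indicator N (x + t *\<^sub>R v) \<partial>lborel) \<partial>lborel)"
  proof (rule nn_integral_cong)
    fix t :: real
    have "(\<lambda>x. indicator N (x + t *\<^sub>R v) :: ennreal) \<in> borel_measurable lborel" by measurable
    from nn_integral_cmult[OF this, of "indicator {0..1} t"]
    show "indicator {0..1} t * emeasure lborel N = (\<integral>\<^sup>+ x. indicator {0..1} t * indicator N (x + t *\<^sub>R v) \<partial>lborel)"
      by (simp add: trans)
  qed
  also have "\<dots> = (\<integral>\<^sup>+ x. (\<integral>\<^sup>+ t. indicator {0..1::real} t * indicator N (x + t *\<^sub>R v) \<partial>lborel) \<partial>lborel)"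
    using lborel_pair.Fubini'[OF meas] by simp
  also have "\<dots> = (\<integral>\<^sup>+ (x::'a). 0 \<partial>lborel)"
  proof (rule nn_integral_cong)
    fix x
    have "(\<integral>\<^sup>+ t. indicator {0..1::real} t * indicator N (x + t *\<^sub>R v) \<partial>lborel) = (\<integral>\<^sup>+ (t::real). 0 \<partial>lborel)"
      by (rule nn_integral_cong_AE, use line[of x] in eventually_elim) auto
    then show "(\<integral>\<^sup>+ t. indicator {0..1::real} t * indicator N (x + t *\<^sub>R v) \<partial>lborel) = 0" by simp
  qed
  finally have "N \<in> null_sets lborel" by (auto simp: null_sets_def)
  then have "AE x in lborel. x \<notin> N" by (rule AE_not_in)
  then show ?thesis by (auto simp: N_def Q_def AE_completion)
qed

lemma set_integrable_continuous_mult: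
  fixes f :: "'a::euclidean_space \<Rightarrow> 'b::euclidean_space"
  assumes k: "continuous_on UNIV k" "compact K" "K \<subseteq> S" "\<And>y. y \<notin> K \<Longrightarrow> k y = (0::real)"
    and f: "locally_integrable S f"
  shows "set_integrable lebesgue S (\<lambda>y. k y *\<^sub>R f y)"
proof -
  obtain B where B: "B > 0" "\<And>y. \<bar>k y\<bar> \<le> B"
    using integrable_lebesgue_continuous_support(2)[OF k(1,2,4)] by auto
  have fi: "integrable lebesgue (\<lambda>y. indicator K y *\<^sub>R f y)"
    using f k unfolding locally_integrable_def set_integrable_def by simp
  have "integrable lebesgue (\<lambda>y. k y *\<^sub>R (indicator K y *\<^sub>R f y))"
  proof (rule Bochner_Integration.integrable_bound[OF integrable_scaleR_right[OF fi, of B]])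
    show "(\<lambda>y. k y *\<^sub>R (indicator K y *\<^sub>R f y)) \<in> borel_measurable lebesgue"
      by (rule borel_measurable_scaleR[OF continuous_borel_measurable_lebesgue[OF k(1)] borel_measurable_integrable[OF fi]])
    show "AE y in lebesgue. norm (k y *\<^sub>R (indicator K y *\<^sub>R f y)) \<le> norm (B *\<^sub>R (indicator K y *\<^sub>R f y))"
    proof (rule AE_I2)
      fix y
      have "\<bar>k y\<bar> * norm (indicator K y *\<^sub>R f y) \<le> B * norm (indicator K y *\<^sub>R f y)"
        by (intro mult_right_mono B) simp
      then show "norm (k y *\<^sub>R (indicator K y *\<^sub>R f y)) \<le> norm (B *\<^sub>R (indicator K y *\<^sub>R f y))"
        using B(1) by (simp add: abs_mult mult.assoc)
    qed
  qed
  moreover have "k y *\<^sub>R (indicator K y *\<^sub>R f y) = indicator S y *\<^sub>R (k y *\<^sub>R f y)" for y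
    using k(3,4) by (cases "y \<in> K") auto
  ultimately show ?thesis by (simp only: set_integrable_def)
qed

lemma column_diff: "column i (G - G') = column i G - column i G'"
  by (simp add: column_def vec_eq_iff)

lemma has_weak_derivative_on_diff:
  fixes f f' :: "real^'n::finite \<Rightarrow> real^'m::finite"
  assumes f: "has_weak_derivative_on f G S" and f': "has_weak_derivative_on f' G' S"
  shows "has_weak_derivative_on (\<lambda>y. f y - f' y) (\<lambda>y. G y - G' y) S"
proof -
  have li: "locally_integrable S f" "locally_integrable S f'" "locally_integrable S G" "locally_integrable S G'"
    using f f' by (auto simp: has_weak_derivative_on_def)
  have col: "locally_integrable S (\<lambda>y. column i (H y))" if "locally_integrable S H" for H :: "real^'n \<Rightarrow> real^'n^'m" and i
    unfolding locally_integrable_def set_integrable_def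
  proof (intro allI impI)
    fix K assume "compact K \<and> K \<subseteq> S"
    then have hi: "integrable lebesgue (\<lambda>y. indicator K y *\<^sub>R H y)"
      using that by (simp add: locally_integrable_def set_integrable_def)
    have "bounded_linear (column i :: real^'n^'m \<Rightarrow> _)"
      by (rule bounded_linear_intro[where K=1]) (auto simp: column_def vec_eq_iff norm_le_sum_columns(1)[unfolded column_def])
    from integrable_bounded_linear[OF this hi]
    have "integrable lebesgue (\<lambda>y. column i (indicator K y *\<^sub>R H y))" .
    moreover have "column i (indicator K y *\<^sub>R H y) = indicator K y *\<^sub>R column i (H y)" for y
      by (simp add: column_def vec_eq_iff)
    ultimately show "integrable lebesgue (\<lambda>y. indicator K y *\<^sub>R column i (H y))" by simp
  qed
  have diff: "locally_integrable S (\<lambda>y. u y - v y)" if "locally_integrable S u" "locally_integrable S v" for u v :: "real^'n \<Rightarrow> 'b::euclidean_space"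
    using that unfolding locally_integrable_def by (auto intro: set_integral_diff(1))
  have parts: "(LINT y:S|lebesgue. frechet_derivative \<psi> (at y) (axis i 1) *\<^sub>R (f y - f' y)) =
        - (LINT y:S|lebesgue. \<psi> y *\<^sub>R column i (G y - G' y))" if tf: "test_function S \<psi>" for \<psi> i
  proof -
    obtain K where s: "smooth_on UNIV \<psi>" and K: "compact K" "K \<subseteq> S" and z: "\<And>y. y \<notin> K \<Longrightarrow> \<psi> y = 0"
      using tf unfolding test_function_def by blast
    note c = smooth_continuous_derivative[OF s]
    have Dz: "frechet_derivative \<psi> (at y) (axis i 1) = 0" if "y \<notin> K" for y
      using frechet_derivative_zero_off_support[OF compact_imp_closed[OF K(1)] z that] by simp
    note i1 = set_integrable_continuous_mult[OF c(1) K Dz]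
    note i2 = set_integrable_continuous_mult[OF c(2) K z]
    have "(LINT y:S|lebesgue. frechet_derivative \<psi> (at y) (axis i 1) *\<^sub>R (f y - f' y)) =
       (LINT y:S|lebesgue. frechet_derivative \<psi> (at y) (axis i 1) *\<^sub>R f y) - (LINT y:S|lebesgue. frechet_derivative \<psi> (at y) (axis i 1) *\<^sub>R f' y)"
      unfolding scaleR_diff_right using li by (intro set_integral_diff(2) i1)
    moreover have "(LINT y:S|lebesgue. \<psi> y *\<^sub>R column i (G y - G' y)) =
      (LINT y:S|lebesgue. \<psi> y *\<^sub>R column i (G y)) - (LINT y:S|lebesgue. \<psi> y *\<^sub>R column i (G' y))"
      unfolding column_diff scaleR_diff_right using li by (intro set_integral_diff(2) i2 col)
    ultimately show ?thesis using f f' tf unfolding has_weak_derivative_on_def by simp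
  qed
  show ?thesis unfolding has_weak_derivative_on_def by (intro conjI allI impI diff li parts)
qed

lemma matrix_vector_mult_norm_bound:
  fixes T :: "real^'n::finite^'m::finite"
  obtains M where "M > 0" "\<And>v. norm (T *v v) \<le> M * norm v"
  using bounded_linear.pos_bounded[OF matrix_vector_mul_bounded_linear[of T]] by (auto simp: mult.commute)

lemma affine_has_weak_derivative:
  fixes T :: "real^'n::finite^'m::finite"
  assumes "open S"
  shows "has_weak_derivative_on (\<lambda>y. c + T *v y) (\<lambda>y. T) S"
proof (rule has_weak_derivative_of_difference_quotients[OF assms])
  obtain M where M: "M > 0" "\<And>v. norm (T *v v) \<le> M * norm v" by (rule matrix_vector_mult_norm_bound[of T]) (rule that)
  show "\<exists>L. L-lipschitz_on K (\<lambda>y. c + T *v y)" for K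
    by (rule exI[of _ M], rule lipschitz_onI)
      (use M(2)[of "_ - _"] M(1) in \<open>auto simp: dist_norm matrix_vector_mult_diff_distrib\<close>)
  fix i
  have "real (Suc j) *\<^sub>R (c + T *v (y + (1 / real (Suc j)) *\<^sub>R axis i 1) - (c + T *v y)) = column i T" for j y
    by (simp add: matrix_vector_right_distrib matrix_vector_mult_scaleR matrix_vector_mult_basis del: of_nat_Suc)
  then show "AE y in lebesgue. y \<in> S \<longrightarrow>
      (\<lambda>j. real (Suc j) *\<^sub>R (c + T *v (y + (1 / real (Suc j)) *\<^sub>R axis i 1) - (c + T *v y))) \<longlonglongrightarrow> column i T"
    by simp
qed

text \<open>Convergence along the steps \<open>1 / (j + 1)\<close> in the coordinate directions is enough for a weak
  derivative; differentiability is deduced from it afterwards.\<close>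

lemma lipschitz_has_weak_derivative:
  fixes f :: "real^'n::finite \<Rightarrow> real^'m::finite"
  assumes f: "L-lipschitz_on UNIV f"
  obtains G where "has_weak_derivative_on f G UNIV"
proof -
  define G where "G y = (\<chi> k i. lim (\<lambda>j. real (Suc j) * (f (y + (1 / real (Suc j)) *\<^sub>R axis i 1) $ k - f y $ k)))" for y
  have L: "L \<ge> 0" using f by (rule lipschitz_on_nonneg)
  have "AE y in lebesgue. y \<in> UNIV \<longrightarrow>
      (\<lambda>j. real (Suc j) *\<^sub>R (f (y + (1 / real (Suc j)) *\<^sub>R axis i 1) - f y)) \<longlonglongrightarrow> column i (G y)" for i
  proof -
    have "AE y in lebesgue. \<forall>k\<in>UNIV. convergent (\<lambda>j. real (Suc j) * (f (y + (1 / real (Suc j)) *\<^sub>R axis i 1) $ k - f y $ k))"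
    proof (subst AE_finite_all, simp, rule ballI, rule lipschitz_quotients_converge)
      fix k and x y :: "real^'n"
      show "\<bar>f x $ k - f y $ k\<bar> \<le> L * norm (x - y)"
        using lipschitz_onD[OF f, of x y] component_le_norm_cart[of "f x - f y" k] by (simp add: dist_norm)
    qed
    then show ?thesis
    proof eventually_elim
      case (elim y)
      show ?case
      proof (intro impI vec_tendstoI)
        fix k
        show "(\<lambda>j. (real (Suc j) *\<^sub>R (f (y + (1 / real (Suc j)) *\<^sub>R axis i 1) - f y)) $ k) \<longlonglongrightarrow> column i (G y) $ k"
          using elim[rule_format, of k] by (simp add: G_def column_def convergent_LIMSEQ_iff del: of_nat_Suc)
      qed
    qed
  qed
  then have "has_weak_derivative_on f G UNIV"
    using f by (intro has_weak_derivative_of_difference_quotients) (auto intro: lipschitz_on_subset)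
  then show ?thesis by (rule that)
qed

lemma lipschitz_cball_oscillation:
  fixes u :: "'a::euclidean_space \<Rightarrow> 'b::euclidean_space"
  assumes u: "L-lipschitz_on UNIV u" and r: "r > 0"
  shows "(LINT y:cball x r|lebesgue. norm (u y - u x)) \<le> L * r * unit_ball_vol (DIM('a)) * r ^ DIM('a)"
proof -
  have c: "continuous_on UNIV u" by (rule lipschitz_on_continuous_on[OF u])
  have L: "L \<ge> 0" using u by (rule lipschitz_on_nonneg)
  have "(LINT y:cball x r|lebesgue. norm (u y - u x)) \<le> (LINT y:cball x r|lebesgue. L * r)"
  proof (rule set_integral_mono)
    show "set_integrable lebesgue (cball x r) (\<lambda>y. norm (u y - u x))"
      by (intro set_integrable_continuous_compact continuous_intros continuous_on_subset[OF c]) auto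
    show "set_integrable lebesgue (cball x r) (\<lambda>y. L * r)" by (rule set_integrable_lebesgue_const) simp
    fix y assume "y \<in> cball x r"
    then have "norm (y - x) \<le> r" by (simp add: dist_norm norm_minus_commute)
    then show "norm (u y - u x) \<le> L * r"
      using lipschitz_onD[OF u, of y x] mult_left_mono[OF _ L, of "norm (y - x)" r] by (simp add: dist_norm)
  qed
  then show ?thesis using set_integral_const_cball(2)[OF less_imp_le[OF r], of x "L * r"] by (simp only:)
qed

lemma leb_point_of_lipschitz:
  fixes u :: "'a::euclidean_space \<Rightarrow> 'b::euclidean_space"
  assumes u: "L-lipschitz_on UNIV u"
  shows "leb_point u x"
  unfolding leb_point_def
proof (rule tendsto_sandwich[OF _ _ tendsto_const])
  show "\<forall>\<^sub>F s in at_right 0. (0::real) \<le> (LINT y:cball x s|lebesgue. norm (u y - u x)) / s ^ DIM('a)"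
    by (rule eventually_mono[OF eventually_at_right_less[of 0]])
      (auto simp: set_lebesgue_integral_def intro!: divide_nonneg_nonneg Bochner_Integration.integral_nonneg)
  show "\<forall>\<^sub>F s in at_right 0. (LINT y:cball x s|lebesgue. norm (u y - u x)) / s ^ DIM('a) \<le> L * s * unit_ball_vol (DIM('a))"
    by (rule eventually_mono[OF eventually_at_right_less[of 0]])
      (use lipschitz_cball_oscillation[OF u] in \<open>auto simp: pos_divide_le_eq\<close>)
  show "((\<lambda>s. L * s * unit_ball_vol (DIM('a))) \<longlongrightarrow> 0) (at_right 0)"
    by (auto intro!: tendsto_eq_intros)
qed

lemma leb_pointD:
  assumes "leb_point (f :: 'a::euclidean_space \<Rightarrow> 'b::euclidean_space) x" "e > 0"
  obtains d where "d > 0" "\<And>s. 0 < s \<Longrightarrow> s < d \<Longrightarrow> (LINT y:cball x s|lebesgue. norm (f y - f x)) \<le> e * s ^ DIM('a)"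
proof -
  have "\<forall>\<^sub>F s in at_right 0. (LINT y:cball x s|lebesgue. norm (f y - f x)) / s ^ DIM('a) < e"
    using assms unfolding leb_point_def by (intro order_tendstoD(2))
  then obtain d where d: "d > 0" "\<And>s. 0 < s \<Longrightarrow> s < d \<Longrightarrow> (LINT y:cball x s|lebesgue. norm (f y - f x)) / s ^ DIM('a) < e"
    by (auto simp: eventually_at_right_field)
  show ?thesis
  proof (rule that[OF d(1)])
    fix s assume s: "0 < s" "s < d"
    then show "(LINT y:cball x s|lebesgue. norm (f y - f x)) \<le> e * s ^ DIM('a)"
      using d(2)[OF s] by (simp add: pos_divide_less_eq)
  qed
qed

text \<open>At a Lebesgue point of its weak derivative a Lipschitz function is differentiable: the
  first-order remainder is Lipschitz, so it is close to its averages at a small fraction of the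
  distance, and these averages are small because the weak derivative oscillates little.\<close>

lemma lipschitz_has_derivative_at_leb_point:
  fixes f :: "real^'n::finite \<Rightarrow> real^'m::finite"
  assumes f: "L-lipschitz_on UNIV f" and weak: "has_weak_derivative_on f G UNIV" and leb: "leb_point G x"
  shows "(f has_derivative (\<lambda>v. G x *v v)) (at x)"
proof -
  let ?n = "CARD('n)"
  define T where "T = G x"
  define q where "q y = f y - ((f x - T *v x) + T *v y)" for y
  have qe: "q y = f y - f x - T *v (y - x)" for y by (simp add: q_def matrix_vector_mult_diff_distrib)
  have qx: "q x = 0" by (simp add: q_def)
  have qw: "has_weak_derivative_on q (\<lambda>y. G y - T) UNIV"
    unfolding q_def by (intro has_weak_derivative_on_diff weak affine_has_weak_derivative) simp
  obtain M where M: "M > 0" "\<And>v. norm (T *v v) \<le> M * norm v" by (rule matrix_vector_mult_norm_bound[of T]) (rule that)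
  define L' where "L' = L + M"
  have L: "L \<ge> 0" using f by (rule lipschitz_on_nonneg)
  have qL: "L'-lipschitz_on UNIV q"
  proof (rule lipschitz_onI)
    fix y z :: "real^'n"
    have "q y - q z = (f y - f z) - T *v (y - z)" by (simp add: q_def matrix_vector_mult_diff_distrib)
    then have "norm (q y - q z) \<le> norm (f y - f z) + norm (T *v (y - z))" by (metis norm_triangle_ineq4)
    also have "\<dots> \<le> L * norm (y - z) + M * norm (y - z)"
      using lipschitz_onD[OF f, of y z] M(2) by (intro add_mono) (auto simp: dist_norm)
    finally show "dist (q y) (q z) \<le> L' * dist y z" by (simp add: L'_def dist_norm algebra_simps)
  qed (use L M in \<open>simp add: L'_def\<close>)
  have L': "L' \<ge> 0" using L M by (simp add: L'_def)
  have qi: "locally_integrable UNIV q" using qw by (simp add: has_weak_derivative_on_def)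
  obtain \<phi> :: "real^'n \<Rightarrow> real" where \<phi>: "smooth_on UNIV \<phi>" "\<And>z. z \<notin> cball 0 1 \<Longrightarrow> \<phi> z = 0"
    "integrable lebesgue \<phi>" "integral\<^sup>L lebesgue \<phi> = 1" by (rule ex_unit_bump) (rule that)
  obtain B where B: "B > 0" "\<And>z. \<bar>\<phi> z\<bar> \<le> B"
    using integrable_lebesgue_continuous_support(2)[OF smooth_continuous_derivative(2)[OF \<phi>(1)] compact_cball[of 0 1] \<phi>(2)]
    by (auto simp del: mem_cball)
  show ?thesis
    unfolding has_derivative_at_alt T_def[symmetric]
  proof (intro conjI matrix_vector_mul_bounded_linear allI impI)
    fix e :: real assume e: "e > 0"
    define c where "c = B * unit_ball_vol (real ?n) * L'"
    have c: "c \<ge> 0" using B L' by (simp add: c_def)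
    \<comment> \<open>the fraction of the distance at which the remainder is averaged around \<open>y\<close>; it keeps the Lipschitz error below half of \<open>e\<close>\<close>
    define l where "l = min 1 (e / (2 * (c + 1)))"
    have l: "0 < l" "l \<le> 1" "c * l \<le> e / 2"
    proof -
      show "0 < l" "l \<le> 1" using e c by (auto simp: l_def)
      have "c * l \<le> c * (e / (2 * (c + 1)))" using c by (intro mult_left_mono) (auto simp: l_def)
      also have "\<dots> \<le> e / 2" using c e by (simp add: field_simps)
      finally show "c * l \<le> e / 2" .
    qed
    define B' where "B' = B / l ^ ?n"
    have B': "B' > 0" using B l by (simp add: B'_def)
    define K where "K = real ?n * 2 * B' * 2 ^ ?n"
    have K: "K > 0" using B' by (simp add: K_def)
    define \<eta> where "\<eta> = e / (2 * K)"
    have \<eta>: "\<eta> > 0" using e K by (simp add: \<eta>_def)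
    obtain d where d: "d > 0" "\<And>s. 0 < s \<Longrightarrow> s < d \<Longrightarrow> (LINT y:cball x s|lebesgue. norm (G y - G x)) \<le> \<eta> * s ^ ?n"
      using leb_pointD[OF leb \<eta>] by auto
    show "\<exists>d>0. \<forall>y. norm (y - x) < d \<longrightarrow> norm (f y - f x - T *v (y - x)) \<le> e * norm (y - x)"
    proof (intro exI[of _ "d / 2"] conjI allI impI)
      show "d / 2 > 0" using d by simp
      fix y assume y: "norm (y - x) < d / 2"
      show "norm (f y - f x - T *v (y - x)) \<le> e * norm (y - x)"
      proof (cases "y = x")
        case False
        define s where "s = norm (y - x)"
        have s: "s > 0" "2 * s < d" using False y by (auto simp: s_def)
        define b where "b = (1 / s) *\<^sub>R (y - x)"
        have nb: "norm b = 1" using False by (simp add: b_def s_def)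
        \<comment> \<open>the kernel, shrunk by \<open>l\<close> and centred at \<open>y\<close>, as seen from \<open>x\<close> at scale \<open>s\<close>\<close>
        define \<phi>' where "\<phi>' w = (1 / l ^ ?n) * \<phi> ((1 / l) *\<^sub>R (w - b))" for w
        have aff: "(1 / l) *\<^sub>R w + (- (1 / l) *\<^sub>R b) = (1 / l) *\<^sub>R (w - b)" for w by (simp add: scaleR_diff_right)
        have \<phi>'s: "smooth_on UNIV \<phi>'"
          unfolding smooth_on_def
        proof
          fix j
          have "Ck_on j \<phi> UNIV" using \<phi>(1) by (simp add: smooth_on_def)
          from Ck_on_affine_compose[OF bounded_linear_scaleR_right[of "1 / l"] this, of "- (1 / l) *\<^sub>R b"]
          show "Ck_on j \<phi>' UNIV" unfolding \<phi>'_def aff by (intro Ck_on_mult Ck_on_const)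
        qed
        have \<phi>'z: "\<phi>' z = 0" if "z \<notin> cball 0 2" for z
        proof -
          have "norm (z - b) > 1" using that norm_triangle_ineq2[of z b] nb by auto
          moreover have "norm ((1 / l) *\<^sub>R (z - b)) = norm (z - b) / l" using l by simp
          ultimately have "norm ((1 / l) *\<^sub>R (z - b)) > 1" using l by (simp only: less_divide_eq_1_pos)
          then have "\<phi> ((1 / l) *\<^sub>R (z - b)) = 0" by (intro \<phi>(2)) (simp only: mem_cball_0 not_le)
          then show ?thesis by (simp add: \<phi>'_def)
        qed
        have \<phi>'B: "\<bar>\<phi>' z\<bar> \<le> B'" for z
          using B(2)[of "(1 / l) *\<^sub>R (z - b)"] l by (simp add: \<phi>'_def B'_def abs_mult divide_right_mono)
        have \<phi>'I: "integral\<^sup>L lebesgue \<phi>' = 1"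
        proof -
          have "(LINT w|lebesgue. \<phi> ((1 / l) *\<^sub>R (w - b))) = l ^ ?n"
            using lebesgue_integral_affine(2)[OF \<phi>(3), of "1 / l" "- (1 / l) *\<^sub>R b"] l \<phi>(4)
            by (simp add: aff[symmetric] add.commute power_divide)
          then show ?thesis using l by (simp add: \<phi>'_def[abs_def])
        qed
        have 1: "norm (kernel_avg \<phi>' q x s - q x) \<le> s * (real ?n * 2 * B' * (2 ^ ?n * \<eta>))"
        proof (rule kernel_avg_point_bound[OF qw \<phi>'s \<phi>'z \<phi>'B _ \<phi>'I s(1) _ leb_point_of_lipschitz[OF qL]])
          fix r assume r: "0 < r" "r \<le> s"
          then show "(LINT y:cball x (r * 2)|lebesgue. norm (G y - T)) \<le> 2 ^ ?n * \<eta> * r ^ ?n"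
            using d(2)[of "r * 2"] s by (simp add: T_def power_mult_distrib mult_ac)
        qed auto
        have "kernel_avg \<phi>' q x s = kernel_avg \<phi> q y (s * l)"
        proof -
          have "(1 / l) *\<^sub>R ((1 / s) *\<^sub>R (z - x) - b) = (1 / (s * l)) *\<^sub>R (z - y)" for z
            by (simp add: b_def scaleR_diff_right[symmetric] mult.commute)
          then have "kernel_avg \<phi>' q x s = (1 / s ^ ?n) *\<^sub>R (LINT z|lebesgue. (1 / l ^ ?n) *\<^sub>R (\<phi> ((1 / (s * l)) *\<^sub>R (z - y)) *\<^sub>R q z))"
            by (simp only: kernel_avg_def \<phi>'_def scaleR_scaleR)
          also have "\<dots> = (1 / s ^ ?n) *\<^sub>R ((1 / l ^ ?n) *\<^sub>R (LINT z|lebesgue. \<phi> ((1 / (s * l)) *\<^sub>R (z - y)) *\<^sub>R q z))"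
            by (simp only: integral_scaleR_right)
          finally show ?thesis by (simp add: kernel_avg_def[of \<phi>] power_mult_distrib)
        qed
        moreover have "norm (kernel_avg \<phi> q y (s * l) - 1 *\<^sub>R q y) \<le> B / (s * l) ^ ?n * (LINT z:cball y (s * l)|lebesgue. norm (q z - q y))"
          using kernel_avg_error[OF qi _ _ smooth_continuous_derivative(2)[OF \<phi>(1)] \<phi>(2) B(2), of y "s * l" 1] s l \<phi>(4)
          by simp
        moreover have "B / (s * l) ^ ?n * (LINT z:cball y (s * l)|lebesgue. norm (q z - q y))
            \<le> B / (s * l) ^ ?n * (L' * (s * l) * unit_ball_vol (real ?n) * (s * l) ^ ?n)"
          using lipschitz_cball_oscillation[OF qL, of "s * l" y] s l B by (intro mult_left_mono) auto
        moreover have "B / (s * l) ^ ?n * (L' * (s * l) * unit_ball_vol (real ?n) * (s * l) ^ ?n) = s * (c * l)"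
          using s l by (simp add: c_def)
        ultimately have 2: "norm (kernel_avg \<phi>' q x s - q y) \<le> s * (c * l)" by simp
        have "norm (q y) \<le> norm (kernel_avg \<phi>' q x s - q x) + norm (kernel_avg \<phi>' q x s - q y)"
          unfolding qx using norm_triangle_ineq4[of "kernel_avg \<phi>' q x s" "kernel_avg \<phi>' q x s - q y"] by simp
        also have "\<dots> \<le> s * (e / 2) + s * (e / 2)"
        proof (rule add_mono)
          have "real ?n * 2 * B' * (2 ^ ?n * \<eta>) = e / 2" using K by (simp add: \<eta>_def K_def[symmetric] mult.assoc[symmetric])
          with 1 show "norm (kernel_avg \<phi>' q x s - q x) \<le> s * (e / 2)" by (simp only:)
          show "norm (kernel_avg \<phi>' q x s - q y) \<le> s * (e / 2)"
            by (rule order_trans[OF 2 mult_left_mono[OF l(3)]]) (use s in simp)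
        qed
        finally show ?thesis by (simp add: qe s_def mult.commute)
      qed simp
    qed
  qed
qed

text \<open>Rademacher's theorem. Locally the function is replaced by a global Lipschitz extension.\<close>

lemma AE_differentiable_of_locally_lipschitz:
  fixes f :: "real^'n::finite \<Rightarrow> real^'m::finite"
  assumes lip: "\<And>y. y \<in> S \<Longrightarrow> \<exists>r>0. \<exists>L. L-lipschitz_on (ball y r) f"
  shows "AE y in lebesgue. y \<in> S \<longrightarrow> f differentiable (at y)"
proof -
  obtain r where r: "\<And>y. y \<in> S \<Longrightarrow> r y > 0" "\<And>y. y \<in> S \<Longrightarrow> \<exists>L. L-lipschitz_on (ball y (r y)) f"
    using lip by metis
  have one: "AE z in lebesgue. z \<in> ball y (r y) \<longrightarrow> f differentiable (at z)" if y: "y \<in> S" for y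
  proof -
    obtain L where L: "L-lipschitz_on (ball y (r y)) f" using r y by blast
    obtain v where v: "\<And>x. x \<in> ball y (r y) \<Longrightarrow> v x = f x" "\<And>x z. norm (v x - v z) \<le> real CARD('m) * L * dist x z"
    proof (rule mcshane_extension[of dist "ball y (r y)" f L])
      show "norm (f x - f z) \<le> L * dist x z" if "x \<in> ball y (r y)" "z \<in> ball y (r y)" for x z
        using lipschitz_onD[OF L that] by (simp add: dist_norm)
      show "0 \<le> L" using L by (rule lipschitz_on_nonneg)
    qed (auto simp: dist_commute dist_triangle that)
    have vL: "(real CARD('m) * L)-lipschitz_on UNIV v"
      using v(2) lipschitz_on_nonneg[OF L] by (intro lipschitz_onI) (auto simp: dist_norm)
    obtain G where G: "has_weak_derivative_on v G UNIV" using lipschitz_has_weak_derivative[OF vL] .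
    have "AE z in lebesgue. z \<in> UNIV \<longrightarrow> leb_point G z"
      by (rule AE_leb_point) (use G in \<open>auto simp: has_weak_derivative_on_def\<close>)
    then show ?thesis
    proof eventually_elim
      case (elim z)
      show ?case
      proof
        assume z: "z \<in> ball y (r y)"
        have "(v has_derivative (\<lambda>h. G z *v h)) (at z)"
          using elim by (intro lipschitz_has_derivative_at_leb_point[OF vL G]) simp
        then have "(f has_derivative (\<lambda>h. G z *v h)) (at z)"
          by (rule has_derivative_transform_within_open[OF _ open_ball z]) (rule v(1))
        then show "f differentiable (at z)" by (auto simp: differentiable_def)
      qed
    qed
  qed
  obtain F where F: "F \<subseteq> (\<lambda>y. ball y (r y)) ` S" "countable F" "\<Union>F = \<Union>((\<lambda>y. ball y (r y)) ` S)"
    using Lindelof[of "(\<lambda>y. ball y (r y)) ` S"] by auto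
  have "AE z in lebesgue. \<forall>b\<in>F. z \<in> b \<longrightarrow> f differentiable (at z)"
    using F(1) one by (subst AE_ball_countable[OF F(2)]) auto
  then show ?thesis
  proof eventually_elim
    case (elim z)
    show ?case
    proof
      assume "z \<in> S"
      then have "z \<in> \<Union>F" unfolding F(3) using r(1) by (auto intro!: bexI[of _ z])
      then show "f differentiable (at z)" using elim by blast
    qed
  qed
qed

section \<open>Locality of the weak derivative\<close>

lemma leb_point_diff_lipschitz:
  fixes u v :: "'a::euclidean_space \<Rightarrow> 'b::euclidean_space"
  assumes u: "leb_point u x" "locally_integrable S u" "cball x r \<subseteq> S" "r > 0" and v: "L-lipschitz_on UNIV v"
  shows "leb_point (\<lambda>y. u y - v y) x"
  unfolding leb_point_def
proof (rule tendsto_sandwich[OF _ _ tendsto_const])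
  let ?A = "\<lambda>f s. (LINT y:cball x s|lebesgue. norm (f y - f x)) / s ^ DIM('a)"
  show "\<forall>\<^sub>F s in at_right 0. (0::real) \<le> ?A (\<lambda>y. u y - v y) s"
    by (rule eventually_mono[OF eventually_at_right_less[of 0]])
      (auto simp: set_lebesgue_integral_def intro!: divide_nonneg_nonneg Bochner_Integration.integral_nonneg)
  show "((\<lambda>s. ?A u s + ?A v s) \<longlongrightarrow> 0) (at_right 0)"
    using tendsto_add[OF u(1)[unfolded leb_point_def] leb_point_of_lipschitz[OF v, of x, unfolded leb_point_def]] by simp
  have "?A (\<lambda>y. u y - v y) s \<le> ?A u s + ?A v s" if s: "0 < s" "s < r" for s
  proof -
    have c: "continuous_on UNIV v" by (rule lipschitz_on_continuous_on[OF v])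
    have "cball x s \<subseteq> S" using subset_cball[of s r x] s u(3) by auto
    then have ui: "set_integrable lebesgue (cball x s) u" using u(2) by (simp add: locally_integrable_def)
    have ud: "set_integrable lebesgue (cball x s) (\<lambda>y. norm (u y - u x))"
      by (intro set_integrable_norm set_integral_diff(1)[OF ui] set_integrable_lebesgue_const) simp
    have vd: "set_integrable lebesgue (cball x s) (\<lambda>y. norm (v y - v x))"
      by (intro set_integrable_continuous_compact continuous_intros continuous_on_subset[OF c]) auto
    have wd: "set_integrable lebesgue (cball x s) (\<lambda>y. norm ((u y - v y) - (u x - v x)))"
      by (intro set_integrable_norm set_integral_diff(1)[OF set_integral_diff(1)[OF ui set_integrable_continuous_compact]]
          set_integrable_lebesgue_const continuous_on_subset[OF c]) auto
    have "(LINT y:cball x s|lebesgue. norm ((u y - v y) - (u x - v x)))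
      \<le> (LINT y:cball x s|lebesgue. norm (u y - u x) + norm (v y - v x))"
    proof (rule set_integral_mono[OF wd set_integral_add(1)[OF ud vd]])
      show "norm ((u y - v y) - (u x - v x)) \<le> norm (u y - u x) + norm (v y - v x)" for y
        using norm_triangle_ineq4[of "u y - u x" "v y - v x"] by (simp add: algebra_simps)
    qed
    also have "\<dots> = (LINT y:cball x s|lebesgue. norm (u y - u x)) + (LINT y:cball x s|lebesgue. norm (v y - v x))"
      by (rule set_integral_add(2)[OF ud vd])
    finally show ?thesis using s by (simp add: add_divide_distrib[symmetric] divide_right_mono)
  qed
  then show "\<forall>\<^sub>F s in at_right 0. ?A (\<lambda>y. u y - v y) s \<le> ?A u s + ?A v s"
    using u(4) by (auto simp: eventually_at_right_field intro!: exI[of _ r])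
qed

lemma locally_integrable_measurable:
  fixes w :: "'a::euclidean_space \<Rightarrow> 'b::euclidean_space"
  assumes "open S" "locally_integrable S w"
  shows "(\<lambda>y. indicator S y *\<^sub>R w y) \<in> borel_measurable lebesgue"
proof -
  obtain C where C: "\<And>n::nat. compact (C n)" "\<And>n. C n \<subseteq> S" "\<And>n. C n \<subseteq> interior (C (Suc n))" "\<Union>(range C) = S"
    using open_Union_compact_subsets[OF assms(1)] by metis
  have mono: "C n \<subseteq> C m" if "n \<le> m" for n m
    using that by (induction rule: dec_induct) (use C(3) interior_subset in blast)+
  show ?thesis
  proof (rule borel_measurable_LIMSEQ_metric)
    show "(\<lambda>y. indicator (C n) y *\<^sub>R w y) \<in> borel_measurable lebesgue" for n
    proof (rule borel_measurable_integrable)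
      show "integrable lebesgue (\<lambda>y. indicator (C n) y *\<^sub>R w y)"
        using assms(2) C(1,2)[of n] by (simp add: locally_integrable_def set_integrable_def)
    qed
    fix x
    show "(\<lambda>n. indicator (C n) x *\<^sub>R w x) \<longlonglongrightarrow> indicator S x *\<^sub>R w x"
    proof (cases "x \<in> S")
      case True
      then obtain n where "x \<in> C n" using C(4) by blast
      then have "\<forall>m\<ge>n. indicator (C m) x *\<^sub>R w x = indicator S x *\<^sub>R w x" using True mono by fastforce
      then show ?thesis by (intro tendsto_eventually) (auto simp: eventually_sequentially)
    next
      case False
      then have "x \<notin> C n" for n using C(2) by blast
      then show ?thesis using False by simp
    qed
  qed
qed

text \<open>At a density point of the zero set that is also a Lebesgue point of the weak derivative,
  the first-order Taylor polynomial must vanish: in the direction where it is large there are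
  points of the zero set at which the pointwise Lipschitz estimate for the remainder holds.\<close>

lemma weak_derivative_zero_on_zero_set:
  fixes w :: "real^'n::finite \<Rightarrow> real^'m::finite"
  assumes S: "open S" and weak: "has_weak_derivative_on w G S"
  shows "AE x in lebesgue. x \<in> S \<longrightarrow> w x = 0 \<longrightarrow> G x = 0"
proof -
  let ?n = "CARD('n)"
  let ?\<omega> = "unit_ball_vol (real ?n)"
  have wi: "locally_integrable S w" and Gi: "locally_integrable S G"
    using weak by (auto simp: has_weak_derivative_on_def)
  define Z where "Z = {y \<in> S. w y = 0}"
  define z where "z = (indicator Z :: real^'n \<Rightarrow> real)"
  have Sm: "S \<in> sets lebesgue" using S by (simp add: borel_open sets_completionI_sets)
  have wm: "(\<lambda>y. indicator S y *\<^sub>R w y) \<in> borel_measurable lebesgue" by (rule locally_integrable_measurable[OF S wi])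
  have Zm: "Z \<in> sets lebesgue"
  proof -
    have "(\<lambda>y. indicator S y *\<^sub>R w y) -` {0} \<inter> space lebesgue \<in> sets lebesgue"
      by (rule measurable_sets[OF wm]) simp
    moreover have "Z = S \<inter> ((\<lambda>y. indicator S y *\<^sub>R w y) -` {0} \<inter> space lebesgue)" by (auto simp: Z_def)
    ultimately show ?thesis using Sm by simp
  qed
  have zi: "locally_integrable S z"
    unfolding locally_integrable_def
  proof (intro allI impI)
    fix K assume "compact K \<and> K \<subseteq> S"
    then have "K \<inter> Z \<in> lmeasurable" using Zm lmeasurable_compact[of K] by (intro fmeasurable_Int_fmeasurable) auto
    from set_integrable_lebesgue_const[OF this, of "1::real"]
    show "set_integrable lebesgue K z"
      unfolding set_integrable_def z_def by (simp add: indicator_inter_arith)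
  qed
  obtain C where C: "C > 0" "\<And>(u :: real^'n \<Rightarrow> real^'m) G S N x y.
      has_weak_derivative_on u G S \<Longrightarrow> leb_point u x \<Longrightarrow> leb_point u y \<Longrightarrow>
      cball x (2 * dist x y) \<subseteq> S \<Longrightarrow> cball y (2 * dist x y) \<subseteq> S \<Longrightarrow>
      (\<And>s. 0 < s \<Longrightarrow> s \<le> 2 * dist x y \<Longrightarrow> (LINT w:cball x s|lebesgue. norm (G w)) \<le> N * s ^ CARD('n)) \<Longrightarrow>
      (\<And>s. 0 < s \<Longrightarrow> s \<le> 2 * dist x y \<Longrightarrow> (LINT w:cball y s|lebesgue. norm (G w)) \<le> N * s ^ CARD('n)) \<Longrightarrow>
      norm (u x - u y) \<le> C * N * dist x y"
    using ex_pointwise_lipschitz_constant[where 'n='n and 'm='m] by blast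
  have lw: "AE x in lebesgue. x \<in> S \<longrightarrow> leb_point w x" by (rule AE_leb_point[OF S wi])
  then obtain E where E: "negligible E" "\<And>x. x \<in> S \<Longrightarrow> x \<notin> E \<Longrightarrow> leb_point w x"
    by (auto simp: eventually_ae_filter_negligible)
  from AE_leb_point[OF S Gi] AE_leb_point[OF S zi] lw show ?thesis
  proof eventually_elim
    case (elim x)
    show ?case
    proof (intro impI, rule ccontr)
      assume x: "x \<in> S" "w x = 0" and nz: "G x \<noteq> 0"
      then have xZ: "z x = 1" by (simp add: z_def Z_def)
      have lG: "leb_point G x" and lz: "leb_point z x" and lwx: "leb_point w x" using elim x by auto
      define T where "T = G x"
      obtain i where i: "column i T \<noteq> 0" using nz by (auto simp: T_def column_def vec_eq_iff)
      define a where "a = norm (column i T)"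
      have a: "a > 0" using i by (simp add: a_def)
      define e where "e = (axis i 1 :: real^'n)"
      have e: "norm e = 1" "T *v e = column i T" by (simp_all add: e_def matrix_vector_mult_basis)
      obtain M where M: "M > 0" "\<And>v. norm (T *v v) \<le> M * norm v" by (rule matrix_vector_mult_norm_bound[of T]) (rule that)
      \<comment> \<open>the relative radius of a ball around \<open>x + s e\<close> on which the linear part stays large\<close>
      define \<kappa> where "\<kappa> = a / (2 * M)"
      have \<kappa>: "\<kappa> > 0" "\<kappa> \<le> 1" "M * \<kappa> = a / 2" using a M M(2)[of e] e by (auto simp: \<kappa>_def a_def field_simps)
      define l where "l = a / (8 * C * 2 ^ ?n)"
      have l: "l > 0" using a C by (simp add: l_def)
      define c1 where "c1 = ?\<omega> * 5 ^ ?n / l * 10 ^ ?n"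
      have c1: "c1 > 0" using l by (simp add: c1_def)
      \<comment> \<open>so small that this ball is covered neither by the complement of the zero set nor by the points of large maximal function\<close>
      define \<eta> where "\<eta> = min (2 ^ ?n * l) (?\<omega> * \<kappa> ^ ?n / (2 * (c1 + 2 ^ ?n)))"
      have \<eta>: "\<eta> > 0" "\<eta> \<le> 2 ^ ?n * l" "(c1 + 2 ^ ?n) * \<eta> < ?\<omega> * \<kappa> ^ ?n"
      proof -
        show "\<eta> > 0" "\<eta> \<le> 2 ^ ?n * l" using l \<kappa> c1 by (auto simp: \<eta>_def intro!: divide_pos_pos add_pos_pos)
        have p: "c1 + 2 ^ ?n > 0" using c1 by (simp add: add_pos_pos)
        have "(c1 + 2 ^ ?n) * \<eta> \<le> (c1 + 2 ^ ?n) * (?\<omega> * \<kappa> ^ ?n / (2 * (c1 + 2 ^ ?n)))"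
          using p by (intro mult_left_mono) (auto simp: \<eta>_def)
        also have "\<dots> = ?\<omega> * \<kappa> ^ ?n / 2" using p by (simp add: field_simps)
        also have "\<dots> < ?\<omega> * \<kappa> ^ ?n" using \<kappa> by simp
        finally show "(c1 + 2 ^ ?n) * \<eta> < ?\<omega> * \<kappa> ^ ?n" .
      qed
      obtain d1 where d1: "d1 > 0" "\<And>s. 0 < s \<Longrightarrow> s < d1 \<Longrightarrow> (LINT y:cball x s|lebesgue. norm (G y - G x)) \<le> \<eta> * s ^ ?n"
        using leb_pointD[OF lG \<eta>(1)] by auto
      obtain d2 where d2: "d2 > 0" "\<And>s. 0 < s \<Longrightarrow> s < d2 \<Longrightarrow> (LINT y:cball x s|lebesgue. norm (z y - z x)) \<le> \<eta> * s ^ ?n"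
        using leb_pointD[OF lz \<eta>(1)] by auto
      obtain d3 where d3: "d3 > 0" "cball x d3 \<subseteq> S" using S x(1) open_contains_cball by blast
      define s where "s = min d1 (min d2 d3) / 20"
      have s: "s > 0" "10 * s < d1" "10 * s < d2" "10 * s < d3" using d1(1) d2(1) d3(1) by (auto simp: s_def)
      have cS: "cball x (10 * s) \<subseteq> S" using subset_cball[of "10 * s" d3 x] s d3(2) by auto
      define h where "h y = indicator (cball x (10 * s)) y *\<^sub>R norm (G y - T)" for y
      have gT: "set_integrable lebesgue (cball x (10 * s)) (\<lambda>y. G y - T)"
        by (rule set_integral_diff(1)[OF _ set_integrable_lebesgue_const]) (use Gi cS in \<open>auto simp: locally_integrable_def\<close>)
      have h: "integrable lebesgue h" "\<And>y. h y \<ge> 0"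
        using set_integrable_norm[OF gT] by (auto simp: set_integrable_def h_def[abs_def])
      have hI: "integral\<^sup>L lebesgue h \<le> \<eta> * (10 * s) ^ ?n"
        using d1(2)[of "10 * s"] s by (simp add: set_lebesgue_integral_def h_def[abs_def] T_def)
      define P where "P = ball (x + s *\<^sub>R e) (\<kappa> * s)"
      have Pm: "measure lebesgue P = ?\<omega> * \<kappa> ^ ?n * s ^ ?n"
        using s \<kappa> by (simp add: P_def content_ball power_mult_distrib)
      have Psub: "P \<subseteq> cball x (2 * s)"
      proof
        fix y assume "y \<in> P"
        then have "norm (x + s *\<^sub>R e - y) < \<kappa> * s" by (simp add: P_def dist_norm)
        moreover have "x - y = (x + s *\<^sub>R e - y) - s *\<^sub>R e" by simp
        ultimately have "norm (x - y) \<le> \<kappa> * s + s"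
          using norm_triangle_ineq4[of "x + s *\<^sub>R e - y" "s *\<^sub>R e"] e s by simp
        also have "\<dots> \<le> 2 * s" using \<kappa> s mult_right_mono[of \<kappa> 1 s] by simp
        finally show "y \<in> cball x (2 * s)" by (simp add: dist_norm)
      qed
      define D where "D = cball x (2 * s) - Z"
      have Dm: "D \<in> lmeasurable" unfolding D_def using Zm by (intro fmeasurable_Diff) auto
      have Dle: "measure lebesgue D \<le> \<eta> * (2 * s) ^ ?n"
      proof -
        have "measure lebesgue D = (LINT y|lebesgue. indicator D y)" using Dm by simp
        also have "\<dots> = (LINT y:cball x (2 * s)|lebesgue. norm (z y - z x))"
          unfolding set_lebesgue_integral_def xZ
          by (intro Bochner_Integration.integral_cong) (auto simp: z_def D_def indicator_def)
        also have "\<dots> \<le> \<eta> * (2 * s) ^ ?n" using d2(2)[of "2 * s"] s by simp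
        finally show ?thesis .
      qed
      \<comment> \<open>the points at which the remainder may fail to have a small Lipschitz constant\<close>
      define W where "W = bad_set l h"
      have Wm: "W \<in> lmeasurable" unfolding W_def by (rule bad_set_lmeasurable[OF h l])
      have Wle: "measure lebesgue W \<le> c1 * \<eta> * s ^ ?n"
      proof -
        have "measure lebesgue W \<le> ?\<omega> * 5 ^ ?n / l * integral\<^sup>L lebesgue h"
          using bad_set_lmeasurable(2)[OF h l] by (simp add: W_def)
        also have "\<dots> \<le> ?\<omega> * 5 ^ ?n / l * (\<eta> * (10 * s) ^ ?n)" using hI l by (intro mult_left_mono) auto
        finally show ?thesis by (simp add: c1_def power_mult_distrib mult_ac)
      qed
      have "\<not> P \<subseteq> D \<union> W \<union> E"
      proof
        assume "P \<subseteq> D \<union> W \<union> E"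
        have Em: "E \<in> lmeasurable" "measure lebesgue E = 0" using E(1) negligible_imp_measurable negligible_imp_measure0 by auto
        have "measure lebesgue P \<le> measure lebesgue (D \<union> W \<union> E)"
          using \<open>P \<subseteq> D \<union> W \<union> E\<close> Dm Wm Em by (intro measure_mono_fmeasurable) (auto simp: P_def)
        also have "\<dots> \<le> measure lebesgue (D \<union> W) + measure lebesgue E"
          using Dm Wm Em by (intro measure_Un_le) auto
        also have "measure lebesgue (D \<union> W) \<le> measure lebesgue D + measure lebesgue W"
          using Dm Wm by (intro measure_Un_le) auto
        finally have "?\<omega> * \<kappa> ^ ?n * s ^ ?n \<le> (c1 + 2 ^ ?n) * \<eta> * s ^ ?n"
          using Pm Dle Wle Em(2) by (simp add: power_mult_distrib algebra_simps)
        then show False using \<eta>(3) s by simp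
      qed
      then obtain y where y: "y \<in> P" "y \<in> Z" "y \<notin> W" "y \<notin> E" using Psub by (auto simp: D_def)
      have yx: "y \<in> cball x (2 * s)" using y Psub by blast
      define r where "r = dist x y"
      have r: "r \<le> 2 * s" using yx by (simp add: r_def)
      have yS: "y \<in> S" "w y = 0" using y by (auto simp: Z_def)
      have cy: "cball y t \<subseteq> cball x (10 * s)" if "t \<le> 4 * s" for t
      proof
        fix v assume "v \<in> cball y t"
        then show "v \<in> cball x (10 * s)" using that yx dist_triangle[of x v y] s by simp
      qed
      have cx: "cball x t \<subseteq> cball x (10 * s)" if "t \<le> 4 * s" for t
        using that s by (intro subset_cball) simp
      define v where "v y = (- (T *v x)) + T *v y" for y
      define q where "q y = w y - v y" for y
      have qw: "has_weak_derivative_on q (\<lambda>y. G y - T) S"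
        unfolding q_def v_def by (intro has_weak_derivative_on_diff weak affine_has_weak_derivative S)
      have vL: "M-lipschitz_on UNIV v"
        using M by (intro lipschitz_onI) (auto simp: v_def dist_norm matrix_vector_mult_diff_distrib[symmetric])
      have lq: "leb_point q x" "leb_point q y"
        unfolding q_def
      proof -
        show "leb_point (\<lambda>y. w y - v y) x" by (rule leb_point_diff_lipschitz[OF lwx wi cS _ vL]) (use s in simp)
        have "cball y s \<subseteq> S" using cy[of s] cS s by auto
        then show "leb_point (\<lambda>y. w y - v y) y"
          by (rule leb_point_diff_lipschitz[OF E(2)[OF yS(1) y(4)] wi _ s(1) vL])
      qed
      have "norm (q x - q y) \<le> C * (2 ^ ?n * l) * dist x y"
      proof (rule C(2)[OF qw lq])
        show "cball x (2 * dist x y) \<subseteq> S" using cx[of "2 * dist x y"] cS r by (auto simp: r_def)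
        show "cball y (2 * dist x y) \<subseteq> S" using cy[of "2 * dist x y"] cS r by (auto simp: r_def)
        fix t assume t: "0 < t" "t \<le> 2 * dist x y"
        have t4: "t \<le> 4 * s" using t r by (simp add: r_def)
        have "(LINT w:cball x t|lebesgue. norm (G w - T)) \<le> \<eta> * t ^ ?n"
          using d1(2)[of t] t t4 s by (simp add: T_def)
        also have "\<dots> \<le> 2 ^ ?n * l * t ^ ?n" using \<eta>(2) t by (intro mult_right_mono) auto
        finally show "(LINT w:cball x t|lebesgue. norm (G w - T)) \<le> 2 ^ ?n * l * t ^ ?n" .
        have "(LINT w:cball y t|lebesgue. norm (G w - T)) = (LINT w:cball y t|lebesgue. h w)"
          by (rule set_lebesgue_integral_cong) (use cy[OF t4] in \<open>auto simp: h_def indicator_def subset_iff\<close>)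
        also have "\<dots> \<le> l * 2 ^ ?n * t ^ ?n"
          using integral_cball_le_of_not_bad[of y l h t] y(3) t(1) h by (simp add: W_def)
        finally show "(LINT w:cball y t|lebesgue. norm (G w - T)) \<le> 2 ^ ?n * l * t ^ ?n" by (simp add: mult.commute)
      qed
      also have "C * (2 ^ ?n * l) * dist x y = a / 8 * r" using C(1) by (simp add: l_def r_def)
      also have "\<dots> \<le> a / 8 * (2 * s)" using r a by (intro mult_left_mono) auto
      finally have up: "norm (q x - q y) \<le> a * s / 4" by simp
      have "q x - q y = T *v (y - x)" using x yS by (simp add: q_def v_def matrix_vector_mult_diff_distrib)
      moreover have "T *v (y - x) = s *\<^sub>R (T *v e) - T *v (x + s *\<^sub>R e - y)"
        by (simp add: matrix_vector_mult_diff_distrib matrix_vector_right_distrib matrix_vector_mult_scaleR)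
      ultimately have "norm (q x - q y) \<ge> norm (s *\<^sub>R (T *v e)) - norm (T *v (x + s *\<^sub>R e - y))"
        using norm_triangle_ineq2[of "s *\<^sub>R (T *v e)" "T *v (x + s *\<^sub>R e - y)"] by simp
      moreover have "norm (s *\<^sub>R (T *v e)) = s * a" using s e by (simp add: a_def)
      moreover have "norm (T *v (x + s *\<^sub>R e - y)) \<le> M * (\<kappa> * s)"
        using M(2)[of "x + s *\<^sub>R e - y"] y(1) mult_left_mono[of "norm (x + s *\<^sub>R e - y)" "\<kappa> * s" M] less_imp_le[OF M(1)]
        by (simp add: P_def dist_norm)
      moreover have "M * (\<kappa> * s) = a / 2 * s" using \<kappa>(3) by (simp add: mult.assoc[symmetric])
      moreover have "a * s > 0" using a s by simp
      ultimately show False using up by (simp add: field_simps)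
    qed
  qed
qed

corollary weak_derivative_unique:
  fixes w :: "real^'n::finite \<Rightarrow> real^'m::finite"
  assumes "open S" "has_weak_derivative_on w G S" "has_weak_derivative_on w G' S"
  shows "AE x in lebesgue. x \<in> S \<longrightarrow> G x = G' x"
  using weak_derivative_zero_on_zero_set[OF assms(1) has_weak_derivative_on_diff[OF assms(2,3)]]
  by eventually_elim simp

section \<open>Change of variables over an arbitrary finite index type\<close>

text \<open>A copy of a finite type on which a well-order can be put. Reindexing the coordinates by it carries
  the change of variables formula from well-ordered to arbitrary finite index types.\<close>

typedef 'n wo = "UNIV :: 'n set" morphisms rep_wo abs_wo by simp

lemma rep_wo_bij: "bij (rep_wo :: 'n wo \<Rightarrow> 'n)" and abs_wo_bij: "bij (abs_wo :: 'n \<Rightarrow> 'n wo)"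
  by (auto simp: bij_def inj_def rep_wo_inject abs_wo_inject surj_def)
    (metis abs_wo_inverse UNIV_I rep_wo_inverse)+

lemma abs_rep_wo [simp]: "abs_wo (rep_wo x) = x" "rep_wo (abs_wo y) = y"
  by (simp_all add: rep_wo_inverse abs_wo_inverse)

instance wo :: (finite) finite
proof
  show "finite (UNIV :: 'a wo set)"
    using bij_betw_finite[OF abs_wo_bij[where 'n='a]] by simp
qed

definition wo_index :: "'n::finite wo \<Rightarrow> nat" where
  "wo_index x = to_nat_on (UNIV :: 'n set) (rep_wo x)"

lemma wo_index_inject: "wo_index x = wo_index y \<longleftrightarrow> x = y"
  unfolding wo_index_def
  using inj_on_to_nat_on[of "UNIV :: 'a set"] by (auto simp: countable_finite inj_on_def rep_wo_inject)

instantiation wo :: (finite) wellorder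
begin

definition less_eq_wo :: "'a wo \<Rightarrow> 'a wo \<Rightarrow> bool" where
  "less_eq_wo x y \<longleftrightarrow> wo_index x \<le> wo_index y"

definition less_wo :: "'a wo \<Rightarrow> 'a wo \<Rightarrow> bool" where
  "less_wo x y \<longleftrightarrow> wo_index x < wo_index y"

instance
proof
  fix P and a :: "'a wo"
  assume step: "\<And>x::'a wo. (\<And>y. y < x \<Longrightarrow> P y) \<Longrightarrow> P x"
  show "P a"
    by (induction a rule: measure_induct_rule[of wo_index]) (use step in \<open>auto simp: less_wo_def\<close>)
qed (auto simp: less_eq_wo_def less_wo_def wo_index_inject)

end

text \<open>Conjugation by the bijection of the index types preserves the sign of a permutation, so the
  Leibniz formulas agree term by term.\<close>

lemma det_reindex:
  fixes A :: "real^'n::finite^'n"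
  shows "det (\<chi> i j. A $ rep_wo i $ rep_wo j) = det A"
proof -
  let ?c = "\<lambda>p::'n \<Rightarrow> 'n. abs_wo \<circ> p \<circ> rep_wo"
  let ?c' = "\<lambda>p::'n wo \<Rightarrow> 'n wo. rep_wo \<circ> p \<circ> abs_wo"
  have perm: "?c p permutes UNIV" if "p permutes UNIV" for p
    using permutes_bij[OF that] rep_wo_bij abs_wo_bij by (intro bij_imp_permutes bij_comp) auto
  have perm': "?c' p permutes UNIV" if "p permutes UNIV" for p
    using permutes_bij[OF that] rep_wo_bij abs_wo_bij by (intro bij_imp_permutes bij_comp) auto
  have sgn: "sign (?c p) = sign p" if "p permutes UNIV" for p
    using that finite_class.finite_UNIV
  proof (induction rule: permutes_induct)
    case id
    have "?c id = id" by (simp add: fun_eq_iff)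
    then show ?case by simp
  next
    case (swap a b p)
    have "?c (Transposition.transpose a b \<circ> p) = Transposition.transpose (abs_wo a) (abs_wo b) \<circ> ?c p"
      by (auto simp: fun_eq_iff Transposition.transpose_def abs_wo_inject)
    moreover have "permutation p" "permutation (?c p)"
      using \<open>p permutes UNIV\<close> perm[OF \<open>p permutes UNIV\<close>] permutation_permutes finite_class.finite_UNIV by blast+
    ultimately have "sign (?c (Transposition.transpose a b \<circ> p)) = sign (Transposition.transpose (abs_wo a) (abs_wo b)) * sign (?c p)"
      "sign (Transposition.transpose a b \<circ> p) = sign (Transposition.transpose a b) * sign p"
      by (simp_all only: sign_compose permutation_swap_id)
    then show ?case using \<open>a \<noteq> b\<close> swap.IH by (simp only: sign_swap_id abs_wo_inject UNIV_I)
  qed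
  have "det (\<chi> i j. A $ rep_wo i $ rep_wo j)
      = (\<Sum>p | p permutes UNIV. of_int (sign (?c p)) * (\<Prod>i\<in>UNIV. A $ rep_wo i $ rep_wo (?c p i)))"
    unfolding det_def
    by (rule sum.reindex_bij_witness[of _ ?c ?c']) (auto simp: perm[unfolded o_def] perm'[unfolded o_def] o_def)
  also have "\<dots> = (\<Sum>p | p permutes UNIV. of_int (sign p) * (\<Prod>i\<in>UNIV. A $ i $ p i))"
  proof (rule sum.cong[OF refl])
    fix p :: "'n \<Rightarrow> 'n" assume "p \<in> {p. p permutes UNIV}"
    moreover have "(\<Prod>i\<in>UNIV. A $ rep_wo i $ rep_wo (?c p i)) = (\<Prod>i\<in>UNIV. A $ i $ p i)"
      using prod.reindex_bij_betw[of rep_wo UNIV UNIV "\<lambda>i. A $ i $ p i"] rep_wo_bij by (simp add: o_def)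
    ultimately show "of_int (sign (?c p)) * (\<Prod>i\<in>UNIV. A $ rep_wo i $ rep_wo (?c p i)) =
        of_int (sign p) * (\<Prod>i\<in>UNIV. A $ i $ p i)" using sgn by simp
  qed
  finally show ?thesis by (simp add: det_def)
qed

definition to_wo :: "real^'n::finite \<Rightarrow> real^('n wo)" where "to_wo x = (\<chi> i. x $ rep_wo i)"
definition of_wo :: "real^('n::finite wo) \<Rightarrow> real^'n" where "of_wo x = (\<chi> i. x $ abs_wo i)"

lemma to_of_wo [simp]: "to_wo (of_wo x) = x" "of_wo (to_wo y) = y"
  by (simp_all add: to_wo_def of_wo_def vec_eq_iff)

lemma linear_to_wo: "linear to_wo" "linear of_wo"
  by (auto intro!: linearI simp: to_wo_def of_wo_def vec_eq_iff)

lemma bounded_linear_to_wo: "bounded_linear to_wo" "bounded_linear of_wo"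
  using linear_to_wo by (simp_all add: linear_conv_bounded_linear)

lemma to_wo_measurable [measurable]: "to_wo \<in> borel_measurable borel" "of_wo \<in> borel_measurable borel"
  using bounded_linear_to_wo by (auto intro!: borel_measurable_continuous_onI linear_continuous_on)

lemma prod_Basis_cart:
  fixes f :: "real^'n::finite \<Rightarrow> 'b::comm_monoid_mult"
  shows "(\<Prod>b\<in>Basis. f b) = (\<Prod>i\<in>UNIV. f (axis i (1::real)))"
proof -
  have B: "(Basis :: (real^'n) set) = (\<lambda>i. axis i 1) ` UNIV" by (auto simp: Basis_vec_def)
  have "inj (\<lambda>i::'n. axis i (1::real))" by (auto simp: inj_def axis_eq_axis)
  from prod.reindex[OF this, of f] show ?thesis by (simp add: B o_def)
qed

lemma lborel_wo: "lborel = distr (lborel :: (real^'n::finite) measure) borel to_wo"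
proof (rule lborel_eqI)
  fix l u :: "real^('n wo)" assume le: "\<And>b. b \<in> Basis \<Longrightarrow> l \<bullet> b \<le> u \<bullet> b"
  have le': "l $ i \<le> u $ i" for i using le[of "axis i 1"] by (auto simp: inner_axis Basis_vec_def)
  have all: "(\<forall>i. Q (rep_wo i)) \<longleftrightarrow> (\<forall>i. Q i)" for Q :: "'n \<Rightarrow> bool" by (metis abs_rep_wo(2))
  have "to_wo -` box l u = box (of_wo l) (of_wo u)"
    using all[of "\<lambda>i. of_wo l $ i < _ $ i \<and> _ $ i < of_wo u $ i"]
    by (auto simp: mem_box_cart to_wo_def of_wo_def)
  then have "emeasure (distr lborel borel to_wo) (box l u) = emeasure lborel (box (of_wo l) (of_wo u))"
    by (simp add: emeasure_distr)
  also have "\<dots> = (\<Prod>b\<in>Basis. (of_wo u - of_wo l) \<bullet> b)"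
    by (rule emeasure_lborel_box) (auto simp: Basis_vec_def inner_axis of_wo_def le')
  also have "(\<Prod>b\<in>Basis. (of_wo u - of_wo l) \<bullet> b) = (\<Prod>b\<in>Basis. (u - l) \<bullet> b)"
    unfolding prod_Basis_cart
    using prod.reindex_bij_betw[of abs_wo UNIV UNIV "\<lambda>i. u $ i - l $ i"] abs_wo_bij by (simp add: inner_axis of_wo_def)
  finally show "emeasure (distr lborel borel to_wo) (box l u) = (\<Prod>b\<in>Basis. (u - l) \<bullet> b)" .
qed simp

lemma lebesgue_set_borel_null:
  fixes A :: "'a::euclidean_space set"
  assumes "A \<in> sets lebesgue"
  obtains B N where "B \<in> sets borel" "negligible N" "A = B \<union> N"
proof -
  obtain B N N' where "A = B \<union> N" "N \<subseteq> N'" "N' \<in> null_sets lborel" "B \<in> sets lborel"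
    using assms by (rule sets_completionE) (rule that)
  then show ?thesis
    using that[of B N] by (auto simp: negligible_iff_null_sets intro: null_sets_completion_subset null_sets_completionI)
qed

lemma emeasure_lebesgue_Un_negligible:
  fixes B :: "'a::euclidean_space set"
  assumes "B \<in> sets lebesgue" "negligible N"
  shows "emeasure lebesgue (B \<union> N) = emeasure lebesgue B"
  using assms by (intro emeasure_Un_null_set) (auto simp: negligible_iff_null_sets)

lemma emeasure_to_wo_image:
  fixes A :: "(real^'n::finite) set"
  assumes "A \<in> sets lebesgue"
  shows "to_wo ` A \<in> sets lebesgue" "emeasure lebesgue (to_wo ` A) = emeasure lebesgue A"
proof -
  obtain B N where BN: "B \<in> sets borel" "negligible N" "A = B \<union> N" by (rule lebesgue_set_borel_null[OF assms])
  have B: "to_wo ` B = of_wo -` B" by (auto simp: image_iff) (metis to_of_wo(1))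
  then have Bb: "to_wo ` B \<in> sets borel" using measurable_sets[OF to_wo_measurable(2) BN(1)] by simp
  have dim: "DIM(real^'n) = DIM(real^('n wo))"
    using bij_betw_same_card[OF abs_wo_bij[where 'n='n]] by simp
  have N: "negligible (to_wo ` N)"
    using BN(2) dim by (intro negligible_differentiable_image_negligible)
      (auto intro!: linear_imp_differentiable_on linear_to_wo)
  have A: "to_wo ` A = to_wo ` B \<union> to_wo ` N" using BN(3) by auto
  show "to_wo ` A \<in> sets lebesgue"
    unfolding A using Bb N by (intro sets.Un) (auto simp: sets_completionI_sets negligible_imp_sets)
  have "emeasure lebesgue (to_wo ` A) = emeasure lborel (to_wo ` B)"
    unfolding A using Bb N emeasure_lebesgue_Un_negligible[of "to_wo ` B" "to_wo ` N"] by (simp add: sets_completionI_sets)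
  also have "\<dots> = emeasure (lborel :: (real^'n) measure) (to_wo -` to_wo ` B)"
    unfolding lborel_wo using Bb by (subst emeasure_distr) auto
  also have "to_wo -` to_wo ` B = B" by (auto dest: arg_cong[of _ _ of_wo])
  also have "emeasure lborel B = emeasure lebesgue A"
    using BN emeasure_lebesgue_Un_negligible[of B N] by (simp add: sets_completionI_sets)
  finally show "emeasure lebesgue (to_wo ` A) = emeasure lebesgue A" .
qed

lemma continuous_on_det:
  fixes A :: "'a::topological_space \<Rightarrow> real^'n::finite^'n"
  assumes "continuous_on S A"
  shows "continuous_on S (\<lambda>y. det (A y))"
  unfolding det_def by (intro continuous_intros continuous_on_component assms)

lemma emeasure_image_wellorder:
  fixes g :: "real^'n::{finite,wellorder} \<Rightarrow> real^'n::_"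
  assumes S: "S \<in> sets lebesgue" and der: "\<And>x. x \<in> S \<Longrightarrow> (g has_derivative g' x) (at x)" and inj: "inj_on g S"
    and m: "(\<lambda>x. indicator S x * \<bar>det (matrix (g' x))\<bar>) \<in> borel_measurable lebesgue"
  shows "emeasure lebesgue (g ` S) = (\<integral>\<^sup>+x. ennreal (indicator S x * \<bar>det (matrix (g' x))\<bar>) \<partial>lebesgue)"
proof -
  let ?k = "\<lambda>x. \<bar>det (matrix (g' x))\<bar>"
  let ?f = "\<lambda>x. indicator S x * ?k x"
  have der': "(g has_derivative g' x) (at x within S)" if "x \<in> S" for x
    using der[OF that] by (rule has_derivative_at_withinI)
  have fS: "?f = (\<lambda>x. if x \<in> S then ?k x else 0)" by (auto simp: indicator_def)
  have eq: "(?f has_integral r) UNIV \<longleftrightarrow> (?k has_integral r) S" for r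
    unfolding fS by (rule has_integral_restrict_UNIV)
  note iff = measurable_differentiable_image_eq[OF S der' inj]
  have gS: "g ` S \<in> sets lebesgue"
    by (rule differentiable_image_in_sets_lebesgue[OF S]) (use der' in \<open>auto simp: differentiable_on_def differentiable_def\<close>)
  show ?thesis
  proof (cases "?k integrable_on S")
    case True
    then have m1: "measure lebesgue (g ` S) = integral S ?k" "g ` S \<in> lmeasurable"
      using measure_differentiable_image_eq[OF S der' inj] iff by auto
    have "(?f has_integral integral S ?k) UNIV" unfolding eq using True by (rule integrable_integral)
    then have "(\<integral>\<^sup>+x. ennreal (?f x) \<partial>lebesgue) = ennreal (integral S ?k)"
      using has_integral_iff_nn_integral_lebesgue[of ?f "integral S ?k"] m by auto
    then show ?thesis using m1 by (simp add: emeasure_eq_measure2)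
  next
    case False
    then have "\<not> emeasure lebesgue (g ` S) < \<infinity>" using iff gS fmeasurableI by blast
    then have "emeasure lebesgue (g ` S) = \<infinity>" by (simp add: not_less top_unique del: emeasure_completion)
    moreover have "(\<integral>\<^sup>+x. ennreal (?f x) \<partial>lebesgue) = \<infinity>"
    proof (rule ccontr)
      assume "\<not> ?thesis"
      then obtain r where "r \<ge> 0" "(\<integral>\<^sup>+x. ennreal (?f x) \<partial>lebesgue) = ennreal r"
        by (cases "(\<integral>\<^sup>+x. ennreal (?f x) \<partial>lebesgue)") auto
      then have "(?f has_integral r) UNIV" using has_integral_iff_nn_integral_lebesgue[of ?f r] m by auto
      then show False using False eq by (auto simp: integrable_on_def)
    qed
    ultimately show ?thesis by simp
  qed
qed

text \<open>A Lebesgue set is split into a Borel set and a negligible set, since reindexing preserves Borel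
  sets and differentiable maps preserve negligible ones.\<close>

lemma emeasure_image_eq_nn_integral_det:
  fixes \<tau> :: "real^'n::finite \<Rightarrow> real^'n"
  assumes S: "open S" and der: "\<And>y. y \<in> S \<Longrightarrow> (\<tau> has_derivative \<tau>' y) (at y)" and inj: "inj_on \<tau> S"
    and cont: "continuous_on S (\<lambda>y. matrix (\<tau>' y))" and Y: "Y \<in> sets lebesgue" "Y \<subseteq> S"
  shows "\<tau> ` Y \<in> sets lebesgue"
    "emeasure lebesgue (\<tau> ` Y) = (\<integral>\<^sup>+y\<in>Y. ennreal \<bar>det (matrix (\<tau>' y))\<bar> \<partial>lebesgue)"
proof -
  let ?J = "\<lambda>y. \<bar>det (matrix (\<tau>' y))\<bar>"
  have diff: "\<tau> differentiable_on Y'" if "Y' \<subseteq> S" for Y'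
    using der that by (auto simp: differentiable_on_def differentiable_def intro: has_derivative_at_withinI)
  show "\<tau> ` Y \<in> sets lebesgue" by (rule differentiable_image_in_sets_lebesgue[OF Y(1) _ diff[OF Y(2)]]) simp
  obtain B N where BN: "B \<in> sets borel" "negligible N" "Y = B \<union> N" by (rule lebesgue_set_borel_null[OF Y(1)])
  have BS: "B \<subseteq> S" "N \<subseteq> S" using BN Y by auto
  have Bl: "B \<in> sets lebesgue" using BN(1) by (simp add: sets_completionI_sets)
  define B' where "B' = to_wo ` B"
  have B'e: "B' = of_wo -` B" unfolding B'_def by (auto simp: image_iff) (metis to_of_wo(1))
  have B': "B' \<in> sets borel" using measurable_sets[OF to_wo_measurable(2) BN(1)] by (simp add: B'e)
  define g where "g = to_wo \<circ> \<tau> \<circ> of_wo"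
  define g' where "g' x = to_wo \<circ> \<tau>' (of_wo x) \<circ> of_wo" for x
  have g: "(g has_derivative g' x) (at x)" if "of_wo x \<in> S" for x
    unfolding g_def g'_def o_assoc[symmetric] o_def
    by (intro has_derivative_compose[OF has_derivative_compose[OF bounded_linear_imp_has_derivative[OF bounded_linear_to_wo(2)] der[OF that]]
        bounded_linear_imp_has_derivative[OF bounded_linear_to_wo(1)], unfolded o_def])
  have detg: "det (matrix (g' x)) = det (matrix (\<tau>' (of_wo x)))" for x
  proof -
    have "of_wo (axis j 1) = axis (rep_wo j) (1::real)" for j :: "'n wo"
      by (auto simp: of_wo_def axis_def vec_eq_iff)
    then have "matrix (g' x) = (\<chi> i j. matrix (\<tau>' (of_wo x)) $ rep_wo i $ rep_wo j)"
      by (simp add: matrix_def g'_def to_wo_def)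
    then show ?thesis by (simp add: det_reindex)
  qed
  have km: "(\<lambda>y. indicator B y * ?J y) \<in> borel_measurable borel"
  proof -
    have "continuous_on B ?J"
      by (intro continuous_intros continuous_on_det continuous_on_subset[OF cont BS(1)])
    from borel_measurable_continuous_on_indicator[OF BN(1) this] show ?thesis by simp
  qed
  have km': "(\<lambda>x. indicator B' x * \<bar>det (matrix (g' x))\<bar>) \<in> borel_measurable borel"
  proof -
    have "(\<lambda>x. indicator B' x * \<bar>det (matrix (g' x))\<bar>) = (\<lambda>x. indicator B (of_wo x) * ?J (of_wo x))"
      by (auto simp: detg B'e indicator_def)
    then show ?thesis using measurable_compose[OF to_wo_measurable(2) km] by simp
  qed
  have "emeasure lebesgue (\<tau> ` Y) = emeasure lebesgue (\<tau> ` B)"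
  proof -
    have "negligible (\<tau> ` N)" by (rule negligible_differentiable_image_negligible[OF _ BN(2) diff[OF BS(2)]]) simp
    moreover have "\<tau> ` B \<in> sets lebesgue" by (rule differentiable_image_in_sets_lebesgue[OF Bl _ diff[OF BS(1)]]) simp
    ultimately show ?thesis using emeasure_lebesgue_Un_negligible[of "\<tau> ` B" "\<tau> ` N"] BN(3) by (simp add: image_Un)
  qed
  also have "\<dots> = emeasure lebesgue (to_wo ` \<tau> ` B)"
    by (rule emeasure_to_wo_image(2)[symmetric], rule differentiable_image_in_sets_lebesgue[OF Bl _ diff[OF BS(1)]]) simp
  also have "to_wo ` \<tau> ` B = g ` B'" by (force simp: B'_def g_def)
  also have "emeasure lebesgue (g ` B') = (\<integral>\<^sup>+x. ennreal (indicator B' x * \<bar>det (matrix (g' x))\<bar>) \<partial>lebesgue)"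
  proof (rule emeasure_image_wellorder)
    show "B' \<in> sets lebesgue" using B' by (simp add: sets_completionI_sets)
    show "(g has_derivative g' x) (at x)" if "x \<in> B'" for x using that BS(1) by (intro g) (auto simp: B'e)
    show "inj_on g B'"
    proof (rule inj_onI)
      fix x y assume xy: "x \<in> B'" "y \<in> B'" "g x = g y"
      from arg_cong[OF xy(3), of of_wo] have "\<tau> (of_wo x) = \<tau> (of_wo y)" by (simp add: g_def)
      then have "of_wo x = of_wo y" using inj xy(1,2) BS(1) by (auto simp: B'e inj_on_def)
      from arg_cong[OF this, of to_wo] show "x = y" by simp
    qed
    show "(\<lambda>x. indicator B' x * \<bar>det (matrix (g' x))\<bar>) \<in> borel_measurable lebesgue"
      using km' by (intro measurable_completion) simp
  qed
  also have "\<dots> = (\<integral>\<^sup>+x. ennreal (indicator B' x * \<bar>det (matrix (g' x))\<bar>) \<partial>lborel)"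
    by (rule nn_integral_completion)
  also have "\<dots> = (\<integral>\<^sup>+y. ennreal (indicator B' (to_wo y) * \<bar>det (matrix (g' (to_wo y)))\<bar>) \<partial>(lborel :: (real^'n) measure))"
    by (subst lborel_wo, subst nn_integral_distr) (use km' in auto)
  also have "\<dots> = (\<integral>\<^sup>+y. ennreal (indicator B y * ?J y) \<partial>lborel)"
    by (intro nn_integral_cong) (simp add: detg B'e indicator_def)
  also have "\<dots> = (\<integral>\<^sup>+y. ennreal (indicator B y * ?J y) \<partial>lebesgue)" by (rule nn_integral_completion[symmetric])
  also have "\<dots> = (\<integral>\<^sup>+y\<in>Y. ennreal (?J y) \<partial>lebesgue)"
  proof (rule nn_integral_cong_AE)
    have "AE y in lebesgue. y \<notin> N" using BN(2) by (auto simp: eventually_ae_filter_negligible)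
    then show "AE y in lebesgue. ennreal (indicator B y * ?J y) = ennreal (?J y) * indicator Y y"
      by eventually_elim (auto simp: BN(3) indicator_def)
  qed
  finally show "emeasure lebesgue (\<tau> ` Y) = (\<integral>\<^sup>+y\<in>Y. ennreal (?J y) \<partial>lebesgue)" .
qed

text \<open>The formula for the measures of images identifies two Borel measures, against which \<open>f\<close> is integrated.\<close>

lemma nn_integral_image_det:
  fixes \<tau> :: "real^'n::finite \<Rightarrow> real^'n"
  assumes S: "open S" and der: "\<And>y. y \<in> S \<Longrightarrow> (\<tau> has_derivative \<tau>' y) (at y)" and inj: "inj_on \<tau> S"
    and cont: "continuous_on S (\<lambda>y. matrix (\<tau>' y))" and Y: "Y \<in> sets lebesgue" "Y \<subseteq> S"
    and T: "open T" "\<tau> ` S \<subseteq> T" and f: "continuous_on T f" "\<And>x. x \<in> T \<Longrightarrow> f x \<ge> (0::real)"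
  shows "(\<integral>\<^sup>+x\<in>\<tau> ` Y. ennreal (f x) \<partial>lebesgue) = (\<integral>\<^sup>+y\<in>Y. ennreal (f (\<tau> y) * \<bar>det (matrix (\<tau>' y))\<bar>) \<partial>lebesgue)"
proof -
  note im = emeasure_image_eq_nn_integral_det[OF S der inj cont]
  define J where "J y = \<bar>det (matrix (\<tau>' y))\<bar>" for y
  have conts: "continuous_on S \<tau>" using der by (auto intro!: continuous_at_imp_continuous_on has_derivative_continuous)
  have meas: "(\<lambda>y. indicator S y *\<^sub>R k y) \<in> borel_measurable lebesgue" if "continuous_on S k" for k :: "real^'n \<Rightarrow> 'b::euclidean_space"
    using borel_measurable_continuous_on_indicator[OF _ that] S by (intro measurable_completion) auto
  have Jm: "(\<lambda>y. indicator S y *\<^sub>R J y) \<in> borel_measurable lebesgue"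
    unfolding J_def by (intro meas continuous_intros continuous_on_det cont)
  define \<tau>0 where "\<tau>0 y = indicator S y *\<^sub>R \<tau> y" for y
  have \<tau>0: "\<tau>0 \<in> borel_measurable lebesgue" unfolding \<tau>0_def by (rule meas[OF conts])
  define w where "w y = ennreal (indicator S y *\<^sub>R J y) * indicator Y y" for y
  have wm: "w \<in> borel_measurable lebesgue" unfolding w_def using Jm Y(1)
    by (intro borel_measurable_times_ennreal measurable_compose[OF Jm measurable_ennreal] borel_measurable_indicator)
  define N1 where "N1 = distr (density lebesgue w) borel \<tau>0"
  define N2 where "N2 = distr (density lebesgue (indicator (\<tau> ` Y))) borel (\<lambda>x. x)"
  have tY: "\<tau> ` Y \<in> sets lebesgue" by (rule im(1)[OF _ Y])
  have idm: "(\<lambda>x. x) \<in> lebesgue \<rightarrow>\<^sub>M (borel :: (real^'n) measure)" by (intro measurable_completion) simp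
  have "N1 = N2"
  proof (rule measure_eqI)
    fix B assume "B \<in> sets N1"
    then have B: "B \<in> sets borel" by (simp add: N1_def)
    have VB: "\<tau>0 -` B \<in> sets lebesgue" using measurable_sets[OF \<tau>0 B] by simp
    have YB: "Y \<inter> \<tau>0 -` B \<in> sets lebesgue" using VB Y(1) by simp
    have "emeasure N1 B = emeasure (density lebesgue w) (\<tau>0 -` B)"
      unfolding N1_def using \<tau>0 B by (subst emeasure_distr) auto
    also have "\<dots> = (\<integral>\<^sup>+y. w y * indicator (\<tau>0 -` B) y \<partial>lebesgue)"
      using wm VB by (subst emeasure_density) auto
    also have "\<dots> = (\<integral>\<^sup>+y\<in>Y \<inter> \<tau>0 -` B. ennreal (J y) \<partial>lebesgue)"
      using Y(2) by (intro nn_integral_cong) (auto simp: w_def indicator_def subset_iff)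
    also have "\<dots> = emeasure lebesgue (\<tau> ` (Y \<inter> \<tau>0 -` B))"
      unfolding J_def by (rule im(2)[symmetric, OF _ YB]) (use Y(2) in auto)
    also have "\<tau> ` (Y \<inter> \<tau>0 -` B) = \<tau> ` Y \<inter> B" using Y(2) by (auto simp: \<tau>0_def indicator_def split: if_splits)
    also have "emeasure lebesgue (\<tau> ` Y \<inter> B) = emeasure N2 B"
    proof -
      have Bl: "B \<in> sets lebesgue" using B by (simp add: sets_completionI_sets)
      have "emeasure N2 B = emeasure (density lebesgue (indicator (\<tau> ` Y))) B"
        unfolding N2_def using idm B by (subst emeasure_distr) auto
      also have "\<dots> = (\<integral>\<^sup>+x. indicator (\<tau> ` Y) x * indicator B x \<partial>lebesgue)"
        using tY Bl by (intro emeasure_density) auto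
      also have "(\<lambda>x. indicator (\<tau> ` Y) x * indicator B x :: ennreal) = indicator (\<tau> ` Y \<inter> B)"
        by (auto simp: indicator_def)
      also have "integral\<^sup>N lebesgue (indicator (\<tau> ` Y \<inter> B)) = emeasure lebesgue (\<tau> ` Y \<inter> B)"
        by (rule nn_integral_indicator) (use tY Bl in auto)
      finally show ?thesis by (rule sym)
    qed
    finally show "emeasure N1 B = emeasure N2 B" .
  qed (simp add: N1_def N2_def)
  define F where "F x = ennreal (indicator T x *\<^sub>R f x)" for x
  have Fm: "F \<in> borel_measurable borel"
    unfolding F_def using borel_measurable_continuous_on_indicator[OF borel_open[OF T(1)] f(1)]
    by (rule measurable_compose[OF _ measurable_ennreal])
  have "(\<integral>\<^sup>+x\<in>\<tau> ` Y. ennreal (f x) \<partial>lebesgue) = (\<integral>\<^sup>+x. indicator (\<tau> ` Y) x * F x \<partial>lebesgue)"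
    using Y(2) T(2) by (intro nn_integral_cong) (auto simp: F_def indicator_def)
  also have "\<dots> = (\<integral>\<^sup>+x. F x \<partial>N2)"
    unfolding N2_def using idm Fm tY measurable_compose[OF idm Fm]
    by (subst nn_integral_distr) (auto simp: nn_integral_density)
  also have "\<dots> = (\<integral>\<^sup>+x. F x \<partial>N1)" using \<open>N1 = N2\<close> by simp
  also have "\<dots> = (\<integral>\<^sup>+y. w y * F (\<tau>0 y) \<partial>lebesgue)"
    unfolding N1_def using \<tau>0 Fm wm measurable_compose[OF \<tau>0 Fm]
    by (subst nn_integral_distr) (auto simp: nn_integral_density)
  also have "\<dots> = (\<integral>\<^sup>+y\<in>Y. ennreal (f (\<tau> y) * J y) \<partial>lebesgue)"
  proof (rule nn_integral_cong)
    fix y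
    show "w y * F (\<tau>0 y) = ennreal (f (\<tau> y) * J y) * indicator Y y"
    proof (cases "y \<in> Y")
      case True
      then have "y \<in> S" "\<tau> y \<in> T" using Y(2) T(2) by auto
      moreover have "J y \<ge> 0" by (simp add: J_def)
      ultimately show ?thesis using True f(2)[of "\<tau> y"]
        by (simp add: w_def F_def \<tau>0_def ennreal_mult mult.commute)
    qed (simp add: w_def)
  qed
  finally show ?thesis by (simp add: J_def)
qed

section \<open>Charts and transition maps\<close>

lemma continuous_on_matrix:
  fixes F :: "'c::topological_space \<Rightarrow> real^'k::finite^'l::finite"
  assumes "\<And>i j. continuous_on S (\<lambda>y. F y $ i $ j)"
  shows "continuous_on S F"
proof -
  have "continuous_on S (\<lambda>y. \<chi> i. \<chi> j. F y $ i $ j)"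
    by (intro continuous_on_vec_lambda assms)
  then show ?thesis by simp
qed

locale closed_riemannian =
  fixes M :: "'a topology" and A :: "('a, 'n::finite) chart set"
    and g :: "('a, 'n) chart \<Rightarrow> real^'n \<Rightarrow> real^'n^'n"
  assumes mfd: "closed_manifold M A" and met: "riemannian_metric A g"
begin

lemma compact_M: "compact_space M" and Hausdorff_M: "Hausdorff_space M" and atlas: "smooth_atlas M A"
  using mfd by (auto simp: closed_manifold_def)

lemma chart: "c \<in> A \<Longrightarrow> is_chart M c"
  using atlas by (auto simp: smooth_atlas_def)

lemma ex_chart: "x \<in> topspace M \<Longrightarrow> \<exists>c\<in>A. x \<in> chart_dom c"
  using atlas by (auto simp: smooth_atlas_def)

lemma chart_at: "x \<in> topspace M \<Longrightarrow> chart_at A x \<in> A \<and> x \<in> chart_dom (chart_at A x)"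
  using ex_chart[of x] someI_ex[of "\<lambda>c. c \<in> A \<and> x \<in> chart_dom c"] unfolding chart_at_def by blast

lemma openin_dom: "c \<in> A \<Longrightarrow> openin M (chart_dom c)"
  using chart by (auto simp: is_chart_def)

lemma dom_subset: "c \<in> A \<Longrightarrow> chart_dom c \<subseteq> topspace M"
  using openin_dom openin_subset by blast

lemma open_img: "c \<in> A \<Longrightarrow> open (chart_img c)"
  using chart by (auto simp: is_chart_def)

lemma chart_homeo: "c \<in> A \<Longrightarrow> homeomorphic_map (subtopology M (chart_dom c)) (top_of_set (chart_img c)) (chart_map c)"
  using chart by (auto simp: is_chart_def)

lemma chart_inj: "c \<in> A \<Longrightarrow> inj_on (chart_map c) (chart_dom c)"
  using homeomorphic_imp_injective_map[OF chart_homeo] dom_subset by (auto simp: inf.absorb2)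

lemma chart_inv_in: "y \<in> chart_img c \<Longrightarrow> chart_inv c y \<in> chart_dom c"
  unfolding chart_img_def chart_inv_def by (rule inv_into_into)

lemma chart_map_inv: "y \<in> chart_img c \<Longrightarrow> chart_map c (chart_inv c y) = y"
  unfolding chart_img_def chart_inv_def by (rule f_inv_into_f)

lemma chart_inv_map: "c \<in> A \<Longrightarrow> x \<in> chart_dom c \<Longrightarrow> chart_inv c (chart_map c x) = x"
  unfolding chart_inv_def by (rule inv_into_f_f[OF chart_inj])

lemma chart_map_in: "x \<in> chart_dom c \<Longrightarrow> chart_map c x \<in> chart_img c"
  by (simp add: chart_img_def)

lemma chart_inv_top: "c \<in> A \<Longrightarrow> y \<in> chart_img c \<Longrightarrow> chart_inv c y \<in> topspace M"
  using chart_inv_in dom_subset by blast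

lemma continuous_chart_map: "c \<in> A \<Longrightarrow> continuous_map (subtopology M (chart_dom c)) euclidean (chart_map c)"
  using homeomorphic_imp_continuous_map[OF chart_homeo] continuous_map_into_fulltopology by blast

lemma openin_chart_vimage:
  assumes "c \<in> A" "open V"
  shows "openin M {x \<in> chart_dom c. chart_map c x \<in> V}"
proof -
  have "openin (subtopology M (chart_dom c)) {x \<in> topspace (subtopology M (chart_dom c)). chart_map c x \<in> V}"
    using openin_continuous_map_preimage[OF continuous_chart_map[OF assms(1)]] assms(2) by simp
  moreover have "topspace (subtopology M (chart_dom c)) = chart_dom c"
    using dom_subset[OF assms(1)] by auto
  ultimately show ?thesis using openin_trans_full openin_dom[OF assms(1)] by metis
qed

lemma open_chart_image:
  assumes "c \<in> A" "openin M U"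
  shows "open (chart_map c ` (U \<inter> chart_dom c))"
proof -
  have "openin (subtopology M (chart_dom c)) (U \<inter> chart_dom c)"
    using assms(2) by (simp add: openin_subtopology_Int)
  then have "openin (top_of_set (chart_img c)) (chart_map c ` (U \<inter> chart_dom c))"
    using homeomorphic_map_openness_eq[OF chart_homeo[OF assms(1)]] by blast
  then show ?thesis using open_img[OF assms(1)] openin_open_trans by blast
qed

lemma continuous_chart_inv:
  assumes "c \<in> A" shows "continuous_map (top_of_set (chart_img c)) M (chart_inv c)"
  unfolding continuous_map_def
proof (intro conjI allI impI)
  show "chart_inv c \<in> topspace (top_of_set (chart_img c)) \<rightarrow> topspace M"
    using chart_inv_top[OF assms] by auto
  fix U assume U: "openin M U"
  have "{y \<in> chart_img c. chart_inv c y \<in> U} = chart_map c ` (U \<inter> chart_dom c)"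
  proof (intro subset_antisym subsetI)
    fix y assume "y \<in> {y \<in> chart_img c. chart_inv c y \<in> U}"
    then show "y \<in> chart_map c ` (U \<inter> chart_dom c)"
      using chart_map_inv[of y c] chart_inv_in[of y c] by (intro image_eqI[of _ _ "chart_inv c y"]) auto
  next
    fix y assume "y \<in> chart_map c ` (U \<inter> chart_dom c)"
    then show "y \<in> {y \<in> chart_img c. chart_inv c y \<in> U}"
      using chart_inv_map[OF assms] chart_map_in[of _ c] by fastforce
  qed
  moreover have "chart_map c ` (U \<inter> chart_dom c) \<subseteq> chart_img c" by (auto simp: chart_img_def)
  ultimately show "openin (top_of_set (chart_img c)) {y \<in> topspace (top_of_set (chart_img c)). chart_inv c y \<in> U}"
    using open_chart_image[OF assms U] by (simp add: open_subset)
qed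

lemma closedin_chart_inv_image:
  assumes "c \<in> A" "compact K" "K \<subseteq> chart_img c"
  shows "closedin M (chart_inv c ` K)"
proof (rule compactin_imp_closedin[OF Hausdorff_M])
  have "compactin (top_of_set (chart_img c)) K" using assms(2,3) by (simp add: compactin_subtopology)
  then show "compactin M (chart_inv c ` K)"
    by (rule image_compactin[OF _ continuous_chart_inv[OF assms(1)]])
qed

definition overlap :: "('a, 'n) chart \<Rightarrow> ('a, 'n) chart \<Rightarrow> (real^'n) set" where
  "overlap c d = chart_map c ` (chart_dom c \<inter> chart_dom d)"

lemma overlap_iff: "c \<in> A \<Longrightarrow> y \<in> overlap c d \<longleftrightarrow> y \<in> chart_img c \<and> chart_inv c y \<in> chart_dom d"
  unfolding overlap_def chart_img_def
  using chart_inv_map[of c] chart_inv_in[of y c] chart_map_inv[of y c]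
  by (auto simp: chart_img_def image_iff)

lemma open_overlap: "c \<in> A \<Longrightarrow> d \<in> A \<Longrightarrow> open (overlap c d)"
  using open_chart_image[OF _ openin_dom, of c d] by (simp add: overlap_def Int_commute)

lemma overlap_subset: "c \<in> A \<Longrightarrow> overlap c d \<subseteq> chart_img c"
  by (auto simp: overlap_def chart_img_def)

lemma transition_eq: "transition c d y = chart_map d (chart_inv c y)"
  by (simp add: transition_def)

lemma transition_in: "c \<in> A \<Longrightarrow> d \<in> A \<Longrightarrow> y \<in> overlap c d \<Longrightarrow> transition c d y \<in> overlap d c"
  using overlap_iff[of c y d] chart_inv_in[of y c] unfolding overlap_def[of d c] transition_eq by auto

lemma chart_inv_transition:
  "c \<in> A \<Longrightarrow> d \<in> A \<Longrightarrow> y \<in> overlap c d \<Longrightarrow> chart_inv d (transition c d y) = chart_inv c y"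
  using overlap_iff[of c y d] chart_inv_map[of d] by (simp add: transition_eq)

lemma transition_transition:
  "c \<in> A \<Longrightarrow> d \<in> A \<Longrightarrow> y \<in> overlap c d \<Longrightarrow> transition d c (transition c d y) = y"
  using overlap_iff[of c y d] chart_inv_transition[of c d y] chart_map_inv[of y c] by (simp add: transition_eq)

lemma transition_smooth: "c \<in> A \<Longrightarrow> d \<in> A \<Longrightarrow> Ck_on 1 (transition c d) (overlap c d)"
  using atlas unfolding smooth_atlas_def smooth_on_def overlap_def by blast

lemma transition_derivative:
  assumes "c \<in> A" "d \<in> A" "y \<in> overlap c d"
  shows "(transition c d has_derivative (\<lambda>v. jacobian c d y *v v)) (at y)"
proof -
  have d: "(transition c d has_derivative frechet_derivative (transition c d) (at y)) (at y)"
    using transition_smooth[OF assms(1,2)] assms(3) by (simp add: frechet_derivative_works[symmetric])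
  have "(\<lambda>v. jacobian c d y *v v) = frechet_derivative (transition c d) (at y)"
    unfolding jacobian_def using matrix_vector_mul(1)[OF linear_matrix_vector_mul_eq[THEN iffD2, OF has_derivative_linear[OF d]]] by simp
  then show ?thesis using d by simp
qed

lemma continuous_jacobian:
  assumes "c \<in> A" "d \<in> A"
  shows "continuous_on (overlap c d) (jacobian c d)"
proof (rule continuous_on_matrix)
  fix i j
  have "continuous_on (overlap c d) (\<lambda>y. frechet_derivative (transition c d) (at y) (axis j 1))"
    using transition_smooth[OF assms] by simp
  then show "continuous_on (overlap c d) (\<lambda>y. jacobian c d y $ i $ j)"
    unfolding jacobian_def matrix_def by (auto intro: continuous_on_component)
qed

lemma transition_inj: "c \<in> A \<Longrightarrow> d \<in> A \<Longrightarrow> inj_on (transition c d) (overlap c d)"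
  by (rule inj_onI) (metis transition_transition)

lemma jacobian_inverse:
  assumes cd: "c \<in> A" "d \<in> A" and y: "y \<in> overlap c d"
  shows "jacobian d c (transition c d y) ** jacobian c d y = mat 1"
proof -
  have "((\<lambda>y. transition d c (transition c d y)) has_derivative (\<lambda>v. jacobian d c (transition c d y) *v (jacobian c d y *v v))) (at y)"
    by (rule has_derivative_compose[OF transition_derivative[OF cd y] transition_derivative[OF cd(2,1) transition_in[OF cd y]]])
  moreover have "((\<lambda>y. transition d c (transition c d y)) has_derivative (\<lambda>v. v)) (at y)"
    by (rule has_derivative_transform_within_open[OF has_derivative_ident open_overlap[OF cd] y])
      (simp add: transition_transition[OF cd])
  ultimately have "(\<lambda>v. jacobian d c (transition c d y) *v (jacobian c d y *v v)) = (\<lambda>v. v)"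
    by (rule has_derivative_unique)
  then show ?thesis by (simp add: matrix_eq matrix_vector_mul_assoc[symmetric] fun_eq_iff)
qed

lemma transition_image:
  assumes cd: "c \<in> A" "d \<in> A" and B: "B \<subseteq> chart_dom c" "B \<subseteq> chart_dom d"
  shows "transition c d ` (chart_map c ` B) = chart_map d ` B"
  using chart_inv_map[OF cd(1)] B by (force simp: transition_eq image_image)

lemma finite_subatlas:
  obtains cs where "set cs \<subseteq> A" "topspace M \<subseteq> (\<Union>c\<in>set cs. chart_dom c)"
proof -
  have "\<exists>F. finite F \<and> F \<subseteq> chart_dom ` A \<and> topspace M \<subseteq> \<Union>F"
    using compact_M openin_dom ex_chart unfolding compact_space_alt by (auto simp: subset_iff)
  then obtain I where "finite I" "I \<subseteq> A" "topspace M \<subseteq> (\<Union>c\<in>I. chart_dom c)"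
    by (metis finite_subset_image)
  then show ?thesis using that finite_list by metis
qed

subsection \<open>The metric in charts\<close>

lemma metric_cont: "c \<in> A \<Longrightarrow> continuous_on (chart_img c) (g c)"
proof -
  assume "c \<in> A"
  then have "Ck_on 0 (g c) (chart_img c)" using met unfolding riemannian_metric_def smooth_on_def by blast
  then show ?thesis by simp
qed

lemma metric_pos: "c \<in> A \<Longrightarrow> y \<in> chart_img c \<Longrightarrow> v \<noteq> 0 \<Longrightarrow> v \<bullet> (g c y *v v) > 0"
  and metric_law: "c \<in> A \<Longrightarrow> d \<in> A \<Longrightarrow> y \<in> overlap c d \<Longrightarrow>
    g c y = transpose (jacobian c d y) ** g d (transition c d y) ** jacobian c d y"
  using met unfolding riemannian_metric_def overlap_def by blast+

end

text \<open>On the segment from the identity to \<open>B\<close> all matrices are positive definite, hence invertible, so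
  the determinant cannot change its sign.\<close>

lemma det_pos_of_positive_definite:
  fixes B :: "real^'n::finite^'n"
  assumes "\<And>v. v \<noteq> 0 \<Longrightarrow> v \<bullet> (B *v v) > 0"
  shows "det B > 0"
proof (rule ccontr)
  assume "\<not> det B > 0"
  define P where "P t = (1 - t) *\<^sub>R mat 1 + t *\<^sub>R B" for t :: real
  have "continuous_on {0..1} (\<lambda>t. det (P t))"
    unfolding P_def by (intro continuous_on_det continuous_intros)
  moreover have "det (P 0) = 1" "det (P 1) \<le> 0" using \<open>\<not> det B > 0\<close> by (simp_all add: P_def)
  ultimately obtain t where t: "0 \<le> t" "t \<le> 1" "det (P t) = 0"
    using IVT2'[of "\<lambda>t. det (P t)" 1 0 0] by auto
  then have "\<not> invertible (P t)" by (simp add: invertible_det_nz)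
  then obtain v where v: "v \<noteq> 0" "P t *v v = 0"
    using matrix_left_invertible_ker[of "P t"] invertible_left_inverse[of "P t"] by auto
  have "0 = v \<bullet> (P t *v v)" using v by simp
  also have "\<dots> = (1 - t) * (v \<bullet> v) + t * (v \<bullet> (B *v v))"
    by (simp add: P_def matrix_vector_mult_add_rdistrib scaleR_matrix_vector_assoc[symmetric] inner_add_right)
  also have "\<dots> > 0"
  proof (cases "t = 0")
    case False
    then show ?thesis using t assms[OF v(1)] by (intro add_nonneg_pos) auto
  qed (use v in simp)
  finally show False by simp
qed

context closed_riemannian
begin

lemma metric_det_pos: "c \<in> A \<Longrightarrow> y \<in> chart_img c \<Longrightarrow> det (g c y) > 0"
  using metric_pos by (intro det_pos_of_positive_definite)

lemma metric_det_law:
  assumes "c \<in> A" "d \<in> A" "y \<in> overlap c d"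
  shows "sqrt (det (g c y)) = sqrt (det (g d (transition c d y))) * \<bar>det (jacobian c d y)\<bar>"
proof -
  have "det (g c y) = det (g d (transition c d y)) * (det (jacobian c d y))\<^sup>2"
    using metric_law[OF assms] by (simp add: det_mul power2_eq_square)
  then show ?thesis by (simp add: real_sqrt_mult)
qed

end

section \<open>The Riemannian volume\<close>

context closed_riemannian
begin

definition volume_sets :: "'a set set" where
  "volume_sets = {B. B \<subseteq> topspace M \<and> (\<forall>c\<in>A. chart_map c ` (B \<inter> chart_dom c) \<in> sets lebesgue)}"

definition vol_density :: "('a, 'n) chart \<Rightarrow> real^'n \<Rightarrow> ennreal" where
  "vol_density c y = ennreal (sqrt (det (g c y)))"

definition chart_vol :: "('a, 'n) chart \<Rightarrow> (real^'n) measure" where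
  "chart_vol c = density lebesgue (\<lambda>y. vol_density c y * indicator (chart_img c) y)"

lemma chart_img_sets: "c \<in> A \<Longrightarrow> chart_img c \<in> sets lebesgue"
  using open_img by (simp add: borel_open sets_completionI_sets)

lemma vol_density_measurable:
  assumes "c \<in> A" shows "(\<lambda>y. vol_density c y * indicator (chart_img c) y) \<in> borel_measurable lebesgue"
proof -
  have "continuous_on (chart_img c) (\<lambda>y. sqrt (det (g c y)))"
    by (intro continuous_intros continuous_on_det metric_cont assms)
  then have "(\<lambda>y. indicator (chart_img c) y *\<^sub>R sqrt (det (g c y))) \<in> borel_measurable borel"
    using open_img[OF assms] by (intro borel_measurable_continuous_on_indicator) auto
  then have "(\<lambda>y. ennreal (indicator (chart_img c) y *\<^sub>R sqrt (det (g c y)))) \<in> borel_measurable borel"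
    by measurable
  moreover have "(\<lambda>y. ennreal (indicator (chart_img c) y *\<^sub>R sqrt (det (g c y)))) = (\<lambda>y. vol_density c y * indicator (chart_img c) y)"
    by (auto simp: vol_density_def indicator_def)
  ultimately show ?thesis by (intro measurable_completion) simp
qed

lemma emeasure_chart_vol:
  assumes "c \<in> A" "Y \<in> sets lebesgue" "Y \<subseteq> chart_img c"
  shows "emeasure (chart_vol c) Y = (\<integral>\<^sup>+y\<in>Y. vol_density c y \<partial>lebesgue)"
  unfolding chart_vol_def using assms vol_density_measurable[OF assms(1)]
  by (subst emeasure_density) (auto intro!: nn_integral_cong simp: indicator_def)

lemma sets_chart_vol [simp]: "sets (chart_vol c) = sets lebesgue"
  by (simp add: chart_vol_def)

lemma volume_sets_image: "B \<in> volume_sets \<Longrightarrow> c \<in> A \<Longrightarrow> B \<subseteq> chart_dom c \<Longrightarrow> chart_map c ` B \<in> sets lebesgue"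
  unfolding volume_sets_def by (metis (mono_tags, lifting) inf.absorb1 mem_Collect_eq)

lemma sigma_volume_sets: "sigma_algebra (topspace M) volume_sets"
  unfolding sigma_algebra_iff2
proof (intro conjI ballI allI impI)
  show "volume_sets \<subseteq> Pow (topspace M)" "{} \<in> volume_sets" by (auto simp: volume_sets_def)
next
  fix B assume B: "B \<in> volume_sets"
  have "chart_map c ` ((topspace M - B) \<inter> chart_dom c) \<in> sets lebesgue" if c: "c \<in> A" for c
  proof -
    have "(topspace M - B) \<inter> chart_dom c = chart_dom c - (B \<inter> chart_dom c)" using dom_subset[OF c] by blast
    then have "chart_map c ` ((topspace M - B) \<inter> chart_dom c) = chart_img c - chart_map c ` (B \<inter> chart_dom c)"
      using inj_on_image_set_diff[OF chart_inj[OF c], of "chart_dom c" "B \<inter> chart_dom c"] by (simp add: chart_img_def Diff_subset)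
    moreover have "chart_map c ` (B \<inter> chart_dom c) \<in> sets lebesgue" using B c unfolding volume_sets_def by blast
    ultimately show ?thesis using chart_img_sets[OF c] by auto
  qed
  then show "topspace M - B \<in> volume_sets" unfolding volume_sets_def by blast
next
  fix F :: "nat \<Rightarrow> 'a set" assume F: "range F \<subseteq> volume_sets"
  have "chart_map c ` ((\<Union>i. F i) \<inter> chart_dom c) \<in> sets lebesgue" if c: "c \<in> A" for c
  proof -
    have "chart_map c ` ((\<Union>i. F i) \<inter> chart_dom c) = (\<Union>i. chart_map c ` (F i \<inter> chart_dom c))" by blast
    moreover have "chart_map c ` (F i \<inter> chart_dom c) \<in> sets lebesgue" for i using F c unfolding volume_sets_def by blast
    ultimately show ?thesis by auto
  qed
  then show "(\<Union>i. F i) \<in> volume_sets" using F unfolding volume_sets_def by blast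
qed

interpretation ms: sigma_algebra "topspace M" volume_sets by (rule sigma_volume_sets)

lemma chart_inv_image_volume_sets:
  assumes c: "c \<in> A" and Y: "Y \<in> sets lebesgue" "Y \<subseteq> chart_img c"
  shows "chart_inv c ` Y \<in> volume_sets"
proof -
  have "chart_map d ` (chart_inv c ` Y \<inter> chart_dom d) \<in> sets lebesgue" if d: "d \<in> A" for d
  proof -
    have eq: "chart_map d ` (chart_inv c ` Y \<inter> chart_dom d) = transition c d ` (Y \<inter> overlap c d)"
      using overlap_iff[OF c, of _ d] Y(2) by (auto simp: transition_eq)
    have "transition c d differentiable_on (Y \<inter> overlap c d)"
      unfolding differentiable_on_def differentiable_def
      by (meson IntD2 c d has_derivative_at_withinI transition_derivative)
    then show ?thesis unfolding eq
      by (intro differentiable_image_in_sets_lebesgue)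
        (use Y open_overlap[OF c d] in \<open>auto simp: borel_open sets_completionI_sets\<close>)
  qed
  then show ?thesis using chart_inv_top[OF c] Y(2) by (auto simp: volume_sets_def)
qed

lemma chart_dom_volume_sets: "c \<in> A \<Longrightarrow> chart_dom c \<in> volume_sets"
proof -
  assume c: "c \<in> A"
  have "chart_inv c ` chart_img c = chart_dom c"
    using chart_inv_in[of _ c] chart_inv_map[OF c] chart_map_in[of _ c] by force
  then show ?thesis using chart_inv_image_volume_sets[OF c chart_img_sets[OF c]] by simp
qed

text \<open>The transformation law of the metric multiplies the density by the Jacobian determinant, which is
  what the change of variables formula requires.\<close>

lemma chart_vol_transition:
  assumes c: "c \<in> A" and d: "d \<in> A" and B: "B \<in> volume_sets" "B \<subseteq> chart_dom c" "B \<subseteq> chart_dom d"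
  shows "emeasure (chart_vol d) (chart_map d ` B) = emeasure (chart_vol c) (chart_map c ` B)"
proof -
  let ?Y = "chart_map c ` B"
  have Y: "?Y \<in> sets lebesgue" "?Y \<subseteq> overlap c d" using volume_sets_image[OF B(1) c B(2)] B by (auto simp: overlap_def)
  have m: "matrix (\<lambda>v. jacobian c d y *v v) = jacobian c d y" for y by (simp add: matrix_of_matrix_vector_mul)
  have im: "chart_map d ` B = transition c d ` ?Y" using transition_image[OF c d B(2,3)] by simp
  have "emeasure (chart_vol d) (chart_map d ` B) = (\<integral>\<^sup>+x\<in>transition c d ` ?Y. vol_density d x \<partial>lebesgue)"
    unfolding im[symmetric] using volume_sets_image[OF B(1) d B(3)] B(3)
    by (intro emeasure_chart_vol[OF d]) (auto simp: chart_img_def)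
  also have "\<dots> = (\<integral>\<^sup>+y\<in>?Y. ennreal (sqrt (det (g d (transition c d y))) * \<bar>det (matrix (\<lambda>v. jacobian c d y *v v))\<bar>) \<partial>lebesgue)"
    unfolding vol_density_def
  proof (rule nn_integral_image_det[OF open_overlap[OF c d] transition_derivative[OF c d] transition_inj[OF c d] _ Y])
    show "continuous_on (overlap c d) (\<lambda>y. matrix (\<lambda>v. jacobian c d y *v v))"
      unfolding m by (rule continuous_jacobian[OF c d])
    show "open (chart_img d)" by (rule open_img[OF d])
    show "transition c d ` overlap c d \<subseteq> chart_img d" using transition_in[OF c d] overlap_subset[OF d] by blast
    show "continuous_on (chart_img d) (\<lambda>x. sqrt (det (g d x)))"
      by (intro continuous_intros continuous_on_det metric_cont d)
    show "0 \<le> sqrt (det (g d x))" if "x \<in> chart_img d" for x using metric_det_pos[OF d that] by simp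
  qed
  also have "\<dots> = (\<integral>\<^sup>+y\<in>?Y. vol_density c y \<partial>lebesgue)"
  proof (rule nn_integral_cong)
    fix y
    show "ennreal (sqrt (det (g d (transition c d y))) * \<bar>det (matrix (\<lambda>v. jacobian c d y *v v))\<bar>) * indicator ?Y y = vol_density c y * indicator ?Y y"
    proof (cases "y \<in> ?Y")
      case True
      then have "y \<in> overlap c d" using Y(2) by blast
      then show ?thesis using metric_det_law[OF c d] by (simp add: m vol_density_def)
    qed simp
  qed
  also have "\<dots> = emeasure (chart_vol c) ?Y"
    by (rule emeasure_chart_vol[OF c Y(1) order_trans[OF Y(2) overlap_subset[OF c]], symmetric])
  finally show ?thesis .
qed

lemma is_riem_volume_iff:
  "is_riem_volume M A g \<mu> \<longleftrightarrow> space \<mu> = topspace M \<and> sets \<mu> = volume_sets \<and>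
     (\<forall>c\<in>A. \<forall>B\<in>volume_sets. B \<subseteq> chart_dom c \<longrightarrow> emeasure \<mu> B = emeasure (chart_vol c) (chart_map c ` B))"
proof -
  have "emeasure (chart_vol c) (chart_map c ` B) = (\<integral>\<^sup>+y\<in>chart_map c ` B. ennreal (sqrt (det (g c y))) \<partial>lebesgue)"
    if "c \<in> A" "B \<in> volume_sets" "B \<subseteq> chart_dom c" for c B
    using emeasure_chart_vol[OF that(1) volume_sets_image[OF that(2,1,3)]] that(3) by (auto simp: chart_img_def vol_density_def)
  then show ?thesis unfolding is_riem_volume_def volume_sets_def[symmetric] by auto
qed

text \<open>The manifold is cut into finitely many disjoint measurable pieces that lie in chart domains, and
  the chart volumes of the pieces are added. Any volume is determined by its values on these pieces.\<close>

lemma ex1_riem_volume: "\<exists>!\<mu>. is_riem_volume M A g \<mu>"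
proof -
  obtain cs where cs: "set cs \<subseteq> A" "topspace M \<subseteq> (\<Union>c\<in>set cs. chart_dom c)" by (rule finite_subatlas)
  define k where "k = length cs"
  have csA: "cs ! i \<in> A" if "i < k" for i using cs(1) that by (auto simp: k_def)
  define P where "P i = chart_dom (cs ! i) - (\<Union>j<i. chart_dom (cs ! j))" for i
  have Pm: "P i \<in> volume_sets" if "i < k" for i
    unfolding P_def using that by (intro ms.Diff chart_dom_volume_sets csA ms.finite_UN) auto
  have Pdom: "P i \<subseteq> chart_dom (cs ! i)" for i by (auto simp: P_def)
  have Pdis: "disjoint_family_on P {..<k}"
    unfolding disjoint_family_on_def
  proof (intro ballI impI)
    fix i j assume "i \<in> {..<k}" "j \<in> {..<k}" "i \<noteq> j"
    then show "P i \<inter> P j = {}" unfolding P_def by (cases i j rule: linorder_cases) auto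
  qed
  have Pcov: "topspace M = (\<Union>i<k. P i)"
  proof
    show "topspace M \<subseteq> (\<Union>i<k. P i)"
    proof
      fix x assume "x \<in> topspace M"
      then obtain c where "c \<in> set cs" "x \<in> chart_dom c" using cs(2) by blast
      then obtain i where i: "i < k" "x \<in> chart_dom (cs ! i)" by (auto simp: in_set_conv_nth k_def)
      define l where "l = (LEAST i. x \<in> chart_dom (cs ! i))"
      have "x \<in> chart_dom (cs ! l)" "l \<le> i" unfolding l_def using i by (auto intro: LeastI Least_le)
      moreover have "x \<notin> chart_dom (cs ! j)" if "j < l" for j using that not_less_Least unfolding l_def by blast
      ultimately have "x \<in> P l" "l < k" using i by (auto simp: P_def)
      then show "x \<in> (\<Union>i<k. P i)" by blast
    qed
    show "(\<Union>i<k. P i) \<subseteq> topspace M" using Pdom dom_subset csA by fastforce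
  qed
  define \<nu> where "\<nu> B = (\<Sum>i<k. emeasure (chart_vol (cs ! i)) (chart_map (cs ! i) ` (B \<inter> P i)))" for B
  have imm: "chart_map (cs ! i) ` (B \<inter> P i) \<in> sets lebesgue" if "B \<in> volume_sets" "i < k" for B i
    using that by (intro volume_sets_image csA ms.Int Pm) (use Pdom in auto)
  have main: "\<nu> B = emeasure (chart_vol c) (chart_map c ` B)" if c: "c \<in> A" and B: "B \<in> volume_sets" "B \<subseteq> chart_dom c" for c B
  proof -
    have BP: "B \<inter> P i \<in> volume_sets" if "i < k" for i using B Pm[OF that] by auto
    have BPd: "B \<inter> P i \<subseteq> chart_dom c" "B \<inter> P i \<subseteq> chart_dom (cs ! i)" for i using B Pdom by auto
    have "\<nu> B = (\<Sum>i<k. emeasure (chart_vol c) (chart_map c ` (B \<inter> P i)))"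
      unfolding \<nu>_def using BPd by (intro sum.cong refl chart_vol_transition[OF c csA BP]) auto
    also have "\<dots> = emeasure (chart_vol c) (\<Union>i<k. chart_map c ` (B \<inter> P i))"
    proof (rule sum_emeasure)
      show "(\<lambda>i. chart_map c ` (B \<inter> P i)) ` {..<k} \<subseteq> sets (chart_vol c)"
        using volume_sets_image[OF BP c BPd(1)] by auto
      show "disjoint_family_on (\<lambda>i. chart_map c ` (B \<inter> P i)) {..<k}"
        unfolding disjoint_family_on_def
      proof (intro ballI impI)
        fix i j assume "i \<in> {..<k}" "j \<in> {..<k}" "i \<noteq> j"
        then have "P i \<inter> P j = {}" using Pdis by (auto simp: disjoint_family_on_def)
        then show "chart_map c ` (B \<inter> P i) \<inter> chart_map c ` (B \<inter> P j) = {}"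
          using inj_on_image_Int[OF chart_inj[OF c] BPd(1)[of i] BPd(1)[of j]] by blast
      qed
    qed simp
    also have "(\<Union>i<k. chart_map c ` (B \<inter> P i)) = chart_map c ` B"
    proof -
      have "(\<Union>i<k. B \<inter> P i) = B" using Pcov ms.sets_into_space[OF B(1)] by blast
      then show ?thesis by (simp only: image_UN[symmetric])
    qed
    finally show ?thesis .
  qed
  have pos: "positive volume_sets \<nu>" by (simp add: positive_def \<nu>_def)
  have ca: "countably_additive volume_sets \<nu>"
    unfolding countably_additive_def
  proof (intro allI impI)
    fix F :: "nat \<Rightarrow> 'a set" assume F: "range F \<subseteq> volume_sets" "disjoint_family F" "(\<Union>i. F i) \<in> volume_sets"
    have "(\<Sum>n. \<nu> (F n)) = (\<Sum>i<k. \<Sum>n. emeasure (chart_vol (cs ! i)) (chart_map (cs ! i) ` (F n \<inter> P i)))"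
      unfolding \<nu>_def by (rule suminf_sum) simp
    also have "\<dots> = \<nu> (\<Union>n. F n)"
      unfolding \<nu>_def
    proof (rule sum.cong[OF refl])
      fix i assume "i \<in> {..<k}"
      then have i: "i < k" by simp
      have "(\<Sum>n. emeasure (chart_vol (cs ! i)) (chart_map (cs ! i) ` (F n \<inter> P i)))
          = emeasure (chart_vol (cs ! i)) (\<Union>n. chart_map (cs ! i) ` (F n \<inter> P i))"
      proof (rule suminf_emeasure)
        show "range (\<lambda>n. chart_map (cs ! i) ` (F n \<inter> P i)) \<subseteq> sets (chart_vol (cs ! i))"
          using imm[OF _ i] F(1) by auto
        show "disjoint_family (\<lambda>n. chart_map (cs ! i) ` (F n \<inter> P i))"
          unfolding disjoint_family_on_def
        proof (intro ballI impI)
          fix m n :: nat assume "m \<noteq> n"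
          then have "F m \<inter> F n = {}" using F(2) by (auto simp: disjoint_family_on_def)
          moreover have "F m \<inter> P i \<subseteq> chart_dom (cs ! i)" "F n \<inter> P i \<subseteq> chart_dom (cs ! i)" using Pdom by auto
          ultimately show "chart_map (cs ! i) ` (F m \<inter> P i) \<inter> chart_map (cs ! i) ` (F n \<inter> P i) = {}"
            using inj_on_image_Int[OF chart_inj[OF csA[OF i]], of "F m \<inter> P i" "F n \<inter> P i"] by blast
        qed
      qed
      also have "(\<Union>n. chart_map (cs ! i) ` (F n \<inter> P i)) = chart_map (cs ! i) ` ((\<Union>n. F n) \<inter> P i)" by blast
      finally show "(\<Sum>n. emeasure (chart_vol (cs ! i)) (chart_map (cs ! i) ` (F n \<inter> P i)))
          = emeasure (chart_vol (cs ! i)) (chart_map (cs ! i) ` ((\<Union>n. F n) \<inter> P i))" .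
    qed
    finally show "(\<Sum>n. \<nu> (F n)) = \<nu> (\<Union>n. F n)" .
  qed
  define \<mu> where "\<mu> = measure_of (topspace M) volume_sets \<nu>"
  have sp: "space \<mu> = topspace M" "sets \<mu> = volume_sets"
    unfolding \<mu>_def using ms.space_closed ms.sets_measure_of_eq by (auto simp: space_measure_of)
  have em: "emeasure \<mu> B = \<nu> B" if "B \<in> volume_sets" for B
    unfolding \<mu>_def by (rule emeasure_measure_of_sigma[OF sigma_volume_sets pos ca that])
  have "is_riem_volume M A g \<mu>" unfolding is_riem_volume_iff using sp em main by auto
  moreover have "\<mu>' = \<mu>" if v: "is_riem_volume M A g \<mu>'" for \<mu>'
  proof (rule measure_eqI)
    have v': "space \<mu>' = topspace M" "sets \<mu>' = volume_sets"
      "\<And>c B. c \<in> A \<Longrightarrow> B \<in> volume_sets \<Longrightarrow> B \<subseteq> chart_dom c \<Longrightarrow> emeasure \<mu>' B = emeasure (chart_vol c) (chart_map c ` B)"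
      using v unfolding is_riem_volume_iff by auto
    show "sets \<mu>' = sets \<mu>" using v' sp by simp
    fix B assume "B \<in> sets \<mu>'"
    then have B: "B \<in> volume_sets" using v' by simp
    have "emeasure \<mu>' B = emeasure \<mu>' (\<Union>i<k. B \<inter> P i)"
      using Pcov ms.sets_into_space[OF B] by (intro arg_cong[of _ _ "emeasure \<mu>'"]) blast
    also have "\<dots> = (\<Sum>i<k. emeasure \<mu>' (B \<inter> P i))"
    proof (rule sum_emeasure[symmetric])
      show "(\<lambda>i. B \<inter> P i) ` {..<k} \<subseteq> sets \<mu>'" unfolding v' using B Pm by auto
      show "disjoint_family_on (\<lambda>i. B \<inter> P i) {..<k}" using Pdis by (auto simp: disjoint_family_on_def)
    qed simp
    also have "\<dots> = \<nu> B"
      unfolding \<nu>_def using B Pm Pdom by (intro sum.cong refl v'(3) csA) auto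
    finally show "emeasure \<mu>' B = emeasure \<mu> B" using em[OF B] by simp
  qed
  ultimately show ?thesis by blast
qed

abbreviation vol :: "'a measure" where "vol \<equiv> riem_volume M A g"

lemma vol_is_volume: "is_riem_volume M A g vol"
  unfolding riem_volume_def by (rule theI'[OF ex1_riem_volume])

lemma space_vol [simp]: "space vol = topspace M" and sets_vol: "sets vol = volume_sets"
  using vol_is_volume unfolding is_riem_volume_iff by auto

lemma emeasure_vol:
  "c \<in> A \<Longrightarrow> B \<in> volume_sets \<Longrightarrow> B \<subseteq> chart_dom c \<Longrightarrow> emeasure vol B = emeasure (chart_vol c) (chart_map c ` B)"
  using vol_is_volume unfolding is_riem_volume_iff by blast

lemma emeasure_vol_chart_inv:
  assumes "c \<in> A" "Y \<in> sets lebesgue" "Y \<subseteq> chart_img c"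
  shows "emeasure vol (chart_inv c ` Y) = (\<integral>\<^sup>+y\<in>Y. vol_density c y \<partial>lebesgue)"
proof -
  have "chart_map c ` chart_inv c ` Y = Y" using assms(3) chart_map_inv[of _ c] by (force simp: image_image)
  moreover have "chart_inv c ` Y \<subseteq> chart_dom c" using assms(3) chart_inv_in[of _ c] by auto
  ultimately show ?thesis
    using emeasure_vol[OF assms(1) chart_inv_image_volume_sets[OF assms]] emeasure_chart_vol[OF assms] by simp
qed

lemma borel_measurable_vol_iff:
  fixes f :: "'a \<Rightarrow> 'b::topological_space"
  shows "f \<in> borel_measurable vol \<longleftrightarrow> (\<forall>c\<in>A. \<forall>V. open V \<longrightarrow> {y \<in> chart_img c. f (chart_inv c y) \<in> V} \<in> sets lebesgue)"
proof -
  have eq: "{y \<in> chart_img c. f (chart_inv c y) \<in> V} = chart_map c ` ((f -` V \<inter> topspace M) \<inter> chart_dom c)"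
    if c: "c \<in> A" for c V
  proof (intro subset_antisym subsetI)
    fix y assume "y \<in> {y \<in> chart_img c. f (chart_inv c y) \<in> V}"
    then show "y \<in> chart_map c ` ((f -` V \<inter> topspace M) \<inter> chart_dom c)"
      using chart_map_inv[of y c] chart_inv_in[of y c] chart_inv_top[OF c, of y] by (intro image_eqI[of _ _ "chart_inv c y"]) auto
  next
    fix y assume "y \<in> chart_map c ` ((f -` V \<inter> topspace M) \<inter> chart_dom c)"
    then show "y \<in> {y \<in> chart_img c. f (chart_inv c y) \<in> V}"
      using chart_inv_map[OF c] chart_map_in[of _ c] by fastforce
  qed
  have iff: "f -` V \<inter> topspace M \<in> sets vol \<longleftrightarrow> (\<forall>c\<in>A. {y \<in> chart_img c. f (chart_inv c y) \<in> V} \<in> sets lebesgue)" for V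
  proof -
    have "f -` V \<inter> topspace M \<in> sets vol \<longleftrightarrow> (\<forall>c\<in>A. chart_map c ` ((f -` V \<inter> topspace M) \<inter> chart_dom c) \<in> sets lebesgue)"
      unfolding sets_vol volume_sets_def by simp
    also have "\<dots> \<longleftrightarrow> (\<forall>c\<in>A. {y \<in> chart_img c. f (chart_inv c y) \<in> V} \<in> sets lebesgue)"
      by (intro ball_cong refl) (simp only: eq)
    finally show ?thesis .
  qed
  show ?thesis
  proof
    assume f: "f \<in> borel_measurable vol"
    have "f -` V \<inter> topspace M \<in> sets vol" if "open V" for V
      using measurable_sets[OF f, of V] that by simp
    then show "\<forall>c\<in>A. \<forall>V. open V \<longrightarrow> {y \<in> chart_img c. f (chart_inv c y) \<in> V} \<in> sets lebesgue"
      using iff by blast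
  next
    assume "\<forall>c\<in>A. \<forall>V. open V \<longrightarrow> {y \<in> chart_img c. f (chart_inv c y) \<in> V} \<in> sets lebesgue"
    then have "f -` V \<inter> topspace M \<in> sets vol" if "open V" for V
      using iff that by blast
    then show "f \<in> borel_measurable vol" by (intro borel_measurableI) simp
  qed
qed

lemma AE_volI:
  assumes "\<And>c. c \<in> A \<Longrightarrow> AE y in lebesgue. y \<in> chart_img c \<longrightarrow> P (chart_inv c y)"
  shows "AE x in vol. P x"
proof -
  obtain cs where cs: "set cs \<subseteq> A" "topspace M \<subseteq> (\<Union>c\<in>set cs. chart_dom c)" by (rule finite_subatlas)
  define N where "N c = {y \<in> chart_img c. \<not> P (chart_inv c y)}" for c :: "('a, 'n) chart"
  have N: "negligible (N c)" if c: "c \<in> A" for c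
    using assms[OF c] unfolding N_def eventually_ae_filter_negligible
    by (metis (mono_tags, lifting) mem_Collect_eq negligible_subset subsetI)
  have null: "chart_inv c ` N c \<in> null_sets vol" if c: "c \<in> A" for c
  proof -
    have Nl: "N c \<in> null_sets lebesgue" using N[OF c] by (simp add: negligible_iff_null_sets)
    have "emeasure vol (chart_inv c ` N c) = (\<integral>\<^sup>+y\<in>N c. vol_density c y \<partial>lebesgue)"
      using Nl by (intro emeasure_vol_chart_inv[OF c]) (auto simp: N_def)
    also have "\<dots> = 0" by (rule nn_integral_null_set[OF Nl])
    finally show ?thesis
      using chart_inv_image_volume_sets[OF c, of "N c"] Nl by (auto simp: null_sets_def sets_vol N_def)
  qed
  have "AE x in vol. x \<notin> (\<Union>c\<in>set cs. chart_inv c ` N c)"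
    by (rule AE_not_in) (use null cs(1) in \<open>auto intro!: null_sets.finite_UN\<close>)
  moreover have "AE x in vol. x \<in> topspace M" using AE_space[of vol] by simp
  ultimately show ?thesis
  proof eventually_elim
    case (elim x)
    then obtain c where c: "c \<in> set cs" "x \<in> chart_dom c" using cs(2) by blast
    then have cA: "c \<in> A" using cs(1) by blast
    show ?case
    proof (rule ccontr)
      assume "\<not> P x"
      then have "chart_map c x \<in> N c"
        using chart_inv_map[OF cA c(2)] chart_map_in[OF c(2)] by (simp add: N_def)
      then have "x \<in> chart_inv c ` N c"
        using chart_inv_map[OF cA c(2)] by (intro image_eqI[of _ _ "chart_map c x"]) simp_all
      then show False using elim(1) c(1) by blast
    qed
  qed
qed

text \<open>The inverse of the chart pushes the chart volume forward to the volume on the chart domain.\<close>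

lemma nn_integral_vol_chart:
  assumes c: "c \<in> A" and h: "h \<in> borel_measurable vol"
  shows "(\<integral>\<^sup>+x\<in>chart_dom c. h x \<partial>vol) = (\<integral>\<^sup>+y\<in>chart_img c. h (chart_inv c y) * vol_density c y \<partial>lebesgue)"
proof (cases "chart_dom c = {}")
  case True
  then show ?thesis by (simp add: chart_img_def)
next
  case False
  then obtain x0 where x0: "x0 \<in> topspace M" using dom_subset[OF c] by blast
  \<comment> \<open>off the image of the chart any point serves, as the chart volume vanishes there\<close>
  define f where "f y = (if y \<in> chart_img c then chart_inv c y else x0)" for y
  have vim: "f -` B = chart_map c ` (B \<inter> chart_dom c) \<union> (if x0 \<in> B then - chart_img c else {})" for B
  proof (rule set_eqI)
    fix y
    have "y \<in> chart_map c ` (B \<inter> chart_dom c) \<longleftrightarrow> y \<in> chart_img c \<and> chart_inv c y \<in> B"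
    proof
      assume "y \<in> chart_map c ` (B \<inter> chart_dom c)"
      then show "y \<in> chart_img c \<and> chart_inv c y \<in> B"
        using chart_inv_map[OF c] chart_map_in[of _ c] by fastforce
    next
      assume "y \<in> chart_img c \<and> chart_inv c y \<in> B"
      then show "y \<in> chart_map c ` (B \<inter> chart_dom c)"
        using chart_map_inv[of y c] chart_inv_in[of y c] by (intro image_eqI[of _ _ "chart_inv c y"]) auto
    qed
    then show "y \<in> f -` B \<longleftrightarrow> y \<in> chart_map c ` (B \<inter> chart_dom c) \<union> (if x0 \<in> B then - chart_img c else {})"
      by (auto simp: f_def)
  qed
  have fm: "f \<in> lebesgue \<rightarrow>\<^sub>M vol"
  proof (rule measurableI)
    show "f y \<in> space vol" for y using x0 chart_inv_top[OF c] by (simp add: f_def)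
    fix B assume "B \<in> sets vol"
    then have "chart_map c ` (B \<inter> chart_dom c) \<in> sets lebesgue" using c by (auto simp: sets_vol volume_sets_def)
    then show "f -` B \<inter> space lebesgue \<in> sets lebesgue"
      unfolding vim using chart_img_sets[OF c] by (auto simp: Compl_in_sets_lebesgue)
  qed
  have fm': "f \<in> chart_vol c \<rightarrow>\<^sub>M vol" using fm by (simp add: chart_vol_def)
  have "density vol (indicator (chart_dom c)) = distr (chart_vol c) vol f"
  proof (rule measure_eqI)
    fix B assume "B \<in> sets (density vol (indicator (chart_dom c)))"
    then have B: "B \<in> volume_sets" by (simp add: sets_vol)
    have Bc: "B \<inter> chart_dom c \<in> volume_sets" using B chart_dom_volume_sets[OF c] by auto
    have Y: "chart_map c ` (B \<inter> chart_dom c) \<in> sets lebesgue" using B c by (auto simp: volume_sets_def)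
    have "emeasure (density vol (indicator (chart_dom c))) B = (\<integral>\<^sup>+x. indicator (chart_dom c) x * indicator B x \<partial>vol)"
      using B chart_dom_volume_sets[OF c] by (intro emeasure_density borel_measurable_indicator) (auto simp: sets_vol)
    also have "(\<lambda>x. indicator (chart_dom c) x * indicator B x :: ennreal) = indicator (B \<inter> chart_dom c)"
      by (auto simp: indicator_def)
    also have "integral\<^sup>N vol (indicator (B \<inter> chart_dom c)) = emeasure vol (B \<inter> chart_dom c)"
      by (rule nn_integral_indicator) (use Bc in \<open>simp add: sets_vol\<close>)
    also have "\<dots> = emeasure (chart_vol c) (chart_map c ` (B \<inter> chart_dom c))" by (rule emeasure_vol[OF c Bc]) auto
    also have "\<dots> = emeasure (chart_vol c) (f -` B)"
    proof -
      have "f -` B \<in> sets lebesgue" unfolding vim using Y chart_img_sets[OF c] by (auto simp: Compl_in_sets_lebesgue)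
      then show ?thesis
        unfolding chart_vol_def using Y vol_density_measurable[OF c]
        by (subst (1 2) emeasure_density) (auto intro!: nn_integral_cong simp: vim indicator_def chart_img_def)
    qed
    also have "\<dots> = emeasure (distr (chart_vol c) vol f) B"
      using fm' B by (subst emeasure_distr) (auto simp: sets_vol chart_vol_def)
    finally show "emeasure (density vol (indicator (chart_dom c))) B = emeasure (distr (chart_vol c) vol f) B" .
  qed simp
  then have "(\<integral>\<^sup>+x. h x \<partial>density vol (indicator (chart_dom c))) = (\<integral>\<^sup>+x. h x \<partial>distr (chart_vol c) vol f)" by simp
  moreover have "(\<integral>\<^sup>+x. h x \<partial>density vol (indicator (chart_dom c))) = (\<integral>\<^sup>+x\<in>chart_dom c. h x \<partial>vol)"
    by (subst nn_integral_density[OF borel_measurable_indicator h]) (use chart_dom_volume_sets[OF c] in \<open>auto simp: sets_vol mult.commute\<close>)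
  moreover have "(\<integral>\<^sup>+x. h x \<partial>distr (chart_vol c) vol f) = (\<integral>\<^sup>+y. (vol_density c y * indicator (chart_img c) y) * h (f y) \<partial>lebesgue)"
    using h fm' fm vol_density_measurable[OF c] measurable_compose[OF fm h]
    by (subst nn_integral_distr) (auto simp: chart_vol_def nn_integral_density)
  moreover have "\<dots> = (\<integral>\<^sup>+y\<in>chart_img c. h (chart_inv c y) * vol_density c y \<partial>lebesgue)"
    by (intro nn_integral_cong) (auto simp: f_def indicator_def mult.commute)
  ultimately show ?thesis by simp
qed

end

section \<open>The norm of a differential\<close>

lemma matrix_inv_eqI:
  fixes B C :: "real^'n::finite^'n"
  assumes "B ** C = mat 1" shows "matrix_inv B = C"
proof -
  have "C ** B = mat 1" using assms matrix_left_right_inverse by blast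
  then have "B ** matrix_inv B = mat 1 \<and> matrix_inv B ** B = mat 1"
    unfolding matrix_inv_def using assms by (intro someI[of "\<lambda>A'. B ** A' = mat 1 \<and> A' ** B = mat 1" C]) simp
  then have "matrix_inv B = (C ** B) ** matrix_inv B" using \<open>C ** B = mat 1\<close> by simp
  also have "\<dots> = C" using \<open>B ** matrix_inv B = mat 1 \<and> _\<close> by (simp add: matrix_mul_assoc[symmetric])
  finally show ?thesis .
qed

lemma matrix_inv_inverse:
  fixes B :: "real^'n::finite^'n"
  assumes "det B \<noteq> 0" shows "B ** matrix_inv B = mat 1"
proof -
  have "invertible B" using assms by (simp add: invertible_det_nz)
  then obtain C where "B ** C = mat 1" unfolding invertible_def by blast
  then show ?thesis using matrix_inv_eqI by metis
qed

text \<open>By Cramer's rule the entries of the inverse are quotients of determinants.\<close>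

lemma continuous_on_matrix_inv:
  fixes F :: "'c::topological_space \<Rightarrow> real^'n::finite^'n"
  assumes F: "continuous_on S F" "\<And>y. y \<in> S \<Longrightarrow> det (F y) \<noteq> 0"
  shows "continuous_on S (\<lambda>y. matrix_inv (F y))"
proof (rule continuous_on_matrix)
  fix k j
  have "matrix_inv (F y) $ k $ j = det (\<chi> i l. if l = k then axis j 1 $ i else F y $ i $ l) / det (F y)" if "y \<in> S" for y
  proof -
    have "F y *v (matrix_inv (F y) *v axis j 1) = axis j 1"
      using matrix_inv_inverse[OF F(2)[OF that]] by (simp add: matrix_vector_mul_assoc)
    then have "matrix_inv (F y) *v axis j 1 = (\<chi> k. det (\<chi> i l. if l = k then axis j 1 $ i else F y $ i $ l) / det (F y))"
      using cramer[OF F(2)[OF that]] by blast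
    then show ?thesis by (simp add: matrix_vector_mult_basis column_def vec_eq_iff)
  qed
  moreover have "continuous_on S (\<lambda>y. det (\<chi> i l. if l = k then axis j 1 $ i else F y $ i $ l) / det (F y))"
  proof (intro continuous_on_divide continuous_on_det F(1))
    show "continuous_on S (\<lambda>y. \<chi> i l. if l = k then axis j 1 $ i else F y $ i $ l)"
    proof (intro continuous_on_vec_lambda)
      fix i l
      show "continuous_on S (\<lambda>y. if l = k then axis j 1 $ i else F y $ i $ l)"
        by (cases "l = k") (auto intro!: continuous_on_component F(1))
    qed
  qed (use F(2) in auto)
  ultimately show "continuous_on S (\<lambda>y. matrix_inv (F y) $ k $ j)"
    by (simp cong: continuous_on_cong)
qed

lemma trace_conjugate:
  fixes T :: "real^'n::finite^'m::finite"
  shows "trace (T ** B ** transpose T) = (\<Sum>k\<in>UNIV. T $ k \<bullet> (B *v T $ k))"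
proof -
  have "(\<Sum>j\<in>UNIV. (\<Sum>i\<in>UNIV. T $ k $ i * B $ i $ j) * T $ k $ j) = T $ k \<bullet> (B *v T $ k)" for k
    by (simp add: inner_vec_def matrix_vector_mult_def sum_distrib_left sum_distrib_right mult.assoc) (rule sum.swap)
  then show ?thesis by (simp add: trace_def matrix_matrix_mult_def transpose_def)
qed

context closed_riemannian
begin

text \<open>The square of \<^const>\<open>differential_norm\<close> for the coordinate expression \<open>T\<close> in the chart \<open>c\<close>.\<close>

definition sqnorm_at :: "('a, 'n) chart \<Rightarrow> real^'n \<Rightarrow> real^'n^'m::finite \<Rightarrow> real" where
  "sqnorm_at c y T = trace (T ** matrix_inv (g c y) ** transpose T)"

lemma sqnorm_at_eq: "sqnorm_at c y T = (\<Sum>k\<in>UNIV. T $ k \<bullet> (matrix_inv (g c y) *v T $ k))"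
  by (simp add: sqnorm_at_def trace_conjugate)

lemma metric_inv:
  assumes "c \<in> A" "y \<in> chart_img c"
  shows "g c y ** matrix_inv (g c y) = mat 1" "g c y *v (matrix_inv (g c y) *v d) = d"
proof -
  show 1: "g c y ** matrix_inv (g c y) = mat 1"
    using metric_det_pos[OF assms] by (intro matrix_inv_inverse) simp
  show "g c y *v (matrix_inv (g c y) *v d) = d" using 1 by (simp add: matrix_vector_mul_assoc)
qed

lemma inverse_metric_form:
  assumes "c \<in> A" "y \<in> chart_img c"
  shows "d \<bullet> (matrix_inv (g c y) *v d) = (matrix_inv (g c y) *v d) \<bullet> (g c y *v (matrix_inv (g c y) *v d))"
    "d \<bullet> (matrix_inv (g c y) *v d) \<ge> 0"
proof -
  show 1: "d \<bullet> (matrix_inv (g c y) *v d) = (matrix_inv (g c y) *v d) \<bullet> (g c y *v (matrix_inv (g c y) *v d))"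
    using metric_inv(2)[OF assms] by (simp add: inner_commute)
  show "d \<bullet> (matrix_inv (g c y) *v d) \<ge> 0"
    unfolding 1 using metric_pos[OF assms, of "matrix_inv (g c y) *v d"]
    by (cases "matrix_inv (g c y) *v d = 0") (auto simp: less_imp_le)
qed

lemma sqnorm_at_nonneg: "c \<in> A \<Longrightarrow> y \<in> chart_img c \<Longrightarrow> sqnorm_at c y T \<ge> 0"
  unfolding sqnorm_at_eq by (intro sum_nonneg inverse_metric_form)

text \<open>The parallelogram law for the inverse metric.\<close>

lemma sqnorm_at_diff_le:
  assumes "c \<in> A" "y \<in> chart_img c"
  shows "sqnorm_at c y (T - T') \<le> 2 * sqnorm_at c y T + 2 * sqnorm_at c y T'"
proof -
  let ?q = "\<lambda>d. d \<bullet> (matrix_inv (g c y) *v d)"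
  have "?q (a - b) \<le> 2 * ?q a + 2 * ?q b" for a b
  proof -
    have "?q (a - b) + ?q (a + b) = 2 * ?q a + 2 * ?q b"
      by (simp add: matrix_vector_mult_diff_distrib matrix_vector_right_distrib inner_diff_left inner_add_left inner_diff_right inner_add_right)
    then show ?thesis using inverse_metric_form(2)[OF assms, of "a + b"] by linarith
  qed
  then have "sqnorm_at c y (T - T') \<le> (\<Sum>k\<in>UNIV. 2 * ?q (T $ k) + 2 * ?q (T' $ k))"
    unfolding sqnorm_at_eq by (intro sum_mono) simp
  then show ?thesis by (simp add: sqnorm_at_eq sum.distrib sum_distrib_left)
qed

lemma sqnorm_at_transition:
  assumes cd: "c \<in> A" "d \<in> A" and y: "y \<in> overlap c d"
  shows "sqnorm_at c y (T ** jacobian c d y) = sqnorm_at d (transition c d y) T"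
proof -
  let ?J = "jacobian c d y" and ?K = "jacobian d c (transition c d y)" and ?h = "g d (transition c d y)"
  have KJ: "?K ** ?J = mat 1" by (rule jacobian_inverse[OF cd y])
  then have JK: "?J ** ?K = mat 1" using matrix_left_right_inverse by blast
  have ty: "transition c d y \<in> chart_img d" using transition_in[OF cd y] overlap_subset[OF cd(2)] by blast
  have tKJ: "transpose ?J ** transpose ?K = mat 1"
    using arg_cong[OF KJ, of transpose] by (simp add: matrix_transpose_mul)
  have tJK: "transpose ?K ** transpose ?J = mat 1"
    using arg_cong[OF JK, of transpose] by (simp add: matrix_transpose_mul)
  have "g c y ** (?K ** matrix_inv ?h ** transpose ?K) = transpose ?J ** (?h ** ((?J ** ?K) ** matrix_inv ?h)) ** transpose ?K"
    unfolding metric_law[OF cd y] by (simp add: matrix_mul_assoc)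
  also have "\<dots> = mat 1" using JK metric_inv(1)[OF cd(2) ty] tKJ by simp
  finally have inv: "matrix_inv (g c y) = ?K ** matrix_inv ?h ** transpose ?K" by (rule matrix_inv_eqI)
  have "(T ** ?J) ** matrix_inv (g c y) ** transpose (T ** ?J)
      = T ** ((?J ** ?K) ** matrix_inv ?h ** (transpose ?K ** transpose ?J)) ** transpose T"
    unfolding inv by (simp add: matrix_transpose_mul matrix_mul_assoc)
  then show ?thesis using JK tJK by (simp add: sqnorm_at_def)
qed

definition covector_law :: "(('a, 'n) chart \<Rightarrow> real^'n \<Rightarrow> real^'n^'m::finite) \<Rightarrow> bool" where
  "covector_law D \<longleftrightarrow> (\<forall>c\<in>A. \<forall>d\<in>A. \<forall>y\<in>overlap c d. D c y = D d (transition c d y) ** jacobian c d y)"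

lemma has_weak_differential_iff:
  "has_weak_differential A u D \<longleftrightarrow>
     (\<forall>c\<in>A. has_weak_derivative_on (u \<circ> chart_inv c) (D c) (chart_img c)) \<and> covector_law D"
  by (simp add: has_weak_differential_def covector_law_def overlap_def)

lemma differential_norm_chart:
  assumes D: "covector_law D" and c: "c \<in> A" and y: "y \<in> chart_img c"
  shows "differential_norm A g D (chart_inv c y) = sqrt (sqnorm_at c y (D c y))"
proof -
  let ?d = "chart_at A (chart_inv c y)"
  have d: "?d \<in> A" "chart_inv c y \<in> chart_dom ?d" using chart_at[OF chart_inv_top[OF c y]] by auto
  then have ov: "y \<in> overlap c ?d" using overlap_iff[OF c] y by simp
  have law: "D c y = D ?d (transition c ?d y) ** jacobian c ?d y" using D c d(1) ov unfolding covector_law_def by blast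
  have "sqnorm_at c y (D c y) = sqnorm_at ?d (transition c ?d y) (D ?d (transition c ?d y))"
    by (rule trans[OF arg_cong[OF law, of "sqnorm_at c y"] sqnorm_at_transition[OF c d(1) ov]])
  moreover have "differential_norm A g D (chart_inv c y) = sqrt (sqnorm_at ?d (transition c ?d y) (D ?d (transition c ?d y)))"
    by (simp add: differential_norm_def Let_def sqnorm_at_def transition_eq)
  ultimately show ?thesis by (simp only:)
qed

text \<open>The metric is continuous and positive on the product of \<open>K\<close> with the unit sphere, which is compact.\<close>

lemma metric_bounds:
  assumes c: "c \<in> A" and K: "compact K" "K \<subseteq> chart_img c"
  obtains m C where "m > 0" "C > 0"
    "\<And>y v. y \<in> K \<Longrightarrow> m * norm v \<le> sqrt (v \<bullet> (g c y *v v)) \<and> sqrt (v \<bullet> (g c y *v v)) \<le> C * norm v"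
    "\<And>y (T :: real^'n^'m::finite). y \<in> K \<Longrightarrow> m * norm T \<le> sqrt (sqnorm_at c y T) \<and> sqrt (sqnorm_at c y T) \<le> C * norm T"
    "\<And>y. y \<in> K \<Longrightarrow> m \<le> sqrt (det (g c y)) \<and> sqrt (det (g c y)) \<le> C"
proof (cases "K = {}")
  case True
  then show ?thesis using that[of 1 1] by simp
next
  case False
  let ?S = "K \<times> sphere (0::real^'n) 1"
  have "axis (SOME i. True) 1 \<in> sphere (0::real^'n) 1" by (simp add: norm_axis_1)
  then have S: "compact ?S" "?S \<noteq> {}" using K False by (auto intro: compact_Times)
  have gc: "continuous_on K (g c)" using metric_cont[OF c] K(2) continuous_on_subset by blast
  have gv: "continuous_on ?S (\<lambda>p. g c (fst p) *v snd p)"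
    unfolding matrix_vector_mult_def
    by (intro continuous_on_vec_lambda continuous_intros continuous_on_component
        continuous_on_compose2[OF gc continuous_on_fst[OF continuous_on_id]]) auto
  have q: "continuous_on ?S (\<lambda>p. snd p \<bullet> (g c (fst p) *v snd p))" by (intro continuous_intros gv)
  obtain p where p: "p \<in> ?S" "\<And>p'. p' \<in> ?S \<Longrightarrow> snd p \<bullet> (g c (fst p) *v snd p) \<le> snd p' \<bullet> (g c (fst p') *v snd p')"
    using continuous_attains_inf[OF S q] by blast
  define a where "a = snd p \<bullet> (g c (fst p) *v snd p)"
  have "snd p \<noteq> 0" using p(1) by auto
  then have a: "a > 0" unfolding a_def using p(1) K(2) by (intro metric_pos[OF c]) auto
  obtain b where b: "b > 0" "\<And>p. p \<in> ?S \<Longrightarrow> norm (g c (fst p) *v snd p) \<le> b"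
    using compact_imp_bounded[OF compact_continuous_image[OF gv S(1)]] by (auto simp: bounded_pos)
  have scal: "v = norm v *\<^sub>R (v /\<^sub>R norm v)" "v /\<^sub>R norm v \<in> sphere 0 1" if "v \<noteq> 0" for v :: "real^'n"
    using that by auto
  have lo: "a * (norm v)\<^sup>2 \<le> v \<bullet> (g c y *v v)" if "y \<in> K" for y v
  proof (cases "v = 0")
    case False
    let ?u = "v /\<^sub>R norm v"
    have "a \<le> ?u \<bullet> (g c y *v ?u)" using p(2)[of "(y, ?u)"] that scal(2)[OF False] by (simp add: a_def)
    also have "\<dots> = (v \<bullet> (g c y *v v)) / (norm v)\<^sup>2"
      by (simp add: matrix_vector_mult_scaleR power2_eq_square divide_inverse mult_ac)
    finally show ?thesis using False by (simp add: pos_le_divide_eq)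
  qed simp
  have up: "norm (g c y *v v) \<le> b * norm v" if "y \<in> K" for y v
  proof (cases "v = 0")
    case False
    let ?u = "v /\<^sub>R norm v"
    have "norm (g c y *v ?u) \<le> b" using b(2)[of "(y, ?u)"] that scal(2)[OF False] by simp
    moreover have "norm (g c y *v ?u) = norm (g c y *v v) / norm v"
      by (simp add: matrix_vector_mult_scaleR divide_inverse mult.commute)
    ultimately show ?thesis using False by (simp add: pos_divide_le_eq)
  qed simp
  have q1: "(a / b\<^sup>2) * (norm d)\<^sup>2 \<le> d \<bullet> (matrix_inv (g c y) *v d)" "d \<bullet> (matrix_inv (g c y) *v d) \<le> (1 / a) * (norm d)\<^sup>2"
    if y: "y \<in> K" for y d
  proof -
    have yi: "y \<in> chart_img c" using y K(2) by blast
    define w where "w = matrix_inv (g c y) *v d"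
    have gw: "g c y *v w = d" unfolding w_def by (rule metric_inv(2)[OF c yi])
    have e: "d \<bullet> w = w \<bullet> (g c y *v w)" using gw by (simp add: inner_commute)
    have "norm d \<le> b * norm w" using up[OF y, of w] gw by simp
    then have "(norm d)\<^sup>2 \<le> b\<^sup>2 * (norm w)\<^sup>2" by (metis norm_ge_zero power_mono power_mult_distrib)
    then have "(a / b\<^sup>2) * (norm d)\<^sup>2 \<le> (a / b\<^sup>2) * (b\<^sup>2 * (norm w)\<^sup>2)" using a b(1) by (intro mult_left_mono) auto
    also have "\<dots> = a * (norm w)\<^sup>2" using b(1) by simp
    also have "\<dots> \<le> d \<bullet> w" unfolding e by (rule lo[OF y])
    finally show "(a / b\<^sup>2) * (norm d)\<^sup>2 \<le> d \<bullet> (matrix_inv (g c y) *v d)" by (simp add: w_def)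
    have "a * (norm w)\<^sup>2 \<le> d \<bullet> w" unfolding e by (rule lo[OF y])
    also have dw: "d \<bullet> w \<le> norm d * norm w" by (rule norm_cauchy_schwarz)
    finally have "a * norm w \<le> norm d" by (cases "w = 0") (auto simp: power2_eq_square mult.assoc[symmetric])
    then have "norm d * norm w \<le> norm d * (norm d / a)" using a by (intro mult_left_mono) (auto simp: pos_le_divide_eq mult.commute)
    with dw show "d \<bullet> (matrix_inv (g c y) *v d) \<le> (1 / a) * (norm d)\<^sup>2" by (simp add: w_def power2_eq_square)
  qed
  have nT: "(norm T)\<^sup>2 = (\<Sum>k\<in>UNIV. (norm (T $ k))\<^sup>2)" for T :: "real^'n^'m"
    by (simp add: norm_vec_def[of T] L2_set_def sum_nonneg)
  have gsqb: "(a / b\<^sup>2) * (norm T)\<^sup>2 \<le> sqnorm_at c y T" "sqnorm_at c y T \<le> (1 / a) * (norm T)\<^sup>2" if "y \<in> K" for y and T :: "real^'n^'m"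
    unfolding nT sqnorm_at_eq sum_distrib_left using q1[OF that] by (auto intro!: sum_mono)
  have dc: "continuous_on K (\<lambda>y. sqrt (det (g c y)))" by (intro continuous_intros continuous_on_det gc)
  obtain y1 where y1: "y1 \<in> K" "\<And>y. y \<in> K \<Longrightarrow> sqrt (det (g c y1)) \<le> sqrt (det (g c y))"
    using continuous_attains_inf[OF K(1) False dc] by blast
  obtain y2 where y2: "y2 \<in> K" "\<And>y. y \<in> K \<Longrightarrow> sqrt (det (g c y)) \<le> sqrt (det (g c y2))"
    using continuous_attains_sup[OF K(1) False dc] by blast
  have d1: "sqrt (det (g c y1)) > 0" using metric_det_pos[OF c] y1(1) K(2) by auto
  define m where "m = min (sqrt a) (min (sqrt (a / b\<^sup>2)) (sqrt (det (g c y1))))"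
  define C where "C = Max {sqrt b, sqrt (1 / a), sqrt (det (g c y2))}"
  have m: "m > 0" using a b(1) d1 by (simp add: m_def)
  have C: "C > 0" "sqrt b \<le> C" "sqrt (1 / a) \<le> C" "sqrt (det (g c y2)) \<le> C"
    using b(1) by (auto simp: C_def less_max_iff_disj)
  have root: "m * r \<le> sqrt Q" if "m \<le> sqrt k" "k * r\<^sup>2 \<le> Q" "r \<ge> 0" "k \<ge> 0" for k r Q
  proof -
    have "m * r \<le> sqrt k * r" using that by (intro mult_right_mono) auto
    also have "\<dots> = sqrt (k * r\<^sup>2)" using that by (simp add: real_sqrt_mult)
    also have "\<dots> \<le> sqrt Q" using that by simp
    finally show ?thesis .
  qed
  have root': "sqrt Q \<le> C * r" if "sqrt k \<le> C" "Q \<le> k * r\<^sup>2" "r \<ge> 0" for k r Q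
  proof -
    have "sqrt Q \<le> sqrt (k * r\<^sup>2)" using that by simp
    also have "\<dots> = sqrt k * r" using that by (simp add: real_sqrt_mult)
    also have "\<dots> \<le> C * r" using that by (intro mult_right_mono) auto
    finally show ?thesis .
  qed
  show ?thesis
  proof (rule that[OF m C(1)])
    fix y assume y: "y \<in> K"
    show "m * norm v \<le> sqrt (v \<bullet> (g c y *v v)) \<and> sqrt (v \<bullet> (g c y *v v)) \<le> C * norm v" for v
    proof
      show "m * norm v \<le> sqrt (v \<bullet> (g c y *v v))" by (rule root[OF _ lo[OF y]]) (use a in \<open>auto simp: m_def\<close>)
      have "v \<bullet> (g c y *v v) \<le> norm v * (b * norm v)"
        by (rule order_trans[OF norm_cauchy_schwarz]) (intro mult_left_mono up[OF y], simp)
      then show "sqrt (v \<bullet> (g c y *v v)) \<le> C * norm v"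
        by (intro root'[OF C(2)]) (auto simp: power2_eq_square mult_ac)
    qed
    show "m * norm T \<le> sqrt (sqnorm_at c y T) \<and> sqrt (sqnorm_at c y T) \<le> C * norm T" for T :: "real^'n^'m"
    proof
      show "m * norm T \<le> sqrt (sqnorm_at c y T)" by (rule root[OF _ gsqb(1)[OF y]]) (use a in \<open>auto simp: m_def\<close>)
      show "sqrt (sqnorm_at c y T) \<le> C * norm T" by (rule root'[OF C(3) gsqb(2)[OF y]]) simp
    qed
    show "m \<le> sqrt (det (g c y)) \<and> sqrt (det (g c y)) \<le> C"
    proof
      have "m \<le> sqrt (det (g c y1))" by (simp add: m_def)
      then show "m \<le> sqrt (det (g c y))" using y1(2)[OF y] by (rule order_trans)
      show "sqrt (det (g c y)) \<le> C" using y2(2)[OF y] C(4) by (rule order_trans)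
    qed
  qed
qed

text \<open>The concentric balls of radius \<open>r\<close>, \<open>2 r\<close>, \<open>3 r\<close> and \<open>4 r\<close> play different roles: the smallest cover the
  manifold, a point of such a ball is compared with the points of the second, balls that are centred
  in the third and have radius at most \<open>r\<close> lie in the largest, and there the gradient is integrated.\<close>

lemma good_cover:
  obtains I where "finite I" "\<And>c p r. (c, p, r) \<in> I \<Longrightarrow> c \<in> A \<and> r > 0 \<and> cball p (4 * r) \<subseteq> chart_img c"
    "\<And>x. x \<in> topspace M \<Longrightarrow> \<exists>(c, p, r)\<in>I. x \<in> chart_dom c \<and> chart_map c x \<in> ball p r"
proof -
  define J where "J = {(c, p, r). c \<in> A \<and> r > 0 \<and> cball p (4 * r) \<subseteq> chart_img c}"
  define V where "V = (\<lambda>(c :: ('a, 'n) chart, p :: real^'n, r :: real). {x \<in> chart_dom c. chart_map c x \<in> ball p r})"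
  have op: "openin M (V j)" if "j \<in> J" for j
    using that unfolding J_def V_def by (auto intro!: openin_chart_vimage simp del: mem_ball)
  have cov: "topspace M \<subseteq> \<Union>(V ` J)"
  proof
    fix x assume "x \<in> topspace M"
    then obtain c where c: "c \<in> A" "x \<in> chart_dom c" using ex_chart by blast
    then obtain e where e: "e > 0" "cball (chart_map c x) e \<subseteq> chart_img c"
      using open_img[OF c(1)] chart_map_in[OF c(2)] open_contains_cball by blast
    then have "(c, chart_map c x, e / 4) \<in> J" using c by (simp add: J_def)
    moreover have "x \<in> V (c, chart_map c x, e / 4)" using c e by (simp add: V_def)
    ultimately show "x \<in> \<Union>(V ` J)" by blast
  qed
  have "\<exists>F. finite F \<and> F \<subseteq> V ` J \<and> topspace M \<subseteq> \<Union>F"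
    using compact_M op cov unfolding compact_space_alt by (metis (no_types, lifting) imageE)
  then obtain I where I: "finite I" "I \<subseteq> J" "topspace M \<subseteq> \<Union>(V ` I)" by (metis finite_subset_image)
  show ?thesis
  proof (rule that[OF I(1)])
    show "c \<in> A \<and> r > 0 \<and> cball p (4 * r) \<subseteq> chart_img c" if "(c, p, r) \<in> I" for c p r
      using that I(2) by (auto simp: J_def)
    show "\<exists>(c, p, r)\<in>I. x \<in> chart_dom c \<and> chart_map c x \<in> ball p r" if "x \<in> topspace M" for x
      using that I(3) by (fastforce simp: V_def)
  qed
qed

lemma finite_vol: "emeasure vol (topspace M) < \<infinity>"
proof -
  obtain I where I: "finite I" "\<And>c p r. (c, p, r) \<in> I \<Longrightarrow> c \<in> A \<and> r > 0 \<and> cball p (4 * r) \<subseteq> chart_img c"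
    "\<And>x. x \<in> topspace M \<Longrightarrow> \<exists>(c, p, r)\<in>I. x \<in> chart_dom c \<and> chart_map c x \<in> ball p r" by (rule good_cover) (rule that)
  define B where "B = (\<lambda>(c :: ('a, 'n) chart, p :: real^'n, r :: real). chart_inv c ` cball p (4 * r))"
  have fin: "emeasure vol (B j) < \<infinity> \<and> B j \<in> sets vol" if jI: "j \<in> I" for j
  proof -
    obtain c p r where j: "j = (c, p, r)" by (cases j)
    note I' = I(2)[of c p r, folded j, OF jI]
    have K: "cball p (4 * r) \<in> sets lebesgue" "cball p (4 * r) \<subseteq> chart_img c" using I' by auto
    obtain m C where C: "C > 0" "\<And>y. y \<in> cball p (4 * r) \<Longrightarrow> m \<le> sqrt (det (g c y)) \<and> sqrt (det (g c y)) \<le> C"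
      using metric_bounds[of c "cball p (4 * r)", where 'm='n] I' by (metis compact_cball)
    have "emeasure vol (B j) = (\<integral>\<^sup>+y\<in>cball p (4 * r). vol_density c y \<partial>lebesgue)"
      using emeasure_vol_chart_inv[of c "cball p (4 * r)"] I' K by (simp add: B_def j)
    also have "\<dots> \<le> (\<integral>\<^sup>+y. ennreal C * indicator (cball p (4 * r)) y \<partial>lebesgue)"
      using C(2) by (intro nn_integral_mono) (auto simp: vol_density_def indicator_def intro!: ennreal_leI)
    also have "\<dots> = ennreal C * emeasure lebesgue (cball p (4 * r))"
      using K(1) by (rule nn_integral_cmult_indicator)
    also have "\<dots> < \<infinity>" using emeasure_lborel_cball_finite[of p "4 * r"] by (simp add: ennreal_mult_less_top)
    finally show ?thesis using chart_inv_image_volume_sets[of c "cball p (4 * r)"] I' K by (simp add: B_def j sets_vol)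
  qed
  have "topspace M \<subseteq> (\<Union>j\<in>I. B j)"
  proof
    fix x assume "x \<in> topspace M"
    then obtain c p r where j: "(c, p, r) \<in> I" "x \<in> chart_dom c" "chart_map c x \<in> ball p r" using I(3) by fastforce
    have "chart_map c x \<in> cball p (4 * r)" using j(3) I(2)[OF j(1)] by simp
    moreover have "x = chart_inv c (chart_map c x)" using chart_inv_map[of c x] I(2)[OF j(1)] j(2) by simp
    ultimately have "x \<in> B (c, p, r)" unfolding B_def by (simp del: mem_cball)
    then show "x \<in> (\<Union>j\<in>I. B j)" using j(1) by blast
  qed
  then have "emeasure vol (topspace M) \<le> emeasure vol (\<Union>j\<in>I. B j)" using fin I(1) by (intro emeasure_mono) auto
  also have "\<dots> \<le> (\<Sum>j\<in>I. emeasure vol (B j))" using fin by (intro emeasure_subadditive_finite I(1)) auto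
  also have "\<dots> < \<infinity>" using fin I(1) by (simp add: less_top[symmetric])
  finally show ?thesis .
qed

lemma differential_norm_measurable:
  fixes D :: "('a, 'n) chart \<Rightarrow> real^'n \<Rightarrow> real^'n^'m::finite"
  assumes D: "covector_law D" and li: "\<And>c. c \<in> A \<Longrightarrow> locally_integrable (chart_img c) (D c)"
  shows "differential_norm A g D \<in> borel_measurable vol"
  unfolding borel_measurable_vol_iff
proof (intro ballI allI impI)
  fix c V assume c: "c \<in> A" and V: "open (V :: real set)"
  define i where "i = (indicator (chart_img c) :: real^'n \<Rightarrow> real)"
  have Dm: "(\<lambda>y. i y *\<^sub>R D c y) \<in> borel_measurable lebesgue"
    unfolding i_def by (rule locally_integrable_measurable[OF open_img[OF c] li[OF c]])
  have comp: "(\<lambda>y. F y $ k $ l) \<in> borel_measurable lebesgue"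
    if F: "F \<in> borel_measurable lebesgue" for F :: "real^'n \<Rightarrow> real^'n^'p::finite" and k l
  proof -
    have "continuous_on UNIV (\<lambda>T::real^'n^'p. T $ k $ l)" by (intro continuous_on_component continuous_on_id)
    from measurable_compose[OF F borel_measurable_continuous_onI[OF this]] show ?thesis .
  qed
  have "continuous_on (chart_img c) (\<lambda>y. matrix_inv (g c y))"
    using metric_det_pos[OF c] by (intro continuous_on_matrix_inv metric_cont c) force
  then have "(\<lambda>y. i y *\<^sub>R matrix_inv (g c y)) \<in> borel_measurable borel"
    unfolding i_def using open_img[OF c] by (intro borel_measurable_continuous_on_indicator) auto
  then have Im: "(\<lambda>y. i y *\<^sub>R matrix_inv (g c y)) \<in> borel_measurable lebesgue" by (intro measurable_completion) simp
  define Q where "Q y = (\<Sum>k\<in>UNIV. \<Sum>a\<in>UNIV. \<Sum>b\<in>UNIV. (i y *\<^sub>R D c y) $ k $ a * ((i y *\<^sub>R matrix_inv (g c y)) $ a $ b * (i y *\<^sub>R D c y) $ k $ b))" for y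
  have Qm: "(\<lambda>y. sqrt (Q y)) \<in> borel_measurable lebesgue"
    unfolding Q_def
    by (intro measurable_compose[OF _ borel_measurable_sqrt] borel_measurable_sum borel_measurable_times comp[OF Dm] comp[OF Im])
  have "{y \<in> chart_img c. differential_norm A g D (chart_inv c y) \<in> V} = chart_img c \<inter> ((\<lambda>y. sqrt (Q y)) -` V \<inter> space lebesgue)"
  proof -
    have "differential_norm A g D (chart_inv c y) = sqrt (Q y)" if "y \<in> chart_img c" for y
      unfolding differential_norm_chart[OF D c that]
      using that by (simp add: sqnorm_at_eq Q_def i_def inner_vec_def matrix_vector_mult_def sum_distrib_left)
    then show ?thesis by auto
  qed
  then show "{y \<in> chart_img c. differential_norm A g D (chart_inv c y) \<in> V} \<in> sets lebesgue"
    using measurable_sets[OF Qm, of V] V chart_img_sets[OF c] by auto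
qed

end

section \<open>Lengths of curves and coordinates\<close>

context closed_riemannian
begin

text \<open>The speed is evaluated in the chart that is selected at the point; the transformation laws of the
  velocity and of the metric cancel.\<close>

lemma curve_speed_chart:
  assumes \<gamma>: "\<gamma> t \<in> chart_dom c" and c: "c \<in> A" and dif: "((chart_map c \<circ> \<gamma>) has_vector_derivative v) (at t)"
    and ev: "\<forall>\<^sub>F s in at t. \<gamma> s \<in> chart_dom c"
    and ev': "\<forall>\<^sub>F s in at t. \<gamma> s \<in> chart_dom (chart_at A (\<gamma> t))"
  shows "curve_speed A g \<gamma> t = sqrt (v \<bullet> (g c (chart_map c (\<gamma> t)) *v v))"
proof -
  let ?d = "chart_at A (\<gamma> t)" and ?y = "chart_map c (\<gamma> t)"
  have d: "?d \<in> A" "\<gamma> t \<in> chart_dom ?d" using chart_at[of "\<gamma> t"] dom_subset[OF c] \<gamma> by auto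
  have yo: "?y \<in> overlap c ?d" using \<gamma> d(2) by (auto simp: overlap_def)
  have ty: "transition c ?d ?y = chart_map ?d (\<gamma> t)" by (simp add: transition_eq chart_inv_map[OF c \<gamma>])
  let ?J = "jacobian c ?d ?y"
  have "((\<lambda>s. transition c ?d ((chart_map c \<circ> \<gamma>) s)) has_derivative (\<lambda>h. ?J *v (h *\<^sub>R v))) (at t)"
    by (rule has_derivative_compose[OF dif[unfolded has_vector_derivative_def]])
      (use transition_derivative[OF c d(1) yo] in simp)
  then have "((\<lambda>s. transition c ?d ((chart_map c \<circ> \<gamma>) s)) has_vector_derivative (?J *v v)) (at t)"
    by (simp add: has_vector_derivative_def matrix_vector_mult_scaleR)
  moreover have "\<forall>\<^sub>F s in at t. transition c ?d ((chart_map c \<circ> \<gamma>) s) = (chart_map ?d \<circ> \<gamma>) s"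
    using ev by eventually_elim (simp add: transition_eq chart_inv_map[OF c])
  ultimately have "((chart_map ?d \<circ> \<gamma>) has_vector_derivative (?J *v v)) (at t)"
    unfolding has_vector_derivative_def
    by (rule has_derivative_transform_eventually) (use ty in auto)
  then have vd: "vector_derivative (chart_map ?d \<circ> \<gamma>) (at t) = ?J *v v" by (rule vector_derivative_at)
  have "v \<bullet> (g c ?y *v v) = v \<bullet> ((transpose ?J ** g ?d (transition c ?d ?y) ** ?J) *v v)"
    by (simp only: metric_law[OF c d(1) yo])
  also have "\<dots> = (?J *v v) \<bullet> (g ?d (transition c ?d ?y) *v (?J *v v))"
  proof -
    have "v \<bullet> (transpose ?J *v w) = (?J *v v) \<bullet> w" for w
    proof -
      have "v \<bullet> (transpose ?J *v w) = (w v* ?J) \<bullet> v" by (simp add: transpose_matrix_vector inner_commute)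
      also have "\<dots> = w \<bullet> (?J *v v)" by (rule dot_lmul_matrix)
      finally show ?thesis by (simp only: inner_commute)
    qed
    then show ?thesis by (simp only: matrix_vector_mul_assoc[symmetric])
  qed
  finally show ?thesis by (simp add: curve_speed_def Let_def vd ty)
qed

lemma curve_eventually_in:
  assumes \<gamma>: "continuous_map (top_of_set {0..1}) M \<gamma>" and U: "openin M U" and t: "t \<in> {0<..<1::real}" "\<gamma> t \<in> U"
  shows "\<forall>\<^sub>F s in at t. \<gamma> s \<in> U"
proof -
  have "openin (top_of_set {0..1}) {s \<in> {0..1}. \<gamma> s \<in> U}"
    using openin_continuous_map_preimage[OF \<gamma> U] by simp
  then have "\<exists>W. open W \<and> {s \<in> {0..1}. \<gamma> s \<in> U} = {0..1} \<inter> W" by (simp only: openin_open)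
  then obtain W where W: "open W" "{s \<in> {0..1}. \<gamma> s \<in> U} = {0..1} \<inter> W" by (elim exE conjE) (rule that)
  have "t \<in> {s \<in> {0..1}. \<gamma> s \<in> U}" using t by simp
  then have "t \<in> {0<..<1} \<inter> W" unfolding W(2) using t(1) by simp
  moreover have "open ({0<..<1} \<inter> W)" using W(1) by (intro open_Int) auto
  ultimately have "\<forall>\<^sub>F s in at t. s \<in> {0<..<1} \<inter> W" by (intro eventually_at_in_open')
  then show ?thesis
  proof (rule eventually_mono)
    fix s assume "s \<in> {0<..<1} \<inter> W"
    then have "s \<in> {0..1} \<inter> W" by simp
    then show "\<gamma> s \<in> U" unfolding W(2)[symmetric] by simp
  qed
qed

text \<open>Along a curve the function changes at most at the rate \<open>L\<close> times the speed: inside the chart because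
  the metric is bounded below on \<open>K\<close>, and elsewhere because the function vanishes near the curve.\<close>

lemma compactly_supported_lipschitz:
  fixes F :: "real^'n \<Rightarrow> 'b::euclidean_space"
  assumes c: "c \<in> A" and K: "compact K" "K \<subseteq> chart_img c"
    and F: "\<And>y. y \<in> chart_img c \<Longrightarrow> (F has_derivative F' y) (at y)"
    and F0: "\<And>y. y \<notin> K \<Longrightarrow> F y = 0"
    and B: "\<And>y v. y \<in> chart_img c \<Longrightarrow> norm (F' y v) \<le> B * norm v * indicator K y" "B \<ge> 0"
  defines "H \<equiv> \<lambda>x. if x \<in> chart_dom c then F (chart_map c x) else 0"
  obtains L where "L > 0" "\<And>x y. ennreal (dist (H x) (H y)) \<le> ennreal L * riem_dist M A g x y"
proof -
  obtain m C where m: "m > 0" "\<And>y v. y \<in> K \<Longrightarrow> m * norm v \<le> sqrt (v \<bullet> (g c y *v v))"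
    using metric_bounds[OF c K, where 'm='n] by metis
  define L where "L = (B + 1) / m"
  have L: "L > 0" using m(1) B(2) by (simp add: L_def)
  have supp: "chart_map c x \<notin> K" if "x \<notin> chart_inv c ` K" "x \<in> chart_dom c" for x
    using that chart_inv_map[OF c that(2)] by (metis imageI)
  have H0: "H x = 0" if "x \<notin> chart_inv c ` K" for x
    using supp[OF that] F0 by (auto simp: H_def)
  have opK: "openin M (topspace M - chart_inv c ` K)" using closedin_chart_inv_image[OF c K] by blast
  have Fcont: "continuous_on (chart_img c) F"
    using F by (auto intro!: continuous_at_imp_continuous_on has_derivative_continuous)
  have Hcont: "continuous_map M euclidean H"
  proof -
    have "openin M {x \<in> topspace M. H x \<in> V}" if V: "open V" for V
    proof (subst openin_subopen, intro ballI)
      fix x assume x: "x \<in> {x \<in> topspace M. H x \<in> V}"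
      show "\<exists>T. openin M T \<and> x \<in> T \<and> T \<subseteq> {x \<in> topspace M. H x \<in> V}"
      proof (cases "x \<in> chart_dom c")
        case True
        obtain W where W: "open W" "F -` V \<inter> chart_img c = W \<inter> chart_img c"
          using Fcont V unfolding continuous_on_open_invariant by metis
        then have oW: "open (F -` V \<inter> chart_img c)" using open_img[OF c] by auto
        show ?thesis
          using openin_chart_vimage[OF c oW] True x dom_subset[OF c] chart_map_in[of _ c]
          by (intro exI[of _ "{x \<in> chart_dom c. chart_map c x \<in> F -` V \<inter> chart_img c}"]) (auto simp: H_def)
      next
        case False
        have "x \<in> topspace M - chart_inv c ` K" using False x K chart_inv_in[of _ c] by auto
        moreover have "0 \<in> V" using x False by (simp add: H_def)
        ultimately show ?thesis using opK H0 by (intro exI[of _ "topspace M - chart_inv c ` K"]) auto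
      qed
    qed
    then show ?thesis by (simp add: continuous_map_def)
  qed
  \<comment> \<open>the fundamental theorem of calculus along a curve, off its finitely many corners\<close>
  have curve: "ennreal (dist (H (\<gamma> 0)) (H (\<gamma> 1))) \<le> ennreal L * curve_length A g \<gamma>" if pw: "pw_C1_curve M A \<gamma>" for \<gamma>
  proof -
    have \<gamma>c: "continuous_map (top_of_set {0..1}) M \<gamma>" using pw by (simp add: pw_C1_curve_def)
    obtain S where S: "finite S" "\<And>d. d \<in> A \<Longrightarrow> (chart_map d \<circ> \<gamma>) C1_differentiable_on {t \<in> {0<..<1} - S. \<gamma> t \<in> chart_dom d}"
      using pw unfolding pw_C1_curve_def by metis
    define h where "h = H \<circ> \<gamma>"
    have hc: "continuous_on {0..1} h"
      using continuous_map_compose[OF \<gamma>c Hcont] by (simp add: h_def)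
    have der: "\<exists>w. (h has_vector_derivative w) (at t) \<and> norm w \<le> L * curve_speed A g \<gamma> t" if t: "t \<in> {0<..<1} - S" for t
    proof (cases "\<gamma> t \<in> chart_dom c")
      case True
      obtain D where D: "\<And>s. s \<in> {t \<in> {0<..<1} - S. \<gamma> t \<in> chart_dom c} \<Longrightarrow> ((chart_map c \<circ> \<gamma>) has_vector_derivative D s) (at s)"
        using S(2)[OF c] unfolding C1_differentiable_on_def by blast
      define v where "v = D t"
      have v: "((chart_map c \<circ> \<gamma>) has_vector_derivative v) (at t)" using D[of t] t True by (simp add: v_def)
      let ?y = "chart_map c (\<gamma> t)"
      have y: "?y \<in> chart_img c" by (rule chart_map_in[OF True])
      have ev: "\<forall>\<^sub>F s in at t. \<gamma> s \<in> chart_dom c"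
        by (rule curve_eventually_in[OF \<gamma>c openin_dom[OF c] _ True]) (use t in auto)
      have d: "chart_at A (\<gamma> t) \<in> A" "\<gamma> t \<in> chart_dom (chart_at A (\<gamma> t))" using chart_at[of "\<gamma> t"] dom_subset[OF c] True by auto
      have ev': "\<forall>\<^sub>F s in at t. \<gamma> s \<in> chart_dom (chart_at A (\<gamma> t))"
        by (rule curve_eventually_in[OF \<gamma>c openin_dom[OF d(1)] _ d(2)]) (use t in auto)
      have sp: "curve_speed A g \<gamma> t = sqrt (v \<bullet> (g c ?y *v v))" by (rule curve_speed_chart[OF True c v ev ev'])
      have "((\<lambda>s. F ((chart_map c \<circ> \<gamma>) s)) has_derivative (\<lambda>h. F' ?y (h *\<^sub>R v))) (at t)"
        by (rule has_derivative_compose[OF v[unfolded has_vector_derivative_def]]) (use F[OF y] in simp)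
      then have "((\<lambda>s. F ((chart_map c \<circ> \<gamma>) s)) has_vector_derivative F' ?y v) (at t)"
        using linear_cmul[OF has_derivative_linear[OF F[OF y]]] by (simp add: has_vector_derivative_def)
      moreover have "\<forall>\<^sub>F s in at t. F ((chart_map c \<circ> \<gamma>) s) = h s"
        using ev by eventually_elim (simp add: h_def H_def)
      ultimately have "(h has_vector_derivative F' ?y v) (at t)"
        unfolding has_vector_derivative_def
        by (rule has_derivative_transform_eventually) (use True in \<open>auto simp: h_def H_def\<close>)
      moreover have "norm (F' ?y v) \<le> L * curve_speed A g \<gamma> t"
      proof (cases "?y \<in> K")
        case True
        have "norm (F' ?y v) \<le> B * norm v" using B(1)[OF y, of v] True by simp
        also have "\<dots> \<le> (B + 1) / m * (m * norm v)" using m(1) B(2) by (simp add: mult_right_mono)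
        also have "\<dots> \<le> L * curve_speed A g \<gamma> t"
          unfolding L_def[symmetric] sp using m(2)[OF True] L by (intro mult_left_mono) auto
        finally show ?thesis .
      next
        case False
        have "v \<bullet> (g c ?y *v v) \<ge> 0" using metric_pos[OF c y, of v] by (cases "v = 0") auto
        then have "curve_speed A g \<gamma> t \<ge> 0" by (simp add: sp)
        then show ?thesis using B(1)[OF y, of v] False L by simp
      qed
      ultimately show ?thesis by blast
    next
      case False
      have \<gamma>t: "\<gamma> t \<in> topspace M" using \<gamma>c t unfolding continuous_map_def by auto
      then have "\<gamma> t \<in> topspace M - chart_inv c ` K" using False K chart_inv_in[of _ c] by auto
      then have "\<forall>\<^sub>F s in at t. \<gamma> s \<in> topspace M - chart_inv c ` K"
        using t by (intro curve_eventually_in[OF \<gamma>c opK]) auto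
      then have "\<forall>\<^sub>F s in at t. 0 = h s" by eventually_elim (use H0 in \<open>simp add: h_def\<close>)
      moreover have "((\<lambda>s. 0) has_derivative (\<lambda>x. x *\<^sub>R 0)) (at t)" by simp
      ultimately have "(h has_vector_derivative 0) (at t)"
        unfolding has_vector_derivative_def
        using has_derivative_transform_eventually[of "\<lambda>s. 0" "\<lambda>x. x *\<^sub>R 0" t UNIV h] False by (auto simp: h_def H_def)
      moreover have "curve_speed A g \<gamma> t \<ge> 0"
      proof -
        let ?d = "chart_at A (\<gamma> t)"
        have d: "?d \<in> A" "\<gamma> t \<in> chart_dom ?d" using chart_at[OF \<gamma>t] by auto
        have "w \<bullet> (g ?d (chart_map ?d (\<gamma> t)) *v w) \<ge> 0" for w
          using metric_pos[OF d(1) chart_map_in[OF d(2)], of w] by (cases "w = 0") auto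
        then show ?thesis by (simp add: curve_speed_def Let_def)
      qed
      ultimately show ?thesis using L by (intro exI[of _ 0]) simp
    qed
    then obtain h' where h': "\<And>t. t \<in> {0<..<1} - S \<Longrightarrow> (h has_vector_derivative h' t) (at t)"
      "\<And>t. t \<in> {0<..<1} - S \<Longrightarrow> norm (h' t) \<le> L * curve_speed A g \<gamma> t" by metis
    have "(h' has_integral (h 1 - h 0)) {0..1}"
      by (rule fundamental_theorem_of_calculus_interior_strong[OF S(1) _ h'(1) hc]) auto
    define k where "k t = (if t \<in> {0..1} then h' t else 0)" for t
    have ke: "k = (\<lambda>t. if t \<in> {0..1} then h' t else 0)" by (simp only: k_def[abs_def])
    have k: "(k has_integral (h 1 - h 0)) UNIV"
      unfolding ke has_integral_restrict_UNIV by (rule \<open>(h' has_integral (h 1 - h 0)) {0..1}\<close>)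
    have km: "k \<in> borel_measurable lebesgue"
      using has_integral_implies_lebesgue_measurable[OF k] by simp
    have le: "(\<integral>\<^sup>+t. ennreal (norm (k t) / L) \<partial>lebesgue) \<le> curve_length A g \<gamma>"
    proof -
      have "AE t in lborel. t \<notin> S \<union> {0, 1}"
        by (rule AE_not_in) (use S(1) in \<open>auto intro: finite_imp_null_set_lborel\<close>)
      then have "AE t in lborel. ennreal (norm (k t) / L) \<le> ennreal (curve_speed A g \<gamma> t) * indicator {0..1} t"
      proof eventually_elim
        case (elim t)
        show ?case
        proof (cases "t \<in> {0..1}")
          case True
          then have "t \<in> {0<..<1} - S" using elim by auto
          from h'(2)[OF this] True L show ?thesis
            by (auto simp: k_def pos_divide_le_eq mult.commute intro!: ennreal_leI)
        next
          case False
          then have "k t = 0" unfolding k_def by (rule if_not_P)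
          then show ?thesis by simp
        qed
      qed
      then show ?thesis unfolding nn_integral_completion curve_length_def by (rule nn_integral_mono_AE)
    qed
    have Lk: "(\<integral>\<^sup>+t. ennreal (norm (k t)) \<partial>lebesgue) = ennreal L * (\<integral>\<^sup>+t. ennreal (norm (k t) / L) \<partial>lebesgue)"
      using km L by (subst nn_integral_cmult[symmetric]) (auto simp: ennreal_mult'[symmetric] intro!: nn_integral_cong)
    show ?thesis
    proof (cases "curve_length A g \<gamma> = \<infinity>")
      case True
      then show ?thesis using L by (simp add: ennreal_mult_top)
    next
      case False
      then have fin: "(\<integral>\<^sup>+t. ennreal (norm (k t)) \<partial>lebesgue) < \<infinity>"
        unfolding Lk using le by (auto simp: ennreal_mult_less_top less_top top_unique)
      then have ki: "integrable lebesgue k" using km by (intro integrableI_bounded) auto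
      have "h 1 - h 0 = integral\<^sup>L lebesgue k"
        using has_integral_unique[OF k has_integral_integral_lebesgue[OF ki]] .
      then have "ennreal (dist (H (\<gamma> 0)) (H (\<gamma> 1))) = ennreal (norm (integral\<^sup>L lebesgue k))"
        by (simp add: h_def dist_norm norm_minus_commute)
      also have "\<dots> \<le> (\<integral>\<^sup>+t. ennreal (norm (k t)) \<partial>lebesgue)" by (rule integral_norm_bound_ennreal[OF ki])
      also have "\<dots> \<le> ennreal L * curve_length A g \<gamma>" unfolding Lk by (intro mult_left_mono le) simp
      finally show ?thesis .
    qed
  qed
  show ?thesis
  proof (rule that[OF L])
    fix x y
    have "ennreal (dist (H x) (H y) / L) \<le> riem_dist M A g x y"
      unfolding riem_dist_def
    proof (rule Inf_greatest)
      fix l assume "l \<in> {curve_length A g \<gamma> |\<gamma>. pw_C1_curve M A \<gamma> \<and> \<gamma> 0 = x \<and> \<gamma> 1 = y}"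
      then obtain \<gamma> where \<gamma>: "l = curve_length A g \<gamma>" "pw_C1_curve M A \<gamma>" "\<gamma> 0 = x" "\<gamma> 1 = y" by blast
      have "ennreal (dist (H x) (H y) / L) = ennreal (1 / L) * ennreal (dist (H x) (H y))"
        using L by (simp add: ennreal_mult'[symmetric])
      also have "\<dots> \<le> ennreal (1 / L) * (ennreal L * l)" using curve[OF \<gamma>(2)] \<gamma> by (intro mult_left_mono) auto
      also have "\<dots> = l" using L by (simp add: mult.assoc[symmetric] ennreal_mult'[symmetric])
      finally show "ennreal (dist (H x) (H y) / L) \<le> l" .
    qed
    then have "ennreal L * ennreal (dist (H x) (H y) / L) \<le> ennreal L * riem_dist M A g x y" by (intro mult_left_mono) auto
    then show "ennreal (dist (H x) (H y)) \<le> ennreal L * riem_dist M A g x y" using L by (simp add: ennreal_mult'[symmetric])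
  qed
qed

text \<open>The segment between two points of the ball is a curve, and its length is bounded by means of the
  upper bound for the metric.\<close>

lemma riem_dist_le_chart:
  assumes c: "c \<in> A" and K: "cball p r \<subseteq> chart_img c"
  obtains C where "C > 0" "\<And>y z. y \<in> cball p r \<Longrightarrow> z \<in> cball p r \<Longrightarrow>
    riem_dist M A g (chart_inv c y) (chart_inv c z) \<le> ennreal (C * dist y z)"
proof -
  obtain C where C: "C > 0" "\<And>y v. y \<in> cball p r \<Longrightarrow> sqrt (v \<bullet> (g c y *v v)) \<le> C * norm v"
    using metric_bounds[OF c compact_cball K, where 'm='n] by metis
  show ?thesis
  proof (rule that[OF C(1)])
    fix y z assume yz: "y \<in> cball p r" "z \<in> cball p r"
    define l where "l t = y + t *\<^sub>R (z - y)" for t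
    define \<gamma> where "\<gamma> t = chart_inv c (l t)" for t
    have lK: "l t \<in> cball p r" if "t \<in> {0..1}" for t
    proof -
      have "l t = (1 - t) *\<^sub>R y + t *\<^sub>R z" by (simp add: l_def algebra_simps)
      then show ?thesis using convexD[OF convex_cball yz, of "1 - t" t] that by simp
    qed
    have li: "l t \<in> chart_img c" if "t \<in> {0..1}" for t using lK[OF that] K by blast
    have ld: "(l has_vector_derivative (z - y)) (at t)" for t
      unfolding l_def by (auto intro!: derivative_eq_intros)
    have lc: "continuous_on S l" for S unfolding l_def by (intro continuous_intros)
    have "continuous_map (top_of_set {0..1}) (top_of_set (chart_img c)) l"
      using li lc by (auto simp: continuous_map_in_subtopology)
    from continuous_map_compose[OF this continuous_chart_inv[OF c]]
    have \<gamma>c: "continuous_map (top_of_set {0..1}) M \<gamma>" by (simp add: \<gamma>_def[abs_def] o_def)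
    have C1: "(chart_map d \<circ> \<gamma>) C1_differentiable_on {t \<in> {0<..<1} - {}. \<gamma> t \<in> chart_dom d}" if d: "d \<in> A" for d
    proof -
      let ?S = "{t \<in> {0<..<1} - {}. \<gamma> t \<in> chart_dom d}"
      have lo: "l t \<in> overlap c d" if "t \<in> ?S" for t
        using that li[of t] overlap_iff[OF c, of "l t" d] by (auto simp: \<gamma>_def)
      have eq: "chart_map d \<circ> \<gamma> = (\<lambda>t. transition c d (l t))" by (simp add: \<gamma>_def transition_eq fun_eq_iff)
      have D: "((\<lambda>t. transition c d (l t)) has_vector_derivative (jacobian c d (l t) *v (z - y))) (at t)" if "t \<in> ?S" for t
        using has_derivative_compose[OF ld[of t, unfolded has_vector_derivative_def] transition_derivative[OF c d lo[OF that]]]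
        by (simp add: has_vector_derivative_def matrix_vector_mult_scaleR)
      have Dc: "continuous_on ?S (\<lambda>t. jacobian c d (l t) *v (z - y))"
      proof -
        have jc: "continuous_on ?S (\<lambda>t. jacobian c d (l t))"
          by (rule continuous_on_compose2[OF continuous_jacobian[OF c d] lc]) (use lo in auto)
        show ?thesis unfolding matrix_vector_mult_def
          by (intro continuous_on_vec_lambda continuous_intros continuous_on_component jc)
      qed
      show ?thesis unfolding eq C1_differentiable_on_def
        by (intro exI[of _ "\<lambda>t. jacobian c d (l t) *v (z - y)"] conjI ballI D Dc)
    qed
    have pw: "pw_C1_curve M A \<gamma>" unfolding pw_C1_curve_def
      by (intro conjI \<gamma>c exI[of _ "{}"] ballI C1) simp
    have sp: "curve_speed A g \<gamma> t \<le> C * dist y z" if t: "t \<in> {0<..<1}" for t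
    proof -
      have t': "t \<in> {0..1}" using t by auto
      have dom: "\<gamma> t \<in> chart_dom c" unfolding \<gamma>_def by (rule chart_inv_in[OF li[OF t']])
      have ev: "\<forall>\<^sub>F s in at t. \<gamma> s \<in> chart_dom c" by (rule curve_eventually_in[OF \<gamma>c openin_dom[OF c] t dom])
      have d: "chart_at A (\<gamma> t) \<in> A" "\<gamma> t \<in> chart_dom (chart_at A (\<gamma> t))" using chart_at[of "\<gamma> t"] dom_subset[OF c] dom by auto
      have ev': "\<forall>\<^sub>F s in at t. \<gamma> s \<in> chart_dom (chart_at A (\<gamma> t))"
        by (rule curve_eventually_in[OF \<gamma>c openin_dom[OF d(1)] t d(2)])
      have "\<forall>\<^sub>F s in at t. s \<in> {0<..<1}" using t by (intro eventually_at_in_open') auto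
      then have "\<forall>\<^sub>F s in at t. l s = (chart_map c \<circ> \<gamma>) s"
        by eventually_elim (use chart_map_inv[OF li] in \<open>simp add: \<gamma>_def\<close>)
      moreover have "l t = (chart_map c \<circ> \<gamma>) t" by (simp add: \<gamma>_def chart_map_inv[OF li[OF t']])
      ultimately have "((chart_map c \<circ> \<gamma>) has_vector_derivative (z - y)) (at t)"
        using has_derivative_transform_eventually[OF ld[of t, unfolded has_vector_derivative_def] _ _ UNIV_I]
        unfolding has_vector_derivative_def by blast
      from curve_speed_chart[OF dom c this ev ev'] C(2)[OF lK[OF t'], of "z - y"] chart_map_inv[OF li[OF t']]
      show ?thesis by (simp add: \<gamma>_def[abs_def] dist_norm norm_minus_commute)
    qed
    have "riem_dist M A g (chart_inv c y) (chart_inv c z) \<le> curve_length A g \<gamma>"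
      unfolding riem_dist_def
    proof (rule Inf_lower, rule CollectI, rule exI[of _ \<gamma>], intro conjI refl pw)
      show "\<gamma> 0 = chart_inv c y" "\<gamma> 1 = chart_inv c z" by (simp_all add: \<gamma>_def l_def)
    qed
    also have "\<dots> \<le> (\<integral>\<^sup>+t. ennreal (C * dist y z) * indicator {0..1::real} t \<partial>lborel)"
      unfolding curve_length_def
    proof (rule nn_integral_mono_AE)
      have "AE t in lborel. t \<notin> {0, 1::real}" by (rule AE_not_in) (auto intro: finite_imp_null_set_lborel)
      then show "AE t in lborel. ennreal (curve_speed A g \<gamma> t) * indicator {0..1} t \<le> ennreal (C * dist y z) * indicator {0..1} t"
        by eventually_elim (use sp in \<open>auto simp: indicator_def intro!: ennreal_leI\<close>)
    qed
    also have "\<dots> = ennreal (C * dist y z)" by (subst nn_integral_cmult_indicator) auto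
    finally show "riem_dist M A g (chart_inv c y) (chart_inv c z) \<le> ennreal (C * dist y z)" .
  qed
qed

end

section \<open>Differentials of Lipschitz maps\<close>

context closed_riemannian
begin

text \<open>The condition on the members of \<^const>\<open>Lip_maps\<close> with its constant made explicit, so that constants
  can be tracked uniformly in \<open>v\<close>.\<close>

definition riem_lipschitz :: "('a \<Rightarrow> real^'m::finite) \<Rightarrow> real \<Rightarrow> bool" where
  "riem_lipschitz v \<Lambda> \<longleftrightarrow> \<Lambda> \<ge> 0 \<and>
     (\<forall>x\<in>topspace M. \<forall>y\<in>topspace M. ennreal (dist (v x) (v y)) \<le> ennreal \<Lambda> * riem_dist M A g x y)"

text \<open>Differentiability at a point does not depend on the chart, so with the value zero elsewhere the
  transformation law holds at all points and not only almost everywhere.\<close>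

definition coord_deriv :: "('a \<Rightarrow> real^'m::finite) \<Rightarrow> ('a, 'n) chart \<Rightarrow> real^'n \<Rightarrow> real^'n^'m" where
  "coord_deriv v c y = (if (v \<circ> chart_inv c) differentiable (at y)
     then matrix (frechet_derivative (v \<circ> chart_inv c) (at y)) else 0)"

lemma coord_deriv_eq:
  assumes "((v \<circ> chart_inv c) has_derivative E) (at y)" shows "coord_deriv v c y = matrix E"
proof -
  have "(v \<circ> chart_inv c) differentiable (at y)" using assms unfolding differentiable_def by blast
  moreover have "frechet_derivative (v \<circ> chart_inv c) (at y) = E" using frechet_derivative_at[OF assms] by simp
  ultimately show ?thesis by (simp add: coord_deriv_def)
qed

lemma has_derivative_change_chart:
  assumes cd: "c \<in> A" "d \<in> A" and y: "y \<in> overlap c d"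
    and E: "((v \<circ> chart_inv d) has_derivative E) (at (transition c d y))"
  shows "((v \<circ> chart_inv c) has_derivative (\<lambda>w. E (jacobian c d y *v w))) (at y)"
proof -
  have "((\<lambda>x. (v \<circ> chart_inv d) (transition c d x)) has_derivative (\<lambda>w. E (jacobian c d y *v w))) (at y)"
    by (rule has_derivative_compose[OF transition_derivative[OF cd y] E])
  then show ?thesis
    by (rule has_derivative_transform_within_open[OF _ open_overlap[OF cd] y]) (simp add: chart_inv_transition[OF cd])
qed

lemma coord_deriv_covector_law:
  fixes v :: "'a \<Rightarrow> real^'m::finite"
  shows "covector_law (coord_deriv v)"
  unfolding covector_law_def
proof (intro ballI)
  fix c d y assume cd: "c \<in> A" "d \<in> A" and y: "y \<in> overlap c d"
  show "coord_deriv v c y = coord_deriv v d (transition c d y) ** jacobian c d y"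
  proof (cases "(v \<circ> chart_inv d) differentiable (at (transition c d y))")
    case True
    then obtain E where E: "((v \<circ> chart_inv d) has_derivative E) (at (transition c d y))" unfolding differentiable_def by blast
    have "matrix (\<lambda>w. E (jacobian c d y *v w)) = matrix E ** jacobian c d y"
      using matrix_compose[OF matrix_vector_mul_linear[of "jacobian c d y"] has_derivative_linear[OF E]]
      by (simp add: o_def matrix_of_matrix_vector_mul)
    then show ?thesis using coord_deriv_eq[OF E] coord_deriv_eq[OF has_derivative_change_chart[OF cd y E]] by simp
  next
    case False
    have "\<not> (v \<circ> chart_inv c) differentiable (at y)"
    proof
      assume "(v \<circ> chart_inv c) differentiable (at y)"
      then obtain E where "((v \<circ> chart_inv c) has_derivative E) (at (transition d c (transition c d y)))"
        unfolding differentiable_def transition_transition[OF cd y] by blast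
      from has_derivative_change_chart[OF cd(2,1) transition_in[OF cd y] this] False
      show False unfolding differentiable_def by blast
    qed
    then have "coord_deriv v c y = 0" by (simp add: coord_deriv_def)
    moreover have "coord_deriv v d (transition c d y) = 0" using False by (simp add: coord_deriv_def)
    moreover have "(0 :: real^'n^'m) ** jacobian c d y = 0" by (simp add: matrix_matrix_mult_def vec_eq_iff)
    ultimately show ?thesis by simp
  qed
qed

lemma riem_lipschitz_in_chart:
  assumes c: "c \<in> A" and K: "cball p r \<subseteq> chart_img c"
  obtains C where "C > 0" "\<And>(v :: 'a \<Rightarrow> real^'m::finite) \<Lambda>. riem_lipschitz v \<Lambda> \<Longrightarrow> (C * \<Lambda>)-lipschitz_on (cball p r) (v \<circ> chart_inv c)"
proof -
  obtain C where C: "C > 0" "\<And>y z. y \<in> cball p r \<Longrightarrow> z \<in> cball p r \<Longrightarrow>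
    riem_dist M A g (chart_inv c y) (chart_inv c z) \<le> ennreal (C * dist y z)"
    using riem_dist_le_chart[OF c K] by metis
  show ?thesis
  proof (rule that[OF C(1)])
    fix v :: "'a \<Rightarrow> real^'m" and \<Lambda> assume v: "riem_lipschitz v \<Lambda>"
    then have \<Lambda>: "\<Lambda> \<ge> 0" by (simp add: riem_lipschitz_def)
    show "(C * \<Lambda>)-lipschitz_on (cball p r) (v \<circ> chart_inv c)"
    proof (rule lipschitz_onI)
      fix y z assume yz: "y \<in> cball p r" "z \<in> cball p r"
      have top: "chart_inv c y \<in> topspace M" "chart_inv c z \<in> topspace M" using yz K chart_inv_top[OF c] by blast+
      have "ennreal (dist (v (chart_inv c y)) (v (chart_inv c z))) \<le> ennreal \<Lambda> * riem_dist M A g (chart_inv c y) (chart_inv c z)"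
        using v top unfolding riem_lipschitz_def by blast
      also have "\<dots> \<le> ennreal \<Lambda> * ennreal (C * dist y z)" by (rule mult_left_mono[OF C(2)[OF yz]]) simp
      also have "\<dots> = ennreal (C * \<Lambda> * dist y z)" using \<Lambda> C(1) by (simp add: ennreal_mult'[symmetric] mult_ac)
      finally show "dist ((v \<circ> chart_inv c) y) ((v \<circ> chart_inv c) z) \<le> C * \<Lambda> * dist y z"
        using C(1) \<Lambda> by (simp add: ennreal_le_iff)
    qed (use C(1) \<Lambda> in simp)
  qed
qed

lemma riem_lipschitz_locally:
  fixes v :: "'a \<Rightarrow> real^'m::finite"
  assumes v: "riem_lipschitz v \<Lambda>" and c: "c \<in> A" and y: "y \<in> chart_img c"
  shows "\<exists>r>0. \<exists>L. L-lipschitz_on (cball y r) (v \<circ> chart_inv c)"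
proof -
  obtain e where e: "e > 0" "cball y e \<subseteq> chart_img c"
    using open_img[OF c] y open_contains_cball by blast
  obtain C where "(C * \<Lambda>)-lipschitz_on (cball y e) (v \<circ> chart_inv c)"
    using riem_lipschitz_in_chart[OF c e(2), where 'm='m] v by metis
  then show ?thesis using e(1) by blast
qed

lemma riem_lipschitz_continuous:
  fixes v :: "'a \<Rightarrow> real^'m::finite"
  assumes v: "riem_lipschitz v \<Lambda>" and c: "c \<in> A"
  shows "continuous_on (chart_img c) (v \<circ> chart_inv c)"
proof -
  have "continuous (at y) (v \<circ> chart_inv c)" if y: "y \<in> chart_img c" for y
  proof -
    obtain r L where r: "r > 0" "L-lipschitz_on (cball y r) (v \<circ> chart_inv c)"
      using riem_lipschitz_locally[OF v c y] by blast
    have "continuous_on (cball y r) (v \<circ> chart_inv c)" by (rule lipschitz_on_continuous_on[OF r(2)])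
    then show ?thesis using continuous_on_interior[of "cball y r" "v \<circ> chart_inv c" y] r(1) by simp
  qed
  then show ?thesis by (rule continuous_at_imp_continuous_on[rule_format])
qed

lemma norm_coord_deriv_le:
  fixes v :: "'a \<Rightarrow> real^'m::finite"
  assumes L: "L-lipschitz_on (cball p r) (v \<circ> chart_inv c)" and y: "y \<in> ball p r"
  shows "norm (coord_deriv v c y) \<le> real CARD('n) * L"
proof (cases "(v \<circ> chart_inv c) differentiable (at y)")
  case True
  then obtain E where E: "((v \<circ> chart_inv c) has_derivative E) (at y)" unfolding differentiable_def by blast
  have col: "norm (column i (matrix E)) \<le> L" for i
  proof -
    let ?h = "\<lambda>j. (1 / real (Suc j)) *\<^sub>R (axis i 1 :: real^'n)"
    have "(\<lambda>j. real (Suc j) *\<^sub>R ((v \<circ> chart_inv c) (y + ?h j) - (v \<circ> chart_inv c) y)) \<longlonglongrightarrow> E (axis i 1)"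
      by (rule difference_quotient_tendsto[OF E])
    moreover have "\<forall>\<^sub>F j in sequentially. norm (real (Suc j) *\<^sub>R ((v \<circ> chart_inv c) (y + ?h j) - (v \<circ> chart_inv c) y)) \<le> L"
    proof -
      have "(\<lambda>j. 1 / real (Suc j)) \<longlonglongrightarrow> 0" by (rule LIMSEQ_Suc[OF lim_1_over_n])
      then have "(\<lambda>j. y + ?h j) \<longlonglongrightarrow> y + 0 *\<^sub>R axis i 1"
        by (intro tendsto_add tendsto_scaleR tendsto_const)
      then have "\<forall>\<^sub>F j in sequentially. y + ?h j \<in> ball p r"
        using y by (intro topological_tendstoD[OF _ open_ball]) auto
      then show ?thesis
      proof eventually_elim
        case (elim j)
        have "dist ((v \<circ> chart_inv c) (y + ?h j)) ((v \<circ> chart_inv c) y) \<le> L * dist (y + ?h j) y"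
          by (rule lipschitz_onD[OF L]) (use elim y in \<open>auto intro: less_imp_le\<close>)
        also have "\<dots> = L / real (Suc j)" by (simp add: dist_norm norm_axis_1)
        finally have "real (Suc j) * dist ((v \<circ> chart_inv c) (y + ?h j)) ((v \<circ> chart_inv c) y) \<le> real (Suc j) * (L / real (Suc j))"
          by (intro mult_left_mono) auto
        then show ?case by (simp add: dist_norm del: of_nat_Suc)
      qed
    qed
    ultimately have "norm (E (axis i 1)) \<le> L" by (intro tendsto_upperbound[OF tendsto_norm]) auto
    moreover have "column i (matrix E) = E (axis i 1)" by (simp add: column_def matrix_def vec_eq_iff)
    ultimately show ?thesis by simp
  qed
  have "norm (matrix E) \<le> (\<Sum>i\<in>UNIV. norm (column i (matrix E)))" by (rule norm_le_sum_columns(2))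
  also have "\<dots> \<le> (\<Sum>i\<in>(UNIV::'n set). L)" by (intro sum_mono col)
  finally show ?thesis using coord_deriv_eq[OF E] by simp
next
  case False
  then show ?thesis using lipschitz_on_nonneg[OF L] by (simp add: coord_deriv_def)
qed

lemma riem_lipschitz_weak_differential:
  fixes v :: "'a \<Rightarrow> real^'m::finite"
  assumes v: "riem_lipschitz v \<Lambda>"
  shows "has_weak_differential A v (coord_deriv v)"
  unfolding has_weak_differential_iff
proof (intro conjI ballI coord_deriv_covector_law)
  fix c assume c: "c \<in> A"
  let ?f = "v \<circ> chart_inv c"
  have loc: "\<exists>r>0. \<exists>L. L-lipschitz_on (ball y r) ?f" if "y \<in> chart_img c" for y
    using riem_lipschitz_locally[OF v c that] lipschitz_on_subset[OF _ ball_subset_cball] by blast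
  show "has_weak_derivative_on ?f (coord_deriv v c) (chart_img c)"
  proof (rule has_weak_derivative_of_difference_quotients[OF open_img[OF c]])
    fix K assume K: "compact K" "K \<subseteq> chart_img c"
    have "local_lipschitz {0::real} K (\<lambda>t. ?f)"
      unfolding local_lipschitz_def
    proof (intro ballI)
      fix y :: "real^'n" and t :: real assume "y \<in> K" "t \<in> {0}"
      then obtain r L where r: "r > 0" "L-lipschitz_on (cball y r) ?f"
        using riem_lipschitz_locally[OF v c, of y] K(2) by blast
      then have "L-lipschitz_on (cball y r \<inter> K) ?f" by (elim lipschitz_on_subset) blast
      then show "\<exists>u>0. \<exists>L. \<forall>t\<in>cball t u \<inter> {0}. L-lipschitz_on (cball y u \<inter> K) ?f" using r(1) by blast
    qed
    then obtain L where "\<And>t. t \<in> {0::real} \<Longrightarrow> L-lipschitz_on K ?f"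
      using local_lipschitz_compact_implies_lipschitz[OF _ K(1) compact_sing, of 0 "\<lambda>t. ?f"] continuous_on_const by blast
    then show "\<exists>L. L-lipschitz_on K ?f" by blast
  next
    fix i
    have "AE y in lebesgue. y \<in> chart_img c \<longrightarrow> ?f differentiable (at y)"
      by (rule AE_differentiable_of_locally_lipschitz[OF loc])
    then show "AE y in lebesgue. y \<in> chart_img c \<longrightarrow>
      (\<lambda>j. real (Suc j) *\<^sub>R (?f (y + (1 / real (Suc j)) *\<^sub>R axis i 1) - ?f y)) \<longlonglongrightarrow> column i (coord_deriv v c y)"
    proof eventually_elim
      case (elim y)
      show ?case
      proof
        assume "y \<in> chart_img c"
        with elim obtain E where E: "(?f has_derivative E) (at y)" unfolding differentiable_def by blast
        have "column i (coord_deriv v c y) = E (axis i 1)" unfolding coord_deriv_eq[OF E] by (simp add: column_def matrix_def vec_eq_iff)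
        then show "(\<lambda>j. real (Suc j) *\<^sub>R (?f (y + (1 / real (Suc j)) *\<^sub>R axis i 1) - ?f y)) \<longlonglongrightarrow> column i (coord_deriv v c y)"
          using difference_quotient_tendsto[OF E, of "axis i 1"] by simp
      qed
    qed
  qed
qed

text \<open>A finite cover makes the constant independent of the map and of the point.\<close>

lemma riem_lipschitz_differential_norm:
  obtains C where "C > 0" "\<And>(v :: 'a \<Rightarrow> real^'m::finite) \<Lambda> x. riem_lipschitz v \<Lambda> \<Longrightarrow> x \<in> topspace M \<Longrightarrow>
    differential_norm A g (coord_deriv v) x \<le> C * \<Lambda>"
proof -
  obtain I where I: "finite I" "\<And>c p r. (c, p, r) \<in> I \<Longrightarrow> c \<in> A \<and> r > 0 \<and> cball p (4 * r) \<subseteq> chart_img c"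
    "\<And>x. x \<in> topspace M \<Longrightarrow> \<exists>(c, p, r)\<in>I. x \<in> chart_dom c \<and> chart_map c x \<in> ball p r" by (rule good_cover) (rule that)
  define P where "P = (\<lambda>(c :: ('a, 'n) chart, p :: real^'n, r :: real) K. K > 0 \<and> (\<forall>(v :: 'a \<Rightarrow> real^'m) \<Lambda>. riem_lipschitz v \<Lambda> \<longrightarrow>
    (\<forall>x. x \<in> chart_dom c \<longrightarrow> chart_map c x \<in> ball p r \<longrightarrow> differential_norm A g (coord_deriv v) x \<le> K * \<Lambda>)))"
  have "\<forall>j\<in>I. \<exists>K. P j K"
  proof
    fix j assume jI: "j \<in> I"
    obtain c p r where j: "j = (c, p, r)" by (cases j)
    have c: "c \<in> A" "r > 0" "cball p (4 * r) \<subseteq> chart_img c" using I(2)[of c p r] jI j by auto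
    have K: "cball p r \<subseteq> chart_img c" using c(2) by (intro order_trans[OF subset_cball c(3)]) simp
    obtain C where C: "C > 0" "\<And>(v :: 'a \<Rightarrow> real^'m) \<Lambda>. riem_lipschitz v \<Lambda> \<Longrightarrow> (C * \<Lambda>)-lipschitz_on (cball p r) (v \<circ> chart_inv c)"
      using riem_lipschitz_in_chart[OF c(1) K, where 'm='m] by metis
    obtain C' where C': "C' > 0" "\<And>y (T :: real^'n^'m). y \<in> cball p r \<Longrightarrow> sqrt (sqnorm_at c y T) \<le> C' * norm T"
      using metric_bounds[OF c(1) compact_cball K, where 'm='m] by metis
    have "differential_norm A g (coord_deriv v) x \<le> C' * (real CARD('n) * C) * \<Lambda>"
      if v: "riem_lipschitz v \<Lambda>" and x: "x \<in> chart_dom c" "chart_map c x \<in> ball p r" for v :: "'a \<Rightarrow> real^'m" and \<Lambda> x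
    proof -
      let ?y = "chart_map c x"
      have "differential_norm A g (coord_deriv v) x = sqrt (sqnorm_at c ?y (coord_deriv v c ?y))"
        using differential_norm_chart[OF coord_deriv_covector_law c(1) chart_map_in[OF x(1)], of v] chart_inv_map[OF c(1) x(1)] by simp
      also have "\<dots> \<le> C' * norm (coord_deriv v c ?y)" by (rule C'(2)) (use x(2) in simp)
      also have "\<dots> \<le> C' * (real CARD('n) * (C * \<Lambda>))"
        using C'(1) by (intro mult_left_mono norm_coord_deriv_le[OF C(2)[OF v] x(2)]) simp
      finally show ?thesis by (simp add: mult_ac)
    qed
    then have "P j (C' * (real CARD('n) * C))" using C(1) C'(1) by (simp add: P_def j del: mem_ball)
    then show "\<exists>K. P j K" by blast
  qed
  from bchoice[OF this] obtain K where K: "\<And>j. j \<in> I \<Longrightarrow> P j (K j)" by blast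
  have K0: "K j \<ge> 0" if "j \<in> I" for j using K[OF that] by (cases j) (simp add: P_def)
  show ?thesis
  proof (rule that[of "1 + (\<Sum>j\<in>I. K j)"])
    show "0 < 1 + (\<Sum>j\<in>I. K j)" using sum_nonneg[of I K] K0 by fastforce
    fix v :: "'a \<Rightarrow> real^'m" and \<Lambda> x assume v: "riem_lipschitz v \<Lambda>" and x: "x \<in> topspace M"
    have \<Lambda>: "\<Lambda> \<ge> 0" using v by (simp add: riem_lipschitz_def)
    obtain c p r where j: "(c, p, r) \<in> I" "x \<in> chart_dom c" "chart_map c x \<in> ball p r" using I(3)[OF x] by fastforce
    have "differential_norm A g (coord_deriv v) x \<le> K (c, p, r) * \<Lambda>"
      using K[OF j(1)] v j(2,3) unfolding P_def by blast
    also have "\<dots> \<le> (1 + (\<Sum>j\<in>I. K j)) * \<Lambda>"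
      using member_le_sum[OF j(1), of K] K0 I(1) \<Lambda> by (intro mult_right_mono) auto
    finally show "differential_norm A g (coord_deriv v) x \<le> (1 + (\<Sum>j\<in>I. K j)) * \<Lambda>" .
  qed
qed

lemma finite_measure_vol: "finite_measure vol"
  using finite_vol by (intro finite_measureI) auto

lemma in_Lp_bounded:
  fixes f :: "'a \<Rightarrow> 'b::euclidean_space"
  assumes "f \<in> borel_measurable vol" "\<And>x. x \<in> topspace M \<Longrightarrow> norm (f x) \<le> B" "p \<ge> 0"
  shows "in_Lp vol p f"
proof -
  interpret finite_measure vol by (rule finite_measure_vol)
  have "integrable vol (\<lambda>x. norm (f x) powr p)"
    using assms by (intro integrable_const_bound[of _ "B powr p"] AE_I2) (auto intro!: powr_mono2)
  then show ?thesis using assms(1) by (simp add: in_Lp_def)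
qed

lemma weak_differential_norm_measurable:
  fixes u :: "'a \<Rightarrow> real^'m::finite"
  assumes "has_weak_differential A u D"
  shows "differential_norm A g D \<in> borel_measurable vol"
  using assms unfolding has_weak_differential_iff
  by (intro differential_norm_measurable) (auto simp: has_weak_derivative_on_def)

lemma differential_norm_nonneg:
  fixes D :: "('a, 'n) chart \<Rightarrow> real^'n \<Rightarrow> real^'n^'m::finite"
  assumes "covector_law D" "x \<in> topspace M"
  shows "differential_norm A g D x \<ge> 0"
proof -
  obtain c where c: "c \<in> A" "x \<in> chart_dom c" using ex_chart[OF assms(2)] by blast
  from differential_norm_chart[OF assms(1) c(1) chart_map_in[OF c(2)]] chart_inv_map[OF c]
    sqnorm_at_nonneg[OF c(1) chart_map_in[OF c(2)]]
  show ?thesis by simp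
qed

lemma riem_lipschitz_in_sobolev_space:
  fixes v :: "'a \<Rightarrow> real^'m::finite"
  assumes v: "riem_lipschitz v \<Lambda>" and B: "\<And>x. x \<in> topspace M \<Longrightarrow> norm (v x) \<le> B" and p: "p \<ge> 0"
  shows "v \<in> sobolev_space M A g p"
proof -
  have vm: "v \<in> borel_measurable vol"
    unfolding borel_measurable_vol_iff
  proof (intro ballI allI impI)
    fix c V assume c: "c \<in> A" and V: "open (V :: (real^'m) set)"
    have "open (chart_img c \<inter> (v \<circ> chart_inv c) -` V)"
      by (rule continuous_open_preimage[OF riem_lipschitz_continuous[OF v c] open_img[OF c] V])
    moreover have "{y \<in> chart_img c. v (chart_inv c y) \<in> V} = chart_img c \<inter> (v \<circ> chart_inv c) -` V" by auto
    ultimately show "{y \<in> chart_img c. v (chart_inv c y) \<in> V} \<in> sets lebesgue"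
      by (simp add: borel_open sets_completionI_sets)
  qed
  obtain C where C: "\<And>x. x \<in> topspace M \<Longrightarrow> differential_norm A g (coord_deriv v) x \<le> C * \<Lambda>"
    using riem_lipschitz_differential_norm[where 'm='m] v by metis
  have "in_Lp vol p (differential_norm A g (coord_deriv v))"
    using C differential_norm_nonneg[OF coord_deriv_covector_law, of _ v] p
    by (intro in_Lp_bounded[of _ "C * \<Lambda>"] weak_differential_norm_measurable[OF riem_lipschitz_weak_differential[OF v]]) auto
  then show ?thesis
    using in_Lp_bounded[OF vm B p] riem_lipschitz_weak_differential[OF v] unfolding sobolev_space_def by blast
qed

end

section \<open>A pseudo-metric dominated by the Riemannian distance\<close>

lemma has_real_derivative_max_square:
  "((\<lambda>s::real. (max 0 s)\<^sup>2) has_real_derivative 2 * max 0 s) (at s)"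
proof -
  consider "s > 0" | "s < 0" | "s = 0" by linarith
  then show ?thesis
  proof cases
    case 1
    have "((\<lambda>s::real. s\<^sup>2) has_real_derivative 2 * max 0 s) (at s)"
      using 1 by (auto intro!: derivative_eq_intros)
    then show ?thesis
      by (rule has_field_derivative_transform_within_open[of _ _ _ "{0<..}"]) (use 1 in auto)
  next
    case 2
    have "((\<lambda>s::real. 0) has_real_derivative 2 * max 0 s) (at s)" using 2 by auto
    then show ?thesis
      by (rule has_field_derivative_transform_within_open[of _ _ _ "{..<0}"]) (use 2 in auto)
  next
    case 3
    have "((\<lambda>h::real. max 0 h) \<longlongrightarrow> max 0 0) (at 0)" by (intro tendsto_intros)
    moreover have "\<forall>\<^sub>F h :: real in at 0. max 0 h = ((max 0 (0 + h))\<^sup>2 - (max 0 0)\<^sup>2) / h"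
      by (auto simp: eventually_at_filter max_def power2_eq_square)
    ultimately have "((\<lambda>h :: real. ((max 0 (0 + h))\<^sup>2 - (max 0 0)\<^sup>2) / h) \<longlongrightarrow> max 0 0) (at 0)"
      by (rule Lim_transform_eventually)
    then show ?thesis using 3 by (simp add: DERIV_def)
  qed
qed

context closed_riemannian
begin

text \<open>The function \<open>H\<close> consists of a cut-off function \<open>\<zeta>\<close> of the chart and of \<open>\<zeta>\<close> times the coordinates. If
  both points lie in the support, the coordinates are recovered from it; if the second point does not,
  then \<open>\<zeta>\<close> alone separates the points.\<close>

lemma ex_chart_separation:
  assumes c: "c \<in> A" and r: "r > 0" and K: "cball p (2 * r) \<subseteq> chart_img c"
  shows "\<exists>H :: 'a \<Rightarrow> real \<times> (real^'n). \<exists>L>0. \<exists>S>0.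
    (\<forall>x y. ennreal (dist (H x) (H y)) \<le> ennreal L * riem_dist M A g x y) \<and>
    (\<forall>x y. x \<in> chart_dom c \<longrightarrow> chart_map c x \<in> ball p r \<longrightarrow>
      (y \<in> chart_dom c \<and> chart_map c y \<in> ball p (2 * r) \<longrightarrow> dist (chart_map c x) (chart_map c y) \<le> S * dist (H x) (H y)) \<and>
      (\<not> (y \<in> chart_dom c \<and> chart_map c y \<in> ball p (2 * r)) \<longrightarrow> 1 \<le> S * dist (H x) (H y)))"
proof -
  \<comment> \<open>\<open>\<zeta>\<close> is continuously differentiable and positive exactly on the ball of radius \<open>2 r\<close>\<close>
  define z where "z y = 4 * r\<^sup>2 - (y - p) \<bullet> (y - p)" for y :: "real^'n"
  define \<zeta> where "\<zeta> y = (max 0 (z y))\<^sup>2" for y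
  define \<zeta>' where "\<zeta>' y w = 2 * max 0 (z y) * (- (2 * ((y - p) \<bullet> w)))" for y w :: "real^'n"
  define F where "F y = (\<zeta> y, \<zeta> y *\<^sub>R (y - p))" for y
  define F' where "F' y w = (\<zeta>' y w, \<zeta> y *\<^sub>R w + \<zeta>' y w *\<^sub>R (y - p))" for y w
  have zd: "(z has_derivative (\<lambda>w. - (2 * ((y - p) \<bullet> w)))) (at y)" for y
    unfolding z_def[abs_def] by (auto intro!: derivative_eq_intros simp: inner_commute)
  have \<zeta>d: "(\<zeta> has_derivative \<zeta>' y) (at y)" for y
    using has_derivative_compose[OF zd has_real_derivative_max_square[unfolded has_field_derivative_def]]
    unfolding \<zeta>_def[abs_def] \<zeta>'_def[abs_def] by (simp add: mult.assoc)
  have Fd: "(F has_derivative F' y) (at y)" for y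
    unfolding F_def[abs_def] F'_def[abs_def]
    by (intro has_derivative_Pair \<zeta>d has_derivative_scaleR[OF \<zeta>d, THEN has_derivative_eq_rhs] derivative_eq_intros) (auto simp: fun_eq_iff)
  have zneg: "z y \<le> 0" if "y \<notin> ball p (2 * r)" for y
  proof -
    have "2 * r \<le> norm (y - p)" using that by (simp add: dist_norm norm_minus_commute)
    then have "(2 * r)\<^sup>2 \<le> (norm (y - p))\<^sup>2" using r by (intro power_mono) auto
    then show ?thesis by (simp add: z_def power2_norm_eq_inner power_mult_distrib)
  qed
  have F0: "F y = 0" if "y \<notin> ball p (2 * r)" for y using zneg[OF that] by (simp add: F_def \<zeta>_def zero_prod_def)
  define B where "B = 32 * r ^ 3 + (16 * r ^ 4 + 64 * r ^ 4)"
  have FB: "norm (F' y w) \<le> B * norm w * indicator (cball p (2 * r)) y" for y w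
  proof (cases "y \<in> cball p (2 * r)")
    case True
    then have n: "norm (y - p) \<le> 2 * r" by (simp add: dist_norm norm_minus_commute)
    have mz: "max 0 (z y) \<le> 4 * r\<^sup>2" "0 \<le> max 0 (z y)" by (auto simp: z_def)
    have "\<zeta> y \<le> (4 * r\<^sup>2)\<^sup>2" unfolding \<zeta>_def using mz by (intro power_mono)
    then have z1: "\<zeta> y \<le> 16 * r ^ 4" "0 \<le> \<zeta> y" by (simp_all add: \<zeta>_def power2_eq_square power4_eq_xxxx)
    have "\<bar>(y - p) \<bullet> w\<bar> \<le> norm (y - p) * norm w" by (rule Cauchy_Schwarz_ineq2)
    also have "\<dots> \<le> 2 * r * norm w" by (intro mult_right_mono n) simp
    finally have cs: "\<bar>(y - p) \<bullet> w\<bar> \<le> 2 * r * norm w" .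
    have "\<bar>\<zeta>' y w\<bar> = 2 * max 0 (z y) * (2 * \<bar>(y - p) \<bullet> w\<bar>)" using mz(2) by (simp add: \<zeta>'_def abs_mult)
    also have "\<dots> \<le> 2 * (4 * r\<^sup>2) * (2 * (2 * r * norm w))" using mz cs by (intro mult_mono) auto
    finally have z2: "\<bar>\<zeta>' y w\<bar> \<le> 32 * r ^ 3 * norm w" by (simp add: power2_eq_square power3_eq_cube mult_ac)
    have "norm (F' y w) \<le> \<bar>\<zeta>' y w\<bar> + norm (\<zeta> y *\<^sub>R w + \<zeta>' y w *\<^sub>R (y - p))"
      unfolding F'_def using norm_Pair_le[of "\<zeta>' y w"] by simp
    also have "\<dots> \<le> \<bar>\<zeta>' y w\<bar> + (\<zeta> y * norm w + \<bar>\<zeta>' y w\<bar> * norm (y - p))"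
      using norm_triangle_ineq[of "\<zeta> y *\<^sub>R w" "\<zeta>' y w *\<^sub>R (y - p)"] z1(2) by simp
    also have "\<dots> \<le> 32 * r ^ 3 * norm w + (16 * r ^ 4 * norm w + 32 * r ^ 3 * norm w * (2 * r))"
      using z1 z2 n r by (intro add_mono mult_mono) auto
    also have "\<dots> = B * norm w" by (simp add: B_def power3_eq_cube power4_eq_xxxx algebra_simps)
    finally show ?thesis using True by simp
  next
    case False
    then have "max 0 (z y) = 0" using zneg[of y] by auto
    then have "F' y w = 0" by (simp add: F'_def \<zeta>'_def \<zeta>_def zero_prod_def)
    then show ?thesis using False by simp
  qed
  define H where "H x = (if x \<in> chart_dom c then F (chart_map c x) else 0)" for x
  have B0: "B \<ge> 0" using r by (simp add: B_def)
  have F0': "F y = 0" if "y \<notin> cball p (2 * r)" for y using F0[of y] that by auto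
  obtain L where L: "L > 0" "\<And>x y. ennreal (dist (H x) (H y)) \<le> ennreal L * riem_dist M A g x y"
    using compactly_supported_lipschitz[OF c compact_cball K Fd F0' FB B0] unfolding H_def by metis
  define S where "S = (2 + 2 * r) / (9 * r ^ 4)"
  have S: "S > 0" using r by (simp add: S_def)
  have r4: "9 * r ^ 4 > 0" using r by simp
  have sep: "(y \<in> chart_dom c \<and> chart_map c y \<in> ball p (2 * r) \<longrightarrow> dist (chart_map c x) (chart_map c y) \<le> S * dist (H x) (H y)) \<and>
      (\<not> (y \<in> chart_dom c \<and> chart_map c y \<in> ball p (2 * r)) \<longrightarrow> 1 \<le> S * dist (H x) (H y))"
    if x: "x \<in> chart_dom c" "chart_map c x \<in> ball p r" for x y
  proof -
    define a where "a = chart_map c x"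
    have "norm (a - p) < r" using x(2) by (simp add: a_def dist_norm norm_minus_commute)
    then have "(norm (a - p))\<^sup>2 \<le> r\<^sup>2" by (intro power_mono) auto
    then have "3 * r\<^sup>2 \<le> z a" by (simp add: z_def power2_norm_eq_inner)
    then have "3 * r\<^sup>2 \<le> max 0 (z a)" by simp
    then have "(3 * r\<^sup>2)\<^sup>2 \<le> \<zeta> a" unfolding \<zeta>_def by (intro power_mono) auto
    then have za: "9 * r ^ 4 \<le> \<zeta> a" by (simp add: power2_eq_square power4_eq_xxxx)
    have Hx: "H x = F a" using x(1) by (simp add: H_def a_def)
    show ?thesis
    proof (intro conjI impI)
      assume y: "y \<in> chart_dom c \<and> chart_map c y \<in> ball p (2 * r)"
      define b where "b = chart_map c y"
      have Hy: "H y = F b" using y by (simp add: H_def b_def)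
      have nb: "norm (b - p) \<le> 2 * r" using y by (simp add: b_def dist_norm norm_minus_commute)
      have d1: "\<bar>\<zeta> a - \<zeta> b\<bar> \<le> dist (H x) (H y)"
        unfolding Hx Hy F_def using dist_fst_le[of "(\<zeta> a, \<zeta> a *\<^sub>R (a - p))" "(\<zeta> b, \<zeta> b *\<^sub>R (b - p))"] by (simp add: dist_norm)
      have d2: "norm (\<zeta> a *\<^sub>R (a - p) - \<zeta> b *\<^sub>R (b - p)) \<le> dist (H x) (H y)"
        unfolding Hx Hy F_def using dist_snd_le[of "(\<zeta> a, \<zeta> a *\<^sub>R (a - p))" "(\<zeta> b, \<zeta> b *\<^sub>R (b - p))"] by (simp add: dist_norm)
      have "9 * r ^ 4 * norm (a - b) \<le> norm (\<zeta> a *\<^sub>R (a - b))" using za r4 by (simp add: mult_right_mono)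
      also have "\<zeta> a *\<^sub>R (a - b) = (\<zeta> a *\<^sub>R (a - p) - \<zeta> b *\<^sub>R (b - p)) - (\<zeta> a - \<zeta> b) *\<^sub>R (b - p)"
        by (simp add: algebra_simps)
      also have "norm \<dots> \<le> dist (H x) (H y) + dist (H x) (H y) * (2 * r)"
        by (rule order_trans[OF norm_triangle_ineq4]) (use d1 d2 nb in \<open>auto intro!: add_mono mult_mono\<close>)
      also have "\<dots> \<le> (2 + 2 * r) * dist (H x) (H y)" by (simp add: algebra_simps)
      finally show "dist (chart_map c x) (chart_map c y) \<le> S * dist (H x) (H y)"
        using r4 by (simp add: S_def a_def b_def dist_norm pos_le_divide_eq mult.commute)
    next
      assume "\<not> (y \<in> chart_dom c \<and> chart_map c y \<in> ball p (2 * r))"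
      then have "H y = 0" using F0 by (auto simp: H_def)
      then have "dist (H x) (H y) = norm (F a)" by (simp add: Hx)
      also have "\<dots> \<ge> \<zeta> a" unfolding F_def using norm_fst_le[of "\<zeta> a" "\<zeta> a *\<^sub>R (a - p)"] by simp
      finally have "9 * r ^ 4 \<le> dist (H x) (H y)" using za by simp
      then have "1 * (9 * r ^ 4) \<le> (2 + 2 * r) * dist (H x) (H y)" using r by (intro mult_mono) auto
      then show "1 \<le> S * dist (H x) (H y)"
        using r4 by (simp add: S_def pos_le_divide_eq)
    qed
  qed
  show ?thesis using L S sep by blast
qed

text \<open>A real-valued substitute for the Riemannian distance: the sum, over a finite family of charts, of the
  distances between the cut-off coordinates.\<close>

lemma ex_comparison_pseudometric:
  assumes I: "finite I" "\<And>c p r. (c, p, r) \<in> I \<Longrightarrow> c \<in> A \<and> r > 0 \<and> cball p (4 * r) \<subseteq> chart_img c"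
  obtains \<rho> :: "'a \<Rightarrow> 'a \<Rightarrow> real" and L S where "L > 0" "S > 0"
    "\<And>x y. \<rho> x y \<ge> 0" "\<And>x. \<rho> x x = 0" "\<And>x y. \<rho> x y = \<rho> y x" "\<And>x y z. \<rho> x z \<le> \<rho> x y + \<rho> y z"
    "\<And>x y. ennreal (\<rho> x y) \<le> ennreal L * riem_dist M A g x y"
    "\<And>c p r x y. (c, p, r) \<in> I \<Longrightarrow> x \<in> chart_dom c \<Longrightarrow> chart_map c x \<in> ball p r \<Longrightarrow>
      y \<in> chart_dom c \<Longrightarrow> chart_map c y \<in> ball p (2 * r) \<Longrightarrow> dist (chart_map c x) (chart_map c y) \<le> S * \<rho> x y"
    "\<And>c p r x y. (c, p, r) \<in> I \<Longrightarrow> x \<in> chart_dom c \<Longrightarrow> chart_map c x \<in> ball p r \<Longrightarrow>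
      \<not> (y \<in> chart_dom c \<and> chart_map c y \<in> ball p (2 * r)) \<Longrightarrow> 1 \<le> S * \<rho> x y"
proof -
  define P where "P = (\<lambda>(c :: ('a, 'n) chart, p :: real^'n, r :: real) (H :: 'a \<Rightarrow> real \<times> (real^'n), L :: real, S :: real). L > 0 \<and> S > 0 \<and>
    (\<forall>x y. ennreal (dist (H x) (H y)) \<le> ennreal L * riem_dist M A g x y) \<and>
    (\<forall>x y. x \<in> chart_dom c \<longrightarrow> chart_map c x \<in> ball p r \<longrightarrow>
      (y \<in> chart_dom c \<and> chart_map c y \<in> ball p (2 * r) \<longrightarrow> dist (chart_map c x) (chart_map c y) \<le> S * dist (H x) (H y)) \<and>
      (\<not> (y \<in> chart_dom c \<and> chart_map c y \<in> ball p (2 * r)) \<longrightarrow> 1 \<le> S * dist (H x) (H y))))"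
  have "\<forall>j\<in>I. \<exists>t. P j t"
  proof
    fix j assume jI: "j \<in> I"
    obtain c p r where j: "j = (c, p, r)" by (cases j)
    have c: "c \<in> A" "r > 0" "cball p (4 * r) \<subseteq> chart_img c" using I(2)[of c p r] jI j by auto
    have K: "cball p (2 * r) \<subseteq> chart_img c" using c(2) by (intro order_trans[OF subset_cball c(3)]) simp
    from ex_chart_separation[OF c(1,2) K] show "\<exists>t. P j t" unfolding P_def j split_paired_Ex prod.case by blast
  qed
  from bchoice[OF this] obtain t where t: "\<And>j. j \<in> I \<Longrightarrow> P j (t j)" by blast
  define H where "H j = fst (t j)" for j
  define L where "L j = fst (snd (t j))" for j
  define S where "S j = snd (snd (t j))" for j
  have tj: "t j = (H j, L j, S j)" for j by (simp add: H_def L_def S_def)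
  have lip: "L j > 0 \<and> S j > 0 \<and> (\<forall>x y. ennreal (dist (H j x) (H j y)) \<le> ennreal (L j) * riem_dist M A g x y)" if "j \<in> I" for j
    using t[OF that] unfolding tj by (cases j) (simp add: P_def)
  define \<rho> where "\<rho> x y = (\<Sum>j\<in>I. dist (H j x) (H j y))" for x y
  define S' where "S' = 1 + (\<Sum>j\<in>I. S j)"
  have S0: "S j \<ge> 0" "L j \<ge> 0" if "j \<in> I" for j using lip[OF that] by auto
  have S': "S' > 0" "\<And>j. j \<in> I \<Longrightarrow> S j \<le> S'"
    using sum_nonneg[of I S] S0 member_le_sum[of _ I S] I(1) by (fastforce simp: S'_def)+
  have \<rho>j: "S j * dist (H j x) (H j y) \<le> S' * \<rho> x y" if j: "j \<in> I" for j x y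
  proof -
    have "dist (H j x) (H j y) \<le> \<rho> x y" unfolding \<rho>_def by (rule member_le_sum[OF j]) (use I(1) in auto)
    then show ?thesis using S0[OF j] S'(1) S'(2)[OF j] by (intro mult_mono) auto
  qed
  show ?thesis
  proof (rule that[of "1 + (\<Sum>j\<in>I. L j)" S' \<rho>])
    show "0 < 1 + (\<Sum>j\<in>I. L j)" using sum_nonneg[of I L] S0 by fastforce
    show "S' > 0" by (rule S'(1))
    show "\<rho> x y \<ge> 0" "\<rho> x x = 0" "\<rho> x y = \<rho> y x" "\<rho> x z \<le> \<rho> x y + \<rho> y z" for x y z
      unfolding \<rho>_def by (auto simp: sum.distrib[symmetric] dist_commute intro!: sum_nonneg sum_mono dist_triangle)
    show "ennreal (\<rho> x y) \<le> ennreal (1 + (\<Sum>j\<in>I. L j)) * riem_dist M A g x y" for x y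
    proof -
      have "ennreal (\<rho> x y) = (\<Sum>j\<in>I. ennreal (dist (H j x) (H j y)))" unfolding \<rho>_def by (rule sum_ennreal[symmetric]) simp
      also have "\<dots> \<le> (\<Sum>j\<in>I. ennreal (L j) * riem_dist M A g x y)" by (intro sum_mono) (use lip in blast)
      also have "\<dots> = ennreal (\<Sum>j\<in>I. L j) * riem_dist M A g x y"
        using S0 by (simp add: sum_distrib_right[symmetric] sum_ennreal)
      also have "\<dots> \<le> ennreal (1 + (\<Sum>j\<in>I. L j)) * riem_dist M A g x y" by (intro mult_right_mono ennreal_leI) auto
      finally show ?thesis .
    qed
    fix c p r x y assume j: "(c, p, r) \<in> I" "x \<in> chart_dom c" "chart_map c x \<in> ball p r"
    note s = t[OF j(1), unfolded tj P_def prod.case, THEN conjunct2, THEN conjunct2, THEN conjunct2, rule_format, OF j(2,3), of y]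
    { assume y: "y \<in> chart_dom c" "chart_map c y \<in> ball p (2 * r)"
      show "dist (chart_map c x) (chart_map c y) \<le> S' * \<rho> x y"
        using conjunct1[OF s] y \<rho>j[OF j(1), of x y] by (meson order_trans) }
    { assume y: "\<not> (y \<in> chart_dom c \<and> chart_map c y \<in> ball p (2 * r))"
      show "1 \<le> S' * \<rho> x y"
        using conjunct2[OF s] y \<rho>j[OF j(1), of x y] by (meson order_trans) }
  qed
qed

end

section \<open>Good points of a Sobolev map\<close>

context closed_riemannian
begin

text \<open>On a compact part of a chart the Euclidean norm of the derivative and Lebesgue measure are comparable
  with the norm of the differential and the volume.\<close>

lemma Sobolev_gradient_integrable:
  fixes u :: "'a \<Rightarrow> real^'m::finite"
  assumes D: "has_weak_differential A u D" and Lp: "in_Lp vol (real CARD('n)) (differential_norm A g D)"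
    and c: "c \<in> A" and K: "compact K" "K \<subseteq> chart_img c"
  shows "integrable lebesgue (\<lambda>y. indicator K y *\<^sub>R norm (D c y))"
    "integrable lebesgue (\<lambda>y. (indicator K y *\<^sub>R norm (D c y)) ^ CARD('n))"
proof -
  let ?n = "CARD('n)"
  define h where "h y = indicator K y *\<^sub>R norm (D c y)" for y
  have law: "covector_law D" and li: "locally_integrable (chart_img c) (D c)"
    using D c unfolding has_weak_differential_iff has_weak_derivative_on_def by auto
  have "set_integrable lebesgue K (D c)" using li K unfolding locally_integrable_def by blast
  then have "set_integrable lebesgue K (\<lambda>y. norm (D c y))" by (rule set_integrable_norm)
  then show hi: "integrable lebesgue (\<lambda>y. indicator K y *\<^sub>R norm (D c y))" by (simp add: set_integrable_def)
  obtain m where m: "m > 0" "\<And>y (T :: real^'n^'m). y \<in> K \<Longrightarrow> m * norm T \<le> sqrt (sqnorm_at c y T)"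
    "\<And>y. y \<in> K \<Longrightarrow> m \<le> sqrt (det (g c y))"
    using metric_bounds[OF c K, where 'm='m] by metis
  define k where "k = (1 / m) ^ Suc ?n"
  define H where "H x = ennreal (k * differential_norm A g D x powr real ?n)" for x
  have k: "k \<ge> 0" using m(1) by (simp add: k_def)
  have dm: "differential_norm A g D \<in> borel_measurable vol" by (rule weak_differential_norm_measurable[OF D])
  then have Hm: "H \<in> borel_measurable vol" unfolding H_def by measurable
  have "integrable vol (\<lambda>x. k * norm (differential_norm A g D x) powr real ?n)"
    using Lp unfolding in_Lp_def by simp
  then have "(\<integral>\<^sup>+x. ennreal (norm (k * norm (differential_norm A g D x) powr real ?n)) \<partial>vol) < \<infinity>"
    unfolding integrable_iff_bounded by blast
  moreover have "(\<integral>\<^sup>+x. H x \<partial>vol) \<le> (\<integral>\<^sup>+x. ennreal (norm (k * norm (differential_norm A g D x) powr real ?n)) \<partial>vol)"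
    unfolding H_def using k differential_norm_nonneg[OF law]
    by (intro nn_integral_mono ennreal_leI) (auto simp: abs_mult)
  ultimately have fin: "(\<integral>\<^sup>+x. H x \<partial>vol) < \<infinity>" by (rule le_less_trans[rotated])
  have "ennreal (h y ^ ?n) \<le> H (chart_inv c y) * vol_density c y * indicator (chart_img c) y" for y
  proof (cases "y \<in> K")
    case True
    then have y: "y \<in> chart_img c" using K(2) by blast
    let ?d = "differential_norm A g D (chart_inv c y)"
    have d: "?d = sqrt (sqnorm_at c y (D c y))" by (rule differential_norm_chart[OF law c y])
    have d0: "?d \<ge> 0" by (rule differential_norm_nonneg[OF law chart_inv_top[OF c y]])
    have pw: "?d powr real ?n = ?d ^ ?n" using d0 by (cases "?d = 0") (auto simp: powr_realpow)
    have "norm (D c y) \<le> 1 / m * ?d" using m(2)[OF True, of "D c y"] m(1) unfolding d by (simp add: pos_le_divide_eq mult.commute)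
    then have "norm (D c y) ^ ?n \<le> (1 / m * ?d) ^ ?n" by (intro power_mono) auto
    also have "\<dots> = (1 / m) ^ ?n * ?d ^ ?n * 1" by (simp only: power_mult_distrib mult_1_right)
    also have "\<dots> \<le> (1 / m) ^ ?n * ?d ^ ?n * (1 / m * sqrt (det (g c y)))"
      using m(1) m(3)[OF True] d0 by (intro mult_left_mono) (auto simp: pos_le_divide_eq)
    also have "\<dots> = k * ?d powr real ?n * sqrt (det (g c y))" by (simp add: k_def pw)
    finally have le: "norm (D c y) ^ ?n \<le> k * ?d powr real ?n * sqrt (det (g c y))" .
    have "ennreal (h y ^ ?n) = ennreal (norm (D c y) ^ ?n)" using True by (simp add: h_def)
    also have "\<dots> \<le> ennreal (k * ?d powr real ?n * sqrt (det (g c y)))" by (rule ennreal_leI[OF le])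
    also have "\<dots> = H (chart_inv c y) * vol_density c y"
      unfolding H_def vol_density_def using k by (intro ennreal_mult') simp
    finally show ?thesis using y by simp
  qed (simp add: h_def power_0_left)
  then have "(\<integral>\<^sup>+y. ennreal (h y ^ ?n) \<partial>lebesgue) \<le> (\<integral>\<^sup>+y\<in>chart_img c. H (chart_inv c y) * vol_density c y \<partial>lebesgue)"
    by (intro nn_integral_mono)
  also have "\<dots> = (\<integral>\<^sup>+x\<in>chart_dom c. H x \<partial>vol)" by (rule nn_integral_vol_chart[OF c Hm, symmetric])
  also have "\<dots> \<le> (\<integral>\<^sup>+x. H x \<partial>vol)" by (intro nn_integral_mono) (auto simp: indicator_def)
  finally have "(\<integral>\<^sup>+y. ennreal (h y ^ ?n) \<partial>lebesgue) < \<infinity>" using fin by (rule le_less_trans)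
  moreover have "h \<in> borel_measurable lebesgue" using borel_measurable_integrable[OF hi] by (simp add: h_def[abs_def])
  moreover have "h y \<ge> 0" for y by (simp add: h_def)
  ultimately have "integrable lebesgue (\<lambda>y. h y ^ ?n)"
    by (intro integrableI_bounded borel_measurable_power) auto
  then show "integrable lebesgue (\<lambda>y. (indicator K y *\<^sub>R norm (D c y)) ^ ?n)" by (simp only: h_def)
qed

definition chart_gradient ::
    "(('a, 'n) chart \<Rightarrow> real^'n \<Rightarrow> real^'n^'m::finite) \<Rightarrow> ('a, 'n) chart \<times> (real^'n) \<times> real \<Rightarrow> real^'n \<Rightarrow> real" where
  "chart_gradient D = (\<lambda>(c, p, r) y. indicator (cball p (4 * r)) y *\<^sub>R norm (D c y))"

definition exceptional ::
    "(('a, 'n) chart \<Rightarrow> real^'n \<Rightarrow> real^'n^'m::finite) \<Rightarrow> (('a, 'n) chart \<times> (real^'n) \<times> real) set \<Rightarrow> real \<Rightarrow> 'a set" where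
  "exceptional D I t = (\<Union>(c, p, r)\<in>I. chart_inv c ` (cball p (3 * r) \<inter> bad_set t (chart_gradient D (c, p, r))))"

lemma exceptional_antimono: "t \<le> t' \<Longrightarrow> exceptional D I t' \<subseteq> exceptional D I t"
  unfolding exceptional_def using bad_set_antimono by fast

text \<open>In each of the finitely many charts this is the decay of the superlevel sets of the maximal
  function, since the density of the volume is bounded there.\<close>

lemma exceptional_measure:
  fixes u :: "'a \<Rightarrow> real^'m::finite"
  assumes D: "has_weak_differential A u D" and Lp: "in_Lp vol (real CARD('n)) (differential_norm A g D)"
    and I: "finite I" "\<And>c p r. (c, p, r) \<in> I \<Longrightarrow> c \<in> A \<and> r > 0 \<and> cball p (4 * r) \<subseteq> chart_img c"
  shows "exceptional D I t \<in> sets vol"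
    "((\<lambda>t. t ^ CARD('n) * measure vol (exceptional D I t)) \<longlongrightarrow> 0) at_top"
proof -
  interpret V: finite_measure vol by (rule finite_measure_vol)
  let ?n = "CARD('n)"
  define h where "h j = chart_gradient D j" for j
  define Y where "Y = (\<lambda>(c :: ('a, 'n) chart, p :: real^'n, r :: real) t. cball p (3 * r) \<inter> bad_set t (h (c, p, r)))"
  define N where "N = (\<lambda>(c :: ('a, 'n) chart, p :: real^'n, r :: real) t. chart_inv c ` Y (c, p, r) t)"
  have ex: "exceptional D I t = (\<Union>j\<in>I. N j t)" for t
    unfolding exceptional_def N_def Y_def h_def by (auto simp: case_prod_unfold)
  have piece: "N j t \<in> sets vol \<and> (\<exists>C\<ge>0. \<forall>t>0. measure vol (N j t) \<le> C * measure lebesgue (bad_set t (h j))) \<and>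
    ((\<lambda>t. t ^ ?n * measure lebesgue (bad_set t (h j))) \<longlongrightarrow> 0) at_top" if jI: "j \<in> I" for j t
  proof -
    obtain c p r where j: "j = (c, p, r)" by (cases j)
    have c: "c \<in> A" "r > 0" "cball p (4 * r) \<subseteq> chart_img c" using I(2)[of c p r] jI j by auto
    have K: "cball p (3 * r) \<subseteq> chart_img c" using c(2) by (intro order_trans[OF subset_cball c(3)]) simp
    have hj: "h j = (\<lambda>y. indicator (cball p (4 * r)) y *\<^sub>R norm (D c y))" by (simp add: h_def chart_gradient_def j)
    have hi: "integrable lebesgue (h j)" "integrable lebesgue (\<lambda>y. h j y ^ DIM(real^'n))" "\<And>y. h j y \<ge> 0"
      using Sobolev_gradient_integrable[OF D Lp c(1) compact_cball c(3)] unfolding hj by simp_all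
    have Ym: "Y j t \<in> sets lebesgue" "Y j t \<subseteq> chart_img c" for t
      using K open_bad_set[of t "h j"] unfolding Y_def j by (auto simp: borel_open sets_completionI_sets simp del: mem_cball)
    obtain C where C: "C > 0" "\<And>y. y \<in> cball p (3 * r) \<Longrightarrow> sqrt (det (g c y)) \<le> C"
      using metric_bounds[OF c(1) compact_cball K, where 'm='m] by metis
    have "measure vol (N j t) \<le> C * measure lebesgue (bad_set t (h j))" if t: "t > 0" for t
    proof -
      have lm: "bad_set t (h j) \<in> lmeasurable" by (rule bad_set_lmeasurable(1)[OF hi(1,3) t])
      have "emeasure vol (N j t) = (\<integral>\<^sup>+y\<in>Y j t. vol_density c y \<partial>lebesgue)"
        using emeasure_vol_chart_inv[OF c(1) Ym, of t] by (simp add: N_def j)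
      also have "\<dots> \<le> (\<integral>\<^sup>+y. ennreal C * indicator (bad_set t (h j)) y \<partial>lebesgue)"
        using C(2) by (intro nn_integral_mono) (auto simp: Y_def j vol_density_def indicator_def intro!: ennreal_leI)
      also have "\<dots> = ennreal C * emeasure lebesgue (bad_set t (h j))"
        using lm by (intro nn_integral_cmult_indicator) auto
      also have "\<dots> = ennreal (C * measure lebesgue (bad_set t (h j)))"
        using C(1) lm by (simp add: emeasure_eq_measure2 fmeasurableD2 ennreal_mult' emeasure_eq_ennreal_measure top.not_eq_extremum)
      finally show ?thesis using C(1) by (simp add: V.emeasure_eq_measure ennreal_le_iff)
    qed
    moreover have "N j t \<in> sets vol" using chart_inv_image_volume_sets[OF c(1) Ym, of t] by (simp add: N_def j sets_vol)
    moreover have "((\<lambda>t. t ^ ?n * measure lebesgue (bad_set t (h j))) \<longlongrightarrow> 0) at_top"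
      using bad_set_measure_tendsto[OF hi(1,3,2)] by simp
    ultimately show ?thesis using C(1) by (intro conjI exI[of _ C]) auto
  qed
  show ms: "exceptional D I t \<in> sets vol" for t unfolding ex using piece I(1) by (intro sets.finite_UN) auto
  have "\<forall>j\<in>I. \<exists>C\<ge>0. \<forall>t>0. measure vol (N j t) \<le> C * measure lebesgue (bad_set t (h j))" using piece by blast
  from bchoice[OF this] obtain C where C: "\<And>j. j \<in> I \<Longrightarrow> C j \<ge> 0"
    "\<And>j t. j \<in> I \<Longrightarrow> t > 0 \<Longrightarrow> measure vol (N j t) \<le> C j * measure lebesgue (bad_set t (h j))" by blast
  have "((\<lambda>t. \<Sum>j\<in>I. C j * (t ^ ?n * measure lebesgue (bad_set t (h j)))) \<longlongrightarrow> (\<Sum>j\<in>I. C j * 0)) at_top"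
    using piece by (intro tendsto_sum tendsto_mult tendsto_const) auto
  then have lim: "((\<lambda>t. \<Sum>j\<in>I. C j * (t ^ ?n * measure lebesgue (bad_set t (h j)))) \<longlongrightarrow> 0) at_top" by simp
  show "((\<lambda>t. t ^ ?n * measure vol (exceptional D I t)) \<longlongrightarrow> 0) at_top"
  proof (rule tendsto_sandwich[OF _ _ tendsto_const lim])
    show "\<forall>\<^sub>F t in at_top. 0 \<le> t ^ ?n * measure vol (exceptional D I t)"
      using eventually_ge_at_top[of "0::real"] by eventually_elim simp
    show "\<forall>\<^sub>F t in at_top. t ^ ?n * measure vol (exceptional D I t) \<le> (\<Sum>j\<in>I. C j * (t ^ ?n * measure lebesgue (bad_set t (h j))))"
      using eventually_gt_at_top[of "0::real"]
    proof eventually_elim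
      case (elim t)
      have "measure vol (exceptional D I t) \<le> (\<Sum>j\<in>I. measure vol (N j t))"
        unfolding ex using piece I(1) by (intro measure_UNION_le) auto
      also have "\<dots> \<le> (\<Sum>j\<in>I. C j * measure lebesgue (bad_set t (h j)))" using C(2) elim by (intro sum_mono) auto
      finally have "t ^ ?n * measure vol (exceptional D I t) \<le> t ^ ?n * (\<Sum>j\<in>I. C j * measure lebesgue (bad_set t (h j)))"
        using elim by (intro mult_left_mono) auto
      then show ?case by (simp add: sum_distrib_left mult_ac)
    qed
  qed
qed

lemma AE_leb_point_in_charts:
  fixes u :: "'a \<Rightarrow> real^'m::finite"
  assumes D: "has_weak_differential A u D"
    and I: "finite I" "\<And>c p r. (c, p, r) \<in> I \<Longrightarrow> c \<in> A"
  shows "AE x in vol. \<forall>(c, p, r)\<in>I. x \<in> chart_dom c \<longrightarrow> leb_point (u \<circ> chart_inv c) (chart_map c x)"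
proof (rule AE_finite_allI[OF I(1)])
  fix j assume jI: "j \<in> I"
  obtain c p r where j: "j = (c, p, r)" by (cases j)
  have c: "c \<in> A" using I(2)[of c p r] jI j by auto
  have "locally_integrable (chart_img c) (u \<circ> chart_inv c)"
    using D c unfolding has_weak_differential_iff has_weak_derivative_on_def by blast
  then have ae: "AE y in lebesgue. y \<in> chart_img c \<longrightarrow> leb_point (u \<circ> chart_inv c) y"
    by (rule AE_leb_point[OF open_img[OF c]])
  define Y where "Y = {y \<in> chart_img c. \<not> leb_point (u \<circ> chart_inv c) y}"
  have "{y \<in> space lebesgue. \<not> (y \<in> chart_img c \<longrightarrow> leb_point (u \<circ> chart_inv c) y)} \<in> null_sets lebesgue"
    using ae by (simp add: AE_iff_null_sets completion.complete_sets_sandwich AE_iff_null null_sets_def completion.AE_iff_null_sets)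
  then have Y: "Y \<in> null_sets lebesgue" by (simp add: Y_def)
  have Yi: "Y \<in> sets lebesgue" "Y \<subseteq> chart_img c" using Y by (auto simp: Y_def)
  have "emeasure vol (chart_inv c ` Y) = 0"
    unfolding emeasure_vol_chart_inv[OF c Yi] by (rule nn_integral_null_set[OF Y])
  then have "chart_inv c ` Y \<in> null_sets vol"
    using chart_inv_image_volume_sets[OF c Yi] by (simp add: null_sets_def sets_vol)
  from AE_not_in[OF this]
  show "AE x in vol. case j of (c, p, r) \<Rightarrow> x \<in> chart_dom c \<longrightarrow> leb_point (u \<circ> chart_inv c) (chart_map c x)"
  proof eventually_elim
    case (elim x)
    show ?case unfolding j prod.case
    proof
      assume x: "x \<in> chart_dom c"
      show "leb_point (u \<circ> chart_inv c) (chart_map c x)"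
      proof (rule ccontr)
        assume "\<not> leb_point (u \<circ> chart_inv c) (chart_map c x)"
        then have "chart_map c x \<in> Y" using chart_map_in[OF x] by (simp add: Y_def)
        then have "chart_inv c (chart_map c x) \<in> chart_inv c ` Y" by blast
        then show False using elim chart_inv_map[OF c x] by simp
      qed
    qed
  qed
qed

definition good_points ::
    "('a \<Rightarrow> real^'m::finite) \<Rightarrow> (('a, 'n) chart \<Rightarrow> real^'n \<Rightarrow> real^'n^'m) \<Rightarrow> (real^'m) set \<Rightarrow>
     (('a, 'n) chart \<times> (real^'n) \<times> real) set \<Rightarrow> real \<Rightarrow> 'a set" where
  "good_points u D X I t = {x \<in> topspace M. u x \<in> X \<and>
     (\<forall>(c, p, r)\<in>I. x \<in> chart_dom c \<longrightarrow> leb_point (u \<circ> chart_inv c) (chart_map c x)) \<and> x \<notin> exceptional D I t}"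

text \<open>Points that are close in a chart satisfy the pointwise Lipschitz estimate, where the maximal function
  of the gradient is at most \<open>t\<close>. For all other pairs the pseudo-metric is bounded below, while their images
  lie in the bounded set \<open>X\<close>.\<close>

lemma Lipschitz_on_good_points:
  fixes u :: "'a \<Rightarrow> real^'m::finite"
  assumes D: "has_weak_differential A u D" and Lp: "in_Lp vol (real CARD('n)) (differential_norm A g D)"
    and I: "finite I" "\<And>c p r. (c, p, r) \<in> I \<Longrightarrow> c \<in> A \<and> r > 0 \<and> cball p (4 * r) \<subseteq> chart_img c"
      "\<And>x. x \<in> topspace M \<Longrightarrow> \<exists>(c, p, r)\<in>I. x \<in> chart_dom c \<and> chart_map c x \<in> ball p r"
    and S: "S > 0" "\<And>x y. \<rho> x y \<ge> 0"
    "\<And>c p r x y. (c, p, r) \<in> I \<Longrightarrow> x \<in> chart_dom c \<Longrightarrow> chart_map c x \<in> ball p r \<Longrightarrow>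
      y \<in> chart_dom c \<Longrightarrow> chart_map c y \<in> ball p (2 * r) \<Longrightarrow> dist (chart_map c x) (chart_map c y) \<le> S * \<rho> x y"
    "\<And>c p r x y. (c, p, r) \<in> I \<Longrightarrow> x \<in> chart_dom c \<Longrightarrow> chart_map c x \<in> ball p r \<Longrightarrow>
      \<not> (y \<in> chart_dom c \<and> chart_map c y \<in> ball p (2 * r)) \<Longrightarrow> 1 \<le> S * \<rho> x y"
    and X: "bounded X"
  obtains C where "C \<ge> 0" "\<And>t x y. t \<ge> 1 \<Longrightarrow> x \<in> good_points u D X I t \<Longrightarrow> y \<in> good_points u D X I t \<Longrightarrow>
    norm (u x - u y) \<le> C * t * \<rho> x y"
proof -
  let ?n = "CARD('n)"
  obtain B where B: "B > 0" "\<And>x. x \<in> X \<Longrightarrow> norm x \<le> B" using X by (auto simp: bounded_pos)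
  obtain C0 :: real where C0: "C0 > 0"
    "\<And>(u :: real^'n \<Rightarrow> real^'m) G S N x y.
      has_weak_derivative_on u G S \<Longrightarrow> leb_point u x \<Longrightarrow> leb_point u y \<Longrightarrow>
      cball x (2 * dist x y) \<subseteq> S \<Longrightarrow> cball y (2 * dist x y) \<subseteq> S \<Longrightarrow>
      (\<And>s. 0 < s \<Longrightarrow> s \<le> 2 * dist x y \<Longrightarrow> (LINT w:cball x s|lebesgue. norm (G w)) \<le> N * s ^ ?n) \<Longrightarrow>
      (\<And>s. 0 < s \<Longrightarrow> s \<le> 2 * dist x y \<Longrightarrow> (LINT w:cball y s|lebesgue. norm (G w)) \<le> N * s ^ ?n) \<Longrightarrow>
      norm (u x - u y) \<le> C0 * N * dist x y"
    using ex_pointwise_lipschitz_constant[where 'n='n and 'm='m] by blast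
  define Kj where "Kj = (\<lambda>(c :: ('a, 'n) chart, p :: real^'n, r :: real). C0 * 2 ^ ?n * S + 2 * B * (2 / r + 1) * S)"
  have Kj0: "Kj j \<ge> 0" if "j \<in> I" for j
    using I(2)[of "fst j" "fst (snd j)" "snd (snd j)"] that C0(1) S(1) B(1) by (simp add: Kj_def case_prod_unfold)
  define C where "C = (\<Sum>j\<in>I. Kj j)"
  have CK: "Kj j \<le> C" if "j \<in> I" for j unfolding C_def by (rule member_le_sum[OF that]) (use Kj0 I(1) in auto)
  show ?thesis
  proof (rule that[of C])
    show "C \<ge> 0" unfolding C_def by (rule sum_nonneg[OF Kj0])
    fix t :: real and x y assume t: "t \<ge> 1" and x: "x \<in> good_points u D X I t" and y: "y \<in> good_points u D X I t"
    have xt: "x \<in> topspace M" using x by (simp add: good_points_def)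
    obtain c p r where j: "(c, p, r) \<in> I" "x \<in> chart_dom c" "chart_map c x \<in> ball p r" using I(3)[OF xt] by fastforce
    have c: "c \<in> A" "r > 0" "cball p (4 * r) \<subseteq> chart_img c" using I(2)[OF j(1)] by auto
    let ?a = "chart_map c x" and ?b = "chart_map c y" and ?K = "Kj (c, p, r)"
    define h where "h = chart_gradient D (c, p, r)"
    have hd: "h = (\<lambda>w. indicator (cball p (4 * r)) w *\<^sub>R norm (D c w))" by (simp add: h_def chart_gradient_def)
    have hi: "integrable lebesgue h" "\<And>w. h w \<ge> 0"
      using Sobolev_gradient_integrable(1)[OF D Lp c(1) compact_cball c(3)] unfolding hd by simp_all
    have small: "cball a s \<subseteq> cball p (4 * r)" if "a \<in> cball p (3 * r)" "s \<le> r" for a s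
      unfolding cball_subset_cball_iff using that by (simp add: dist_commute)
    have max: "(LINT w:cball a s|lebesgue. norm (D c w)) \<le> (t * 2 ^ ?n) * s ^ ?n"
      if a: "z \<in> good_points u D X I t" "z \<in> chart_dom c" "a = chart_map c z" "a \<in> cball p (3 * r)" and s: "s > 0" "s \<le> r" for z a s
    proof -
      have nb: "a \<notin> bad_set t h"
      proof
        assume "a \<in> bad_set t h"
        then have "chart_inv c a \<in> chart_inv c ` (cball p (3 * r) \<inter> bad_set t (chart_gradient D (c, p, r)))"
          using a(4) unfolding h_def by blast
        then have "chart_inv c a \<in> exceptional D I t" unfolding exceptional_def using j(1) by blast
        then show False using a(1) chart_inv_map[OF c(1) a(2)] unfolding a(3) good_points_def by simp
      qed
      have sub: "cball a s \<subseteq> cball p (4 * r)"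
        using a(4) s(2) by (rule small)
      have "(LINT w:cball a s|lebesgue. norm (D c w)) = (LINT w:cball a s|lebesgue. h w)"
        using sub by (intro set_lebesgue_integral_cong) (auto simp: hd)
      also have "\<dots> \<le> t * 2 ^ ?n * s ^ ?n" using integral_cball_le_of_not_bad[OF nb s(1) hi] by simp
      finally show ?thesis .
    qed
    have far: "norm (u x - u y) \<le> C * t * \<rho> x y" if f: "1 \<le> (2 / r + 1) * (S * \<rho> x y)"
    proof -
      have "norm (u x - u y) \<le> norm (u x) + norm (u y)" by (rule norm_triangle_ineq4)
      also have "\<dots> \<le> 2 * B * 1" using B(2)[of "u x"] B(2)[of "u y"] x y by (auto simp: good_points_def)
      also have "\<dots> \<le> 2 * B * ((2 / r + 1) * (S * \<rho> x y))" using f B(1) by (intro mult_left_mono) auto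
      also have "\<dots> = (2 * B * (2 / r + 1) * S) * 1 * \<rho> x y" by simp
      also have "\<dots> \<le> C * t * \<rho> x y"
      proof (intro mult_right_mono[OF mult_mono] S(2) t)
        show "2 * B * (2 / r + 1) * S \<le> C"
          using CK[OF j(1)] C0(1) S(1) by (intro order_trans[OF _ CK[OF j(1)]]) (simp add: Kj_def)
        show "0 \<le> C" unfolding C_def by (rule sum_nonneg[OF Kj0])
      qed simp
      finally show ?thesis .
    qed
    show "norm (u x - u y) \<le> C * t * \<rho> x y"
    proof (cases "y \<in> chart_dom c \<and> ?b \<in> ball p (2 * r)")
      case False
      from S(4)[OF j False] have "1 * 1 \<le> (2 / r + 1) * (S * \<rho> x y)" using c(2) by (intro mult_mono) auto
      then show ?thesis by (intro far) simp
    next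
      case True
      have dle: "dist ?a ?b \<le> S * \<rho> x y" using S(3)[OF j] True by blast
      show ?thesis
      proof (cases "dist ?a ?b \<le> r / 2")
        case False
        then have "1 \<le> 2 / r * dist ?a ?b" using c(2) by (simp add: field_simps)
        also have "\<dots> \<le> (2 / r + 1) * (S * \<rho> x y)" using dle c(2) by (intro mult_mono) auto
        finally show ?thesis by (rule far)
      next
        case near: True
        have lp: "leb_point (u \<circ> chart_inv c) ?a" "leb_point (u \<circ> chart_inv c) ?b"
          using x y j(1,2) True unfolding good_points_def by fast+
        have ab: "?a \<in> cball p (3 * r)" "?b \<in> cball p (3 * r)" using j(3) True c(2) by auto
        have sub: "cball ?a (2 * dist ?a ?b) \<subseteq> chart_img c" "cball ?b (2 * dist ?a ?b) \<subseteq> chart_img c"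
          using order_trans[OF small[OF ab(1)] c(3), of "2 * dist ?a ?b"] order_trans[OF small[OF ab(2)] c(3), of "2 * dist ?a ?b"] near
          by simp_all
        have wd: "has_weak_derivative_on (u \<circ> chart_inv c) (D c) (chart_img c)"
          using D c(1) unfolding has_weak_differential_iff by blast
        have "norm ((u \<circ> chart_inv c) ?a - (u \<circ> chart_inv c) ?b) \<le> C0 * (t * 2 ^ ?n) * dist ?a ?b"
        proof (rule C0(2)[OF wd lp sub])
          fix s :: real assume s: "0 < s" "s \<le> 2 * dist ?a ?b"
          have "s \<le> r" using s(2) near by simp
          show "(LINT w:cball ?a s|lebesgue. norm (D c w)) \<le> (t * 2 ^ ?n) * s ^ ?n"
            by (rule max[OF x j(2) refl ab(1) s(1) \<open>s \<le> r\<close>])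
          show "(LINT w:cball ?b s|lebesgue. norm (D c w)) \<le> (t * 2 ^ ?n) * s ^ ?n"
            by (rule max[OF y conjunct1[OF True] refl ab(2) s(1) \<open>s \<le> r\<close>])
        qed
        also have "\<dots> \<le> C0 * (t * 2 ^ ?n) * (S * \<rho> x y)" using dle C0(1) t by (intro mult_left_mono) auto
        also have "\<dots> = (C0 * 2 ^ ?n * S) * t * \<rho> x y" by simp
        also have "\<dots> \<le> C * t * \<rho> x y"
        proof (intro mult_right_mono S(2))
          show "C0 * 2 ^ ?n * S \<le> C"
            using B(1) S(1) c(2) by (intro order_trans[OF _ CK[OF j(1)]]) (simp add: Kj_def)
        qed (use t in simp)
        finally show ?thesis using chart_inv_map[OF c(1) j(2)] chart_inv_map[OF c(1) conjunct1[OF True]] by simp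
      qed
    qed
  qed
qed

text \<open>Almost all points off the exceptional set are good. A ball of radius comparable to \<open>\<delta> / t\<close> without good
  points would be contained in the exceptional set up to a null set, but its volume is at least a
  multiple of \<open>(\<delta> / t) ^ n\<close>.\<close>

lemma good_points_dense:
  fixes u :: "'a \<Rightarrow> real^'m::finite"
  assumes D: "has_weak_differential A u D" and Lp: "in_Lp vol (real CARD('n)) (differential_norm A g D)"
    and I: "finite I" "\<And>c p r. (c, p, r) \<in> I \<Longrightarrow> c \<in> A \<and> r > 0 \<and> cball p (4 * r) \<subseteq> chart_img c"
      "\<And>x. x \<in> topspace M \<Longrightarrow> \<exists>(c, p, r)\<in>I. x \<in> chart_dom c \<and> chart_map c x \<in> ball p r"
    and L: "L > 0" "\<And>x y. ennreal (\<rho> x y) \<le> ennreal L * riem_dist M A g x y"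
    and X: "AE x in vol. u x \<in> X" and \<delta>: "\<delta> > 0"
  shows "\<forall>\<^sub>F t in at_top. \<forall>x\<in>topspace M. \<exists>y\<in>good_points u D X I t. \<rho> x y \<le> \<delta> / t"
proof -
  interpret V: finite_measure vol by (rule finite_measure_vol)
  let ?n = "CARD('n)" and ?N = "exceptional D I"
  have AEg: "AE x in vol. u x \<in> X \<and> (\<forall>(c, p, r)\<in>I. x \<in> chart_dom c \<longrightarrow> leb_point (u \<circ> chart_inv c) (chart_map c x))"
    using X AE_leb_point_in_charts[OF D I(1)] I(2) by (intro AE_conjI) auto
  have "\<forall>j\<in>I. \<forall>\<^sub>F t in at_top. case j of (c, p, r) \<Rightarrow>
    \<forall>x. x \<in> chart_dom c \<longrightarrow> chart_map c x \<in> ball p r \<longrightarrow> (\<exists>y\<in>good_points u D X I t. \<rho> x y \<le> \<delta> / t)"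
  proof
    fix j assume jI: "j \<in> I"
    obtain c p r where j: "j = (c, p, r)" by (cases j)
    have c: "c \<in> A" "r > 0" "cball p (4 * r) \<subseteq> chart_img c" using I(2)[of c p r] jI j by auto
    have K: "cball p (2 * r) \<subseteq> chart_img c" using c(2) by (intro order_trans[OF subset_cball c(3)]) simp
    obtain m where m: "m > 0" "\<And>y. y \<in> cball p (2 * r) \<Longrightarrow> m \<le> sqrt (det (g c y))"
      using metric_bounds[OF c(1) compact_cball K, where 'm='m] by metis
    obtain C where C: "C > 0" "\<And>y z. y \<in> cball p (2 * r) \<Longrightarrow> z \<in> cball p (2 * r) \<Longrightarrow>
      riem_dist M A g (chart_inv c y) (chart_inv c z) \<le> ennreal (C * dist y z)"
      using riem_dist_le_chart[OF c(1) K] by metis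
    define \<sigma> where "\<sigma> = \<delta> / (L * C)"
    have \<sigma>: "\<sigma> > 0" using \<delta> L(1) C(1) by (simp add: \<sigma>_def)
    let ?\<omega> = "unit_ball_vol (real ?n)"
    have \<omega>: "m * ?\<omega> * \<sigma> ^ ?n > 0" using m(1) \<sigma> by simp
    have "\<forall>\<^sub>F t in at_top. t ^ ?n * measure vol (?N t) < m * ?\<omega> * \<sigma> ^ ?n"
      by (rule order_tendstoD(2)[OF exceptional_measure(2)[OF D Lp I(1,2)] \<omega>])
    moreover have "\<forall>\<^sub>F t in at_top. t \<ge> max 1 (\<sigma> / r)" by (rule eventually_ge_at_top)
    ultimately have "\<forall>\<^sub>F t in at_top. \<forall>x. x \<in> chart_dom c \<longrightarrow> chart_map c x \<in> ball p r \<longrightarrow> (\<exists>y\<in>good_points u D X I t. \<rho> x y \<le> \<delta> / t)"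
    proof eventually_elim
      case (elim t)
      have t: "t \<ge> 1" "t > 0" "\<sigma> / t \<le> r" using elim(2) c(2) by (auto simp: field_simps)
      show ?case
      proof (intro allI impI)
        fix x assume x: "x \<in> chart_dom c" "chart_map c x \<in> ball p r"
        let ?a = "chart_map c x" and ?s = "\<sigma> / t"
        have s: "?s > 0" using \<sigma> t by simp
        have sub: "ball ?a ?s \<subseteq> cball p (2 * r)"
        proof
          fix y assume "y \<in> ball ?a ?s"
          then show "y \<in> cball p (2 * r)" using x(2) t(3) dist_triangle[of p y ?a] by auto
        qed
        have Bm: "ball ?a ?s \<in> sets lebesgue" "ball ?a ?s \<subseteq> chart_img c" using sub K by auto
        have "ennreal m * emeasure lebesgue (ball ?a ?s) = (\<integral>\<^sup>+y. ennreal m * indicator (ball ?a ?s) y \<partial>lebesgue)"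
          by (rule nn_integral_cmult_indicator[symmetric]) simp
        also have "\<dots> \<le> (\<integral>\<^sup>+y\<in>ball ?a ?s. vol_density c y \<partial>lebesgue)"
        proof (rule nn_integral_mono)
          fix y show "ennreal m * indicator (ball ?a ?s) y \<le> vol_density c y * indicator (ball ?a ?s) y"
            using m(2)[of y] sub by (cases "y \<in> ball ?a ?s") (auto simp: vol_density_def intro!: ennreal_leI simp del: mem_ball mem_cball)
        qed
        also have "\<dots> = emeasure vol (chart_inv c ` ball ?a ?s)" by (rule emeasure_vol_chart_inv[OF c(1) Bm, symmetric])
        finally have "ennreal (m * ?\<omega> * ?s ^ ?n) \<le> emeasure vol (chart_inv c ` ball ?a ?s)"
          using s m(1) emeasure_lebesgue_ball[of ?s ?a] by (simp add: ennreal_mult'[symmetric] mult.assoc del: emeasure_completion)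
        then have vle: "m * ?\<omega> * ?s ^ ?n \<le> measure vol (chart_inv c ` ball ?a ?s)"
          by (simp add: V.emeasure_eq_measure ennreal_le_iff)
        have "\<exists>y\<in>chart_inv c ` ball ?a ?s. y \<in> good_points u D X I t"
        proof (rule ccontr)
          assume no: "\<not> ?thesis"
          have "measure vol (chart_inv c ` ball ?a ?s) \<le> measure vol (?N t)"
          proof (rule V.finite_measure_mono_AE[OF _ exceptional_measure(1)[OF D Lp I(1,2)]])
            from AEg show "AE y in vol. y \<in> chart_inv c ` ball ?a ?s \<longrightarrow> y \<in> ?N t"
            proof eventually_elim
              case (elim y)
              show ?case
              proof
                assume y: "y \<in> chart_inv c ` ball ?a ?s"
                then have "y \<in> topspace M" using Bm(2) chart_inv_top[OF c(1)] by blast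
                then show "y \<in> ?N t" using no y elim unfolding good_points_def by blast
              qed
            qed
          qed
          then have "t ^ ?n * (m * ?\<omega> * ?s ^ ?n) \<le> t ^ ?n * measure vol (?N t)"
            using vle t by (intro mult_left_mono) auto
          moreover have "t ^ ?n * (m * ?\<omega> * ?s ^ ?n) = m * ?\<omega> * \<sigma> ^ ?n" using t by (simp add: power_divide)
          ultimately show False using elim(1) by linarith
        qed
        then obtain b where b: "b \<in> ball ?a ?s" "chart_inv c b \<in> good_points u D X I t" by blast
        have "?a \<in> cball p (2 * r)" using x(2) c(2) by simp
        from C(2)[OF this subsetD[OF sub b(1)]]
        have "riem_dist M A g x (chart_inv c b) \<le> ennreal (C * dist ?a b)" using chart_inv_map[OF c(1) x(1)] by simp
        also have "\<dots> \<le> ennreal (C * ?s)" using b(1) C(1) by (intro ennreal_leI mult_left_mono) auto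
        finally have rd: "riem_dist M A g x (chart_inv c b) \<le> ennreal (C * ?s)" .
        have "ennreal (\<rho> x (chart_inv c b)) \<le> ennreal L * riem_dist M A g x (chart_inv c b)" by (rule L(2))
        also have "\<dots> \<le> ennreal L * ennreal (C * ?s)" by (rule mult_left_mono[OF rd]) simp
        also have "\<dots> = ennreal (\<delta> / t)" using L(1) C(1) t by (simp add: ennreal_mult'[symmetric] \<sigma>_def)
        finally have "\<rho> x (chart_inv c b) \<le> \<delta> / t" using \<delta> t by (simp add: ennreal_le_iff)
        then show "\<exists>y\<in>good_points u D X I t. \<rho> x y \<le> \<delta> / t" using b(2) by blast
      qed
    qed
    then show "\<forall>\<^sub>F t in at_top. case j of (c, p, r) \<Rightarrow>
      \<forall>x. x \<in> chart_dom c \<longrightarrow> chart_map c x \<in> ball p r \<longrightarrow> (\<exists>y\<in>good_points u D X I t. \<rho> x y \<le> \<delta> / t)"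
      by (simp only: j prod.case)
  qed
  then have "\<forall>\<^sub>F t in at_top. \<forall>j\<in>I. case j of (c, p, r) \<Rightarrow>
    \<forall>x. x \<in> chart_dom c \<longrightarrow> chart_map c x \<in> ball p r \<longrightarrow> (\<exists>y\<in>good_points u D X I t. \<rho> x y \<le> \<delta> / t)"
    by (rule eventually_ball_finite[OF I(1)])
  then show ?thesis
  proof eventually_elim
    case (elim t)
    show ?case
    proof
      fix x assume "x \<in> topspace M"
      then obtain c p r where "(c, p, r) \<in> I" "x \<in> chart_dom c" "chart_map c x \<in> ball p r" using I(3) by fastforce
      with bspec[OF elim] show "\<exists>y\<in>good_points u D X I t. \<rho> x y \<le> \<delta> / t" by fastforce
    qed
  qed
qed

end

section \<open>Lipschitz truncation and density\<close>

context closed_riemannian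
begin

text \<open>The extension from the good points moves by at most \<open>\<eta>\<close> on the way to the nearest good point, where it
  has a value in \<open>X\<close>; so it stays in the domain of the retraction.\<close>

lemma Lipschitz_truncation:
  fixes u :: "'a \<Rightarrow> real^'m::finite"
  assumes D: "has_weak_differential A u D" and Lp: "in_Lp vol (real CARD('n)) (differential_norm A g D)"
    and uX: "AE x in vol. u x \<in> X" and X: "compact X" "Lipschitz_neighborhood_retract X"
  obtains N C where "\<And>t. N t \<in> sets vol" "\<And>t t'. t \<le> t' \<Longrightarrow> N t' \<subseteq> N t"
    "((\<lambda>t. t ^ CARD('n) * measure vol (N t)) \<longlongrightarrow> 0) at_top" "C > 0"
    "\<forall>\<^sub>F t :: real in at_top. \<exists>v. riem_lipschitz v (C * t) \<and> v ` topspace M \<subseteq> X \<and> (AE x in vol. x \<notin> N t \<longrightarrow> v x = u x)"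
proof -
  obtain I where I: "finite I" "\<And>c p r. (c, p, r) \<in> I \<Longrightarrow> c \<in> A \<and> r > 0 \<and> cball p (4 * r) \<subseteq> chart_img c"
    "\<And>x. x \<in> topspace M \<Longrightarrow> \<exists>(c, p, r)\<in>I. x \<in> chart_dom c \<and> chart_map c x \<in> ball p r" by (rule good_cover) (rule that)
  obtain \<rho> :: "'a \<Rightarrow> 'a \<Rightarrow> real" and L S where L: "L > 0" and S: "S > 0"
    and \<rho>: "\<And>x y. \<rho> x y \<ge> 0" "\<And>x. \<rho> x x = 0" "\<And>x y. \<rho> x y = \<rho> y x" "\<And>x y z. \<rho> x z \<le> \<rho> x y + \<rho> y z"
    and \<rho>L: "\<And>x y. ennreal (\<rho> x y) \<le> ennreal L * riem_dist M A g x y"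
    and \<rho>S: "\<And>c p r x y. (c, p, r) \<in> I \<Longrightarrow> x \<in> chart_dom c \<Longrightarrow> chart_map c x \<in> ball p r \<Longrightarrow>
      y \<in> chart_dom c \<Longrightarrow> chart_map c y \<in> ball p (2 * r) \<Longrightarrow> dist (chart_map c x) (chart_map c y) \<le> S * \<rho> x y"
    "\<And>c p r x y. (c, p, r) \<in> I \<Longrightarrow> x \<in> chart_dom c \<Longrightarrow> chart_map c x \<in> ball p r \<Longrightarrow>
      \<not> (y \<in> chart_dom c \<and> chart_map c y \<in> ball p (2 * r)) \<Longrightarrow> 1 \<le> S * \<rho> x y"
    by (rule ex_comparison_pseudometric[OF I(1,2)]) (assumption, rule that)
  obtain C where C: "C \<ge> 0" "\<And>t x y. t \<ge> 1 \<Longrightarrow> x \<in> good_points u D X I t \<Longrightarrow> y \<in> good_points u D X I t \<Longrightarrow>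
    norm (u x - u y) \<le> C * t * \<rho> x y"
  proof (rule Lipschitz_on_good_points[where \<rho>=\<rho> and S=S and I=I and u=u and D=D and X=X, OF D Lp I(1)])
    show "(c, p, r) \<in> I \<Longrightarrow> c \<in> A \<and> r > 0 \<and> cball p (4 * r) \<subseteq> chart_img c" for c p r by (rule I(2))
  qed (rule I(3) S \<rho>(1) \<rho>S compact_imp_bounded[OF X(1)] that; assumption)+
  obtain U r Lr where "open U \<and> X \<subseteq> U \<and> Lr-lipschitz_on U r \<and> r ` U \<subseteq> X \<and> (\<forall>x\<in>X. r x = x)"
    using X(2) unfolding Lipschitz_neighborhood_retract_def by (elim exE) (rule that)
  then have U: "open U" "X \<subseteq> U" and r: "Lr-lipschitz_on U r" "r ` U \<subseteq> X" "\<And>x. x \<in> X \<Longrightarrow> r x = x"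
    by simp_all
  obtain \<eta> where \<eta>: "\<eta> > 0" "(\<Union>x\<in>X. cball x \<eta>) \<subseteq> U"
    by (rule compact_subset_open_imp_cball_epsilon_subset[OF X(1) U]) (rule that)
  have Lr: "Lr \<ge> 0" by (rule lipschitz_on_nonneg[OF r(1)])
  define K where "K = real CARD('m) * C"
  have K: "K \<ge> 0" using C(1) by (simp add: K_def)
  \<comment> \<open>adding 1 covers the case that the Lipschitz constant vanishes\<close>
  define \<delta> where "\<delta> = \<eta> / (K + 1)"
  have \<delta>: "\<delta> > 0" "K * \<delta> \<le> \<eta>" using \<eta>(1) K by (auto simp: \<delta>_def field_simps)
  define C' where "C' = Lr * K * L + 1"
  have C': "C' > 0" using Lr K L by (simp add: C'_def add_nonneg_pos)
  have AEg: "AE x in vol. u x \<in> X \<and> (\<forall>(c, p, r)\<in>I. x \<in> chart_dom c \<longrightarrow> leb_point (u \<circ> chart_inv c) (chart_map c x))"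
    using uX AE_leb_point_in_charts[OF D I(1)] I(2) by (intro AE_conjI) auto
  have dense: "\<forall>\<^sub>F t in at_top. \<forall>x\<in>topspace M. \<exists>y\<in>good_points u D X I t. \<rho> x y \<le> \<delta> / t"
    by (rule good_points_dense[OF D Lp I L \<rho>L uX \<delta>(1)])
  show ?thesis
  proof (rule that[of "exceptional D I" C'])
    show "exceptional D I t \<in> sets vol" for t by (rule exceptional_measure(1)[OF D Lp I(1,2)])
    show "t \<le> t' \<Longrightarrow> exceptional D I t' \<subseteq> exceptional D I t" for t t' by (rule exceptional_antimono)
    show "((\<lambda>t. t ^ CARD('n) * measure vol (exceptional D I t)) \<longlongrightarrow> 0) at_top"
      by (rule exceptional_measure(2)[OF D Lp I(1,2)])
    show "C' > 0" by (rule C')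
    show "\<forall>\<^sub>F t :: real in at_top. \<exists>v. riem_lipschitz v (C' * t) \<and> v ` topspace M \<subseteq> X \<and> (AE x in vol. x \<notin> exceptional D I t \<longrightarrow> v x = u x)"
      using dense eventually_ge_at_top[of 1]
    proof eventually_elim
      case (elim t)
      let ?E = "good_points u D X I t"
      have t: "t \<ge> 1" by (rule elim(2))
      have Ct: "C * t \<ge> 0" using C(1) t by simp
      obtain w where w: "\<And>x. x \<in> ?E \<Longrightarrow> w x = u x" "\<And>x y. norm (w x - w y) \<le> real CARD('m) * (C * t) * \<rho> x y"
        by (rule mcshane_extension[OF \<rho> C(2)[OF t] Ct]) (assumption+, rule that)
      have wl: "norm (w x - w y) \<le> K * t * \<rho> x y" for x y using w(2)[of x y] by (simp add: K_def mult.assoc)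
      have wU: "w x \<in> U" if x: "x \<in> topspace M" for x
      proof -
        obtain y where y: "y \<in> ?E" "\<rho> x y \<le> \<delta> / t" using elim(1) x by blast
        have "norm (w x - w y) \<le> K * t * (\<delta> / t)"
          by (rule order_trans[OF wl]) (use y(2) K t in \<open>intro mult_left_mono; simp\<close>)
        also have "\<dots> \<le> \<eta>" using \<delta>(2) t by simp
        finally have "w x \<in> cball (u y) \<eta>" using w(1)[OF y(1)] by (simp add: dist_norm norm_minus_commute)
        moreover have "u y \<in> X" using y(1) by (simp add: good_points_def)
        ultimately show ?thesis using \<eta>(2) by blast
      qed
      have "riem_lipschitz (r \<circ> w) (C' * t)"
        unfolding riem_lipschitz_def
      proof (intro conjI ballI)
        fix x y assume xy: "x \<in> topspace M" "y \<in> topspace M"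
        have "dist (r (w x)) (r (w y)) \<le> Lr * dist (w x) (w y)" by (rule lipschitz_onD[OF r(1) wU[OF xy(1)] wU[OF xy(2)]])
        also have "\<dots> \<le> Lr * (K * t * \<rho> x y)" unfolding dist_norm by (rule mult_left_mono[OF wl Lr])
        finally have "ennreal (dist ((r \<circ> w) x) ((r \<circ> w) y)) \<le> ennreal (Lr * (K * t * \<rho> x y))" by (simp add: ennreal_leI)
        also have "\<dots> = ennreal (Lr * K * t) * ennreal (\<rho> x y)" using Lr K t by (simp add: ennreal_mult'[symmetric] mult.assoc)
        also have "\<dots> \<le> ennreal (Lr * K * t) * (ennreal L * riem_dist M A g x y)" by (rule mult_left_mono[OF \<rho>L]) simp
        also have "\<dots> = ennreal (Lr * K * L * t) * riem_dist M A g x y"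
        proof -
          have "ennreal (Lr * K * t) * ennreal L = ennreal (Lr * K * L * t)"
            using Lr K L t by (simp add: ennreal_mult'[symmetric] mult_ac)
          then show ?thesis unfolding mult.assoc[symmetric] by simp
        qed
        also have "\<dots> \<le> ennreal (C' * t) * riem_dist M A g x y"
          using t by (intro mult_right_mono ennreal_leI) (auto simp: C'_def)
        finally show "ennreal (dist ((r \<circ> w) x) ((r \<circ> w) y)) \<le> ennreal (C' * t) * riem_dist M A g x y" .
      qed (use C' t in simp)
      moreover have "(r \<circ> w) ` topspace M \<subseteq> X" using wU r(2) by auto
      moreover have "AE x in vol. x \<notin> exceptional D I t \<longrightarrow> (r \<circ> w) x = u x"
        using AEg AE_space
      proof eventually_elim
        case (elim x)
        show ?case
        proof
          assume "x \<notin> exceptional D I t"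
          then have "x \<in> ?E" using elim unfolding good_points_def by simp
          then show "(r \<circ> w) x = u x" using w(1) r(3) elim(1) by simp
        qed
      qed
      ultimately show ?case by blast
    qed
  qed
qed

text \<open>By uniqueness, the weak differential of the difference that is selected by the Sobolev norm agrees
  almost everywhere with the difference of the given ones; where the maps agree it vanishes by locality.\<close>

lemma differential_norm_difference:
  fixes u v :: "'a \<Rightarrow> real^'m::finite"
  assumes u: "has_weak_differential A u Du" and v: "has_weak_differential A v Dv"
  defines "D \<equiv> weak_differential A (\<lambda>x. u x - v x)"
  shows "has_weak_differential A (\<lambda>x. u x - v x) D"
    "AE x in vol. differential_norm A g D x \<le> 2 * (differential_norm A g Du x + differential_norm A g Dv x)"
    "AE x in vol. u x = v x \<longrightarrow> differential_norm A g D x = 0"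
proof -
  let ?w = "\<lambda>x. u x - v x" and ?D = "\<lambda>c y. Du c y - Dv c y"
  have uc: "covector_law Du" "\<And>c. c \<in> A \<Longrightarrow> has_weak_derivative_on (u \<circ> chart_inv c) (Du c) (chart_img c)"
    and vc: "covector_law Dv" "\<And>c. c \<in> A \<Longrightarrow> has_weak_derivative_on (v \<circ> chart_inv c) (Dv c) (chart_img c)"
    using u v unfolding has_weak_differential_iff by blast+
  have dc: "has_weak_derivative_on (?w \<circ> chart_inv c) (?D c) (chart_img c)" if "c \<in> A" for c
    using has_weak_derivative_on_diff[OF uc(2)[OF that] vc(2)[OF that]] by (simp add: o_def)
  have dist: "(P - Q) ** J = P ** J - Q ** J" for P Q :: "real^'n^'m" and J :: "real^'n^'n"
    by (simp add: matrix_matrix_mult_def vec_eq_iff left_diff_distrib sum_subtractf)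
  have "covector_law ?D"
    unfolding covector_law_def
  proof (intro ballI)
    fix c d y assume cd: "c \<in> A" "d \<in> A" "y \<in> overlap c d"
    have "Du c y = Du d (transition c d y) ** jacobian c d y" using uc(1) cd unfolding covector_law_def by blast
    moreover have "Dv c y = Dv d (transition c d y) ** jacobian c d y" using vc(1) cd unfolding covector_law_def by blast
    ultimately show "?D c y = ?D d (transition c d y) ** jacobian c d y" unfolding dist by (rule arg_cong2)
  qed
  then have "has_weak_differential A ?w ?D" unfolding has_weak_differential_iff using dc by blast
  then show wD: "has_weak_differential A ?w D"
    unfolding D_def weak_differential_def by (rule someI[of "has_weak_differential A ?w"])
  then have law: "covector_law D" and Dc: "\<And>c. c \<in> A \<Longrightarrow> has_weak_derivative_on (?w \<circ> chart_inv c) (D c) (chart_img c)"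
    unfolding has_weak_differential_iff by blast+
  show "AE x in vol. differential_norm A g D x \<le> 2 * (differential_norm A g Du x + differential_norm A g Dv x)"
  proof (rule AE_volI)
    fix c assume c: "c \<in> A"
    from weak_derivative_unique[OF open_img[OF c] Dc[OF c] dc[OF c]]
    show "AE y in lebesgue. y \<in> chart_img c \<longrightarrow> differential_norm A g D (chart_inv c y)
      \<le> 2 * (differential_norm A g Du (chart_inv c y) + differential_norm A g Dv (chart_inv c y))"
    proof eventually_elim
      case (elim y)
      show ?case
      proof
        assume y: "y \<in> chart_img c"
        define a b where "a = sqnorm_at c y (Du c y)" and "b = sqnorm_at c y (Dv c y)"
        have ab: "a \<ge> 0" "b \<ge> 0" unfolding a_def b_def by (rule sqnorm_at_nonneg[OF c y])+
        have "sqnorm_at c y (D c y) \<le> 2 * a + 2 * b" using elim y sqnorm_at_diff_le[OF c y, of "Du c y" "Dv c y"] by (simp add: a_def b_def)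
        also have "\<dots> \<le> (2 * (sqrt a + sqrt b))\<^sup>2"
        proof -
          define s t where "s = sqrt a" and "t = sqrt b"
          have st: "s \<ge> 0" "t \<ge> 0" "a = s\<^sup>2" "b = t\<^sup>2" using ab by (auto simp: s_def t_def)
          have "2 * s\<^sup>2 + 2 * t\<^sup>2 \<le> (2 * (s + t))\<^sup>2 " using st(1,2) by (simp add: power2_eq_square algebra_simps)
          then show ?thesis unfolding s_def[symmetric] t_def[symmetric] st(3,4)[symmetric] .
        qed
        finally have "sqrt (sqnorm_at c y (D c y)) \<le> 2 * (sqrt a + sqrt b)" using ab by (intro real_le_lsqrt) auto
        then show "differential_norm A g D (chart_inv c y)
            \<le> 2 * (differential_norm A g Du (chart_inv c y) + differential_norm A g Dv (chart_inv c y))"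
          unfolding differential_norm_chart[OF law c y] differential_norm_chart[OF uc(1) c y]
            differential_norm_chart[OF vc(1) c y] a_def b_def .
      qed
    qed
  qed
  show "AE x in vol. u x = v x \<longrightarrow> differential_norm A g D x = 0"
  proof (rule AE_volI)
    fix c assume c: "c \<in> A"
    from weak_derivative_zero_on_zero_set[OF open_img[OF c] Dc[OF c]]
    show "AE y in lebesgue. y \<in> chart_img c \<longrightarrow> u (chart_inv c y) = v (chart_inv c y) \<longrightarrow> differential_norm A g D (chart_inv c y) = 0"
    proof eventually_elim
      case (elim y)
      then show ?case using differential_norm_chart[OF law c] by (auto simp: sqnorm_at_eq)
    qed
  qed
qed

lemma Lp_norm_le_root:
  assumes "0 \<le> (LINT x|\<mu>. norm (f x) powr p)" "(LINT x|\<mu>. norm (f x) powr p) < \<epsilon> powr p" "\<epsilon> > 0" "p > 0"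
  shows "Lp_norm \<mu> p f < \<epsilon>"
proof -
  have "Lp_norm \<mu> p f < (\<epsilon> powr p) powr (1 / p)" unfolding Lp_norm_def using assms by (intro powr_less_mono2) auto
  then show ?thesis using assms by (simp add: powr_powr)
qed

text \<open>Both integrals in the Sobolev norm are concentrated on the sets \<open>N\<close>. The differential of \<open>v k\<close> is of order
  \<open>k\<close>, and \<open>k ^ n\<close> times the volume of \<open>N\<close> tends to zero by assumption; the integral of the differential
  of \<open>u\<close> over \<open>N\<close> tends to zero since these sets decrease to a null set.\<close>

lemma sobolev_dist_truncation_tendsto_0:
  fixes u :: "'a \<Rightarrow> real^'m::finite"
  assumes u: "in_Lp vol (real CARD('n)) u" and D: "has_weak_differential A u D"
    and Lp: "in_Lp vol (real CARD('n)) (differential_norm A g D)"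
    and uX: "AE x in vol. u x \<in> X" and X: "bounded X"
    and N: "\<And>t :: real. N t \<in> sets vol" "\<And>t t'. t \<le> t' \<Longrightarrow> N t' \<subseteq> N t"
      "((\<lambda>t. t ^ CARD('n) * measure vol (N t)) \<longlongrightarrow> 0) at_top" and C: "C > 0"
    and v: "\<forall>\<^sub>F k in sequentially. riem_lipschitz (v k) (C * real k) \<and> v k ` topspace M \<subseteq> X \<and> (AE x in vol. x \<notin> N (real k) \<longrightarrow> v k x = u x)"
    and \<epsilon>: "\<epsilon> > 0"
  shows "\<forall>\<^sub>F k in sequentially. sobolev_dist M A g (real CARD('n)) u (v k) < \<epsilon>"
proof -
  interpret V: finite_measure vol by (rule finite_measure_vol)
  let ?n = "CARD('n)" and ?p = "real CARD('n)" and ?N = "\<lambda>k. N (real k)"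
  have NM: "N t \<inter> topspace M = N t" for t using sets.sets_into_space[OF N(1)] by (simp add: Int_absorb2)
  obtain B where B: "B > 0" "\<And>x. x \<in> X \<Longrightarrow> norm x \<le> B" using X by (auto simp: bounded_pos)
  obtain C0 where C0: "C0 > 0" "\<And>(v :: 'a \<Rightarrow> real^'m) \<Lambda> x. riem_lipschitz v \<Lambda> \<Longrightarrow> x \<in> topspace M \<Longrightarrow>
    differential_norm A g (coord_deriv v) x \<le> C0 * \<Lambda>"
    using riem_lipschitz_differential_norm[where 'm='m] by metis
  define f where "f x = differential_norm A g D x powr ?p" for x
  have law: "covector_law D" using D unfolding has_weak_differential_iff by blast
  have dn0: "differential_norm A g D x \<ge> 0" if "x \<in> topspace M" for x by (rule differential_norm_nonneg[OF law that])
  have dm: "differential_norm A g D \<in> borel_measurable vol" by (rule weak_differential_norm_measurable[OF D])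
  have fi: "integrable vol f"
  proof -
    have "integrable vol (\<lambda>x. norm (differential_norm A g D x) powr ?p)" using Lp unfolding in_Lp_def by blast
    then show ?thesis by (rule Bochner_Integration.integrable_cong[THEN iffD1, rotated 2]) (auto simp: f_def dn0)
  qed
  have f0: "f x \<ge> 0" for x by (simp add: f_def)
  have tN: "(\<lambda>k. real k ^ ?n * measure vol (?N k)) \<longlonglongrightarrow> 0"
    by (rule filterlim_compose[OF N(3) filterlim_real_sequentially])
  have mN: "(\<lambda>k. measure vol (?N k)) \<longlonglongrightarrow> 0"
  proof (rule tendsto_sandwich[OF _ _ tendsto_const tN])
    show "\<forall>\<^sub>F k in sequentially. measure vol (?N k) \<le> real k ^ ?n * measure vol (?N k)"
      using eventually_ge_at_top[of 1] by eventually_elim (simp add: mult_le_cancel_right1 one_le_power)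
  qed simp
  have lim0: "(\<lambda>k. LINT x:?N k|vol. f x) \<longlonglongrightarrow> 0"
  proof -
    define Z where "Z = (\<Inter>k::nat. ?N k)"
    have Zm: "Z \<in> sets vol" unfolding Z_def using N(1) by (intro sets.countable_INT) auto
    have "measure vol Z \<le> measure vol (?N k)" for k
      by (rule V.finite_measure_mono[OF _ N(1)]) (auto simp: Z_def)
    then have "measure vol Z \<le> 0" by (intro LIMSEQ_le_const[OF mN]) auto
    then have "measure vol Z = 0" using measure_nonneg[of vol Z] by linarith
    then have "Z \<in> null_sets vol" using Zm by (simp add: null_sets_def V.emeasure_eq_measure)
    then have Z: "AE x in vol. x \<notin> Z" by (rule AE_not_in)
    have "(\<lambda>k. LINT x|vol. indicator (?N k) x *\<^sub>R f x) \<longlonglongrightarrow> (LINT x|vol. 0)"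
    proof (rule integral_dominated_convergence[where w=f])
      show "AE x in vol. (\<lambda>k. indicator (?N k) x *\<^sub>R f x) \<longlonglongrightarrow> 0"
        using Z
      proof eventually_elim
        case (elim x)
        then obtain k0 where "x \<notin> ?N k0" unfolding Z_def by blast
        then have "x \<notin> ?N k" if "k \<ge> k0" for k using N(2)[of "real k0" "real k"] that by auto
        then have "\<forall>\<^sub>F k in sequentially. indicator (?N k) x *\<^sub>R f x = 0"
          unfolding eventually_sequentially by (intro exI[of _ k0]) simp
        then show ?case by (rule tendsto_eventually)
      qed
      show "(\<lambda>x. indicator (?N k) x *\<^sub>R f x) \<in> borel_measurable vol" for k
        using N(1) borel_measurable_integrable[OF fi] by measurable
      show "AE x in vol. norm (indicator (?N k) x *\<^sub>R f x) \<le> f x" for k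
        by (rule AE_I2) (simp add: f0 indicator_def)
    qed (use fi in auto)
    then show ?thesis by (simp add: set_lebesgue_integral_def)
  qed
  define q where "q k = 4 powr ?p * ((LINT x:?N k|vol. f x) + (C0 * C) powr ?p * (real k ^ ?n * measure vol (?N k)))" for k
  define q' where "q' k = (2 * B) powr ?p * measure vol (?N k)" for k
  have q0: "q \<longlonglongrightarrow> 0"
  proof -
    have "(\<lambda>k. 4 powr ?p * ((LINT x:?N k|vol. f x) + (C0 * C) powr ?p * (real k ^ ?n * measure vol (?N k)))) \<longlonglongrightarrow> 4 powr ?p * (0 + (C0 * C) powr ?p * 0)"
      by (intro tendsto_mult tendsto_add tendsto_const lim0 tN)
    then show ?thesis by (simp add: q_def[abs_def])
  qed
  have q'0: "q' \<longlonglongrightarrow> 0"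
    unfolding q'_def[abs_def] using tendsto_mult[OF tendsto_const[of "(2 * B) powr ?p"] mN] by simp
  have e2: "(\<epsilon> / 2) powr ?p > 0" using \<epsilon> by simp
  have "\<forall>\<^sub>F k in sequentially. q k < (\<epsilon> / 2) powr ?p" "\<forall>\<^sub>F k in sequentially. q' k < (\<epsilon> / 2) powr ?p"
    using order_tendstoD(2)[OF q0 e2] order_tendstoD(2)[OF q'0 e2] by auto
  then show ?thesis using v eventually_gt_at_top[of 0]
  proof eventually_elim
    case (elim k)
    define w where "w x = u x - v k x" for x
    have vl: "riem_lipschitz (v k) (C * real k)" and vX: "\<And>x. x \<in> topspace M \<Longrightarrow> v k x \<in> X"
      and vu: "AE x in vol. x \<notin> ?N k \<longrightarrow> v k x = u x" using elim(3) by auto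
    have vD: "has_weak_differential A (v k) (coord_deriv (v k))" by (rule riem_lipschitz_weak_differential[OF vl])
    have vm: "v k \<in> borel_measurable vol"
      using riem_lipschitz_in_sobolev_space[OF vl, of B ?p] B(2) vX unfolding sobolev_space_def in_Lp_def by auto
    have um: "u \<in> borel_measurable vol" using u by (simp add: in_Lp_def)
    have wm: "w \<in> borel_measurable vol" unfolding w_def using um vm by measurable
    define Dw where "Dw = weak_differential A w"
    have we: "w = (\<lambda>x. u x - v k x)" by (simp add: w_def[abs_def])
    note dd = differential_norm_difference[OF D vD, folded we, folded Dw_def]
    have lawv: "covector_law (coord_deriv (v k))" by (rule coord_deriv_covector_law)
    have laww: "covector_law Dw" using dd(1) unfolding has_weak_differential_iff by blast
    \<comment> \<open>the difference vanishes almost everywhere off \<open>N k\<close>, and both maps are bounded by \<open>B\<close>\<close>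
    have i1: "AE x in vol. norm (w x) powr ?p \<le> (2 * B) powr ?p * indicator (?N k) x"
      using vu uX AE_space
    proof eventually_elim
      case (elim x)
      show ?case
      proof (cases "x \<in> ?N k")
        case True
        have "norm (w x) \<le> norm (u x) + norm (v k x)" unfolding w_def by (rule norm_triangle_ineq4)
        also have "\<dots> \<le> 2 * B" using B(2)[OF elim(2)] B(2)[OF vX, of x] elim(3) by simp
        finally show ?thesis using True by (simp add: powr_mono2)
      qed (use elim in \<open>simp add: w_def\<close>)
    qed
    have i1i: "integrable vol (\<lambda>x. (2 * B) powr ?p * indicator (?N k) x)" using N(1) by (simp add: V.emeasure_eq_measure)
    have "(LINT x|vol. norm (w x) powr ?p) \<le> (LINT x|vol. (2 * B) powr ?p * indicator (?N k) x)"
    proof (rule integral_mono_AE[OF _ i1i i1])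
      show "integrable vol (\<lambda>x. norm (w x) powr ?p)"
        by (rule Bochner_Integration.integrable_bound[OF i1i]) (use wm i1 in auto)
    qed
    also have "\<dots> = q' k" by (simp add: q'_def NM)
    finally have "Lp_norm vol ?p w < \<epsilon> / 2" using elim(2) \<epsilon> by (intro Lp_norm_le_root) auto
    \<comment> \<open>the factor 4 combines the factor 2 of the triangle inequality with \<open>a + b \<le> 2 * max a b\<close>\<close>
    moreover have i2: "AE x in vol. norm (differential_norm A g Dw x) powr ?p \<le>
      4 powr ?p * (indicator (?N k) x *\<^sub>R f x + (C0 * (C * real k)) powr ?p * indicator (?N k) x)"
      using vu dd(2,3) AE_space
    proof eventually_elim
      case (elim x)
      show ?case
      proof (cases "x \<in> ?N k")
        case True
        have x: "x \<in> topspace M" using elim(4) by simp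
        define a where "a = differential_norm A g D x"
        define b where "b = C0 * (C * real k)"
        have ab: "a \<ge> 0" "b \<ge> 0" unfolding a_def b_def using dn0[OF x] C0(1) C by auto
        have "norm (differential_norm A g Dw x) \<le> 2 * (a + b)"
          using elim(2) C0(2)[OF vl x] differential_norm_nonneg[OF laww x] by (simp add: a_def b_def)
        also have "\<dots> \<le> 4 * max a b" by simp
        finally have "norm (differential_norm A g Dw x) powr ?p \<le> (4 * max a b) powr ?p" by (intro powr_mono2) auto
        also have "\<dots> = 4 powr ?p * max a b powr ?p" using ab by (intro powr_mult)
        also have "\<dots> \<le> 4 powr ?p * (a powr ?p + b powr ?p)" by (intro mult_left_mono) (auto simp: max_def)
        finally show ?thesis using True by (simp add: f_def a_def b_def)
      qed (use elim in simp)
    qed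
    define G where "G x = 4 powr ?p * (indicator (?N k) x *\<^sub>R f x + (C0 * (C * real k)) powr ?p * indicator (?N k) x)" for x
    have gi1: "integrable vol (\<lambda>x. indicator (?N k) x *\<^sub>R f x)" using fi N(1) by (intro integrable_mult_indicator) auto
    have gi2: "integrable vol (\<lambda>x. (C0 * (C * real k)) powr ?p * indicator (?N k) x)" using N(1) by (simp add: V.emeasure_eq_measure)
    have Gi: "integrable vol G" unfolding G_def[abs_def] by (intro integrable_mult_right Bochner_Integration.integrable_add gi1 gi2)
    have "(C0 * (C * real k)) powr ?p = (C0 * C) powr ?p * real k ^ ?n"
      using C0(1) C elim(4) by (simp add: powr_mult powr_realpow mult.assoc[symmetric])
    then have Gq: "integral\<^sup>L vol G = q k"
      unfolding G_def[abs_def] q_def set_lebesgue_integral_def using gi1 gi2 by (simp add: NM)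
    have wdm: "differential_norm A g Dw \<in> borel_measurable vol" by (rule weak_differential_norm_measurable[OF dd(1)])
    have "(LINT x|vol. norm (differential_norm A g Dw x) powr ?p) \<le> integral\<^sup>L vol G"
    proof (rule integral_mono_AE[OF _ Gi])
      show "AE x in vol. norm (differential_norm A g Dw x) powr ?p \<le> G x" using i2 by (simp only: G_def)
      then show "integrable vol (\<lambda>x. norm (differential_norm A g Dw x) powr ?p)"
        by (intro Bochner_Integration.integrable_bound[OF Gi]) (use wdm in auto)
    qed
    then have "Lp_norm vol ?p (differential_norm A g Dw) < \<epsilon> / 2"
      using elim(1) \<epsilon> unfolding Gq by (intro Lp_norm_le_root) auto
    ultimately show ?case unfolding sobolev_dist_def sobolev_norm_def we[symmetric] Dw_def[symmetric] by simp
  qed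
qed

lemma Lip_maps_iff: "v \<in> Lip_maps M A g X \<longleftrightarrow> v ` topspace M \<subseteq> X \<and> (\<exists>L>0. riem_lipschitz v L)"
  unfolding Lip_maps_def riem_lipschitz_def by (auto intro: less_imp_le)

lemma Lip_maps_subset_sobolev_maps:
  fixes X :: "(real^'m::finite) set"
  assumes "bounded X" "p \<ge> 0"
  shows "Lip_maps M A g X \<subseteq> sobolev_maps M A g p X"
proof
  fix v assume v: "v \<in> Lip_maps M A g X"
  obtain B where B: "\<And>x. x \<in> X \<Longrightarrow> norm x \<le> B" using assms(1) by (auto simp: bounded_iff)
  obtain L where L: "riem_lipschitz v L" "\<And>x. x \<in> topspace M \<Longrightarrow> v x \<in> X" using v unfolding Lip_maps_iff by blast
  have "v \<in> sobolev_space M A g p" by (rule riem_lipschitz_in_sobolev_space[OF L(1) B[OF L(2)] assms(2)])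
  moreover have "AE x in vol. v x \<in> X" by (rule AE_I2) (simp add: L(2))
  ultimately show "v \<in> sobolev_maps M A g p X" unfolding sobolev_maps_def by blast
qed

lemma Lip_maps_dense:
  fixes X :: "(real^'m::finite) set"
  assumes X: "compact X" "Lipschitz_neighborhood_retract X"
    and u: "u \<in> sobolev_maps M A g (real CARD('n)) X" and \<epsilon>: "\<epsilon> > 0"
  shows "\<exists>v\<in>Lip_maps M A g X. sobolev_dist M A g (real CARD('n)) u v < \<epsilon>"
proof -
  obtain D where uL: "in_Lp vol (real CARD('n)) u" and uX: "AE x in vol. u x \<in> X"
    and D: "has_weak_differential A u D" "in_Lp vol (real CARD('n)) (differential_norm A g D)"
    using u unfolding sobolev_maps_def sobolev_space_def by blast
  obtain N C where N: "\<And>t :: real. N t \<in> sets vol" "\<And>t t'. t \<le> t' \<Longrightarrow> N t' \<subseteq> N t"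
    "((\<lambda>t. t ^ CARD('n) * measure vol (N t)) \<longlongrightarrow> 0) at_top" "C > 0"
    and ev: "\<forall>\<^sub>F t :: real in at_top. \<exists>v. riem_lipschitz v (C * t) \<and> v ` topspace M \<subseteq> X \<and> (AE x in vol. x \<notin> N t \<longrightarrow> v x = u x)"
    by (rule Lipschitz_truncation[OF D uX X]) (rule that)
  define P where "P k v \<longleftrightarrow> riem_lipschitz v (C * real k) \<and> v ` topspace M \<subseteq> X \<and> (AE x in vol. x \<notin> N (real k) \<longrightarrow> v x = u x)" for k v
  have "\<forall>\<^sub>F k in sequentially. \<exists>v. P k v"
    unfolding P_def by (rule eventually_compose_filterlim[OF ev filterlim_real_sequentially])
  then have evP: "\<forall>\<^sub>F k in sequentially. P k (SOME v. P k v)" by eventually_elim (erule someI_ex)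
  have "\<forall>\<^sub>F k in sequentially. sobolev_dist M A g (real CARD('n)) u (SOME v. P k v) < \<epsilon>"
    by (rule sobolev_dist_truncation_tendsto_0[OF uL D uX compact_imp_bounded[OF X(1)] N evP[unfolded P_def] \<epsilon>, folded P_def])
  with evP have "\<forall>\<^sub>F k in sequentially. (SOME v. P k v) \<in> Lip_maps M A g X \<and> sobolev_dist M A g (real CARD('n)) u (SOME v. P k v) < \<epsilon>"
    using eventually_gt_at_top[of 0]
  proof eventually_elim
    case (elim k)
    have "C * real k > 0" using N(4) elim(3) by simp
    then show ?case using elim(1,2) unfolding Lip_maps_iff P_def by blast
  qed
  then obtain k where "(SOME v. P k v) \<in> Lip_maps M A g X \<and> sobolev_dist M A g (real CARD('n)) u (SOME v. P k v) < \<epsilon>"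
    unfolding eventually_sequentially by blast
  then show ?thesis by blast
qed

end

theorem theorem1p3:
  fixes M :: "'a topology"
    and A :: "('a, 'n::finite) chart set"
    and g :: "('a, 'n) chart \<Rightarrow> real^'n \<Rightarrow> real^'n^'n"
    and X :: "(real^'m::finite) set"
  assumes "closed_manifold M A"
    and "riemannian_metric A g"
    and "compact X"
    and "Lipschitz_neighborhood_retract X"
  shows "Lip_maps M A g X \<subseteq> sobolev_maps M A g (real CARD('n)) X \<and>
    (\<forall>u\<in>sobolev_maps M A g (real CARD('n)) X. \<forall>\<epsilon>>0.
       \<exists>v\<in>Lip_maps M A g X. sobolev_dist M A g (real CARD('n)) u v < \<epsilon>)"
proof -
  interpret closed_riemannian M A g by (rule closed_riemannian.intro[OF assms(1,2)])
  show ?thesis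
    using Lip_maps_subset_sobolev_maps[OF compact_imp_bounded[OF assms(3)]] Lip_maps_dense[OF assms(3,4)] by auto
qed

end
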